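(* Let $X$ be a hyperelliptic curve over $K$ of genus $g$ and type $(i,n,m)$ with $n>1$ whose field of moduli for the extension $K|k$ equals $k$, represented by a binary form $f$ over $K$ of type $(i,n,m)$. Let $L|k$ be the invariant extension defined by $f$. Then: (1) If $X$ is of type $(0,n,m)$ or $(2,n,m)$, then a hyperelliptic descent of $X$ always exists if $m$ is odd. If $m$ is even, then $X$ descends hyperelliptically if and only if its norm obstruction is trivial. In either of the two cases, $X$ always admits a hyperelliptic model of the given type over the at most quadratic extension $L$ of $k$ (i.e. there is a binary form $f_L$ of type $(i,n,m)$ with coefficients in $L$ such that $X$ is $K$-isomorphic to $y^2=f_L(x,z)$). (2) If $X$ is of type $(1,n,m)$, then a hyperelliptic descent of $X$ always exists. Moreover, this descent can be defined by a hyperelliptic model of the given type over $k$ (i.e. by $y^2=f_0(x,z)$ with $f_0$ a binary form of type $(1,n,m)$ with coefficients in $k$).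
   Context: General setting: $k$ is a perfect field of characteristic different from $2$, $K$ its algebraic closure, $\Gamma=\mathrm{Gal}(K|k)$. Curves are smooth, proper, geometrically irreducible. A curve is hyperelliptic if it has genus $\geq 2$ and admits a degree $2$ morphism to $\mathbb{P}^1$ over $K$. The field of moduli of $X$ for $K|k$ is the fixed field of $\{\sigma\in\Gamma: X\cong X^\sigma \text{ over } K\}$. A hyperelliptic descent of $X$ is a curve over $k$, isomorphic to $X$ over $K$, that is the desingularization of $y^2=f_0(x,z)$ in the $(1,1,g+1)$-weighted projective $(x,z,y)$-space, with $f_0\in k[x,z]$ homogeneous of degree $2g+2$ without repeated roots; $X$ descends hyperelliptically if it has one. Binary forms: for $A\in \mathrm{GL}_2(K)$ put $(A.f)(x,z)=f(A^{-1}(x,z))$; write $f_1\sim f_2$ if $f_1=\lambda f_2$ for a nonzero scalar $\lambda\in K^*$; $\mathrm{Aut}(f)$ is the group of $A\in\mathrm{PGL}_2(K)$ with $A.f\sim f$. Types: let $n,m$ be positive integers, $n$ coprime to the characteristic, $\zeta_n$ a primitive $n$-th root of unity. A binary form $f$ of even degree over $K$ is of type $(0,n,m)$, resp. $(1,n,m)$, resp. $(2,n,m)$, if $f=e\cdot\sum_{j=0}^m a_jx^{jn}z^{(m-j)n}$ with $e=1$, resp. $e=z$, resp. $e=xz$, and moreover $\mathrm{Aut}(f)$ equals the group $\mathbf{C}_n$ generated by $(x:z)\mapsto(\zeta_nx:z)$ and $f$ has no repeated linear factors. A hyperelliptic curve over $K$ is of type $(i,n,m)$ if it is isomorphic to $y^2=f(x,z)$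 for a form $f$ of type $(i,n,m)$; one then says that $f$ represents it. Homogeneous diagonal invariants: let $f$ be of type $(i,n,m)$ with coefficients $a_j$. A tuple $S=(s_1,\dots,s_r)$ of distinct integers in $\{0,\dots,m\}$ is such that $f$ is $S$-admissible if $a_s\neq0$ for all $s\in S$ and, whenever one of $a_j,a_{m-j}$ is nonzero, exactly one element of $\{j,m-j\}$ is in $S$. Let $M_S=(2s_1-m,\dots,2s_r-m)$ and $K_S=\ker(M_S)\cap\mathbb{Z}^r$. One chooses $S$ such that $f$ is $S$-admissible and $K_S$ has a $\mathbb{Z}$-basis $\{v_i\}$ contained in $\mathbb{N}^r$ (such an $S$ exists; if necessary one exchanges the entry $m$ of $S$ for $0$ or conversely). The homogeneous diagonal invariants $J(f)$ are the values of the monomials $\prod_{t=1}^r a_{s_t}^{v_{i,t}}$ attached to the basis vectors $v_i$, together with $a_{m-j}a_j$ for $0\le j<m/2$; each is given its degree as a polynomial in the $a_j$ as weight, so that $J(f)$ defines a point in a weighted projective space. Invariant extension: $L$ is the field of definition over $k$ of the point $J(f)$, i.e. the fixed field of $\{\sigma\in\Gamma: J(f)^\sigma\text{ and }J(f)\text{ define the same point of the weighted projective space}\}$. Under the hypothesis that the field of moduli of $X$ is $k$ and $n>1$, $L$ is an extension of $k$ of degree at most $2$, and $f$ is isomorphic over $K$ (under $\mathrm{GL}_2(K)$, up to scalars) to a form $f_L$ of the same type with coefficients in $L$. Norm obstruction (types $(0,n,m)$ and $(2,n,m)$): if $L\ne k$, let $\sigma$ generate $\mathrm{Gal}(L|k)$.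 Then there are $\lambda,\mu\in K^*$ with $f_L^\sigma\sim \begin{pmatrix}\lambda&0\\0&\mu\end{pmatrix}\begin{pmatrix}0&1\\1&0\end{pmatrix}.f_L$, and $r=\mu^n/\lambda^n$ lies in $k^*$. The norm obstruction of $X$ is the class of $r$ in $k^*/\mathrm{Nm}_{L|k}(L^* )$; if $L=k$ it is trivial. *)

theory Defs
  imports
    "HOL-Analysis.Determinants"
    "HOL-Library.FuncSet"
    "HOL-Library.Poly_Mapping"
    "HOL-Algebra.Algebraic_Closure_Type"
begin

section \<open>Multivariate polynomials\<close>

type_synonym 'a mpoly = "(nat \<Rightarrow>\<^sub>0 nat) \<Rightarrow>\<^sub>0 'a"

definition mp_const :: "'a::zero \<Rightarrow> 'a mpoly" where
  "mp_const c = Poly_Mapping.single 0 c"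

definition mp_var :: "nat \<Rightarrow> 'a::zero_neq_one mpoly" where
  "mp_var i = Poly_Mapping.single (Poly_Mapping.single i 1) 1"

text \<open>Evaluation along a map \<open>h\<close> of coefficients: \<open>h = id\<close> gives values,
  \<open>h = mp_const\<close> gives substitution of polynomials for the variables.\<close>

definition mp_eval :: "('a \<Rightarrow> 'b) \<Rightarrow> (nat \<Rightarrow> 'b) \<Rightarrow> 'a::zero mpoly \<Rightarrow> 'b::comm_semiring_1" where
  "mp_eval h v p = (\<Sum>mon\<in>Poly_Mapping.keys p. h (Poly_Mapping.lookup p mon) *
     (\<Prod>i\<in>Poly_Mapping.keys mon. v i ^ Poly_Mapping.lookup mon i))"

definition coeffs_in :: "'a::zero set \<Rightarrow> 'a mpoly \<Rightarrow> bool" where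
  "coeffs_in L p \<longleftrightarrow> (\<forall>mon. Poly_Mapping.lookup p mon \<in> L)"

definition homogeneous :: "nat list \<Rightarrow> nat \<Rightarrow> 'a::zero mpoly \<Rightarrow> bool" where
  "homogeneous w d p \<longleftrightarrow> (\<forall>mon\<in>Poly_Mapping.keys p.
     Poly_Mapping.keys mon \<subseteq> {..<length w} \<and>
     (\<Sum>i\<in>Poly_Mapping.keys mon. w ! i * Poly_Mapping.lookup mon i) = d)"


section \<open>Projective varieties over an algebraically closed field\<close>

text \<open>A projective variety is given by the list of weights of the variables of an ambient
  weighted projective space and a set of weighted homogeneous equations; all weights equal to
  \<open>1\<close> is the case of ordinary projective space. Over an algebraically closed field it is
  described by its set of closed points, its Zariski topology and its sheaf of regular
  functions. A point is an orbit \<open>{(c ^ w\<^sub>0 v\<^sub>0, c ^ w\<^sub>1 v\<^sub>1, \<dots>) | c \<noteq> 0}\<close> with \<open>v \<noteq> 0\<close>.\<close>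

type_synonym 'a point = "(nat \<Rightarrow> 'a) set"
type_synonym 'a variety = "nat list \<times> 'a mpoly set"

definition orbit :: "nat list \<Rightarrow> (nat \<Rightarrow> 'a::field) \<Rightarrow> 'a point" where
  "orbit w v = {\<lambda>i. if i < length w then c ^ (w ! i) * v i else 0 | c. c \<noteq> 0}"

definition wspace :: "nat list \<Rightarrow> 'a::field point set" where
  "wspace w = {orbit w v | v. (\<exists>i. v i \<noteq> 0) \<and> (\<forall>i\<ge>length w. v i = 0)}"

definition vanishes :: "'a::field mpoly \<Rightarrow> 'a point \<Rightarrow> bool" where
  "vanishes F P \<longleftrightarrow> (\<forall>v\<in>P. mp_eval id v F = 0)"

definition projective_variety :: "'a::field variety \<Rightarrow> bool" where
  "projective_variety C \<longleftrightarrow> (\<forall>c\<in>set (fst C). 0 < c) \<and> (\<forall>F\<in>snd C. \<exists>d. homogeneous (fst C) d F)"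

definition pts :: "'a::field variety \<Rightarrow> 'a point set" where
  "pts C = {P \<in> wspace (fst C). \<forall>F\<in>snd C. vanishes F P}"

definition zclosed :: "'a::field variety \<Rightarrow> 'a point set \<Rightarrow> bool" where
  "zclosed C Z \<longleftrightarrow> (\<exists>E. (\<forall>F\<in>E. \<exists>d. homogeneous (fst C) d F) \<and> Z = {P \<in> pts C. \<forall>F\<in>E. vanishes F P})"

definition zopen :: "'a::field variety \<Rightarrow> 'a point set \<Rightarrow> bool" where
  "zopen C U \<longleftrightarrow> U \<subseteq> pts C \<and> zclosed C (pts C - U)"

definition zirreducible :: "'a::field variety \<Rightarrow> 'a point set \<Rightarrow> bool" where
  "zirreducible C Z \<longleftrightarrow> zclosed C Z \<and> Z \<noteq> {} \<and>
     (\<forall>Z1 Z2. zclosed C Z1 \<and> zclosed C Z2 \<and> Z = Z1 \<union> Z2 \<longrightarrow> Z = Z1 \<or> Z = Z2)"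

definition chain_of_length :: "'a::field variety \<Rightarrow> nat \<Rightarrow> bool" where
  "chain_of_length C d \<longleftrightarrow>
     (\<exists>Z. (\<forall>i\<le>d. zirreducible C (Z i)) \<and> (\<forall>i<d. Z i \<subset> Z (Suc i)))"

definition has_dim :: "'a::field variety \<Rightarrow> nat \<Rightarrow> bool" where
  "has_dim C d \<longleftrightarrow> chain_of_length C d \<and> \<not> chain_of_length C (Suc d)"

text \<open>The value of \<open>F / G\<close> at a point; independent of the representative when \<open>F\<close> and \<open>G\<close> are
  homogeneous of the same degree.\<close>

definition ratio :: "'a::field mpoly \<Rightarrow> 'a mpoly \<Rightarrow> 'a point \<Rightarrow> 'a" where
  "ratio F G P = (let v = (SOME v. v \<in> P) in mp_eval id v F / mp_eval id v G)"

definition regular_on :: "'a::field variety \<Rightarrow> 'a point set \<Rightarrow> ('a point \<Rightarrow> 'a) \<Rightarrow> bool" where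
  "regular_on C U h \<longleftrightarrow> (\<forall>P\<in>U. \<exists>V F G d. zopen C V \<and> P \<in> V \<and> V \<subseteq> U \<and>
     homogeneous (fst C) d F \<and> homogeneous (fst C) d G \<and>
     (\<forall>Q\<in>V. \<not> vanishes G Q \<and> h Q = ratio F G Q))"

definition morphism :: "'a::field variety \<Rightarrow> 'a variety \<Rightarrow> ('a point \<Rightarrow> 'a point) \<Rightarrow> bool" where
  "morphism C Y \<phi> \<longleftrightarrow> \<phi> ` pts C \<subseteq> pts Y \<and>
     (\<forall>V h. zopen Y V \<and> regular_on Y V h \<longrightarrow>
        zopen C {P \<in> pts C. \<phi> P \<in> V} \<and> regular_on C {P \<in> pts C. \<phi> P \<in> V} (h \<circ> \<phi>))"

definition isomorphic :: "'a::field variety \<Rightarrow> 'a variety \<Rightarrow> bool" where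
  "isomorphic C Y \<longleftrightarrow> (\<exists>\<phi> \<psi>. morphism C Y \<phi> \<and> morphism Y C \<psi> \<and>
     (\<forall>P\<in>pts C. \<psi> (\<phi> P) = P) \<and> (\<forall>Q\<in>pts Y. \<phi> (\<psi> Q) = Q))"


section \<open>Rational functions, smooth curves, genus\<close>

text \<open>On an irreducible variety, a rational function is a function that is regular on a nonempty
  open subset, and two of them are identified if they agree on a nonempty open subset. Sums,
  products and inverses can be formed pointwise.\<close>

definition geneq :: "'a::field variety \<Rightarrow> ('a point \<Rightarrow> 'a) \<Rightarrow> ('a point \<Rightarrow> 'a) \<Rightarrow> bool" where
  "geneq C \<phi> \<psi> \<longleftrightarrow> (\<exists>U. zopen C U \<and> U \<noteq> {} \<and> (\<forall>P\<in>U. \<phi> P = \<psi> P))"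

definition rational :: "'a::field variety \<Rightarrow> ('a point \<Rightarrow> 'a) \<Rightarrow> bool" where
  "rational C \<phi> \<longleftrightarrow> (\<exists>U. zopen C U \<and> U \<noteq> {} \<and> regular_on C U \<phi>)"

definition local_ring :: "'a::field variety \<Rightarrow> 'a point \<Rightarrow> ('a point \<Rightarrow> 'a) set" where
  "local_ring C P = {\<phi>. \<exists>U \<psi>. zopen C U \<and> P \<in> U \<and> regular_on C U \<psi> \<and> geneq C \<phi> \<psi>}"

definition local_max_ideal :: "'a::field variety \<Rightarrow> 'a point \<Rightarrow> ('a point \<Rightarrow> 'a) set" where
  "local_max_ideal C P = {\<phi>. \<exists>U \<psi>. zopen C U \<and> P \<in> U \<and> regular_on C U \<psi> \<and> geneq C \<phi> \<psi> \<and> \<psi> P = 0}"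

definition uniformizer :: "'a::field variety \<Rightarrow> 'a point \<Rightarrow> ('a point \<Rightarrow> 'a) \<Rightarrow> bool" where
  "uniformizer C P t \<longleftrightarrow> t \<in> local_max_ideal C P \<and> \<not> geneq C t (\<lambda>_. 0) \<and>
     (\<forall>\<phi>\<in>local_max_ideal C P. \<exists>\<psi>\<in>local_ring C P. geneq C \<phi> (\<lambda>Q. \<psi> Q * t Q))"

text \<open>Smooth means that all local rings are regular: since the dimension is \<open>1\<close>, this says that
  their maximal ideals are generated by one element.\<close>

definition smooth_projective_curve :: "'a::field variety \<Rightarrow> bool" where
  "smooth_projective_curve C \<longleftrightarrow> projective_variety C \<and> zirreducible C (pts C) \<and> has_dim C 1 \<and>
     (\<forall>P\<in>pts C. \<exists>t. uniformizer C P t)"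

text \<open>Divisors are integer valued functions \<open>D\<close> with finite support on the points. The
  Riemann-Roch space of \<open>D\<close> consists of the rational functions \<open>\<phi>\<close> with
  \<open>ord\<^sub>P \<phi> \<ge> - D P\<close> for all \<open>P\<close>, i.e. with \<open>t ^ (D P) \<phi>\<close> regular at \<open>P\<close> for a uniformizer \<open>t\<close>.\<close>

definition is_divisor :: "'a::field variety \<Rightarrow> ('a point \<Rightarrow> int) \<Rightarrow> bool" where
  "is_divisor C D \<longleftrightarrow> finite {P \<in> pts C. D P \<noteq> 0}"

definition divisor_degree :: "'a::field variety \<Rightarrow> ('a point \<Rightarrow> int) \<Rightarrow> int" where
  "divisor_degree C D = (\<Sum>P\<in>{P \<in> pts C. D P \<noteq> 0}. D P)"

definition riemann_roch_space :: "'a::field variety \<Rightarrow> ('a point \<Rightarrow> int) \<Rightarrow> ('a point \<Rightarrow> 'a) set" where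
  "riemann_roch_space C D = {\<phi>. rational C \<phi> \<and>
     (\<forall>P\<in>pts C. \<forall>t. uniformizer C P t \<longrightarrow> (\<lambda>Q. t Q powi D P * \<phi> Q) \<in> local_ring C P)}"

definition riemann_roch_dim :: "'a::field variety \<Rightarrow> ('a point \<Rightarrow> int) \<Rightarrow> nat \<Rightarrow> bool" where
  "riemann_roch_dim C D l \<longleftrightarrow> (\<exists>b :: nat \<Rightarrow> 'a point \<Rightarrow> 'a.
     (\<forall>j<l. b j \<in> riemann_roch_space C D) \<and>
     (\<forall>\<phi>\<in>riemann_roch_space C D. \<exists>c. geneq C \<phi> (\<lambda>Q. \<Sum>j<l. c j * b j Q)) \<and>
     (\<forall>c. geneq C (\<lambda>Q. \<Sum>j<l. c j * b j Q) (\<lambda>_. 0) \<longrightarrow> (\<forall>j<l. c j = 0)))"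

text \<open>The genus is the maximum of \<open>deg D + 1 - l(D)\<close> over all divisors \<open>D\<close> (see Stichtenoth,
  Algebraic Function Fields and Codes, Definition 1.4.15).\<close>

definition has_genus :: "'a::field variety \<Rightarrow> nat \<Rightarrow> bool" where
  "has_genus C g \<longleftrightarrow>
     (\<forall>D l. is_divisor C D \<and> riemann_roch_dim C D l \<longrightarrow> divisor_degree C D + 1 - int l \<le> int g) \<and>
     (\<exists>D l. is_divisor C D \<and> riemann_roch_dim C D l \<and> divisor_degree C D + 1 - int l = int g)"

text \<open>A morphism of irreducible varieties has degree \<open>d\<close> if it is dominant and the function field
  of the source has dimension \<open>d\<close> over the pullback of the function field of the target.\<close>

definition morphism_of_degree ::
    "'a::field variety \<Rightarrow> 'a variety \<Rightarrow> ('a point \<Rightarrow> 'a point) \<Rightarrow> nat \<Rightarrow> bool" where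
  "morphism_of_degree C Y \<phi> d \<longleftrightarrow> morphism C Y \<phi> \<and>
     (\<forall>Z. zclosed Y Z \<and> \<phi> ` pts C \<subseteq> Z \<longrightarrow> Z = pts Y) \<and>
     (\<exists>b :: nat \<Rightarrow> 'a point \<Rightarrow> 'a. (\<forall>j<d. rational C (b j)) \<and>
        (\<forall>\<xi>. rational C \<xi> \<longrightarrow> (\<exists>a. (\<forall>j<d. rational Y (a j)) \<and>
           geneq C \<xi> (\<lambda>P. \<Sum>j<d. a j (\<phi> P) * b j P))) \<and>
        (\<forall>a. (\<forall>j<d. rational Y (a j)) \<and> geneq C (\<lambda>P. \<Sum>j<d. a j (\<phi> P) * b j P) (\<lambda>_. 0) \<longrightarrow>
           (\<forall>j<d. geneq Y (a j) (\<lambda>_. 0))))"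

definition projective_line :: "'a::field variety" where
  "projective_line = ([1, 1], {})"

definition hyperelliptic :: "'a::field variety \<Rightarrow> bool" where
  "hyperelliptic C \<longleftrightarrow> smooth_projective_curve C \<and> (\<exists>g\<ge>2. has_genus C g) \<and>
     (\<exists>\<phi>. morphism_of_degree C projective_line \<phi> 2)"


section \<open>Galois theory\<close>

text \<open>\<open>K = 'k alg_closure\<close> is the algebraic closure of the field \<open>'k\<close>, which is identified with
  the following subfield of \<open>K\<close>.\<close>

definition ground_field :: "'k::field alg_closure set" where
  "ground_field = range to_ac"

definition perfect :: "'k::field itself \<Rightarrow> bool" where
  "perfect _ \<longleftrightarrow> CHAR('k) = 0 \<or> surj (\<lambda>x :: 'k. x ^ CHAR('k))"

text \<open>Automorphisms of a subfield \<open>L\<close> over \<open>k\<close>, extended by \<open>undefined\<close> outside of \<open>L\<close> so that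
  they are determined by their values on \<open>L\<close>.\<close>

definition Gal :: "'a::field set \<Rightarrow> 'a set \<Rightarrow> ('a \<Rightarrow> 'a) set" where
  "Gal L k = {\<sigma> \<in> extensional L. bij_betw \<sigma> L L \<and> (\<forall>x\<in>k. \<sigma> x = x) \<and>
     (\<forall>x\<in>L. \<forall>y\<in>L. \<sigma> (x + y) = \<sigma> x + \<sigma> y \<and> \<sigma> (x * y) = \<sigma> x * \<sigma> y)}"

definition generates_Gal :: "'a::field set \<Rightarrow> 'a set \<Rightarrow> ('a \<Rightarrow> 'a) \<Rightarrow> bool" where
  "generates_Gal L k \<sigma> \<longleftrightarrow> \<sigma> \<in> Gal L k \<and> (\<forall>\<tau>\<in>Gal L k. \<exists>j. \<forall>x\<in>L. \<tau> x = (\<sigma> ^^ j) x)"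

definition fixed_field :: "('a \<Rightarrow> 'a) set \<Rightarrow> 'a set" where
  "fixed_field H = {x. \<forall>\<sigma>\<in>H. \<sigma> x = x}"

definition norm_group :: "'a::field set \<Rightarrow> 'a set \<Rightarrow> 'a set" where
  "norm_group L k = {\<Prod>\<tau>\<in>Gal L k. \<tau> x | x. x \<in> L \<and> x \<noteq> 0}"

definition conjugate :: "('a \<Rightarrow> 'a) \<Rightarrow> 'a::field variety \<Rightarrow> 'a variety" where
  "conjugate \<sigma> C = (fst C, Poly_Mapping.map \<sigma> ` snd C)"

definition field_of_moduli :: "'a::field set \<Rightarrow> 'a variety \<Rightarrow> 'a set" where
  "field_of_moduli k C = fixed_field {\<sigma> \<in> Gal UNIV k. isomorphic C (conjugate \<sigma> C)}"


section \<open>Binary forms\<close>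

text \<open>The variables \<open>x\<close>, \<open>z\<close>, \<open>y\<close> have the indices \<open>0\<close>, \<open>1\<close>, \<open>2\<close>.\<close>

abbreviation x_var :: "'a::zero_neq_one mpoly" where "x_var \<equiv> mp_var 0"
abbreviation z_var :: "'a::zero_neq_one mpoly" where "z_var \<equiv> mp_var 1"
abbreviation y_var :: "'a::zero_neq_one mpoly" where "y_var \<equiv> mp_var 2"

definition binary_form :: "nat \<Rightarrow> 'a::field mpoly \<Rightarrow> bool" where
  "binary_form d f \<longleftrightarrow> homogeneous [1, 1] d f"

definition no_repeated_linear_factors :: "'a::field mpoly \<Rightarrow> bool" where
  "no_repeated_linear_factors f \<longleftrightarrow>
     (\<forall>\<alpha> \<beta>. (\<alpha>, \<beta>) \<noteq> (0, 0) \<longrightarrow> \<not> (mp_const \<alpha> * x_var + mp_const \<beta> * z_var)\<^sup>2 dvd f)"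

definition gl_act :: "'a::field ^ 2 ^ 2 \<Rightarrow> 'a mpoly \<Rightarrow> 'a mpoly" where
  "gl_act A f = (let B = matrix_inv A in
     mp_eval mp_const
       (\<lambda>j. if j = 0 then mp_const (B $ 1 $ 1) * x_var + mp_const (B $ 1 $ 2) * z_var
            else if j = 1 then mp_const (B $ 2 $ 1) * x_var + mp_const (B $ 2 $ 2) * z_var
            else mp_var j) f)"

definition form_sim :: "'a::field mpoly \<Rightarrow> 'a mpoly \<Rightarrow> bool" where
  "form_sim f1 f2 \<longleftrightarrow> (\<exists>c. c \<noteq> 0 \<and> f1 = mp_const c * f2)"

definition diag2 :: "'a::field \<Rightarrow> 'a \<Rightarrow> 'a ^ 2 ^ 2" where
  "diag2 a d = vector [vector [a, 0], vector [0, d]]"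

definition swap2 :: "'a::field ^ 2 ^ 2" where
  "swap2 = vector [vector [0, 1], vector [1, 0]]"

text \<open>The element of \<open>PGL\<^sub>2\<close> given by an invertible matrix.\<close>

definition pgl_class :: "'a::field ^ 2 ^ 2 \<Rightarrow> ('a ^ 2 ^ 2) set" where
  "pgl_class A = {mat c ** A | c. c \<noteq> 0}"

definition Aut_form :: "'a::field mpoly \<Rightarrow> ('a ^ 2 ^ 2) set set" where
  "Aut_form f = {pgl_class A | A. invertible A \<and> form_sim (gl_act A f) f}"

definition primitive_root_of_unity :: "nat \<Rightarrow> 'a::field \<Rightarrow> bool" where
  "primitive_root_of_unity n \<zeta> \<longleftrightarrow> \<zeta> ^ n = 1 \<and> (\<forall>j. 0 < j \<and> j < n \<longrightarrow> \<zeta> ^ j \<noteq> 1)"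

definition diag_form :: "nat \<Rightarrow> nat \<Rightarrow> nat \<Rightarrow> (nat \<Rightarrow> 'a::field) \<Rightarrow> 'a mpoly" where
  "diag_form i n m a =
     (if i = 0 then 1 else if i = 1 then z_var else x_var * z_var) *
     (\<Sum>j\<le>m. mp_const (a j) * x_var ^ (j * n) * z_var ^ ((m - j) * n))"

text \<open>The form \<open>diag_form i n m a\<close> has degree \<open>n * m + i\<close>. A number \<open>n > 0\<close> is coprime to the
  characteristic exponent iff it is not divisible by the characteristic, which puts no condition
  on \<open>n\<close> in characteristic \<open>0\<close>.\<close>

definition form_of_type :: "nat \<Rightarrow> nat \<Rightarrow> nat \<Rightarrow> 'a::field mpoly \<Rightarrow> bool" where
  "form_of_type i n m f \<longleftrightarrow> i \<in> {0, 1, 2} \<and> 0 < n \<and> 0 < m \<and> \<not> CHAR('a) dvd n \<and> even (n * m + i) \<and>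
     (\<exists>a. f = diag_form i n m a) \<and>
     (\<exists>\<zeta>. primitive_root_of_unity n \<zeta> \<and> Aut_form f = {pgl_class (diag2 (\<zeta> ^ j) 1) | j. True}) \<and>
     no_repeated_linear_factors f"


section \<open>Hyperelliptic models and descents\<close>

text \<open>The curve \<open>y\<^sup>2 = f(x, z)\<close> in the weighted projective \<open>(x, z, y)\<close>-space with weights
  \<open>(1, 1, w)\<close>, for \<open>f\<close> of degree \<open>2 * w\<close>. If \<open>f\<close> has no repeated linear factors and the
  characteristic is not \<open>2\<close>, then it avoids the point \<open>(0 : 0 : 1)\<close> and is smooth, so that it is its
  own desingularization.\<close>

definition hyp_model :: "nat \<Rightarrow> 'a::field mpoly \<Rightarrow> 'a variety" where
  "hyp_model w f = ([1, 1, w], {y_var\<^sup>2 - f})"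

definition represents :: "nat \<Rightarrow> nat \<Rightarrow> nat \<Rightarrow> 'a::field mpoly \<Rightarrow> 'a variety \<Rightarrow> bool" where
  "represents i n m f C \<longleftrightarrow> form_of_type i n m f \<and> isomorphic C (hyp_model ((n * m + i) div 2) f)"

definition hyperelliptic_descent :: "'a::field set \<Rightarrow> nat \<Rightarrow> 'a variety \<Rightarrow> 'a mpoly \<Rightarrow> bool" where
  "hyperelliptic_descent k g C f0 \<longleftrightarrow> binary_form (2 * g + 2) f0 \<and> coeffs_in k f0 \<and>
     no_repeated_linear_factors f0 \<and> isomorphic C (hyp_model (g + 1) f0)"

definition descends_hyperelliptically :: "'a::field set \<Rightarrow> nat \<Rightarrow> 'a variety \<Rightarrow> bool" where
  "descends_hyperelliptically k g C \<longleftrightarrow> (\<exists>f0. hyperelliptic_descent k g C f0)"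


section \<open>Homogeneous diagonal invariants\<close>

definition admissible :: "nat \<Rightarrow> (nat \<Rightarrow> 'a::field) \<Rightarrow> nat list \<Rightarrow> bool" where
  "admissible m a S \<longleftrightarrow> distinct S \<and> set S \<subseteq> {0..m} \<and> (\<forall>s\<in>set S. a s \<noteq> 0) \<and>
     (\<forall>j\<le>m. a j \<noteq> 0 \<or> a (m - j) \<noteq> 0 \<longrightarrow> (\<exists>!s. s \<in> {j, m - j} \<and> s \<in> set S))"

text \<open>Elements of \<open>\<int>\<^sup>r\<close> are functions on \<open>nat\<close> that are zero on \<open>{r..}\<close>.\<close>

definition kernel_lattice :: "nat \<Rightarrow> nat list \<Rightarrow> (nat \<Rightarrow> int) set" where
  "kernel_lattice m S = {v. (\<forall>t\<ge>length S. v t = 0) \<and>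
     (\<Sum>t<length S. (2 * int (S ! t) - int m) * v t) = 0}"

definition is_Z_basis :: "(nat \<Rightarrow> int) set \<Rightarrow> (nat \<Rightarrow> int) list \<Rightarrow> bool" where
  "is_Z_basis M bs \<longleftrightarrow> set bs \<subseteq> M \<and>
     (\<forall>v\<in>M. \<exists>!c :: nat \<Rightarrow> int. (\<forall>l\<ge>length bs. c l = 0) \<and> v = (\<lambda>t. \<Sum>l<length bs. c l * (bs ! l) t))"

definition nonneg_basis :: "nat \<Rightarrow> nat list \<Rightarrow> (nat \<Rightarrow> nat) list \<Rightarrow> bool" where
  "nonneg_basis m S vs \<longleftrightarrow> is_Z_basis (kernel_lattice m S) (map (\<lambda>v t. int (v t)) vs)"

definition J_values :: "nat \<Rightarrow> nat list \<Rightarrow> (nat \<Rightarrow> nat) list \<Rightarrow> (nat \<Rightarrow> 'a::field) \<Rightarrow> 'a list" where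
  "J_values m S vs a =
     map (\<lambda>v. \<Prod>t<length S. a (S ! t) ^ v t) vs @
     map (\<lambda>j. a (m - j) * a j) (filter (\<lambda>j. 2 * j < m) [0..<m])"

definition J_weights :: "nat \<Rightarrow> nat list \<Rightarrow> (nat \<Rightarrow> nat) list \<Rightarrow> nat list" where
  "J_weights m S vs =
     map (\<lambda>v. \<Sum>t<length S. v t) vs @ map (\<lambda>j. 2) (filter (\<lambda>j. 2 * j < m) [0..<m])"

definition same_weighted_point :: "nat list \<Rightarrow> 'a::field list \<Rightarrow> 'a list \<Rightarrow> bool" where
  "same_weighted_point w p q \<longleftrightarrow> (\<exists>c. c \<noteq> 0 \<and> (\<forall>l<length w. q ! l = c ^ (w ! l) * p ! l))"

definition invariant_extension ::
    "'a::field set \<Rightarrow> nat \<Rightarrow> nat list \<Rightarrow> (nat \<Rightarrow> nat) list \<Rightarrow> (nat \<Rightarrow> 'a) \<Rightarrow> 'a set" where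
  "invariant_extension k m S vs a = fixed_field {\<sigma> \<in> Gal UNIV k.
     same_weighted_point (J_weights m S vs) (map \<sigma> (J_values m S vs a)) (J_values m S vs a)}"


section \<open>The norm obstruction\<close>

text \<open>Elements of \<open>k\<^sup>* / Nm(L\<^sup>*)\<close> are represented as cosets of \<open>norm_group L k\<close>.\<close>

definition norm_obstruction ::
    "'a::field set \<Rightarrow> 'a set \<Rightarrow> nat \<Rightarrow> nat \<Rightarrow> nat \<Rightarrow> 'a mpoly \<Rightarrow> 'a set" where
  "norm_obstruction k L i n m f =
     (if L = k then norm_group L k
      else (THE N. \<exists>fL A \<sigma> \<nu> \<mu>.
        form_of_type i n m fL \<and> coeffs_in L fL \<and>
        invertible A \<and> form_sim fL (gl_act A f) \<and>
        generates_Gal L k \<sigma> \<and> \<nu> \<noteq> 0 \<and> \<mu> \<noteq> 0 \<and>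
        form_sim (Poly_Mapping.map \<sigma> fL) (gl_act (diag2 \<nu> \<mu> ** swap2) fL) \<and>
        N = (\<lambda>c. \<mu> ^ n / \<nu> ^ n * c) ` norm_group L k))"

definition norm_obstruction_trivial ::
    "'a::field set \<Rightarrow> 'a set \<Rightarrow> nat \<Rightarrow> nat \<Rightarrow> nat \<Rightarrow> 'a mpoly \<Rightarrow> bool" where
  "norm_obstruction_trivial k L i n m f \<longleftrightarrow> norm_obstruction k L i n m f = norm_group L k"

end

theory Submission
  imports Defs
begin

text \<open>The proof translates the statement about curves into one about binary forms, this into one about the
  coefficients \<open>a\<^sub>j\<close>, and finally into arithmetic of the quadratic extension \<open>L|k\<close>.

  \<^emph>\<open>Curves and forms.\<close> For \<open>w \<ge> 3\<close>, two models \<open>y\<^sup>2 = F\<close> and \<open>y\<^sup>2 = G\<close> of degree \<open>2w\<close> are isomorphic iff \<open>F\<close> and \<open>G\<close>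
  are equivalent under \<open>GL\<^sub>2\<close> and scalars (\<open>form_equiv_imp_isomorphic\<close>, \<open>isomorphic_imp_form_equiv\<close>). The nontrivial direction
  rests on the uniqueness of the map to the projective line: the Riemann-Roch spaces of the divisors of zeros of products
  of linear forms are computed by hand (\<open>rr_fdiv_upper\<close>), and in genus at least \<open>2\<close> a function with a divisor of poles of
  degree \<open>2\<close> is therefore a fractional linear function of \<open>x\<close> (\<open>degree_two_function\<close>). The same computation gives
  the genus \<open>w - 1\<close> (\<open>genus_hyp_model\<close>).

  \<^emph>\<open>Forms and coefficients.\<close> A substitution that relates two forms of the same type normalizes \<open>C\<^sub>n\<close>, \<open>n > 1\<close>, so it is diagonal
  or antidiagonal, and it is diagonal for type \<open>(1, n, m)\<close> (\<open>typed_equiv_cases\<close>). In terms of coefficients it replaces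
  \<open>a\<^sub>j\<close> by \<open>c t\<^sup>j a\<^sub>j\<close> or by \<open>c t\<^sup>j a\<^sub>m\<^sub>-\<^sub>j\<close>. The elements of \<open>\<Gamma>\<close> that fix the isomorphism class of the curve act on the
  coefficients in this way. Since their fixed field is \<open>k\<close>, every element of \<open>\<Gamma>\<close> agrees with one of them on the finitely many
  coefficients (\<open>artin_tuple\<close>), so all of \<open>\<Gamma>\<close> acts in this way (\<open>\<Gamma>_cases\<close>).

  \<^emph>\<open>The field \<open>L\<close>.\<close> The elements of \<open>\<Gamma>\<close> that act diagonally form a subgroup \<open>H\<close> of index at most \<open>2\<close>. They are the ones that fix
  the point \<open>J(f)\<close>, because the monomials in \<open>J(f)\<close> generate the monomials that are invariant under diagonal substitutions
  (\<open>same_invariants_iff_diag_equiv\<close>); so \<open>L\<close> is the fixed field of \<open>H\<close>. A diagonal substitution makes all coefficients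
  \<open>H\<close>-invariant (\<open>rational_coefficients\<close>), which gives a form of the given type over \<open>L\<close>. If \<open>H = \<Gamma>\<close>, in particular for type
  \<open>(1, n, m)\<close>, this form is a descent.

  \<^emph>\<open>The quadratic case.\<close> Otherwise let \<open>s \<in> \<Gamma> - H\<close> and let \<open>b\<^sub>j \<in> L\<close> be the coefficients over \<open>L\<close>, so that
  \<open>s(b\<^sub>j) = c t\<^sup>j b\<^sub>m\<^sub>-\<^sub>j\<close>. Applying \<open>s\<close> twice shows \<open>t \<in> k\<close> and \<open>c s(c) t\<^sup>m = 1\<close>. The class of \<open>t\<close> modulo norms is the norm
  obstruction (\<open>norm_obstruction_eq\<close>), and for odd \<open>m\<close> the relation exhibits \<open>t\<close> as a norm (\<open>norm_if_odd\<close>). If \<open>t\<close> is a norm,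
  a rescaling achieves \<open>s(b\<^sub>j) = b\<^sub>m\<^sub>-\<^sub>j\<close>, and substituting \<open>x + \<delta>z\<close> and \<open>x - \<delta>z\<close> with \<open>s(\<delta>) = -\<delta>\<close> gives a form over \<open>k\<close>
  (\<open>descent_if_norm\<close>). Conversely a form over \<open>k\<close> is, in two conjugate linear forms over \<open>L\<close>, a form with
  \<open>s(b\<^sub>j) = b\<^sub>m\<^sub>-\<^sub>j\<close>, whence \<open>t\<close> is a norm (\<open>norm_if_descent\<close>).\<close>

section \<open>Evaluation of multivariate polynomials\<close>

text \<open>Homomorphisms of semirings as plain functions: evaluations, substitutions and field automorphisms are
  instances of one notion.\<close>

definition rhom :: "('a::comm_semiring_1 \<Rightarrow> 'b::comm_semiring_1) \<Rightarrow> bool" where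
  "rhom h \<longleftrightarrow> h 0 = 0 \<and> h 1 = 1 \<and> (\<forall>a b. h (a + b) = h a + h b) \<and> (\<forall>a b. h (a * b) = h a * h b)"

lemma rhomD:
  assumes "rhom h"
  shows "h 0 = 0" "h 1 = 1" "h (a + b) = h a + h b" "h (a * b) = h a * h b"
  using assms by (auto simp: rhom_def)

lemma rhom_power: "rhom h \<Longrightarrow> h (a ^ n) = h a ^ n"
  by (induction n) (auto simp: rhomD)

lemma rhom_sum: "rhom h \<Longrightarrow> h (sum g A) = (\<Sum>x\<in>A. h (g x))"
  by (induction A rule: infinite_finite_induct) (auto simp: rhomD)

lemma rhom_prod: "rhom h \<Longrightarrow> h (prod g A) = (\<Prod>x\<in>A. h (g x))"
  by (induction A rule: infinite_finite_induct) (auto simp: rhomD)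

lemma rhom_id [simp]: "rhom id"
  by (auto simp: rhom_def)

lemma rhom_mp_const [simp]: "rhom (mp_const :: 'a::comm_semiring_1 \<Rightarrow> _)"
  by (auto simp: rhom_def mp_const_def single_add mult_single)

lemma rhom_comp: "rhom g \<Longrightarrow> rhom h \<Longrightarrow> rhom (\<lambda>x. g (h x))"
  by (auto simp: rhom_def)

definition mon_eval :: "(nat \<Rightarrow> 'b::comm_semiring_1) \<Rightarrow> (nat \<Rightarrow>\<^sub>0 nat) \<Rightarrow> 'b" where
  "mon_eval v mm = (\<Prod>i\<in>Poly_Mapping.keys mm. v i ^ Poly_Mapping.lookup mm i)"

lemma mon_eval_superset:
  assumes "finite A" "Poly_Mapping.keys mm \<subseteq> A"
  shows "mon_eval v mm = (\<Prod>i\<in>A. v i ^ Poly_Mapping.lookup mm i)"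
  unfolding mon_eval_def using assms
  by (intro prod.mono_neutral_left) (auto simp: in_keys_iff)

lemma mon_eval_0 [simp]: "mon_eval v 0 = 1"
  by (simp add: mon_eval_def)

lemma mon_eval_single [simp]: "mon_eval v (Poly_Mapping.single i e) = v i ^ e"
  by (cases "e = 0") (auto simp: mon_eval_def)

lemma mon_eval_add: "mon_eval v (m1 + m2) = mon_eval v m1 * mon_eval v m2"
proof -
  let ?A = "Poly_Mapping.keys m1 \<union> Poly_Mapping.keys m2"
  have "mon_eval v (m1 + m2) = (\<Prod>i\<in>?A. v i ^ Poly_Mapping.lookup (m1 + m2) i)"
    by (rule mon_eval_superset) (auto simp: keys_add)
  also have "\<dots> = (\<Prod>i\<in>?A. v i ^ Poly_Mapping.lookup m1 i) * (\<Prod>i\<in>?A. v i ^ Poly_Mapping.lookup m2 i)"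
    by (simp add: lookup_add power_add prod.distrib)
  also have "\<dots> = mon_eval v m1 * mon_eval v m2"
    by (subst (1 2) mon_eval_superset[of ?A]) auto
  finally show ?thesis .
qed

lemma mp_eval_superset:
  assumes "finite A" "Poly_Mapping.keys p \<subseteq> A" "h 0 = 0"
  shows "mp_eval h v p = (\<Sum>mm\<in>A. h (Poly_Mapping.lookup p mm) * mon_eval v mm)"
  unfolding mp_eval_def mon_eval_def using assms
  by (intro sum.mono_neutral_left) (auto simp: in_keys_iff)

lemma mp_eval_zero [simp]: "mp_eval h v 0 = 0"
  by (simp add: mp_eval_def)

lemma mp_eval_single: "h 0 = 0 \<Longrightarrow> mp_eval h v (Poly_Mapping.single k c) = h c * mon_eval v k"
  by (cases "c = 0") (auto simp: mp_eval_def mon_eval_def)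

lemma mp_eval_add:
  assumes "rhom h" shows "mp_eval h v (p + q) = mp_eval h v p + mp_eval h v q"
proof -
  let ?A = "Poly_Mapping.keys p \<union> Poly_Mapping.keys q"
  have 0: "h 0 = 0" using assms by (rule rhomD)
  have "mp_eval h v (p + q) = (\<Sum>mm\<in>?A. h (Poly_Mapping.lookup (p + q) mm) * mon_eval v mm)"
    by (rule mp_eval_superset) (auto simp: keys_add 0)
  also have "\<dots> = mp_eval h v p + mp_eval h v q"
    by (subst (1 2) mp_eval_superset[of ?A])
       (auto simp: 0 lookup_add rhomD[OF assms] distrib_right sum.distrib)
  finally show ?thesis .
qed

lemma mp_eval_sum:
  assumes "rhom h" shows "mp_eval h v (sum g A) = (\<Sum>x\<in>A. mp_eval h v (g x))"
  by (induction A rule: infinite_finite_induct) (auto simp: mp_eval_add[OF assms])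

lemma poly_mapping_expand:
  "p = (\<Sum>k\<in>Poly_Mapping.keys p. Poly_Mapping.single k (Poly_Mapping.lookup p k))"
  by (rule poly_mapping_eqI)
     (auto simp: lookup_sum lookup_single when_def sum.delta in_keys_iff cong: if_cong)

lemma mp_eval_mult:
  assumes "rhom h" shows "mp_eval h v (p * q) = mp_eval h v p * mp_eval h v q"
proof -
  have 0: "h 0 = 0" using assms by (rule rhomD)
  let ?l = "Poly_Mapping.lookup" and ?k = "Poly_Mapping.keys"
  have "p * q = (\<Sum>k\<in>?k p. \<Sum>k'\<in>?k q. Poly_Mapping.single (k + k') (?l p k * ?l q k'))"
    by (subst (1) poly_mapping_expand[of p], subst (1) poly_mapping_expand[of q])
       (simp add: sum_product mult_single)
  hence "mp_eval h v (p * q) =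
      (\<Sum>k\<in>?k p. \<Sum>k'\<in>?k q. h (?l p k) * mon_eval v k * (h (?l q k') * mon_eval v k'))"
    by (simp add: mp_eval_sum[OF assms] mp_eval_single 0 rhomD[OF assms] mon_eval_add ac_simps)
  also have "\<dots> = mp_eval h v p * mp_eval h v q"
    by (simp add: sum_product mp_eval_def mon_eval_def)
  finally show ?thesis .
qed

lemma mp_eval_const [simp]: "h 0 = 0 \<Longrightarrow> mp_eval h v (mp_const c) = h c"
  by (simp add: mp_const_def mp_eval_single)

lemma mp_eval_one: "rhom h \<Longrightarrow> mp_eval h v 1 = 1"
  using mp_eval_const[of h v 1] by (simp add: rhomD mp_const_def)

lemma mp_eval_var [simp]: "h 0 = 0 \<Longrightarrow> h 1 = 1 \<Longrightarrow> mp_eval h v (mp_var i) = v i"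
  by (simp add: mp_var_def mp_eval_single)

lemma rhom_mp_eval: "rhom h \<Longrightarrow> rhom (mp_eval h v)"
  by (auto simp: rhom_def mp_eval_add[unfolded rhom_def] mp_eval_mult[unfolded rhom_def] mp_eval_one[unfolded rhom_def])

lemma rhom_eval [simp]: "rhom (mp_eval id v)"
  by (rule rhom_mp_eval) simp

lemma rhom_subst [simp]: "rhom (mp_eval mp_const v)"
  by (rule rhom_mp_eval) simp

lemma rhom_uminus:
  fixes h :: "'a::comm_ring_1 \<Rightarrow> 'b::comm_ring_1"
  assumes "rhom h" shows "h (- a) = - h a"
  using rhomD(3)[OF assms, of a "-a"] rhomD(1)[OF assms] by (simp add: minus_unique)

lemma rhom_diff:
  fixes h :: "'a::comm_ring_1 \<Rightarrow> 'b::comm_ring_1"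
  assumes "rhom h" shows "h (a - b) = h a - h b"
  using rhomD(3)[OF assms, of a "-b"] by (simp add: rhom_uminus[OF assms])

lemma eval_simps [simp]:
  fixes p q :: "'a::field mpoly"
  shows "mp_eval id v (p + q) = mp_eval id v p + mp_eval id v q"
    and "mp_eval id v (p - q) = mp_eval id v p - mp_eval id v q"
    and "mp_eval id v (- p) = - mp_eval id v p"
    and "mp_eval id v (p * q) = mp_eval id v p * mp_eval id v q"
    and "mp_eval id v (p ^ n) = mp_eval id v p ^ n"
    and "mp_eval id v (sum g A) = (\<Sum>x\<in>A. mp_eval id v (g x))"
    and "mp_eval id v (prod g A) = (\<Prod>x\<in>A. mp_eval id v (g x))"
    and "mp_eval id v (1 :: 'a mpoly) = 1"
  using rhom_eval[of v]
  by (simp_all only: rhomD rhom_diff rhom_uminus rhom_power rhom_sum rhom_prod)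

lemma rhom_mp_eval_comp:
  assumes "rhom g"
  shows "g (mp_eval h v p) = mp_eval (\<lambda>x. g (h x)) (\<lambda>i. g (v i)) p"
  by (simp add: mp_eval_def rhom_sum[OF assms] rhom_prod[OF assms] rhom_power[OF assms] rhomD[OF assms])

lemma eval_subst:
  "mp_eval id v (mp_eval mp_const T p) = mp_eval id (\<lambda>i. mp_eval id v (T i)) (p :: 'a::field mpoly)"
  by (subst rhom_mp_eval_comp) (auto simp: id_def[symmetric] o_def)

lemma mon_eval_var: "mon_eval mp_var k = Poly_Mapping.single k (1::'a::comm_semiring_1)"
proof -
  have pw: "(mp_var i :: 'a mpoly) ^ e = Poly_Mapping.single (Poly_Mapping.single i e) 1" for i e
    by (induction e) (auto simp: mp_var_def mult_single single_add[symmetric] single_one)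
  have pr: "finite A \<Longrightarrow> (\<Prod>i\<in>A. Poly_Mapping.single (Poly_Mapping.single i (g i)) (1::'a))
      = Poly_Mapping.single (\<Sum>i\<in>A. Poly_Mapping.single i (g i)) 1" for A :: "nat set" and g :: "nat \<Rightarrow> nat"
    by (induction A rule: finite_induct) (auto simp: mult_single)
  show ?thesis
    unfolding mon_eval_def pw by (subst pr) (auto simp: poly_mapping_expand[symmetric])
qed

text \<open>Applying a map to the coefficients is an evaluation, so it is a homomorphism if the map is one.\<close>

lemma map_eq_eval:
  fixes p :: "'a::field mpoly"
  assumes "\<sigma> 0 = (0::'b::field)"
  shows "Poly_Mapping.map \<sigma> p = mp_eval (\<lambda>c. mp_const (\<sigma> c)) mp_var p"
proof -
  have "mp_eval (\<lambda>c. mp_const (\<sigma> c)) mp_var p =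
      (\<Sum>k\<in>Poly_Mapping.keys p. mp_const (\<sigma> (Poly_Mapping.lookup p k)) * mon_eval mp_var k)"
    by (simp add: mp_eval_def mon_eval_def)
  also have "\<dots> = (\<Sum>k\<in>Poly_Mapping.keys p. Poly_Mapping.single k (\<sigma> (Poly_Mapping.lookup p k)))"
    by (simp add: mon_eval_var mp_const_def mult_single)
  also have "\<dots> = Poly_Mapping.map \<sigma> p"
    by (rule poly_mapping_eqI)
       (auto simp: lookup_sum lookup_single when_def sum.delta in_keys_iff map.rep_eq assms cong: if_cong)
  finally show ?thesis by simp
qed

lemma rhom_map: "rhom \<sigma> \<Longrightarrow> rhom (Poly_Mapping.map \<sigma> :: 'a::field mpoly \<Rightarrow> 'b::field mpoly)"
proof -
  assume s: "rhom \<sigma>"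
  have "Poly_Mapping.map \<sigma> = mp_eval (\<lambda>c. mp_const (\<sigma> c)) mp_var"
    using map_eq_eval[of \<sigma>] rhomD(1)[OF s] by blast
  thus ?thesis using rhom_mp_eval[OF rhom_comp[OF rhom_mp_const s]] by metis
qed

lemma lookup_map: "\<sigma> 0 = 0 \<Longrightarrow> Poly_Mapping.lookup (Poly_Mapping.map \<sigma> p) k = \<sigma> (Poly_Mapping.lookup p k)"
  by (auto simp: map.rep_eq when_def)

lemma eval_map:
  fixes p :: "'a::field mpoly" and \<sigma> :: "'a \<Rightarrow> 'b::field"
  assumes "rhom \<sigma>"
  shows "mp_eval id (\<lambda>i. \<sigma> (v i)) (Poly_Mapping.map \<sigma> p) = \<sigma> (mp_eval id v p)"
proof -
  have [simp]: "\<sigma> 0 = 0" "\<sigma> 1 = 1" using rhomD[OF assms] by auto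
  have "mp_eval id (\<lambda>i. \<sigma> (v i)) (Poly_Mapping.map \<sigma> p) = mp_eval (\<lambda>c. \<sigma> c) (\<lambda>i. \<sigma> (v i)) p"
    by (subst map_eq_eval, simp, subst rhom_mp_eval_comp) auto
  also have "\<dots> = \<sigma> (mp_eval id v p)"
    by (subst rhom_mp_eval_comp[OF assms]) simp
  finally show ?thesis .
qed

lemma map_const [simp]: "\<sigma> 0 = 0 \<Longrightarrow> Poly_Mapping.map \<sigma> (mp_const c) = mp_const (\<sigma> c)"
  by (simp add: mp_const_def)

lemma map_var [simp]: "\<sigma> 0 = 0 \<Longrightarrow> \<sigma> 1 = 1 \<Longrightarrow> Poly_Mapping.map \<sigma> (mp_var i) = mp_var i"
  by (simp add: mp_var_def)

lemma map_map: "\<sigma> 0 = 0 \<Longrightarrow> \<tau> 0 = 0 \<Longrightarrow> Poly_Mapping.map \<sigma> (Poly_Mapping.map \<tau> p) = Poly_Mapping.map (\<lambda>x. \<sigma> (\<tau> x)) p"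
  by (rule poly_mapping_eqI) (simp add: lookup_map)

lemma map_ident: "(\<And>x. \<sigma> x = x) \<Longrightarrow> Poly_Mapping.map \<sigma> p = p"
  by (rule poly_mapping_eqI) (simp add: lookup_map)

section \<open>Weighted homogeneous polynomials\<close>

definition wdeg :: "nat list \<Rightarrow> (nat \<Rightarrow>\<^sub>0 nat) \<Rightarrow> nat" where
  "wdeg w mm = (\<Sum>i\<in>Poly_Mapping.keys mm. w ! i * Poly_Mapping.lookup mm i)"

lemma homogeneous_alt: "homogeneous w d p \<longleftrightarrow> (\<forall>mm\<in>Poly_Mapping.keys p.
     Poly_Mapping.keys mm \<subseteq> {..<length w} \<and> wdeg w mm = d)"
  by (simp add: homogeneous_def wdeg_def)

lemma wdeg_superset:
  assumes "finite A" "Poly_Mapping.keys mm \<subseteq> A"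
  shows "wdeg w mm = (\<Sum>i\<in>A. w ! i * Poly_Mapping.lookup mm i)"
  unfolding wdeg_def using assms
  by (intro sum.mono_neutral_left) (auto simp: in_keys_iff)

lemma wdeg_add: "wdeg w (m1 + m2) = wdeg w m1 + wdeg w m2"
proof -
  let ?A = "Poly_Mapping.keys m1 \<union> Poly_Mapping.keys m2"
  have "wdeg w (m1 + m2) = (\<Sum>i\<in>?A. w ! i * Poly_Mapping.lookup (m1 + m2) i)"
    by (rule wdeg_superset) (auto simp: keys_add)
  also have "\<dots> = wdeg w m1 + wdeg w m2"
    by (subst (1 2) wdeg_superset[of ?A]) (auto simp: lookup_add distrib_left sum.distrib)
  finally show ?thesis .
qed

lemma homogeneous_0 [simp]: "homogeneous w d 0"
  by (simp add: homogeneous_def)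

lemma homogeneous_const [simp]: "homogeneous w 0 (mp_const c)"
  by (auto simp: homogeneous_def mp_const_def)

lemma homogeneous_1 [simp]: "homogeneous w 0 (1::'a::field mpoly)"
  using homogeneous_const[of w "1::'a"] by (simp add: mp_const_def)

lemma homogeneous_var: "i < length w \<Longrightarrow> w ! i = d \<Longrightarrow> homogeneous w d (mp_var i)"
  by (auto simp: homogeneous_def mp_var_def)

lemma homogeneous_add [intro]:
  "homogeneous w d p \<Longrightarrow> homogeneous w d q \<Longrightarrow> homogeneous w d (p + q)"
  using keys_add[of p q] by (auto simp: homogeneous_alt)

lemma homogeneous_sum [intro]:
  "(\<And>x. x \<in> A \<Longrightarrow> homogeneous w d (g x)) \<Longrightarrow> homogeneous w d (sum g A)"
  by (induction A rule: infinite_finite_induct) auto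

lemma homogeneous_uminus [intro]: "homogeneous w d p \<Longrightarrow> homogeneous w d (- p)"
  for p :: "'a::field mpoly"
  by (auto simp: homogeneous_alt in_keys_iff)

lemma homogeneous_diff [intro]:
  "homogeneous w d p \<Longrightarrow> homogeneous w d q \<Longrightarrow> homogeneous w d (p - q)" for p :: "'a::field mpoly"
  using homogeneous_add[of w d p "-q"] by auto

lemma homogeneous_mult:
  assumes "homogeneous w d p" "homogeneous w e q"
  shows "homogeneous w (d + e) (p * q)"
  unfolding homogeneous_alt
proof
  fix mm assume "mm \<in> Poly_Mapping.keys (p * q)"
  then obtain a b where ab: "mm = a + b" "a \<in> Poly_Mapping.keys p" "b \<in> Poly_Mapping.keys q"
    using keys_mult[of p q] by auto
  have "Poly_Mapping.keys mm \<subseteq> Poly_Mapping.keys a \<union> Poly_Mapping.keys b"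
    using ab keys_add[of a b] by simp
  thus "Poly_Mapping.keys mm \<subseteq> {..<length w} \<and> wdeg w mm = d + e"
    using assms ab by (auto simp: homogeneous_alt wdeg_add)
qed

lemma homogeneous_mult':
  "homogeneous w d p \<Longrightarrow> homogeneous w e q \<Longrightarrow> c = d + e \<Longrightarrow> homogeneous w c (p * q)"
  using homogeneous_mult by blast

lemma homogeneous_power:
  fixes p :: "'a::field mpoly"
  assumes "homogeneous w d p" "e = d * n" shows "homogeneous w e (p ^ n)"
proof -
  have "homogeneous w (d * n) (p ^ n)"
    by (induction n) (auto intro!: homogeneous_mult[OF assms(1)])
  thus ?thesis using assms by simp
qed

lemma homogeneous_prod:
  fixes g :: "'c \<Rightarrow> 'a::field mpoly"
  assumes "\<And>x. x \<in> A \<Longrightarrow> homogeneous w (d x) (g x)"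
  shows "homogeneous w (sum d A) (prod g A)"
  using assms by (induction A rule: infinite_finite_induct) (auto intro!: homogeneous_mult)

lemma homogeneous_subst:
  fixes F :: "'a::field mpoly"
  assumes F: "homogeneous w d F" and T: "\<And>i. i < length w \<Longrightarrow> homogeneous w' (w ! i) (T i)"
  shows "homogeneous w' d (mp_eval mp_const T F)"
  unfolding mp_eval_def
proof (rule homogeneous_sum)
  fix mm assume mm: "mm \<in> Poly_Mapping.keys F"
  have "homogeneous w' (wdeg w mm) (\<Prod>i\<in>Poly_Mapping.keys mm. T i ^ Poly_Mapping.lookup mm i)"
    unfolding wdeg_def using F mm
    by (intro homogeneous_prod homogeneous_power[OF T]) (auto simp: homogeneous_def)
  from homogeneous_mult[OF homogeneous_const this]
  show "homogeneous w' d (mp_const (Poly_Mapping.lookup F mm) *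
      (\<Prod>i\<in>Poly_Mapping.keys mm. T i ^ Poly_Mapping.lookup mm i))"
    using F mm by (simp add: homogeneous_alt)
qed

lemma homogeneous_map:
  assumes "homogeneous w d p" "\<sigma> 0 = 0" shows "homogeneous w d (Poly_Mapping.map \<sigma> p)"
proof -
  have "Poly_Mapping.keys (Poly_Mapping.map \<sigma> p) \<subseteq> Poly_Mapping.keys p"
    using assms(2) by (auto simp: in_keys_iff lookup_map)
  thus ?thesis using assms by (auto simp: homogeneous_def)
qed

text \<open>The action of a scalar on the affine cone over the weighted projective space.\<close>

definition scal :: "nat list \<Rightarrow> 'a::field \<Rightarrow> (nat \<Rightarrow> 'a) \<Rightarrow> nat \<Rightarrow> 'a" where
  "scal w c v = (\<lambda>i. if i < length w then c ^ (w ! i) * v i else 0)"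

lemma eval_scal:
  assumes "homogeneous w d F"
  shows "mp_eval id (scal w c v) F = c ^ d * mp_eval id v F"
proof -
  have "mon_eval (scal w c v) mm = c ^ d * mon_eval v mm" if "mm \<in> Poly_Mapping.keys F" for mm
  proof -
    have "mon_eval (scal w c v) mm = (\<Prod>i\<in>Poly_Mapping.keys mm. c ^ (w ! i * Poly_Mapping.lookup mm i)) * mon_eval v mm"
      unfolding mon_eval_def prod.distrib[symmetric] using assms that
      by (intro prod.cong) (auto simp: scal_def homogeneous_alt power_mult_distrib power_mult)
    also have "(\<Prod>i\<in>Poly_Mapping.keys mm. c ^ (w ! i * Poly_Mapping.lookup mm i)) = c ^ d"
      using assms that by (simp add: homogeneous_alt wdeg_def power_sum[symmetric])
    finally show ?thesis .
  qed
  thus ?thesis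
    by (simp add: mp_eval_def mon_eval_def[symmetric] sum_distrib_left mult.left_commute)
qed

lemma eval_cong_hom:
  assumes "homogeneous w d F" "\<And>i. i < length w \<Longrightarrow> v i = v' i"
  shows "mp_eval h v F = mp_eval h v' F"
  unfolding mp_eval_def
proof (intro sum.cong arg_cong2[where f="(*)"] prod.cong refl)
  fix k i assume "k \<in> Poly_Mapping.keys F" "i \<in> Poly_Mapping.keys k"
  hence "i < length w" using assms(1) by (auto simp: homogeneous_def)
  thus "v i ^ Poly_Mapping.lookup k i = v' i ^ Poly_Mapping.lookup k i" using assms(2) by simp
qed

lemma orbit_alt: "orbit w v = {scal w c v | c. c \<noteq> 0}"
  by (simp add: orbit_def scal_def)

lemma scal_scal: "scal w c (scal w c' v) = scal w (c * c') v"
  by (auto simp: scal_def power_mult_distrib)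

lemma orbit_eq:
  assumes "u \<in> orbit w v" shows "orbit w u = orbit w v"
proof -
  obtain c where c: "c \<noteq> 0" "u = scal w c v" using assms by (auto simp: orbit_alt)
  have b: "scal w b v = scal w (b / c) u" for b using c by (simp add: scal_scal)
  show ?thesis
  proof (intro equalityI subsetI)
    fix y assume "y \<in> orbit w u"
    thus "y \<in> orbit w v" using c by (auto simp: orbit_alt scal_scal)
  next
    fix y assume "y \<in> orbit w v"
    then obtain d where "d \<noteq> 0" "y = scal w d v" by (auto simp: orbit_alt)
    hence "y = scal w (d / c) u" "d / c \<noteq> 0" using b[of d] c(1) by auto
    thus "y \<in> orbit w u" unfolding orbit_alt by blast
  qed
qed

lemma wspace_orbit:
  assumes "P \<in> wspace w" "v \<in> P"
  shows "P = orbit w v" "\<exists>i. v i \<noteq> 0" "\<forall>i\<ge>length w. v i = 0"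
proof -
  obtain u where u: "P = orbit w u" "\<exists>i. u i \<noteq> 0" "\<forall>i\<ge>length w. u i = 0" using assms by (auto simp: wspace_def)
  show "P = orbit w v" using orbit_eq[of v w u] assms u by simp
  obtain c where c: "c \<noteq> 0" "v = scal w c u" using assms u by (auto simp: orbit_alt)
  show "\<forall>i\<ge>length w. v i = 0" using c by (auto simp: scal_def)
  obtain i where "u i \<noteq> 0" using u by auto
  moreover from this have "i < length w" using u by (meson not_le)
  ultimately show "\<exists>i. v i \<noteq> 0" using c by (auto simp: scal_def intro!: exI[of _ i])
qed

lemma orbit_nonempty: "orbit w v \<noteq> {}"
  unfolding orbit_def by (auto intro: exI[of _ 1])

lemma wspace_nonempty: "P \<in> wspace w \<Longrightarrow> P \<noteq> {}"
  using orbit_nonempty by (auto simp only: wspace_def)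

definition rep :: "'a point \<Rightarrow> nat \<Rightarrow> 'a" where
  "rep P = (SOME v. v \<in> P)"

lemma rep_in: "P \<in> wspace w \<Longrightarrow> rep P \<in> P"
  unfolding rep_def by (rule some_in_eq[THEN iffD2]) (rule wspace_nonempty)

text \<open>The value of a form at a chosen representative of a point. Whether it vanishes, and the ratio of two such
  values for forms of equal degree, do not depend on the choice.\<close>

definition val :: "'a::field mpoly \<Rightarrow> 'a point \<Rightarrow> 'a" where
  "val F P = mp_eval id (rep P) F"

lemma val_simps [simp]:
  fixes p q :: "'a::field mpoly"
  shows "val (p + q) v = val p v + val q v"
    and "val (p - q) v = val p v - val q v"
    and "val (- p) v = - val p v"
    and "val (p * q) v = val p v * val q v"
    and "val (p ^ n) v = val p v ^ n"
    and "val (sum g A) v = (\<Sum>x\<in>A. val (g x) v)"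
    and "val (prod g A) v = (\<Prod>x\<in>A. val (g x) v)"
    and "val (1 :: 'a mpoly) v = 1" "val (0 :: 'a mpoly) v = 0" "val (mp_const c) v = c"
  by (simp_all add: val_def)

lemma ratio_val: "ratio F G P = val F P / val G P"
  by (simp add: ratio_def val_def rep_def Let_def)

lemma vanishes_val:
  assumes "P \<in> wspace w" "homogeneous w d F"
  shows "vanishes F P \<longleftrightarrow> val F P = 0"
proof -
  have "v \<in> orbit w (rep P)" if "v \<in> P" for v
    using wspace_orbit(1)[OF assms(1) rep_in[OF assms(1)]] that by metis
  hence v: "\<exists>c. v = scal w c (rep P)" if "v \<in> P" for v using that unfolding orbit_alt by blast
  have *: "\<exists>c. mp_eval id v F = c ^ d * val F P" if "v \<in> P" for v
    using v[OF that] eval_scal[OF assms(2)] unfolding val_def by blast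
  have "mp_eval id v F = 0" if "val F P = 0" "v \<in> P" for v
    using *[OF that(2)] that(1) by auto
  thus ?thesis using rep_in[OF assms(1)] unfolding vanishes_def val_def by blast
qed

lemma ratio_any:
  assumes "P \<in> wspace w" "v \<in> P" "homogeneous w d F" "homogeneous w d G"
  shows "ratio F G P = mp_eval id v F / mp_eval id v G"
proof -
  have "rep P \<in> orbit w v"
    using rep_in[OF assms(1)] by (subst wspace_orbit(1)[OF assms(1,2), symmetric])
  then obtain c where c: "c \<noteq> 0" "rep P = scal w c v" by (auto simp: orbit_alt)
  show ?thesis unfolding ratio_val val_def c(2) eval_scal[OF assms(3)] eval_scal[OF assms(4)]
    using c(1) by simp
qed

section \<open>Isomorphisms preserve the genus and commute with conjugation\<close>

lemma zopen_pts: "zopen C U \<Longrightarrow> U \<subseteq> pts C"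
  by (simp add: zopen_def)

lemma pts_wspace: "P \<in> pts C \<Longrightarrow> P \<in> wspace (fst C)"
  by (simp add: pts_def)

text \<open>Morphisms pull back regular functions on open sets. Applied to the zero function this gives the continuity of
  morphisms.\<close>

lemma regular_on_zero:
  assumes "zopen Y V" shows "regular_on Y V (\<lambda>_. 0)"
  unfolding regular_on_def
proof
  fix P assume P: "P \<in> V"
  have "\<not> vanishes 1 Q" if "Q \<in> V" for Q
    using that assms zopen_pts pts_wspace vanishes_val[of Q "fst Y" 0 1] by fastforce
  thus "\<exists>V' F G d. zopen Y V' \<and> P \<in> V' \<and> V' \<subseteq> V \<and> homogeneous (fst Y) d F \<and> homogeneous (fst Y) d G \<and>
     (\<forall>Q\<in>V'. \<not> vanishes G Q \<and> 0 = ratio F G Q)"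
    using assms P
    by (intro exI[of _ V] exI[of _ 0] exI[of _ "1"] exI[of _ "0::nat"]) (auto simp: ratio_val)
qed

lemma morphism_in: "morphism C Y \<phi> \<Longrightarrow> P \<in> pts C \<Longrightarrow> \<phi> P \<in> pts Y"
  by (auto simp: morphism_def)

lemma morphism_open: "morphism C Y \<phi> \<Longrightarrow> zopen Y V \<Longrightarrow> zopen C {P \<in> pts C. \<phi> P \<in> V}"
  unfolding morphism_def using regular_on_zero by blast

lemma morphism_regular:
  "morphism C Y \<phi> \<Longrightarrow> zopen Y V \<Longrightarrow> regular_on Y V h \<Longrightarrow> regular_on C {P \<in> pts C. \<phi> P \<in> V} (h \<circ> \<phi>)"
  unfolding morphism_def by blast

lemma morphism_comp:
  assumes "morphism C Y \<phi>" "morphism Y Z \<psi>"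
  shows "morphism C Z (\<psi> \<circ> \<phi>)"
proof -
  have eq: "{P \<in> pts C. (\<psi> \<circ> \<phi>) P \<in> V} = {P \<in> pts C. \<phi> P \<in> {Q \<in> pts Y. \<psi> Q \<in> V}}" for V
    using morphism_in[OF assms(1)] by auto
  show ?thesis
    unfolding morphism_def eq o_assoc
  proof (intro conjI allI impI)
    show "(\<psi> \<circ> \<phi>) ` pts C \<subseteq> pts Z"
      using morphism_in[OF assms(1)] morphism_in[OF assms(2)] by auto
    fix V h assume "zopen Z V \<and> regular_on Z V h"
    hence "zopen Y {Q \<in> pts Y. \<psi> Q \<in> V}" "regular_on Y {Q \<in> pts Y. \<psi> Q \<in> V} (h \<circ> \<psi>)"
      using morphism_open[OF assms(2)] morphism_regular[OF assms(2)] by auto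
    thus "zopen C {P \<in> pts C. \<phi> P \<in> {Q \<in> pts Y. \<psi> Q \<in> V}}"
      "regular_on C {P \<in> pts C. \<phi> P \<in> {Q \<in> pts Y. \<psi> Q \<in> V}} (h \<circ> \<psi> \<circ> \<phi>)"
      using morphism_open[OF assms(1), of "{Q \<in> pts Y. \<psi> Q \<in> V}"]
        morphism_regular[OF assms(1), of "{Q \<in> pts Y. \<psi> Q \<in> V}" "h \<circ> \<psi>"] by simp_all
  qed
qed

lemma isomorphic_sym: "isomorphic C Y \<Longrightarrow> isomorphic Y C"
  unfolding isomorphic_def by blast

lemma isomorphic_trans:
  assumes "isomorphic C Y" "isomorphic Y Z" shows "isomorphic C Z"
proof -
  obtain p q where 1: "morphism C Y p" "morphism Y C q" "\<forall>P\<in>pts C. q (p P) = P" "\<forall>Q\<in>pts Y. p (q Q) = Q"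
    using assms(1) unfolding isomorphic_def by blast
  obtain r s where 2: "morphism Y Z r" "morphism Z Y s" "\<forall>P\<in>pts Y. s (r P) = P" "\<forall>Q\<in>pts Z. r (s Q) = Q"
    using assms(2) unfolding isomorphic_def by blast
  show ?thesis unfolding isomorphic_def
    using morphism_comp[OF 1(1) 2(1)] morphism_comp[OF 2(2) 1(2)] morphism_in[OF 1(1)] morphism_in[OF 2(2)] 1(3,4) 2(3,4)
    by (intro exI[of _ "r \<circ> p"] exI[of _ "q \<circ> s"]) auto
qed

lemma geneq_cong:
  assumes "\<And>P. P \<in> pts C \<Longrightarrow> h P = h' P" "\<And>P. P \<in> pts C \<Longrightarrow> k P = k' P"
  shows "geneq C h k \<longleftrightarrow> geneq C h' k'"
proof -
  have "(\<forall>P\<in>U. h P = k P) \<longleftrightarrow> (\<forall>P\<in>U. h' P = k' P)" if "zopen C U" for U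
    using that zopen_pts assms by (metis subsetD)
  thus ?thesis unfolding geneq_def by blast
qed

lemma local_ring_cong:
  assumes "\<And>P. P \<in> pts C \<Longrightarrow> h P = h' P"
  shows "h \<in> local_ring C P \<longleftrightarrow> h' \<in> local_ring C P"
  unfolding local_ring_def using geneq_cong[of C h h', OF assms refl] by simp

lemma riemann_roch_space_cong:
  assumes "\<And>P. P \<in> pts C \<Longrightarrow> D P = D' P"
  shows "riemann_roch_space C D = riemann_roch_space C D'"
  unfolding riemann_roch_space_def using assms by auto

text \<open>Mutually inverse isomorphisms. All notions that enter the definition of the genus are transported by pulling
  back functions; the other direction follows by exchanging the two isomorphisms.\<close>

locale iso_pair =
  fixes C Y :: "'a::field variety" and \<phi> \<psi> :: "'a point \<Rightarrow> 'a point"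
  assumes mor: "morphism C Y \<phi>" "morphism Y C \<psi>"
    and inv: "\<And>P. P \<in> pts C \<Longrightarrow> \<psi> (\<phi> P) = P" "\<And>Q. Q \<in> pts Y \<Longrightarrow> \<phi> (\<psi> Q) = Q"
begin

lemma flip: "iso_pair Y C \<psi> \<phi>"
  using mor inv by unfold_locales

lemma in_pts: "P \<in> pts C \<Longrightarrow> \<phi> P \<in> pts Y" "Q \<in> pts Y \<Longrightarrow> \<psi> Q \<in> pts C"
  using mor morphism_in by blast+

lemma open_nonempty:
  assumes "zopen Y V" "Q \<in> V" shows "\<psi> Q \<in> {P \<in> pts C. \<phi> P \<in> V}"
proof -
  have "Q \<in> pts Y" using assms zopen_pts by blast
  thus ?thesis using in_pts inv assms(2) by simp
qed

lemma geneq_pull: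
  assumes "geneq Y h k" shows "geneq C (\<lambda>P. h (\<phi> P)) (\<lambda>P. k (\<phi> P))"
proof -
  obtain U Q where "zopen Y U" "Q \<in> U" "\<forall>P\<in>U. h P = k P" using assms by (auto simp: geneq_def)
  thus ?thesis unfolding geneq_def using morphism_open[OF mor(1), of U] open_nonempty[of U Q]
    by (intro exI[of _ "{P \<in> pts C. \<phi> P \<in> U}"]) auto
qed

lemma rational_pull:
  assumes "rational Y h" shows "rational C (\<lambda>P. h (\<phi> P))"
proof -
  obtain U Q where "zopen Y U" "Q \<in> U" "regular_on Y U h" using assms by (auto simp: rational_def)
  thus ?thesis unfolding rational_def
    using morphism_open[OF mor(1), of U] open_nonempty[of U Q] morphism_regular[OF mor(1), of U h]
    by (intro exI[of _ "{P \<in> pts C. \<phi> P \<in> U}"]) (auto simp: o_def)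
qed

lemma local_ring_pull:
  assumes "h \<in> local_ring Y Q" shows "(\<lambda>P. h (\<phi> P)) \<in> local_ring C (\<psi> Q)"
proof -
  obtain U k where "zopen Y U" "Q \<in> U" "regular_on Y U k" "geneq Y h k"
    using assms by (auto simp: local_ring_def)
  thus ?thesis unfolding local_ring_def
    using morphism_open[OF mor(1), of U] open_nonempty[of U Q] morphism_regular[OF mor(1), of U k] geneq_pull[of h k]
    by (intro CollectI exI[of _ "{P \<in> pts C. \<phi> P \<in> U}"] exI[of _ "k \<circ> \<phi>"]) (auto simp: o_def)
qed

lemma local_max_ideal_pull:
  assumes "h \<in> local_max_ideal Y Q" shows "(\<lambda>P. h (\<phi> P)) \<in> local_max_ideal C (\<psi> Q)"
proof -
  obtain U k where "zopen Y U" "Q \<in> U" "regular_on Y U k" "geneq Y h k" "k Q = 0"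
    using assms by (auto simp: local_max_ideal_def)
  moreover have "\<phi> (\<psi> Q) = Q" using calculation inv zopen_pts by blast
  ultimately show ?thesis unfolding local_max_ideal_def
    using morphism_open[OF mor(1), of U] open_nonempty[of U Q] morphism_regular[OF mor(1), of U k] geneq_pull[of h k]
    by (intro CollectI exI[of _ "{P \<in> pts C. \<phi> P \<in> U}"] exI[of _ "k \<circ> \<phi>"]) (auto simp: o_def)
qed

lemma uniformizer_pull:
  assumes t: "uniformizer Y Q t" and Q: "Q \<in> pts Y" shows "uniformizer C (\<psi> Q) (\<lambda>P. t (\<phi> P))"
  unfolding uniformizer_def
proof (intro conjI ballI notI)
  show "(\<lambda>P. t (\<phi> P)) \<in> local_max_ideal C (\<psi> Q)" using t local_max_ideal_pull by (simp add: uniformizer_def)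
next
  assume "geneq C (\<lambda>P. t (\<phi> P)) (\<lambda>_. 0)"
  from iso_pair.geneq_pull[OF flip this] have "geneq Y (\<lambda>Q. t (\<phi> (\<psi> Q))) (\<lambda>_. 0)" .
  hence "geneq Y t (\<lambda>_. 0)" using geneq_cong[of Y "\<lambda>Q. t (\<phi> (\<psi> Q))" t "\<lambda>_. 0" "\<lambda>_. 0"] inv by simp
  thus False using t by (simp add: uniformizer_def)
next
  fix h assume "h \<in> local_max_ideal C (\<psi> Q)"
  from iso_pair.local_max_ideal_pull[OF flip this] have "(\<lambda>P. h (\<psi> P)) \<in> local_max_ideal Y Q"
    using inv Q by simp
  then obtain k where k: "k \<in> local_ring Y Q" "geneq Y (\<lambda>P. h (\<psi> P)) (\<lambda>Q. k Q * t Q)"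
    using t by (auto simp: uniformizer_def)
  have "geneq C h (\<lambda>P. k (\<phi> P) * t (\<phi> P))"
    using geneq_pull[OF k(2)] geneq_cong[of C "\<lambda>P. h (\<psi> (\<phi> P))" h] inv by simp
  thus "\<exists>k\<in>local_ring C (\<psi> Q). geneq C h (\<lambda>P. k P * t (\<phi> P))"
    using local_ring_pull[OF k(1)] by (intro bexI[of _ "\<lambda>P. k (\<phi> P)"])
qed

lemma riemann_roch_space_pull:
  assumes h: "h \<in> riemann_roch_space Y D"
  shows "(\<lambda>P. h (\<phi> P)) \<in> riemann_roch_space C (\<lambda>P. D (\<phi> P))"
  unfolding riemann_roch_space_def
proof (intro CollectI conjI ballI allI impI)
  show "rational C (\<lambda>P. h (\<phi> P))" using h rational_pull by (simp add: riemann_roch_space_def)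
  fix P t assume P: "P \<in> pts C" and t: "uniformizer C P t"
  have "uniformizer Y (\<phi> P) (\<lambda>Q. t (\<psi> Q))" using iso_pair.uniformizer_pull[OF flip t P] .
  hence "(\<lambda>Q. t (\<psi> Q) powi D (\<phi> P) * h Q) \<in> local_ring Y (\<phi> P)"
    using h in_pts(1)[OF P] by (simp add: riemann_roch_space_def)
  from local_ring_pull[OF this]
  have "(\<lambda>R. t (\<psi> (\<phi> R)) powi D (\<phi> P) * h (\<phi> R)) \<in> local_ring C P" using inv P by simp
  thus "(\<lambda>Q. t Q powi D (\<phi> P) * h (\<phi> Q)) \<in> local_ring C P"
    by (rule iffD1[OF local_ring_cong, rotated]) (simp add: inv)
qed

lemma divisor_bij: "bij_betw \<phi> {P \<in> pts C. D (\<phi> P) \<noteq> 0} {Q \<in> pts Y. D Q \<noteq> 0}"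
  by (rule bij_betwI[of _ _ _ \<psi>]) (auto simp: in_pts inv)

lemma is_divisor_pull: "is_divisor Y D \<Longrightarrow> is_divisor C (\<lambda>P. D (\<phi> P))"
  unfolding is_divisor_def using bij_betw_finite[OF divisor_bij] by blast

lemma divisor_degree_pull: "divisor_degree C (\<lambda>P. D (\<phi> P)) = divisor_degree Y D"
  unfolding divisor_degree_def using sum.reindex_bij_betw[OF divisor_bij, of D D] by simp

lemma riemann_roch_dim_pull:
  assumes "riemann_roch_dim Y D l" shows "riemann_roch_dim C (\<lambda>P. D (\<phi> P)) l"
proof -
  obtain b where b: "\<And>j. j < l \<Longrightarrow> b j \<in> riemann_roch_space Y D"
    "\<And>h. h \<in> riemann_roch_space Y D \<Longrightarrow> \<exists>c. geneq Y h (\<lambda>Q. \<Sum>j<l. c j * b j Q)"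
    "\<And>c. geneq Y (\<lambda>Q. \<Sum>j<l. c j * b j Q) (\<lambda>_. 0) \<Longrightarrow> (\<forall>j<l. c j = 0)"
    using assms unfolding riemann_roch_dim_def by blast
  show ?thesis unfolding riemann_roch_dim_def
  proof (intro exI[of _ "\<lambda>j P. b j (\<phi> P)"] conjI allI impI ballI)
    show "(\<lambda>P. b j (\<phi> P)) \<in> riemann_roch_space C (\<lambda>P. D (\<phi> P))" if "j < l" for j
      using riemann_roch_space_pull b(1) that by blast
  next
    fix h assume "h \<in> riemann_roch_space C (\<lambda>P. D (\<phi> P))"
    from iso_pair.riemann_roch_space_pull[OF flip this]
    have "(\<lambda>P. h (\<psi> P)) \<in> riemann_roch_space Y D"
      using riemann_roch_space_cong[of Y "\<lambda>P. D (\<phi> (\<psi> P))" D] inv by simp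
    then obtain c where "geneq Y (\<lambda>P. h (\<psi> P)) (\<lambda>Q. \<Sum>j<l. c j * b j Q)" using b(2) by blast
    from geneq_pull[OF this] have "geneq C h (\<lambda>Q. \<Sum>j<l. c j * b j (\<phi> Q))"
      using geneq_cong[of C "\<lambda>P. h (\<psi> (\<phi> P))" h] inv by simp
    thus "\<exists>c. geneq C h (\<lambda>Q. \<Sum>j<l. c j * b j (\<phi> Q))" by blast
  next
    fix c j assume "geneq C (\<lambda>Q. \<Sum>j<l. c j * b j (\<phi> Q)) (\<lambda>_. 0)" "j < l"
    from iso_pair.geneq_pull[OF flip this(1)] have "geneq Y (\<lambda>Q. \<Sum>j<l. c j * b j Q) (\<lambda>_. 0)"
      using geneq_cong[of Y "\<lambda>Q. \<Sum>j<l. c j * b j (\<phi> (\<psi> Q))" "\<lambda>Q. \<Sum>j<l. c j * b j Q"] inv by simp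
    thus "c j = 0" using b(3) \<open>j < l\<close> by blast
  qed
qed

lemma has_genus_push:
  assumes "has_genus C g" shows "has_genus Y g"
proof -
  have 1: "divisor_degree Y D + 1 - int l \<le> int g" if "is_divisor Y D" "riemann_roch_dim Y D l" for D l
    using assms is_divisor_pull[OF that(1)] riemann_roch_dim_pull[OF that(2)]
    unfolding has_genus_def divisor_degree_pull[symmetric] by blast
  obtain D l where D: "is_divisor C D" "riemann_roch_dim C D l" "divisor_degree C D + 1 - int l = int g"
    using assms unfolding has_genus_def by blast
  show ?thesis unfolding has_genus_def
    using 1 iso_pair.is_divisor_pull[OF flip D(1)] iso_pair.riemann_roch_dim_pull[OF flip D(2)] D(3)
      iso_pair.divisor_degree_pull[OF flip, of D]
    by (metis (no_types, lifting))
qed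

end

lemma isomorphic_pair: "isomorphic C Y \<longleftrightarrow> (\<exists>\<phi> \<psi>. iso_pair C Y \<phi> \<psi>)"
  by (simp add: isomorphic_def iso_pair_def Ball_def conj_assoc)

abbreviation finv :: "('a \<Rightarrow> 'a) \<Rightarrow> 'a \<Rightarrow> 'a" where
  "finv \<sigma> \<equiv> inv_into UNIV \<sigma>"

definition field_auto :: "('a::field \<Rightarrow> 'a) \<Rightarrow> bool" where
  "field_auto \<sigma> \<longleftrightarrow> rhom \<sigma> \<and> bij \<sigma>"

lemma field_auto_inv:
  assumes "field_auto \<sigma>" shows "field_auto (finv \<sigma>)"
proof -
  have b: "bij \<sigma>" and h: "rhom \<sigma>" using assms by (auto simp: field_auto_def)
  have i: "finv \<sigma> x = y \<longleftrightarrow> x = \<sigma> y" for x y using b by (metis bij_inv_eq_iff)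
  have s: "\<sigma> (finv \<sigma> x) = x" for x using b by (simp add: bij_is_surj surj_f_inv_f)
  show ?thesis unfolding field_auto_def rhom_def
    using rhomD[OF h] by (auto simp: i s bij_imp_bij_inv[OF b])
qed

lemma inv_auto [simp]:
  assumes "field_auto \<sigma>" shows "\<sigma> (finv \<sigma> x) = x" "finv \<sigma> (\<sigma> x) = x" "finv (finv \<sigma>) = \<sigma>"
  using assms by (auto simp: field_auto_def bij_is_inj bij_is_surj surj_f_inv_f inv_inv_eq)

text \<open>A field automorphism \<open>\<sigma>\<close> gives a bijection from the points of \<open>C\<close> to those of its conjugate. It is not a
  morphism, but it transports closed sets, regular functions (up to applying \<open>\<sigma>\<close> to the values) and morphisms.\<close>

definition conj_pt :: "('a \<Rightarrow> 'a) \<Rightarrow> 'a point \<Rightarrow> 'a point" where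
  "conj_pt \<sigma> P = (\<lambda>v i. \<sigma> (v i)) ` P"

lemma conj_pt_inv:
  assumes "field_auto \<sigma>"
  shows "conj_pt (finv \<sigma>) (conj_pt \<sigma> P) = P" "conj_pt \<sigma> (conj_pt (finv \<sigma>) P) = P"
  using assms by (simp_all add: conj_pt_def image_image)

lemma conj_image_iff:
  assumes "field_auto \<sigma>" shows "P \<in> conj_pt \<sigma> ` A \<longleftrightarrow> conj_pt (finv \<sigma>) P \<in> A"
  using conj_pt_inv[OF assms] by (auto intro!: image_eqI[of _ _ "conj_pt (finv \<sigma>) P"])

lemma conj_pt_orbit:
  assumes "field_auto \<sigma>" shows "conj_pt \<sigma> (orbit w v) = orbit w (\<lambda>i. \<sigma> (v i))"
proof -
  have h: "rhom \<sigma>" using assms by (simp add: field_auto_def)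
  have *: "(\<lambda>i. \<sigma> (scal w c v i)) = scal w (\<sigma> c) (\<lambda>i. \<sigma> (v i))" for c
    by (auto simp: scal_def rhomD[OF h] rhom_power[OF h])
  have z: "\<sigma> c \<noteq> 0" if "c \<noteq> 0" for c using that assms rhomD(1)[OF h] inv_auto(2) by metis
  have "scal w c (\<lambda>i. \<sigma> (v i)) \<in> conj_pt \<sigma> (orbit w v)" if "c \<noteq> 0" for c
  proof -
    have "finv \<sigma> c \<noteq> 0" using that rhomD(1)[OF h] inv_auto(1)[OF assms] by metis
    thus ?thesis unfolding conj_pt_def orbit_alt
      using *[of "finv \<sigma> c"] inv_auto(1)[OF assms, of c] by (auto intro!: image_eqI[of _ _ "scal w (finv \<sigma> c) v"])
  qed
  moreover have "conj_pt \<sigma> (orbit w v) \<subseteq> orbit w (\<lambda>i. \<sigma> (v i))"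
    unfolding conj_pt_def orbit_alt using * z by auto
  ultimately show ?thesis unfolding orbit_alt[of w "\<lambda>i. \<sigma> (v i)"] by (auto simp: orbit_alt)
qed

lemma conj_pt_wspace:
  assumes "field_auto \<sigma>" "P \<in> wspace w" shows "conj_pt \<sigma> P \<in> wspace w"
proof -
  have h: "rhom \<sigma>" using assms by (simp add: field_auto_def)
  obtain v i where v: "P = orbit w v" "v i \<noteq> 0" "\<forall>i\<ge>length w. v i = 0" using assms by (auto simp: wspace_def)
  have nz: "\<sigma> (v i) \<noteq> 0" using v(2) assms(1) rhomD(1)[OF h] inv_auto(2) by metis
  show ?thesis unfolding v(1) conj_pt_orbit[OF assms(1)] wspace_def using v(3) rhomD(1)[OF h] nz
    by (intro CollectI exI[of _ "\<lambda>i. \<sigma> (v i)"]) (auto intro: exI[of _ i])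
qed

lemma conj_vanishes:
  assumes "field_auto \<sigma>" shows "vanishes (Poly_Mapping.map \<sigma> F) (conj_pt \<sigma> P) \<longleftrightarrow> vanishes F P"
proof -
  have h: "rhom \<sigma>" using assms by (simp add: field_auto_def)
  have z: "\<sigma> c = 0 \<longleftrightarrow> c = 0" for c using assms rhomD(1)[OF h] inv_auto(2) by metis
  show ?thesis by (simp add: vanishes_def conj_pt_def eval_map[OF h] z)
qed

lemma conj_pts:
  assumes "field_auto \<sigma>" shows "pts (conjugate \<sigma> C) = conj_pt \<sigma> ` pts C"
proof -
  have "P \<in> pts (conjugate \<sigma> C) \<longleftrightarrow> conj_pt (finv \<sigma>) P \<in> pts C" for P
  proof -
    have "P \<in> wspace w \<longleftrightarrow> conj_pt (finv \<sigma>) P \<in> wspace w" for w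
      using conj_pt_wspace[OF assms, of "conj_pt (finv \<sigma>) P" w] conj_pt_wspace[OF field_auto_inv[OF assms], of P w]
      by (auto simp: conj_pt_inv[OF assms])
    moreover have "vanishes (Poly_Mapping.map \<sigma> F) P \<longleftrightarrow> vanishes F (conj_pt (finv \<sigma>) P)" for F
      using conj_vanishes[OF assms, of F "conj_pt (finv \<sigma>) P"] by (simp add: conj_pt_inv[OF assms])
    ultimately show ?thesis by (simp add: pts_def conjugate_def)
  qed
  thus ?thesis using conj_image_iff[OF assms] by blast
qed

lemma conj_zclosed:
  assumes "field_auto \<sigma>" "zclosed C Z" shows "zclosed (conjugate \<sigma> C) (conj_pt \<sigma> ` Z)"
proof -
  have h: "\<sigma> 0 = 0" using assms rhomD(1)[of \<sigma>] by (simp add: field_auto_def)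
  obtain E where E: "\<And>F. F \<in> E \<Longrightarrow> \<exists>d. homogeneous (fst C) d F" "Z = {P \<in> pts C. \<forall>F\<in>E. vanishes F P}"
    using assms(2) by (auto simp: zclosed_def)
  show ?thesis unfolding zclosed_def
  proof (intro exI[of _ "Poly_Mapping.map \<sigma> ` E"] conjI)
    show "\<forall>F\<in>Poly_Mapping.map \<sigma> ` E. \<exists>d. homogeneous (fst (conjugate \<sigma> C)) d F"
      using E(1) homogeneous_map[of _ _ _ \<sigma>] h by (fastforce simp: conjugate_def)
    show "conj_pt \<sigma> ` Z = {P \<in> pts (conjugate \<sigma> C). \<forall>F\<in>Poly_Mapping.map \<sigma> ` E. vanishes F P}"
      unfolding E(2) conj_pts[OF assms(1)] by (auto simp: conj_vanishes[OF assms(1)])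
  qed
qed

lemma inj_conj_pt: "field_auto \<sigma> \<Longrightarrow> inj (conj_pt \<sigma>)"
  by (rule inj_on_inverseI[of _ "conj_pt (finv \<sigma>)"]) (simp add: conj_pt_inv)

lemma conj_zopen:
  assumes "field_auto \<sigma>" "zopen C U" shows "zopen (conjugate \<sigma> C) (conj_pt \<sigma> ` U)"
proof -
  have "conj_pt \<sigma> ` pts C - conj_pt \<sigma> ` U = conj_pt \<sigma> ` (pts C - U)"
    using image_set_diff[OF inj_conj_pt[OF assms(1)], of "pts C" U] by simp
  thus ?thesis using assms conj_zclosed[OF assms(1), of C "pts C - U"]
    unfolding zopen_def conj_pts[OF assms(1)] by auto
qed

lemma conj_ratio:
  assumes "field_auto \<sigma>" "P \<in> wspace w" "homogeneous w d F" "homogeneous w d G"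
  shows "ratio (Poly_Mapping.map \<sigma> F) (Poly_Mapping.map \<sigma> G) (conj_pt \<sigma> P) = \<sigma> (ratio F G P)"
proof -
  have h: "rhom \<sigma>" using assms by (simp add: field_auto_def)
  have d: "\<sigma> (x / y) = \<sigma> x / \<sigma> y" for x y
  proof (cases "y = 0")
    case False
    hence "\<sigma> (x / y) * \<sigma> y = \<sigma> x" by (simp add: rhomD(4)[OF h, symmetric])
    moreover have "\<sigma> y \<noteq> 0" using False assms(1) rhomD(1)[OF h] inv_auto(2) by metis
    ultimately show ?thesis by (simp add: field_simps)
  qed (simp add: rhomD[OF h])
  have "(\<lambda>i. \<sigma> (rep P i)) \<in> conj_pt \<sigma> P" using rep_in[OF assms(2)] by (auto simp: conj_pt_def)
  from ratio_any[OF conj_pt_wspace[OF assms(1,2)] this homogeneous_map[OF assms(3)] homogeneous_map[OF assms(4)]]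
  show ?thesis by (simp add: rhomD[OF h] eval_map[OF h] ratio_val val_def d)
qed

lemma conj_regular_on:
  assumes "field_auto \<sigma>" "regular_on C U h"
  shows "regular_on (conjugate \<sigma> C) (conj_pt \<sigma> ` U) (\<lambda>P. \<sigma> (h (conj_pt (finv \<sigma>) P)))"
  unfolding regular_on_def
proof
  have h0: "\<sigma> 0 = 0" using assms rhomD(1)[of \<sigma>] by (simp add: field_auto_def)
  fix P assume "P \<in> conj_pt \<sigma> ` U"
  then obtain Q where Q: "P = conj_pt \<sigma> Q" "Q \<in> U" by auto
  then obtain V F G d where V: "zopen C V" "Q \<in> V" "V \<subseteq> U" "homogeneous (fst C) d F" "homogeneous (fst C) d G"
     "\<And>Q. Q \<in> V \<Longrightarrow> \<not> vanishes G Q \<and> h Q = ratio F G Q"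
    using assms(2) unfolding regular_on_def by blast
  have f: "fst (conjugate \<sigma> C) = fst C" by (simp add: conjugate_def)
  show "\<exists>V F G d. zopen (conjugate \<sigma> C) V \<and> P \<in> V \<and> V \<subseteq> conj_pt \<sigma> ` U \<and>
     homogeneous (fst (conjugate \<sigma> C)) d F \<and> homogeneous (fst (conjugate \<sigma> C)) d G \<and>
     (\<forall>Q\<in>V. \<not> vanishes G Q \<and> \<sigma> (h (conj_pt (finv \<sigma>) Q)) = ratio F G Q)"
  proof (intro exI conjI)
    show "zopen (conjugate \<sigma> C) (conj_pt \<sigma> ` V)" using conj_zopen[OF assms(1) V(1)] .
    show "P \<in> conj_pt \<sigma> ` V" "conj_pt \<sigma> ` V \<subseteq> conj_pt \<sigma> ` U" using Q V by auto
    show "homogeneous (fst (conjugate \<sigma> C)) d (Poly_Mapping.map \<sigma> F)"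
      "homogeneous (fst (conjugate \<sigma> C)) d (Poly_Mapping.map \<sigma> G)"
      unfolding f using homogeneous_map[OF V(4)] homogeneous_map[OF V(5)] h0 by auto
    show "\<forall>Q\<in>conj_pt \<sigma> ` V. \<not> vanishes (Poly_Mapping.map \<sigma> G) Q \<and>
        \<sigma> (h (conj_pt (finv \<sigma>) Q)) = ratio (Poly_Mapping.map \<sigma> F) (Poly_Mapping.map \<sigma> G) Q"
    proof
      fix R assume "R \<in> conj_pt \<sigma> ` V"
      then obtain Q where R: "R = conj_pt \<sigma> Q" "Q \<in> V" by blast
      have "Q \<in> wspace (fst C)" using R zopen_pts[OF V(1)] pts_wspace by blast
      from conj_ratio[OF assms(1) this V(4,5)] V(6)[OF R(2)]
      show "\<not> vanishes (Poly_Mapping.map \<sigma> G) R \<and>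
          \<sigma> (h (conj_pt (finv \<sigma>) R)) = ratio (Poly_Mapping.map \<sigma> F) (Poly_Mapping.map \<sigma> G) R"
        by (simp add: R(1) conj_vanishes[OF assms(1)] conj_pt_inv[OF assms(1)])
    qed
  qed
qed

lemma conjugate_inv:
  assumes "field_auto \<sigma>" shows "conjugate (finv \<sigma>) (conjugate \<sigma> C) = C"
proof -
  have h: "\<sigma> 0 = 0" "finv \<sigma> 0 = 0" using assms field_auto_inv[OF assms] rhomD(1) by (auto simp: field_auto_def)
  have "Poly_Mapping.map (finv \<sigma>) (Poly_Mapping.map \<sigma> F) = F" for F :: "'a mpoly"
    using h by (simp add: map_map map_ident assms)
  thus ?thesis by (cases C) (simp add: conjugate_def image_image)
qed

lemma conj_morphism:
  assumes s: "field_auto \<sigma>" and m: "morphism C Y \<phi>"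
  shows "morphism (conjugate \<sigma> C) (conjugate \<sigma> Y) (\<lambda>P. conj_pt \<sigma> (\<phi> (conj_pt (finv \<sigma>) P)))"
    (is "morphism _ _ ?f")
  unfolding morphism_def
proof (intro conjI allI impI)
  note [simp] = conj_pt_inv[OF s]
  show "?f ` pts (conjugate \<sigma> C) \<subseteq> pts (conjugate \<sigma> Y)"
    unfolding conj_pts[OF s] using morphism_in[OF m] by auto
  fix V h assume V: "zopen (conjugate \<sigma> Y) V \<and> regular_on (conjugate \<sigma> Y) V h"
  define V' where "V' = conj_pt (finv \<sigma>) ` V"
  define h' where "h' P = finv \<sigma> (h (conj_pt \<sigma> P))" for P
  have V': "zopen Y V'" "regular_on Y V' h'"
    using conj_zopen[OF field_auto_inv[OF s], of "conjugate \<sigma> Y" V]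
      conj_regular_on[OF field_auto_inv[OF s], of "conjugate \<sigma> Y" V h] V
    by (simp_all add: V'_def h'_def[abs_def] conjugate_inv s)
  have eq: "{P \<in> pts (conjugate \<sigma> C). ?f P \<in> V} = conj_pt \<sigma> ` {P \<in> pts C. \<phi> P \<in> V'}"
  proof -
    have "Q \<in> V' \<longleftrightarrow> conj_pt \<sigma> Q \<in> V" for Q
      using conj_image_iff[OF field_auto_inv[OF s], of Q V] s by (simp add: V'_def)
    thus ?thesis by (auto simp: set_eq_iff conj_pts[OF s] conj_image_iff[OF s])
  qed
  show "zopen (conjugate \<sigma> C) {P \<in> pts (conjugate \<sigma> C). ?f P \<in> V}"
    unfolding eq by (rule conj_zopen[OF s morphism_open[OF m V'(1)]])
  show "regular_on (conjugate \<sigma> C) {P \<in> pts (conjugate \<sigma> C). ?f P \<in> V} (h \<circ> ?f)"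
    unfolding eq using conj_regular_on[OF s morphism_regular[OF m V']]
    by (simp add: h'_def o_def s)
qed

lemma conj_isomorphic:
  assumes s: "field_auto \<sigma>" and "isomorphic C Y"
  shows "isomorphic (conjugate \<sigma> C) (conjugate \<sigma> Y)"
proof -
  obtain p q where 1: "morphism C Y p" "morphism Y C q" "\<forall>P\<in>pts C. q (p P) = P" "\<forall>Q\<in>pts Y. p (q Q) = Q"
    using assms(2) unfolding isomorphic_def by blast
  show ?thesis unfolding isomorphic_def
    using conj_morphism[OF s 1(1)] conj_morphism[OF s 1(2)] 1(3,4)
    by (intro exI conjI) (assumption, assumption, auto simp: conj_pts[OF s] conj_pt_inv[OF s])
qed

\<comment> \<open>The degree of linear forms is kept in the shape \<open>1\<close>.\<close>
declare One_nat_def [simp del]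

section \<open>Binary forms and their dehomogenizations\<close>

text \<open>The value of the binary form of degree \<open>d\<close> with dehomogenization \<open>p\<close>. A degree of \<open>p\<close> below \<open>d\<close> means
  a zero at infinity.\<close>

definition hf :: "nat \<Rightarrow> 'a::field poly \<Rightarrow> 'a \<Rightarrow> 'a \<Rightarrow> 'a" where
  "hf d p x z = (\<Sum>j\<le>d. Polynomial.coeff p j * x ^ j * z ^ (d - j))"

lemma hf_0 [simp]: "hf d 0 x z = 0"
  by (simp add: hf_def)

lemma hf_add: "hf d (p + q) x z = hf d p x z + hf d q x z"
  by (simp add: hf_def sum.distrib distrib_right)

lemma hf_diff: "hf d (p - q) x z = hf d p x z - hf d q x z"
  by (simp add: hf_def sum_subtractf left_diff_distrib)

lemma hf_uminus: "hf d (- p) x z = - hf d p x z"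
  by (simp add: hf_def sum_negf)

lemma hf_smult: "hf d (Polynomial.smult c p) x z = c * hf d p x z"
  by (simp add: hf_def sum_distrib_left mult.assoc)

lemma hf_scale: "hf d p (c * x) (c * z) = c ^ d * hf d p x z"
proof -
  have "c ^ j * c ^ (d - j) = c ^ d" if "j \<le> d" for j using that by (simp add: power_add[symmetric])
  hence "(c * x) ^ j * (c * z) ^ (d - j) = c ^ d * (x ^ j * z ^ (d - j))" if "j \<le> d" for j
    using that by (simp add: power_mult_distrib mult.assoc mult.left_commute)
  thus ?thesis unfolding hf_def sum_distrib_left
    by (intro sum.cong refl) (simp add: mult.assoc mult.left_commute)
qed

lemma hf_1: "Polynomial.degree p \<le> d \<Longrightarrow> hf d p x 1 = poly p x"
  unfolding hf_def poly_altdef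
  by (rule sum.mono_neutral_cong_right) (auto simp: coeff_eq_0)

lemma hf_z: "z \<noteq> 0 \<Longrightarrow> Polynomial.degree p \<le> d \<Longrightarrow> hf d p x z = z ^ d * poly p (x / z)"
  using hf_scale[of d p z "x / z" 1] by (simp add: hf_1)

lemma hf_z0: "hf d p x 0 = Polynomial.coeff p d * x ^ d"
proof -
  have "hf d p x 0 = (\<Sum>j\<in>{d}. Polynomial.coeff p j * x ^ j * 0 ^ (d - j))"
    unfolding hf_def by (rule sum.mono_neutral_right) (auto simp: power_0_left)
  thus ?thesis by simp
qed

lemma coeff_mult_top:
  fixes p q :: "'a::field poly"
  assumes "Polynomial.degree p \<le> d" "Polynomial.degree q \<le> e"
  shows "Polynomial.coeff (p * q) (d + e) = Polynomial.coeff p d * Polynomial.coeff q e"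
proof (cases "Polynomial.degree p = d \<and> Polynomial.degree q = e")
  case True thus ?thesis using coeff_mult_degree_sum[of p q] by auto
next
  case False
  hence lt: "Polynomial.degree p + Polynomial.degree q < d + e" using assms by linarith
  have "Polynomial.coeff (p * q) (d + e) = 0"
    using degree_mult_le[of p q] lt by (intro coeff_eq_0) linarith
  moreover have "Polynomial.coeff p d = 0 \<or> Polynomial.coeff q e = 0" using False assms
    by (metis coeff_eq_0 le_neq_implies_less)
  ultimately show ?thesis by auto
qed

lemma hf_mult:
  assumes "Polynomial.degree p \<le> d" "Polynomial.degree q \<le> e"
  shows "hf (d + e) (p * q) x z = hf d p x z * hf e q x z"
proof (cases "z = 0")
  case True thus ?thesis by (simp add: hf_z0 coeff_mult_top[OF assms] power_add)
next
  case False
  moreover have "Polynomial.degree (p * q) \<le> d + e" using degree_mult_le[of p q] assms by linarith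
  ultimately show ?thesis using assms by (simp add: hf_z power_add)
qed

lemma hf_monom: "j \<le> d \<Longrightarrow> hf d (Polynomial.monom c j) x z = c * x ^ j * z ^ (d - j)"
proof -
  assume j: "j \<le> d"
  have "hf d (Polynomial.monom c j) x z = (\<Sum>i\<in>{j}. Polynomial.coeff (Polynomial.monom c j) i * x ^ i * z ^ (d - i))"
    unfolding hf_def using j by (intro sum.mono_neutral_right) auto
  thus ?thesis by simp
qed

lemma hf_one: "hf d 1 x z = z ^ d"
  using hf_monom[of 0 d 1 x z] by (simp add: monom_0 pCons_one)

lemma hf_linear: "hf 1 [:b, a:] x z = a * x + b * z"
  by (simp add: hf_def One_nat_def)

text \<open>The binary form of degree \<open>d\<close> with a given dehomogenization.\<close>

definition hform :: "nat \<Rightarrow> 'a::field poly \<Rightarrow> 'a mpoly" where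
  "hform d p = (\<Sum>j\<le>d. mp_const (Polynomial.coeff p j) * x_var ^ j * z_var ^ (d - j))"

lemma eval_hform [simp]: "mp_eval id v (hform d p) = hf d p (v 0) (v 1)"
  by (simp add: hform_def hf_def)

lemma homogeneous_hform:
  assumes "length w \<ge> 2" "w ! 0 = 1" "w ! 1 = 1"
  shows "homogeneous w d (hform d p)"
  unfolding hform_def
proof (intro homogeneous_sum)
  fix j assume "j \<in> {..d}"
  thus "homogeneous w d (mp_const (Polynomial.coeff p j) * x_var ^ j * z_var ^ (d - j))"
    using assms
    by (intro homogeneous_mult'[where d=j and e="d-j"] homogeneous_mult'[where d=0 and e=j]
        homogeneous_power[where d=1] homogeneous_var) auto
qed

lemma binary_form_hform [simp]: "binary_form d (hform d p)"
  unfolding binary_form_def by (rule homogeneous_hform) auto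

lemma binary_form_imp_hform:
  assumes "binary_form d F"
  obtains p where "Polynomial.degree p \<le> d" "F = hform d p"
proof -
  define m where "m j = Poly_Mapping.single (0::nat) j + Poly_Mapping.single (1::nat) (d - j)" for j
  define p where "p = (\<Sum>j\<le>d. Polynomial.monom (Poly_Mapping.lookup F (m j)) j)"
  have cp: "Polynomial.coeff p j = (if j \<le> d then Poly_Mapping.lookup F (m j) else 0)" for j
    by (simp add: p_def coeff_sum sum.delta)
  have pw: "(mp_var i :: 'a mpoly) ^ e = Poly_Mapping.single (Poly_Mapping.single i e) 1" for i e
    by (induction e) (auto simp: mp_var_def mult_single single_add[symmetric] single_one One_nat_def)
  have inj: "m j = m j' \<longleftrightarrow> j = j'" for j j'
  proof -
    have "Poly_Mapping.lookup (m j) 0 = j" for j by (simp add: m_def lookup_add lookup_single)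
    thus ?thesis by metis
  qed
  have ks: "k \<in> m ` {..d}" if k: "k \<in> Poly_Mapping.keys F" for k
  proof -
    have sub: "Poly_Mapping.keys k \<subseteq> {0, 1}" and diag_equiv: "wdeg [1, 1] k = d"
      using assms k less_2_cases_iff by (fastforce simp: binary_form_def homogeneous_alt One_nat_def)+
    have "wdeg [1, 1] k = Poly_Mapping.lookup k 0 + Poly_Mapping.lookup k 1"
      by (subst wdeg_superset[OF _ sub]) auto
    moreover have "k = Poly_Mapping.single 0 (Poly_Mapping.lookup k 0) + Poly_Mapping.single 1 (Poly_Mapping.lookup k 1)"
      using sub by (intro poly_mapping_eqI) (auto simp: lookup_add lookup_single when_def in_keys_iff)
    moreover have "d - Poly_Mapping.lookup k 0 = Poly_Mapping.lookup k 1" using diag_equiv calculation(1) by simp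
    ultimately have "k = m (Poly_Mapping.lookup k 0)" "Poly_Mapping.lookup k 0 \<le> d"
      using diag_equiv unfolding m_def by auto
    thus ?thesis by blast
  qed
  have "hform d p = (\<Sum>j\<le>d. Poly_Mapping.single (m j) (Poly_Mapping.lookup F (m j)))"
    unfolding hform_def cp pw mp_const_def mult_single m_def by simp
  also have "\<dots> = F"
  proof (rule poly_mapping_eqI)
    fix k
    show "Poly_Mapping.lookup (\<Sum>j\<le>d. Poly_Mapping.single (m j) (Poly_Mapping.lookup F (m j))) k = Poly_Mapping.lookup F k"
    proof (cases "k \<in> m ` {..d}")
      case True
      then obtain j where j: "k = m j" "j \<le> d" by auto
      thus ?thesis by (simp add: lookup_sum lookup_single when_def inj sum.delta')
    next
      case False
      hence "Poly_Mapping.lookup F k = 0" using ks by (auto simp: in_keys_iff)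
      moreover have "m j \<noteq> k" if "j \<le> d" for j using False that by auto
      ultimately show ?thesis by (simp add: lookup_sum lookup_single when_def)
    qed
  qed
  finally have "F = hform d p" ..
  moreover have "Polynomial.degree p \<le> d" by (rule degree_le) (simp add: cp)
  ultimately show ?thesis using that by blast
qed

lemma infinite_alg_closed: "infinite (UNIV :: 'a::alg_closed_field set)"
proof
  assume fin: "finite (UNIV :: 'a set)"
  define p where "p = (\<Prod>a\<in>(UNIV::'a set). [:- a, 1:]) + 1"
  have "Polynomial.degree (\<Prod>a\<in>(UNIV::'a set). [:- a, 1:]) = card (UNIV :: 'a set)"
    by (subst degree_prod_eq_sum_degree) auto
  moreover have "card (UNIV :: 'a set) > 0" using fin by (simp add: card_gt_0_iff)
  ultimately have "Polynomial.degree p > 0" unfolding p_def by (simp add: degree_add_eq_left)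
  then obtain x where "poly p x = 0" using alg_closed_imp_poly_has_root[of p] by blast
  moreover have "poly (\<Prod>a\<in>(UNIV::'a set). [:- a, 1:]) x = 0"
    using fin by (auto simp: poly_prod prod_zero_iff)
  ultimately show False by (simp add: p_def)
qed

lemma poly_eqI_cofinite:
  fixes p q :: "'a::alg_closed_field poly"
  assumes "finite {x. poly p x \<noteq> poly q x}" shows "p = q"
proof (rule ccontr)
  assume "p \<noteq> q"
  hence "finite {x. poly (p - q) x = 0}" by (intro poly_roots_finite) auto
  hence "finite ({x. poly (p - q) x = 0} \<union> {x. poly p x \<noteq> poly q x})" using assms by simp
  moreover have "{x. poly (p - q) x = 0} \<union> {x. poly p x \<noteq> poly q x} = UNIV" by auto
  ultimately show False using infinite_alg_closed by metis
qed

text \<open>Binary forms as functions of two variables.\<close>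

definition fe :: "'a::field mpoly \<Rightarrow> 'a \<Rightarrow> 'a \<Rightarrow> 'a" where
  "fe F x z = mp_eval id (\<lambda>i. if i = 0 then x else if i = 1 then z else 0) F"

lemma fe_simps [simp]:
  fixes F G :: "'a::field mpoly"
  shows "fe (F * G) x z = fe F x z * fe G x z" "fe (F + G) x z = fe F x z + fe G x z"
    "fe (F - G) x z = fe F x z - fe G x z" "fe (F ^ n) x z = fe F x z ^ n"
    "fe (mp_const c) x z = c" "fe x_var x z = x" "fe z_var x z = z" "fe 1 x z = 1" "fe 0 x z = 0"
    "fe (hform d p) x z = hf d p x z" "fe (sum g A) x z = (\<Sum>i\<in>A. fe (g i) x z)"
  by (simp_all add: fe_def)

lemma eval_binary_form:
  assumes "binary_form d F" shows "mp_eval id v F = fe F (v 0) (v 1)"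
  unfolding fe_def by (rule eval_cong_hom[of "[1,1]" d]) (use assms in \<open>auto simp: binary_form_def less_2_cases_iff One_nat_def[symmetric]\<close>)

lemma binary_form_eqI:
  fixes F G :: "'a::alg_closed_field mpoly"
  assumes "binary_form d F" "binary_form d G" "\<And>x z. z \<noteq> 0 \<Longrightarrow> fe F x z = fe G x z"
  shows "F = G"
proof -
  obtain p where p: "Polynomial.degree p \<le> d" "F = hform d p" using binary_form_imp_hform[OF assms(1)] .
  obtain q where q: "Polynomial.degree q \<le> d" "G = hform d q" using binary_form_imp_hform[OF assms(2)] .
  have "poly p x = poly q x" for x
    using assms(3)[of 1 x] p q by (simp add: hf_1)
  hence "p = q" by (intro poly_eqI_cofinite) simp
  thus ?thesis using p q by simp
qed

lemma binary_form_mult: "binary_form d F \<Longrightarrow> binary_form e G \<Longrightarrow> c = d + e \<Longrightarrow> binary_form c (F * G)"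
  unfolding binary_form_def by (rule homogeneous_mult')

lemma binary_form_basic [simp]:
  "binary_form 0 (mp_const c)" "binary_form 1 (x_var :: 'a::field mpoly)" "binary_form 1 (z_var :: 'a::field mpoly)"
  by (auto simp: binary_form_def homogeneous_var)

lemma binary_form_const_mult: "binary_form d F \<Longrightarrow> binary_form d (mp_const c * F)"
  by (rule binary_form_mult) auto

lemma binary_form_linear [simp]: "binary_form 1 (mp_const a * x_var + mp_const b * z_var :: 'a::field mpoly)"
  using binary_form_const_mult[OF binary_form_basic(2)] binary_form_const_mult[OF binary_form_basic(3)]
  unfolding binary_form_def by auto

text \<open>The last inequality excludes a double zero at infinity.\<close>

lemma no_repeated_hform:
  fixes p :: "'a::alg_closed_field poly"
  assumes nr: "no_repeated_linear_factors (hform d p)" and deg: "Polynomial.degree p \<le> d"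
  shows "p \<noteq> 0" "\<not> [:- s, 1:] ^ 2 dvd p" "d \<le> Polynomial.degree p + 1"
proof -
  have nd: "\<not> (mp_const \<alpha> * x_var + mp_const \<beta> * z_var)\<^sup>2 dvd hform d p" if "(\<alpha>, \<beta>) \<noteq> (0, 0)" for \<alpha> \<beta>
    using nr that unfolding no_repeated_linear_factors_def by blast
  have lin2: "binary_form 2 ((mp_const \<alpha> * x_var + mp_const \<beta> * z_var :: 'a mpoly)\<^sup>2)" for \<alpha> \<beta>
    unfolding power2_eq_square by (rule binary_form_mult[where d=1 and e=1]) auto
  show p0: "p \<noteq> 0"
    using nd[of 1 0] by (auto simp: hform_def mp_const_def)
  show "\<not> [:- s, 1:] ^ 2 dvd p"
  proof
    assume "[:- s, 1:] ^ 2 dvd p"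
    then obtain q where q: "p = [:- s, 1:] ^ 2 * q" by (auto elim: dvdE)
    have "q \<noteq> 0" using p0 q by auto
    hence dp: "Polynomial.degree p = 2 + Polynomial.degree q"
      unfolding q by (subst degree_mult_eq) (auto simp: degree_linear_power)
    hence d2: "2 \<le> d" "Polynomial.degree q \<le> d - 2" using deg by auto
    have "hform d p = (mp_const 1 * x_var + mp_const (- s) * z_var)\<^sup>2 * hform (d - 2) q"
    proof (rule binary_form_eqI[of d])
      fix x z :: 'a assume z: "z \<noteq> 0"
      have e: "z ^ d = z ^ 2 * z ^ (d - 2)" using d2 by (simp only: power_add[symmetric] le_add_diff_inverse)
      have "(x + - s * z)\<^sup>2 = z\<^sup>2 * (x / z - s)\<^sup>2"
        using z by (simp add: power_mult_distrib[symmetric] algebra_simps)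
      thus "fe (hform d p) x z = fe ((mp_const 1 * x_var + mp_const (- s) * z_var)\<^sup>2 * hform (d - 2) q) x z"
        using z d2 deg by (simp add: hf_z q e)
    qed (simp, rule binary_form_mult[OF lin2 binary_form_hform], use d2 in simp)
    thus False using nd[of 1 "-s"] by (auto simp: mp_const_def)
  qed
  show "d \<le> Polynomial.degree p + 1"
  proof (rule ccontr)
    assume "\<not> d \<le> Polynomial.degree p + 1"
    hence d2: "2 \<le> d" "Polynomial.degree p \<le> d - 2" by auto
    have "hform d p = (mp_const 0 * x_var + mp_const 1 * z_var)\<^sup>2 * hform (d - 2) p"
    proof (rule binary_form_eqI[of d])
      fix x z :: 'a assume z: "z \<noteq> 0"
      have e: "z ^ d = z ^ 2 * z ^ (d - 2)" using d2 by (simp only: power_add[symmetric] le_add_diff_inverse)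
      show "fe (hform d p) x z = fe ((mp_const 0 * x_var + mp_const 1 * z_var)\<^sup>2 * hform (d - 2) p) x z"
        using z d2 deg by (simp add: hf_z e)
    qed (simp, rule binary_form_mult[OF lin2 binary_form_hform], use d2 in simp)
    thus False using nd[of 0 1] by (auto simp: mp_const_def)
  qed
qed

section \<open>Linear substitutions\<close>

definition subst2 :: "'a::field \<Rightarrow> 'a \<Rightarrow> 'a \<Rightarrow> 'a \<Rightarrow> 'a mpoly \<Rightarrow> 'a mpoly" where
  "subst2 p q r s = mp_eval mp_const
       (\<lambda>j. if j = 0 then mp_const p * x_var + mp_const q * z_var
            else if j = 1 then mp_const r * x_var + mp_const s * z_var
            else mp_var j)"

lemma gl_act_subst2:
  "gl_act A = (let B = matrix_inv A in subst2 (B $ 1 $ 1) (B $ 1 $ 2) (B $ 2 $ 1) (B $ 2 $ 2))"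
  by (simp add: gl_act_def subst2_def Let_def fun_eq_iff)

lemma rhom_subst2 [simp]: "rhom (subst2 p q r s)"
  unfolding subst2_def by simp

lemma fe_subst2: "fe (subst2 p q r s F) x z = fe F (p * x + q * z) (r * x + s * z)"
proof -
  have *: "(\<lambda>i. mp_eval id (\<lambda>i. if i = 0 then x else if i = 1 then z else 0)
            (if i = 0 then mp_const p * x_var + mp_const q * z_var
             else if i = 1 then mp_const r * x_var + mp_const s * z_var else mp_var i)) =
     (\<lambda>i. if i = 0 then p * x + q * z else if i = 1 then r * x + s * z else 0)"
    by auto
  show ?thesis unfolding fe_def subst2_def eval_subst * ..
qed

lemma binary_form_subst2: "binary_form d F \<Longrightarrow> binary_form d (subst2 p q r s F)"
  unfolding binary_form_def subst2_def
  by (rule homogeneous_subst[of "[1,1]"])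
     (use binary_form_linear in \<open>auto simp: less_2_cases_iff One_nat_def[symmetric] binary_form_def\<close>)

lemma subst2_inverse:
  assumes "p * s - q * r = D" "D \<noteq> 0"
  shows "subst2 (s / D) (- q / D) (- r / D) (p / D) (subst2 p q r s F) = F"
proof -
  let ?g = "subst2 (s / D) (- q / D) (- r / D) (p / D)"
  have gc: "?g (mp_const c) = mp_const c" for c by (simp add: subst2_def rhomD[OF rhom_mp_const])
  have gv: "?g x_var = mp_const (s / D) * x_var + mp_const (- q / D) * z_var"
    "?g z_var = mp_const (- r / D) * x_var + mp_const (p / D) * z_var" "i \<ge> 2 \<Longrightarrow> ?g (mp_var i) = mp_var i" for i
    by (simp_all add: subst2_def rhomD[OF rhom_mp_const])
  have lin: "mp_const a * (mp_const b * x_var + mp_const c * z_var) + mp_const a' * (mp_const b' * x_var + mp_const c' * z_var)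
     = mp_const (a * b + a' * b') * x_var + mp_const (a * c + a' * c') * (z_var :: 'a mpoly)" for a b c a' b' c'
    by (simp add: rhomD[OF rhom_mp_const] algebra_simps)
  have D: "p * (s / D) + q * (- r / D) = 1" "p * (- q / D) + q * (p / D) = 0"
    "r * (s / D) + s * (- r / D) = 0" "r * (- q / D) + s * (p / D) = 1"
    using assms by (simp_all add: field_simps)
  have c01: "mp_const 1 = (1 :: 'a mpoly)" "mp_const 0 = (0 :: 'a mpoly)" by (simp_all add: rhomD[OF rhom_mp_const])
  have "?g (mp_const p * x_var + mp_const q * z_var) = x_var"
    "?g (mp_const r * x_var + mp_const s * z_var) = z_var"
    by (simp_all only: rhomD[OF rhom_subst2] gc gv lin D c01 mult_1_left mult_zero_left add_0_right add_0_left)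
  hence gT: "?g (if i = 0 then mp_const p * x_var + mp_const q * z_var
            else if i = 1 then mp_const r * x_var + mp_const s * z_var else mp_var i) = mp_var i" for i
    using gv(3)[of i] by (cases "i = 0"; cases "i = 1") auto
  have "?g (subst2 p q r s F) = mp_eval (\<lambda>c. mp_const c) mp_var F"
    unfolding subst2_def[of p q r s] by (subst rhom_mp_eval_comp[OF rhom_subst2]) (simp only: gT gc)
  also have "\<dots> = Poly_Mapping.map (\<lambda>c. c) F" by (rule map_eq_eval[symmetric]) simp
  also have "\<dots> = F" by (rule map_ident) simp
  finally show ?thesis .
qed

lemma no_repeated_const_mult:
  assumes "no_repeated_linear_factors F" "c \<noteq> 0" shows "no_repeated_linear_factors (mp_const c * F)"
proof -
  have "mp_const (1 / c) * (mp_const c * F) = F"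
    using assms(2) by (simp add: mult.assoc[symmetric] rhomD(4)[OF rhom_mp_const, symmetric]) (simp add: mp_const_def)
  hence "G dvd F" if "G dvd mp_const c * F" for G using that dvd_mult by metis
  thus ?thesis using assms(1) unfolding no_repeated_linear_factors_def by blast
qed

lemma no_repeated_subst2:
  assumes nr: "no_repeated_linear_factors F" and D: "p * s - q * r \<noteq> 0"
  shows "no_repeated_linear_factors (subst2 p q r s F)"
  unfolding no_repeated_linear_factors_def
proof (intro allI impI notI)
  fix \<alpha> \<beta> :: 'a assume ne: "(\<alpha>, \<beta>) \<noteq> (0, 0)"
    and "(mp_const \<alpha> * x_var + mp_const \<beta> * z_var)\<^sup>2 dvd subst2 p q r s F"
  then obtain h where h: "subst2 p q r s F = (mp_const \<alpha> * x_var + mp_const \<beta> * z_var)\<^sup>2 * h" by (auto elim: dvdE)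
  define D where "D = p * s - q * r"
  let ?g = "subst2 (s / D) (- q / D) (- r / D) (p / D)"
  define \<alpha>' \<beta>' where "\<alpha>' = \<alpha> * (s / D) + \<beta> * (- r / D)" and "\<beta>' = \<alpha> * (- q / D) + \<beta> * (p / D)"
  have gc: "?g (mp_const c) = mp_const c" for c by (simp add: subst2_def rhomD[OF rhom_mp_const])
  have gv: "?g x_var = mp_const (s / D) * x_var + mp_const (- q / D) * z_var"
    "?g z_var = mp_const (- r / D) * x_var + mp_const (p / D) * z_var"
    by (simp_all add: subst2_def rhomD[OF rhom_mp_const])
  have "F = ?g ((mp_const \<alpha> * x_var + mp_const \<beta> * z_var)\<^sup>2 * h)"
    using subst2_inverse[of p s q r D F] D unfolding h D_def by simp
  also have "\<dots> = (mp_const \<alpha>' * x_var + mp_const \<beta>' * z_var)\<^sup>2 * ?g h"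
    by (simp only: rhomD[OF rhom_subst2] rhom_power[OF rhom_subst2] gc gv \<alpha>'_def \<beta>'_def rhomD[OF rhom_mp_const])
       (simp add: algebra_simps)
  finally have "(mp_const \<alpha>' * x_var + mp_const \<beta>' * z_var)\<^sup>2 dvd F" by (rule dvdI)
  moreover have "(\<alpha>', \<beta>') \<noteq> (0, 0)"
  proof
    assume "(\<alpha>', \<beta>') = (0, 0)"
    hence "\<alpha> * s = \<beta> * r" "\<beta> * p = \<alpha> * q" using D unfolding \<alpha>'_def \<beta>'_def D_def by (auto simp: field_simps)
    moreover have "\<alpha> * (p * s - q * r) = p * (\<alpha> * s - \<beta> * r) + r * (\<beta> * p - \<alpha> * q)"
      "\<beta> * (p * s - q * r) = s * (\<beta> * p - \<alpha> * q) + q * (\<alpha> * s - \<beta> * r)" by (simp_all add: algebra_simps)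
    ultimately have "\<alpha> * (p * s - q * r) = 0" "\<beta> * (p * s - q * r) = 0" by simp_all
    thus False using D ne by auto
  qed
  ultimately show False using nr unfolding no_repeated_linear_factors_def by blast
qed

lemma matrix_inv_2:
  fixes A :: "'a::field ^ 2 ^ 2"
  assumes "A $ 1 $ 1 * A $ 2 $ 2 - A $ 1 $ 2 * A $ 2 $ 1 = D" "D \<noteq> 0"
  shows "matrix_inv A = vector [vector [A $ 2 $ 2 / D, - A $ 1 $ 2 / D], vector [- A $ 2 $ 1 / D, A $ 1 $ 1 / D]]"
    (is "_ = ?B") and "invertible A"
proof -
  have AB: "A ** ?B = mat 1" "?B ** A = mat 1"
    using assms by (simp_all add: vec_eq_iff forall_2 matrix_matrix_mult_def sum_2 vector_2 mat_def field_simps)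
  show inv: "invertible A" using AB unfolding invertible_def by blast
  have inv': "matrix_inv A ** A = mat 1"
    using someI_ex[OF inv[unfolded invertible_def]] unfolding matrix_inv_def by blast
  have "matrix_inv A = matrix_inv A ** (A ** ?B)" unfolding AB by simp
  also have "\<dots> = ?B" unfolding matrix_mul_assoc inv' by simp
  finally show "matrix_inv A = ?B" .
qed

lemma invertible_2:
  fixes A :: "'a::field ^ 2 ^ 2"
  shows "invertible A \<longleftrightarrow> A $ 1 $ 1 * A $ 2 $ 2 - A $ 1 $ 2 * A $ 2 $ 1 \<noteq> 0"
  by (simp add: invertible_det_nz det_2)

definition form_equiv :: "'a::field mpoly \<Rightarrow> 'a mpoly \<Rightarrow> bool" where
  "form_equiv F G \<longleftrightarrow> (\<exists>p q r s c. p * s - q * r \<noteq> 0 \<and> c \<noteq> 0 \<and>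
     (\<forall>x z. fe F x z = c * fe G (p * x + q * z) (r * x + s * z)))"

lemma inverse_substitution:
  fixes p q r s :: "'a::field"
  assumes D: "p * s - q * r \<noteq> 0"
  obtains p' q' r' s' where "p' * s' - q' * r' \<noteq> 0"
    and "\<And>x z. p * (p' * x + q' * z) + q * (r' * x + s' * z) = x" "\<And>x z. r * (p' * x + q' * z) + s * (r' * x + s' * z) = z"
      "\<And>x z. p' * (p * x + q * z) + q' * (r * x + s * z) = x" "\<And>x z. r' * (p * x + q * z) + s' * (r * x + s * z) = z"
proof -
  define E where "E = 1 / (p * s - q * r)"
  have E: "E * (p * s - q * r) = 1" using D by (simp add: E_def)
  show ?thesis
  proof (rule that[of "s * E" "p * E" "- q * E" "- r * E"])
    have "(s * E) * (p * E) - (- q * E) * (- r * E) = E * (E * (p * s - q * r))" by (simp add: algebra_simps)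
    also have "\<dots> \<noteq> 0" unfolding E using D by (simp add: E_def)
    finally show "(s * E) * (p * E) - (- q * E) * (- r * E) \<noteq> 0" .
    fix x z
    have "p * (s * E * x + - q * E * z) + q * (- r * E * x + p * E * z) = (E * (p * s - q * r)) * x"
      "r * (s * E * x + - q * E * z) + s * (- r * E * x + p * E * z) = (E * (p * s - q * r)) * z"
      "s * E * (p * x + q * z) + - q * E * (r * x + s * z) = (E * (p * s - q * r)) * x"
      "- r * E * (p * x + q * z) + p * E * (r * x + s * z) = (E * (p * s - q * r)) * z"
      by (simp_all add: algebra_simps)
    thus "p * (s * E * x + - q * E * z) + q * (- r * E * x + p * E * z) = x"
      "r * (s * E * x + - q * E * z) + s * (- r * E * x + p * E * z) = z"
      "s * E * (p * x + q * z) + - q * E * (r * x + s * z) = x"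
      "- r * E * (p * x + q * z) + p * E * (r * x + s * z) = z"
      unfolding E by simp_all
  qed
qed

section \<open>Isomorphisms given by graded substitutions\<close>

text \<open>Regular functions are locally quotients of forms, and such quotients are preserved by a substitution of weighted
  homogeneous polynomials.\<close>

lemma subst_morphism:
  fixes C Y :: "'a::field variety"
  assumes S: "\<And>i. i < length (fst Y) \<Longrightarrow> homogeneous (fst C) (fst Y ! i) (S i)"
    and T: "\<And>v. T v = (\<lambda>i. if i < length (fst Y) then mp_eval id v (S i) else 0)"
    and im: "\<And>P. P \<in> pts C \<Longrightarrow> T ` P \<in> pts Y"
  shows "morphism C Y (image T)"
proof -
  define sub where "sub H = mp_eval mp_const S H" for H :: "'a mpoly"
  have hom: "homogeneous (fst C) d (sub H)" if "homogeneous (fst Y) d H" for d H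
    unfolding sub_def by (rule homogeneous_subst[OF that S])
  have ev: "mp_eval id (T v) H = mp_eval id v (sub H)" if "homogeneous (fst Y) d H" for v d H
    unfolding sub_def eval_subst by (rule eval_cong_hom[OF that]) (simp add: T)
  have van: "vanishes H (T ` P) \<longleftrightarrow> vanishes (sub H) P" if "homogeneous (fst Y) d H" for d H P
    by (simp add: vanishes_def ev[OF that])
  have rat: "ratio H G (T ` P) = ratio (sub H) (sub G) P"
    if "homogeneous (fst Y) d H" "homogeneous (fst Y) d G" "P \<in> pts C" for d H G P
  proof -
    have r: "rep P \<in> P" using rep_in pts_wspace that(3) by blast
    hence "T (rep P) \<in> T ` P" by blast
    from ratio_any[OF pts_wspace[OF im[OF that(3)]] this that(1,2)]
    show ?thesis by (simp add: ratio_val val_def ev[OF that(1)] ev[OF that(2)])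
  qed
  have open_pre: "zopen C {P \<in> pts C. T ` P \<in> V}" if "zopen Y V" for V
  proof -
    obtain E where E: "\<And>F. F \<in> E \<Longrightarrow> \<exists>d. homogeneous (fst Y) d F" "pts Y - V = {P \<in> pts Y. \<forall>F\<in>E. vanishes F P}"
      using \<open>zopen Y V\<close> unfolding zopen_def zclosed_def by blast
    have "zclosed C (pts C - {P \<in> pts C. T ` P \<in> V})"
      unfolding zclosed_def
    proof (intro exI[of _ "sub ` E"] conjI ballI)
      show "\<exists>d. homogeneous (fst C) d F" if "F \<in> sub ` E" for F using that E(1) hom by blast
      have "T ` P \<notin> V \<longleftrightarrow> (\<forall>F\<in>E. vanishes (sub F) P)" if "P \<in> pts C" for P
      proof -
        have "T ` P \<notin> V \<longleftrightarrow> T ` P \<in> pts Y - V" using im[OF that] by blast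
        also have "\<dots> \<longleftrightarrow> (\<forall>F\<in>E. vanishes F (T ` P))" unfolding E(2) using im[OF that] by blast
        also have "\<dots> \<longleftrightarrow> (\<forall>F\<in>E. vanishes (sub F) P)" using E(1) van by blast
        finally show ?thesis .
      qed
      thus "pts C - {P \<in> pts C. T ` P \<in> V} = {P \<in> pts C. \<forall>F\<in>sub ` E. vanishes F P}" by auto
    qed
    thus ?thesis unfolding zopen_def by blast
  qed
  show ?thesis unfolding morphism_def
  proof (intro conjI allI impI)
    show "(`) T ` pts C \<subseteq> pts Y" using im by blast
    fix V h assume Vh: "zopen Y V \<and> regular_on Y V h"
    thus "zopen C {P \<in> pts C. T ` P \<in> V}" using open_pre by blast
    show "regular_on C {P \<in> pts C. T ` P \<in> V} (h \<circ> (`) T)"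
      unfolding regular_on_def
    proof
      fix P assume "P \<in> {P \<in> pts C. T ` P \<in> V}"
      hence P: "P \<in> pts C" "T ` P \<in> V" by auto
      then obtain U F G d where U: "zopen Y U" "T ` P \<in> U" "U \<subseteq> V" "homogeneous (fst Y) d F" "homogeneous (fst Y) d G"
        "\<And>Q. Q \<in> U \<Longrightarrow> \<not> vanishes G Q \<and> h Q = ratio F G Q"
        using Vh unfolding regular_on_def by blast
      show "\<exists>U F G d. zopen C U \<and> P \<in> U \<and> U \<subseteq> {P \<in> pts C. T ` P \<in> V} \<and>
        homogeneous (fst C) d F \<and> homogeneous (fst C) d G \<and>
        (\<forall>Q\<in>U. \<not> vanishes G Q \<and> (h \<circ> (`) T) Q = ratio F G Q)"
      proof (intro exI conjI)
        show "zopen C {P \<in> pts C. T ` P \<in> U}" using open_pre U(1) by blast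
        show "P \<in> {P \<in> pts C. T ` P \<in> U}" "{P \<in> pts C. T ` P \<in> U} \<subseteq> {P \<in> pts C. T ` P \<in> V}" using P U by auto
        show "homogeneous (fst C) d (sub F)" "homogeneous (fst C) d (sub G)" using hom U by auto
        show "\<forall>Q\<in>{P \<in> pts C. T ` P \<in> U}. \<not> vanishes (sub G) Q \<and> (h \<circ> (`) T) Q = ratio (sub F) (sub G) Q"
        proof
          fix Q assume "Q \<in> {P \<in> pts C. T ` P \<in> U}"
          thus "\<not> vanishes (sub G) Q \<and> (h \<circ> (`) T) Q = ratio (sub F) (sub G) Q"
            using U(6)[of "T ` Q"] van[OF U(5), of Q] rat[OF U(4,5), of Q] by simp
        qed
      qed
    qed
  qed
qed

definition lin_map :: "'a::field \<Rightarrow> 'a \<Rightarrow> 'a \<Rightarrow> 'a \<Rightarrow> 'a \<Rightarrow> (nat \<Rightarrow> 'a) \<Rightarrow> nat \<Rightarrow> 'a" where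
  "lin_map p q r s e v = (\<lambda>i. if i = 0 then p * v 0 + q * v 1 else if i = 1 then r * v 0 + s * v 1
     else if i = 2 then e * v 2 else 0)"

lemma pts_hyp_model:
  assumes "binary_form (2 * w) F"
  shows "P \<in> pts (hyp_model w F) \<longleftrightarrow> P \<in> wspace [1, 1, w] \<and> (\<forall>v\<in>P. (v 2)\<^sup>2 = fe F (v 0) (v 1))"
  by (simp add: pts_def hyp_model_def vanishes_def eval_binary_form[OF assms])

lemma less3: "i < length [a, b, c] \<longleftrightarrow> i = 0 \<or> i = 1 \<or> i = (2::nat)"
  by auto

lemma lin_map_pts:
  assumes F: "binary_form (2 * w) F" and G: "binary_form (2 * w) G"
    and D: "p * s - q * r \<noteq> 0" and e: "e \<noteq> 0"
    and eq: "\<And>x z. e\<^sup>2 * fe F x z = fe G (p * x + q * z) (r * x + s * z)"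
    and P: "P \<in> pts (hyp_model w F)"
  shows "lin_map p q r s e ` P \<in> pts (hyp_model w G)"
proof -
  have Pw: "P \<in> wspace [1, 1, w]" using P unfolding pts_hyp_model[OF F] by blast
  obtain v where v: "v \<in> P" using wspace_nonempty[OF Pw] by blast
  note vp = wspace_orbit[OF Pw v]
  have sc: "lin_map p q r s e (scal [1,1,w] c v) = scal [1,1,w] c (lin_map p q r s e v)" for c
    by (auto simp: lin_map_def scal_def fun_eq_iff algebra_simps)
  have o: "lin_map p q r s e ` P = orbit [1,1,w] (lin_map p q r s e v)"
  proof (intro equalityI subsetI)
    fix u assume "u \<in> lin_map p q r s e ` P"
    thus "u \<in> orbit [1,1,w] (lin_map p q r s e v)" unfolding vp(1) by (auto simp: orbit_alt sc)
  next
    fix u assume "u \<in> orbit [1,1,w] (lin_map p q r s e v)"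
    then obtain c where "c \<noteq> 0" "u = lin_map p q r s e (scal [1,1,w] c v)" by (auto simp: orbit_alt sc)
    moreover have "scal [1,1,w] c v \<in> P" using calculation(1) unfolding vp(1) by (auto simp: orbit_alt)
    ultimately show "u \<in> lin_map p q r s e ` P" by blast
  qed
  have "\<exists>i. lin_map p q r s e v i \<noteq> 0"
  proof (rule ccontr)
    assume "\<not> ?thesis"
    hence z: "lin_map p q r s e v i = 0" for i by blast
    have "p * v 0 + q * v 1 = 0" "r * v 0 + s * v 1 = 0" "v 2 = 0"
      using z[of 0] z[of 1] z[of 2] e by (auto simp: lin_map_def)
    moreover have "(p * s - q * r) * v 0 = s * (p * v 0 + q * v 1) - q * (r * v 0 + s * v 1)"
      "(p * s - q * r) * v 1 = p * (r * v 0 + s * v 1) - r * (p * v 0 + q * v 1)" by (simp_all add: algebra_simps)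
    ultimately have "v 0 = 0" "v 1 = 0" "v 2 = 0" using D by simp_all
    hence "v i = 0" if "i < length [1,1,w]" for i using that unfolding less3 by auto
    thus False using vp(2,3) by (meson not_le)
  qed
  moreover have "\<forall>i\<ge>length [1,1,w]. lin_map p q r s e v i = 0" by (auto simp: lin_map_def)
  ultimately have "lin_map p q r s e ` P \<in> wspace [1,1,w]" unfolding o wspace_def by blast
  moreover have "(lin_map p q r s e v 2)\<^sup>2 = fe G (lin_map p q r s e v 0) (lin_map p q r s e v 1)" if "v \<in> P" for v
    using P that eq[of "v 0" "v 1"] unfolding pts_hyp_model[OF F] by (simp add: lin_map_def power_mult_distrib)
  ultimately show ?thesis unfolding pts_hyp_model[OF G] by blast
qed

lemma lin_map_morphism:
  assumes F: "binary_form (2 * w) F" and G: "binary_form (2 * w) G"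
    and D: "p * s - q * r \<noteq> 0" and e: "e \<noteq> 0"
    and eq: "\<And>x z. e\<^sup>2 * fe F x z = fe G (p * x + q * z) (r * x + s * z)"
  shows "morphism (hyp_model w F) (hyp_model w G) (image (lin_map p q r s e))"
proof (rule subst_morphism)
  let ?S = "\<lambda>i. if i = 0 then mp_const p * x_var + mp_const q * z_var
     else if i = 1 then mp_const r * x_var + mp_const s * z_var else mp_const e * y_var"
  show "lin_map p q r s e ` P \<in> pts (hyp_model w G)" if "P \<in> pts (hyp_model w F)" for P
    using lin_map_pts[OF assms that] .
  show "lin_map p q r s e v = (\<lambda>i. if i < length (fst (hyp_model w G)) then mp_eval id v (?S i) else 0)" for v
    by (auto simp: lin_map_def hyp_model_def fun_eq_iff)
  show "homogeneous (fst (hyp_model w F)) (fst (hyp_model w G) ! i) (?S i)"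
    if "i < length (fst (hyp_model w G))" for i
  proof -
    have h: "homogeneous [1,1,w] 1 (x_var::'a mpoly)" "homogeneous [1,1,w] 1 (z_var::'a mpoly)" "homogeneous [1,1,w] w (y_var::'a mpoly)"
      by (auto intro!: homogeneous_var)
    have m: "homogeneous [1,1,w] d (mp_const c * H)" if "homogeneous [1,1,w] d H" for c d and H :: "'a mpoly"
      using homogeneous_mult[OF homogeneous_const that] by simp
    from that have "i = 0 \<or> i = 1 \<or> i = 2" by (auto simp: hyp_model_def)
    thus ?thesis using h m by (auto simp: hyp_model_def)
  qed
qed

text \<open>The scalar factor is absorbed into \<open>y\<close> by means of a square root.\<close>

lemma form_equiv_imp_isomorphic:
  fixes F G :: "'a::alg_closed_field mpoly"
  assumes F: "binary_form (2 * w) F" and G: "binary_form (2 * w) G" and "form_equiv F G"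
  shows "isomorphic (hyp_model w F) (hyp_model w G)"
proof -
  obtain p q r s c where D: "p * s - q * r \<noteq> 0" and c: "c \<noteq> 0"
    and eq: "\<And>x z. fe F x z = c * fe G (p * x + q * z) (r * x + s * z)"
    using assms(3) unfolding form_equiv_def by blast
  obtain e where "e ^ 2 = 1 / c" using nth_root_exists[of 2 "1 / c"] by auto
  hence e: "e\<^sup>2 * c = 1" "e \<noteq> 0" using c by (auto simp: field_simps)
  obtain p' q' r' s' where D2: "p' * s' - q' * r' \<noteq> 0"
    and comp: "\<And>x z. p * (p' * x + q' * z) + q * (r' * x + s' * z) = x" "\<And>x z. r * (p' * x + q' * z) + s * (r' * x + s' * z) = z"
      "\<And>x z. p' * (p * x + q * z) + q' * (r * x + s * z) = x" "\<And>x z. r' * (p * x + q * z) + s' * (r * x + s * z) = z"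
    by (rule inverse_substitution[OF D]) (rule that)
  have eq1: "e\<^sup>2 * fe F x z = fe G (p * x + q * z) (r * x + s * z)" for x z
    using e by (simp add: eq mult.assoc[symmetric])
  have eq2: "(1/e)\<^sup>2 * fe G x z = fe F (p' * x + q' * z) (r' * x + s' * z)" for x z
  proof -
    have "(1/e)\<^sup>2 * (e\<^sup>2 * fe F (p' * x + q' * z) (r' * x + s' * z)) = (1/e)\<^sup>2 * fe G x z"
      by (simp only: eq1 comp)
    thus ?thesis using e(2) by (simp add: power_divide)
  qed
  have id1: "lin_map p' q' r' s' (1/e) ` lin_map p q r s e ` P = P"
    and id2: "lin_map p q r s e ` lin_map p' q' r' s' (1/e) ` P = P" if "P \<in> wspace [1,1,w]" for P
  proof -
    have "lin_map p' q' r' s' (1/e) (lin_map p q r s e v) = v" "lin_map p q r s e (lin_map p' q' r' s' (1/e) v) = v" if "v \<in> P" for v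
    proof -
      have z: "\<forall>i\<ge>length [1,1,w]. v i = 0" using wspace_orbit(3)[OF \<open>P \<in> wspace _\<close> that] .
      hence "v i = 0" if "i \<noteq> 0" "i \<noteq> 1" "i \<noteq> 2" for i using that less3[of i 1 1 w] by (meson not_le)
      thus "lin_map p' q' r' s' (1/e) (lin_map p q r s e v) = v" "lin_map p q r s e (lin_map p' q' r' s' (1/e) v) = v"
        using e(2) unfolding lin_map_def by (auto simp: fun_eq_iff comp)
    qed
    thus "lin_map p' q' r' s' (1/e) ` lin_map p q r s e ` P = P"
      "lin_map p q r s e ` lin_map p' q' r' s' (1/e) ` P = P" by (auto simp: image_image)
  qed
  show ?thesis unfolding isomorphic_def
    using lin_map_morphism[OF F G D e(2) eq1] lin_map_morphism[OF G F D2 _ eq2] e(2)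
    by (intro exI[of _ "image (lin_map p q r s e)"] exI[of _ "image (lin_map p' q' r' s' (1/e))"])
       (auto simp: pts_hyp_model[OF F] pts_hyp_model[OF G] id1 id2)
qed

section \<open>The geometry of a hyperelliptic model\<close>

text \<open>The model \<open>y\<^sup>2 = f(x, z)\<close> in terms of the dehomogenization \<open>p\<close> of \<open>f\<close>; its degree is \<open>2w\<close> or \<open>2w - 1\<close> because \<open>f\<close> has
  at most a simple zero at infinity.\<close>

locale hyp_curve =
  fixes w :: nat and p :: "'a::alg_closed_field poly"
  assumes w: "w \<ge> 1" and deg_le: "Polynomial.degree p \<le> 2 * w" and deg_ge: "2 * w \<le> Polynomial.degree p + 1"
    and sqf: "\<And>s. \<not> [:- s, 1:] ^ 2 dvd p" and two: "(2::'a) \<noteq> 0"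
begin

definition Cv :: "'a variety" where "Cv = hyp_model w (hform (2 * w) p)"

abbreviation hom :: "nat \<Rightarrow> 'a mpoly \<Rightarrow> bool" where "hom d H \<equiv> homogeneous [1, 1, w] d H"

definition xc :: "'a point \<Rightarrow> 'a" where "xc P = rep P 0"
definition zc :: "'a point \<Rightarrow> 'a" where "zc P = rep P 1"
definition yc :: "'a point \<Rightarrow> 'a" where "yc P = rep P 2"

lemma p0: "p \<noteq> 0" using deg_ge w by auto

lemma fst_Cv [simp]: "fst Cv = [1, 1, w]" by (simp add: Cv_def hyp_model_def)

lemma val_var [simp]: "val x_var P = xc P" "val z_var P = zc P" "val y_var P = yc P"
  by (simp_all add: val_def xc_def zc_def yc_def)

lemma val_hform [simp]: "val (hform d a) P = hf d a (xc P) (zc P)"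
  by (simp add: val_def xc_def zc_def)

lemma hom_hform [simp]: "hom d (hform d a)"
  by (rule homogeneous_hform) auto

lemma hom_var: "hom 1 x_var" "hom 1 z_var" "hom w y_var"
  by (auto intro!: homogeneous_var)

lemma pts_Cv: "P \<in> pts Cv \<longleftrightarrow> P \<in> wspace [1, 1, w] \<and> (\<forall>v\<in>P. (v 2)\<^sup>2 = hf (2 * w) p (v 0) (v 1))"
  unfolding Cv_def by (simp add: pts_hyp_model)

lemma yc_sq: "P \<in> pts Cv \<Longrightarrow> (yc P)\<^sup>2 = hf (2 * w) p (xc P) (zc P)"
  using rep_in[of P "[1,1,w]"] by (auto simp: pts_Cv xc_def zc_def yc_def)

lemma coords_nz: "P \<in> pts Cv \<Longrightarrow> xc P \<noteq> 0 \<or> zc P \<noteq> 0"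
proof (rule ccontr)
  assume P: "P \<in> pts Cv" and "\<not> (xc P \<noteq> 0 \<or> zc P \<noteq> 0)"
  hence z: "xc P = 0" "zc P = 0" by auto
  have "(yc P)\<^sup>2 = 0" unfolding yc_sq[OF P] z using w by (simp add: hf_z0 power_0_left)
  hence "rep P i = 0" if "i < length [1,1,w]" for i
    using z that unfolding less3 by (auto simp: xc_def zc_def yc_def)
  moreover have "P \<in> wspace [1,1,w]" using P by (simp add: pts_Cv)
  ultimately show False using wspace_orbit(2,3)[OF _ rep_in] by (meson not_le)
qed

definition vec3 :: "'a \<Rightarrow> 'a \<Rightarrow> 'a \<Rightarrow> nat \<Rightarrow> 'a" where
  "vec3 x z y = (\<lambda>i. if i = 0 then x else if i = 1 then z else if i = 2 then y else 0)"

definition pt :: "'a \<Rightarrow> 'a \<Rightarrow> 'a \<Rightarrow> 'a point" where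
  "pt x z y = orbit [1, 1, w] (vec3 x z y)"

lemma scal_vec3: "scal [1,1,w] c (vec3 x z y) = vec3 (c * x) (c * z) (c ^ w * y)"
proof
  fix i
  show "scal [1,1,w] c (vec3 x z y) i = vec3 (c * x) (c * z) (c ^ w * y) i"
    using less3[of i 1 1 w] by (auto simp: scal_def vec3_def)
qed

lemma pt_alt: "pt x z y = {vec3 (c * x) (c * z) (c ^ w * y) | c. c \<noteq> 0}"
  unfolding pt_def orbit_alt scal_vec3 ..

lemma pt_eq: "P \<in> pts Cv \<Longrightarrow> P = pt (xc P) (zc P) (yc P)"
proof -
  assume P: "P \<in> pts Cv"
  hence Pw: "P \<in> wspace [1,1,w]" by (simp add: pts_Cv)
  note o = wspace_orbit[OF Pw rep_in[OF Pw]]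
  have "rep P i = vec3 (xc P) (zc P) (yc P) i" for i
    using o(3) by (auto simp: vec3_def xc_def zc_def yc_def)
  hence "rep P = vec3 (xc P) (zc P) (yc P)" by blast
  thus ?thesis using o(1) by (simp add: pt_def)
qed

lemma pt_scale: "c \<noteq> 0 \<Longrightarrow> pt (c * x) (c * z) (c ^ w * y) = pt x z y"
proof -
  assume "c \<noteq> 0"
  hence "vec3 (c * x) (c * z) (c ^ w * y) \<in> orbit [1,1,w] (vec3 x z y)" by (auto simp: orbit_alt scal_vec3[symmetric])
  thus ?thesis unfolding pt_def by (rule orbit_eq)
qed

lemma pt_in:
  assumes "x \<noteq> 0 \<or> z \<noteq> 0" "y\<^sup>2 = hf (2 * w) p x z" shows "pt x z y \<in> pts Cv"
proof -
  have "vec3 x z y 0 \<noteq> 0 \<or> vec3 x z y 1 \<noteq> 0" using assms(1) by (simp add: vec3_def)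
  hence "\<exists>i. vec3 x z y i \<noteq> 0" by blast
  moreover have "\<forall>i\<ge>length [1,1,w]. vec3 x z y i = 0" by (auto simp: vec3_def)
  ultimately have "pt x z y \<in> wspace [1,1,w]" unfolding wspace_def pt_def by blast
  moreover have "(v 2)\<^sup>2 = hf (2 * w) p (v 0) (v 1)" if "v \<in> pt x z y" for v
  proof -
    have "\<exists>c. v = vec3 (c * x) (c * z) (c ^ w * y)" using that unfolding pt_alt by blast
    then obtain c where c: "v = vec3 (c * x) (c * z) (c ^ w * y)" ..
    moreover have "(c ^ w * y)\<^sup>2 = c ^ (2 * w) * y\<^sup>2"
      by (simp only: power_mult_distrib power_mult[symmetric] mult.commute[of w 2])
    ultimately show ?thesis unfolding c using assms(2) by (simp add: vec3_def hf_scale)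
  qed
  ultimately show ?thesis unfolding pts_Cv by blast
qed

lemma pt_coords:
  assumes "x \<noteq> 0 \<or> z \<noteq> 0" "y\<^sup>2 = hf (2 * w) p x z"
  obtains c where "c \<noteq> 0" "xc (pt x z y) = c * x" "zc (pt x z y) = c * z" "yc (pt x z y) = c ^ w * y"
proof -
  have "rep (pt x z y) \<in> pt x z y" using rep_in pt_in[OF assms] unfolding pts_Cv by blast
  then obtain c where "c \<noteq> 0" "rep (pt x z y) = vec3 (c * x) (c * z) (c ^ w * y)" by (auto simp: pt_alt)
  thus ?thesis using that[of c] by (simp add: xc_def zc_def yc_def vec3_def)
qed

text \<open>The projection to the projective line, whose points are \<open>None\<close> (infinity) and \<open>Some s\<close>.
  The point \<open>s\<close> has normalized coordinates \<open>nx s\<close>, \<open>nz s\<close>, it is the zero of the linear form with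
  dehomogenization \<open>lp s\<close>, and the linear form with dehomogenization \<open>lo s\<close> does not vanish at \<open>s\<close>.\<close>

definition bs :: "'a point \<Rightarrow> 'a option" where
  "bs P = (if zc P = 0 then None else Some (xc P / zc P))"

definition lp :: "'a option \<Rightarrow> 'a poly" where
  "lp s = (case s of None \<Rightarrow> 1 | Some a \<Rightarrow> [:- a, 1:])"

definition lo :: "'a option \<Rightarrow> 'a poly" where
  "lo s = (case s of None \<Rightarrow> [:0, 1:] | Some a \<Rightarrow> 1)"

definition nx :: "'a option \<Rightarrow> 'a" where "nx s = (case s of None \<Rightarrow> 1 | Some a \<Rightarrow> a)"
definition nz :: "'a option \<Rightarrow> 'a" where "nz s = (case s of None \<Rightarrow> 0 | Some a \<Rightarrow> 1)"

lemma deg_lp [simp]: "Polynomial.degree (lp s) \<le> 1" and deg_lo [simp]: "Polynomial.degree (lo s) \<le> 1"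
  and lp_nz [simp]: "lp s \<noteq> 0" and lo_nz [simp]: "lo s \<noteq> 0"
  by (auto simp: lp_def lo_def split: option.splits)

lemma n_nz: "nx s \<noteq> 0 \<or> nz s \<noteq> 0"
  by (auto simp: nx_def nz_def split: option.splits)

lemma hf1_one: "hf 1 1 x z = (z::'a)"
  by (simp add: hf_one)

lemma lp_zero: "P \<in> pts Cv \<Longrightarrow> hf 1 (lp s) (xc P) (zc P) = 0 \<longleftrightarrow> bs P = s"
  using coords_nz[of P] by (auto simp: lp_def bs_def hf1_one hf_linear field_simps split: option.splits)

lemma lo_nonzero: "P \<in> pts Cv \<Longrightarrow> bs P = s \<Longrightarrow> hf 1 (lo s) (xc P) (zc P) \<noteq> 0"
  using coords_nz[of P] by (auto simp: lo_def bs_def hf1_one hf_linear split: option.splits if_splits)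

lemma coords_n:
  assumes "P \<in> pts Cv" "bs P = s"
  obtains c where "c \<noteq> 0" "xc P = c * nx s" "zc P = c * nz s"
proof (cases "zc P = 0")
  case True thus ?thesis using that[of "xc P"] coords_nz[OF assms(1)] assms(2) by (auto simp: bs_def nx_def nz_def)
next
  case False thus ?thesis using that[of "zc P"] assms(2) by (auto simp: bs_def nx_def nz_def)
qed

lemma bs_pt:
  assumes "y\<^sup>2 = hf (2 * w) p (nx s) (nz s)" shows "bs (pt (nx s) (nz s) y) = s"
proof -
  obtain c where "c \<noteq> 0" "xc (pt (nx s) (nz s) y) = c * nx s" "zc (pt (nx s) (nz s) y) = c * nz s"
    using pt_coords[OF n_nz assms] by metis
  thus ?thesis by (auto simp: bs_def nx_def nz_def split: option.splits)
qed

lemma fibre: "{P \<in> pts Cv. bs P = s} = (\<lambda>y. pt (nx s) (nz s) y) ` {y. y\<^sup>2 = hf (2 * w) p (nx s) (nz s)}"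
proof (intro equalityI subsetI)
  fix P assume "P \<in> {P \<in> pts Cv. bs P = s}"
  hence P: "P \<in> pts Cv" "bs P = s" by auto
  obtain c where c: "c \<noteq> 0" "xc P = c * nx s" "zc P = c * nz s" using coords_n[OF P] .
  define y where "y = yc P / c ^ w"
  have yc: "yc P = c ^ w * y" using c by (simp add: y_def)
  have "c ^ (2 * w) * y\<^sup>2 = c ^ (2 * w) * hf (2 * w) p (nx s) (nz s)"
    using yc_sq[OF P(1)] unfolding yc c(2,3) hf_scale by (simp add: power_mult_distrib power_mult[symmetric] mult.commute)
  hence "y\<^sup>2 = hf (2 * w) p (nx s) (nz s)" using c by simp
  moreover have "P = pt (nx s) (nz s) y" using pt_eq[OF P(1)] unfolding c(2,3) yc pt_scale[OF c(1)] .
  ultimately show "P \<in> (\<lambda>y. pt (nx s) (nz s) y) ` {y. y\<^sup>2 = hf (2 * w) p (nx s) (nz s)}" by blast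
next
  fix P assume "P \<in> (\<lambda>y. pt (nx s) (nz s) y) ` {y. y\<^sup>2 = hf (2 * w) p (nx s) (nz s)}"
  thus "P \<in> {P \<in> pts Cv. bs P = s}" using pt_in[OF n_nz] bs_pt by auto
qed

lemma finite_sqrt: "finite {y::'a. y\<^sup>2 = c}"
proof -
  have "finite {y. poly [:- c, 0, 1:] y = 0}" by (rule poly_roots_finite) auto
  moreover have "poly [:- c, 0, 1:] y = 0 \<longleftrightarrow> y\<^sup>2 = c" for y
    by (auto simp: power2_eq_square algebra_simps)
  ultimately show ?thesis by simp
qed

lemma sqrt_exists: "\<exists>y::'a. y\<^sup>2 = c"
  using nth_root_exists[of 2 c] by auto

lemma finite_fibre: "finite {P \<in> pts Cv. bs P = s}"
  unfolding fibre using finite_sqrt by blast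

lemma fibre_nonempty: "\<exists>P\<in>pts Cv. bs P = s"
  using fibre[of s] sqrt_exists[of "hf (2 * w) p (nx s) (nz s)"] by blast

lemma finite_over: "finite S \<Longrightarrow> finite {P \<in> pts Cv. bs P \<in> S}"
proof -
  assume "finite S"
  hence "finite (\<Union>s\<in>S. {P \<in> pts Cv. bs P = s})" using finite_fibre by blast
  moreover have "(\<Union>s\<in>S. {P \<in> pts Cv. bs P = s}) = {P \<in> pts Cv. bs P \<in> S}" by auto
  ultimately show ?thesis by simp
qed

lemma infinite_pts: "infinite (pts Cv)"
proof
  assume "finite (pts Cv)"
  hence "finite (bs ` pts Cv)" by simp
  moreover have "range Some \<subseteq> bs ` pts Cv"
  proof
    fix s assume "s \<in> range (Some :: 'a \<Rightarrow> _)"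
    obtain P where "P \<in> pts Cv" "bs P = s" using fibre_nonempty[of s] by blast
    thus "s \<in> bs ` pts Cv" by blast
  qed
  ultimately have "finite (range (Some :: 'a \<Rightarrow> _))" by (rule finite_subset[rotated])
  thus False using infinite_alg_closed finite_imageD[of Some UNIV] by auto
qed

text \<open>Nonempty open sets of the curve are cofinite, so that equality of rational functions means equality at all but
  finitely many points.\<close>

definition ae :: "('a point \<Rightarrow> bool) \<Rightarrow> bool" where
  "ae Q \<longleftrightarrow> finite {P \<in> pts Cv. \<not> Q P}"

lemma ae_conj: "ae Q \<Longrightarrow> ae R \<Longrightarrow> ae (\<lambda>P. Q P \<and> R P)"
proof -
  assume "ae Q" "ae R"
  hence "finite ({P \<in> pts Cv. \<not> Q P} \<union> {P \<in> pts Cv. \<not> R P})" by (simp add: ae_def)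
  moreover have "{P \<in> pts Cv. \<not> (Q P \<and> R P)} = {P \<in> pts Cv. \<not> Q P} \<union> {P \<in> pts Cv. \<not> R P}" by auto
  ultimately show ?thesis by (simp add: ae_def)
qed

lemma ae_mono: "ae Q \<Longrightarrow> (\<And>P. P \<in> pts Cv \<Longrightarrow> Q P \<Longrightarrow> R P) \<Longrightarrow> ae R"
  unfolding ae_def by (erule finite_subset[rotated]) auto

lemma ae_mono2: "ae Q \<Longrightarrow> ae Q' \<Longrightarrow> (\<And>P. P \<in> pts Cv \<Longrightarrow> Q P \<Longrightarrow> Q' P \<Longrightarrow> R P) \<Longrightarrow> ae R"
  using ae_mono[OF ae_conj[of Q Q'], of R] by blast

lemma ae_mono3: "ae Q \<Longrightarrow> ae Q' \<Longrightarrow> ae Q'' \<Longrightarrow> (\<And>P. P \<in> pts Cv \<Longrightarrow> Q P \<Longrightarrow> Q' P \<Longrightarrow> Q'' P \<Longrightarrow> R P) \<Longrightarrow> ae R"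
  using ae_mono2[OF ae_conj[of Q Q'], of Q'' R] by blast

lemma ae_all: "(\<And>P. P \<in> pts Cv \<Longrightarrow> Q P) \<Longrightarrow> ae Q"
proof -
  assume "\<And>P. P \<in> pts Cv \<Longrightarrow> Q P"
  hence e: "{P \<in> pts Cv. \<not> Q P} = {}" by auto
  show ?thesis unfolding ae_def e by simp
qed

lemma ae_ex: "ae Q \<Longrightarrow> \<exists>P\<in>pts Cv. Q P"
proof (rule ccontr)
  assume "ae Q" "\<not> (\<exists>P\<in>pts Cv. Q P)"
  hence "finite {P \<in> pts Cv. \<not> Q P}" "{P \<in> pts Cv. \<not> Q P} = pts Cv" by (auto simp: ae_def)
  thus False using infinite_pts by metis
qed

lemma degree_add_bound:
  fixes u v :: "'a poly"
  assumes "u = 0 \<or> Polynomial.degree u + w \<le> d" "v = 0 \<or> Polynomial.degree v + w \<le> d"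
  shows "u + v = 0 \<or> Polynomial.degree (u + v) + w \<le> d"
proof (cases "u = 0 \<or> v = 0")
  case False
  hence "max (Polynomial.degree u) (Polynomial.degree v) + w \<le> d" using assms by auto
  thus ?thesis using degree_add_le_max[of u v] by linarith
qed (use assms in auto)

text \<open>On the curve, every form of degree \<open>d\<close> is of the shape \<open>A + B y\<close> with binary forms \<open>A\<close> and \<open>B\<close> of degrees \<open>d\<close> and
  \<open>d - w\<close>. For \<open>d < w\<close>, where the subtraction truncates, the condition on the dehomogenizations forces \<open>B = 0\<close>.\<close>

definition okp :: "nat \<Rightarrow> 'a poly \<Rightarrow> 'a poly \<Rightarrow> bool" where
  "okp d a b \<longleftrightarrow> Polynomial.degree a \<le> d \<and> (b = 0 \<or> Polynomial.degree b + w \<le> d)"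

definition el :: "nat \<Rightarrow> 'a poly \<Rightarrow> 'a poly \<Rightarrow> 'a mpoly" where
  "el d a b = hform d a + y_var * hform (d - w) b"

lemma val_el: "val (el d a b) P = hf d a (xc P) (zc P) + yc P * hf (d - w) b (xc P) (zc P)"
  by (simp add: el_def)

lemma hform_0 [simp]: "hform d 0 = 0"
  by (simp add: hform_def mp_const_def)

lemma hom_el: "okp d a b \<Longrightarrow> hom d (el d a b)"
proof (cases "b = 0")
  case False
  assume "okp d a b"
  hence "d = w + (d - w)" using False by (auto simp: okp_def)
  from homogeneous_mult'[OF hom_var(3) hom_hform this] show ?thesis
    unfolding el_def by (intro homogeneous_add hom_hform)
qed (simp add: el_def)

lemma el_mult:
  assumes ok: "okp d a b" "okp e a' b'" and P: "P \<in> pts Cv"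
  shows "val (el d a b) P * val (el e a' b') P = val (el (d + e) (a * a' + b * b' * p) (a * b' + a' * b)) P"
    and "okp (d + e) (a * a' + b * b' * p) (a * b' + a' * b)"
proof -
  let ?x = "xc P" and ?z = "zc P" and ?y = "yc P"
  have 1: "hf (d + e) (a * a') ?x ?z = hf d a ?x ?z * hf e a' ?x ?z"
    by (rule hf_mult) (use ok in \<open>auto simp: okp_def\<close>)
  have 2: "hf (d + e) (b * b' * p) ?x ?z = ?y\<^sup>2 * hf (d - w) b ?x ?z * hf (e - w) b' ?x ?z"
  proof (cases "b = 0 \<or> b' = 0")
    case False
    hence d: "Polynomial.degree b \<le> d - w" "Polynomial.degree b' \<le> e - w" "d + e = (d - w) + (e - w) + 2 * w"
      using ok by (auto simp: okp_def)
    have "Polynomial.degree (b * b') \<le> (d - w) + (e - w)" using degree_mult_le[of b b'] d by linarith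
    from hf_mult[OF this deg_le] hf_mult[OF d(1,2)] show ?thesis unfolding d(3) yc_sq[OF P] by (simp add: ac_simps)
  qed auto
  have 3: "hf (d + e - w) (a * b') ?x ?z = hf d a ?x ?z * hf (e - w) b' ?x ?z"
    if ok: "okp d a b" "okp e a' b'" for d e a b a' b'
  proof (cases "b' = 0")
    case False
    hence d: "Polynomial.degree b' \<le> e - w" "d + e - w = d + (e - w)" "Polynomial.degree a \<le> d" using ok by (auto simp: okp_def)
    show ?thesis unfolding d(2) by (rule hf_mult[OF d(3,1)])
  qed auto
  show "val (el d a b) P * val (el e a' b') P = val (el (d + e) (a * a' + b * b' * p) (a * b' + a' * b)) P"
    unfolding val_el hf_add 1 2 3[OF ok] 3[OF ok(2,1), unfolded add.commute[of e d]]
    by (simp add: algebra_simps power2_eq_square)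
  have "Polynomial.degree (a * a') \<le> d + e" using ok degree_mult_le[of a a'] by (auto simp: okp_def)
  moreover have "Polynomial.degree (b * b' * p) \<le> d + e"
  proof (cases "b = 0 \<or> b' = 0")
    case False
    thus ?thesis using ok degree_mult_le[of b b'] degree_mult_le[of "b * b'" p] deg_le by (auto simp: okp_def)
  qed auto
  ultimately have A: "Polynomial.degree (a * a' + b * b' * p) \<le> d + e" by (rule degree_add_le)
  have "b' = 0 \<or> (Polynomial.degree (a * b') + w \<le> d + e)" "b = 0 \<or> (Polynomial.degree (a' * b) + w \<le> d + e)"
    using ok degree_mult_le[of a b'] degree_mult_le[of a' b] by (auto simp: okp_def)
  hence "a * b' + a' * b = 0 \<or> Polynomial.degree (a * b' + a' * b) + w \<le> d + e"
    by (intro degree_add_bound) auto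
  thus "okp (d + e) (a * a' + b * b' * p) (a * b' + a' * b)" using A by (simp add: okp_def)
qed

definition good :: "nat \<Rightarrow> 'a mpoly \<Rightarrow> bool" where
  "good d H \<longleftrightarrow> (\<exists>a b. okp d a b \<and> (\<forall>P\<in>pts Cv. val H P = val (el d a b) P))"

lemma goodI: "okp d a b \<Longrightarrow> (\<And>P. P \<in> pts Cv \<Longrightarrow> val H P = val (el d a b) P) \<Longrightarrow> good d H"
  unfolding good_def by blast

lemma good_mult: "good d H \<Longrightarrow> good e G \<Longrightarrow> good (d + e) (H * G)"
proof -
  assume "good d H" "good e G"
  then obtain a b a' b' where 1: "okp d a b" "\<forall>P\<in>pts Cv. val H P = val (el d a b) P"
    "okp e a' b'" "\<forall>P\<in>pts Cv. val G P = val (el e a' b') P" unfolding good_def by blast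
  obtain P where P: "P \<in> pts Cv" using fibre_nonempty by blast
  show ?thesis by (rule goodI[OF el_mult(2)[OF 1(1,3) P]]) (use 1 el_mult(1)[OF 1(1,3)] in simp)
qed

lemma good_add: assumes "good d H" "good d G" shows "good d (H + G)"
proof -
  obtain a b a' b' where 1: "okp d a b" "\<forall>P\<in>pts Cv. val H P = val (el d a b) P"
    "okp d a' b'" "\<forall>P\<in>pts Cv. val G P = val (el d a' b') P" using assms unfolding good_def by blast
  have "b + b' = 0 \<or> Polynomial.degree (b + b') + w \<le> d"
    using 1(1,3) by (intro degree_add_bound) (auto simp: okp_def)
  hence "okp d (a + a') (b + b')" using 1(1,3) by (auto simp: okp_def intro: degree_add_le)
  thus ?thesis by (rule goodI) (use 1 in \<open>simp add: val_el hf_add algebra_simps\<close>)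
qed

lemma good_0: "good d 0"
  by (rule goodI[of _ 0 0]) (auto simp: okp_def val_el)

lemma good_basic: "good 0 (mp_const c)" "good 1 x_var" "good 1 z_var" "good w y_var"
proof -
  show "good 0 (mp_const c)" by (rule goodI[of _ "[:c:]" 0]) (auto simp: okp_def val_el hf_def)
  show "good 1 x_var" by (rule goodI[of _ "[:0,1:]" 0]) (auto simp: okp_def val_el hf_linear)
  show "good 1 z_var" by (rule goodI[of _ 1 0]) (auto simp: okp_def val_el hf1_one)
  show "good w y_var" by (rule goodI[of _ 0 1]) (auto simp: okp_def val_el hf_one)
qed

lemma good_power: "good d H \<Longrightarrow> good (d * n) (H ^ n)"
proof (induction n)
  case 0 thus ?case using good_basic(1)[of 1] by (simp add: mp_const_def)
next
  case (Suc n) thus ?case using good_mult[of d H "d * n" "H ^ n"] by simp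
qed

lemma good_sum: "(\<And>k. k \<in> A \<Longrightarrow> good d (g k)) \<Longrightarrow> good d (sum g A)"
  by (induction A rule: infinite_finite_induct) (auto simp: good_0 good_add)

lemma hom_good:
  assumes "hom d H" shows "good d H"
proof -
  have "good d (Poly_Mapping.single k (Poly_Mapping.lookup H k))" if k: "k \<in> Poly_Mapping.keys H" for k
  proof -
    let ?l = "Poly_Mapping.lookup k" and ?c = "Poly_Mapping.lookup H k"
    have sub: "Poly_Mapping.keys k \<subseteq> {0, 1, 2}"
    proof
      fix i assume "i \<in> Poly_Mapping.keys k"
      hence "i < length [1, 1, w]" using assms k by (auto simp: homogeneous_alt)
      thus "i \<in> {0, 1, 2}" unfolding less3 by blast
    qed
    have "wdeg [1,1,w] k = d" using assms k by (auto simp: homogeneous_alt)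
    moreover have "wdeg [1,1,w] k = ?l 0 + ?l 1 + w * ?l 2" by (subst wdeg_superset[OF _ sub]) auto
    ultimately have d: "?l 0 + ?l 1 + w * ?l 2 = d" by simp
    have "good (0 + 1 * ?l 0 + 1 * ?l 1 + w * ?l 2) (mp_const ?c * x_var ^ ?l 0 * z_var ^ ?l 1 * y_var ^ ?l 2)"
      by (intro good_mult good_power good_basic)
    hence g: "good d (mp_const ?c * x_var ^ ?l 0 * z_var ^ ?l 1 * y_var ^ ?l 2)" using d by simp
    have "val (Poly_Mapping.single k ?c) P = val (mp_const ?c * x_var ^ ?l 0 * z_var ^ ?l 1 * y_var ^ ?l 2) P" for P
      unfolding val_def[of "Poly_Mapping.single _ _"] mp_eval_single[of id, simplified] mon_eval_superset[OF _ sub, simplified]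
      by (simp add: xc_def yc_def zc_def)
    thus ?thesis using g unfolding good_def by simp
  qed
  hence "good d (\<Sum>k\<in>Poly_Mapping.keys H. Poly_Mapping.single k (Poly_Mapping.lookup H k))" by (rule good_sum)
  thus ?thesis by (simp only: poly_mapping_expand[symmetric])
qed

lemma hom_el_ex:
  assumes "hom d H" obtains a b where "okp d a b" "\<And>P. P \<in> pts Cv \<Longrightarrow> val H P = val (el d a b) P"
  using hom_good[OF assms] unfolding good_def by blast

lemma hf_zeros_finite:
  assumes "q \<noteq> 0" "Polynomial.degree q \<le> d" shows "finite {P \<in> pts Cv. hf d q (xc P) (zc P) = 0}"
proof -
  let ?S = "insert None (Some ` {x. poly q x = 0})"
  have "{P \<in> pts Cv. hf d q (xc P) (zc P) = 0} \<subseteq> {P \<in> pts Cv. bs P \<in> ?S}"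
    using assms(2) by (auto simp: bs_def hf_z)
  moreover have "finite ?S" using poly_roots_finite[OF assms(1)] by simp
  ultimately show ?thesis using finite_over finite_subset by blast
qed

lemma root_p: "\<exists>r. poly p r = 0"
  using deg_ge w by (intro alg_closed_imp_poly_has_root) linarith

lemma order_p: assumes "poly p r = 0" shows "Polynomial.order r p = 1"
proof -
  have "Polynomial.order r p \<noteq> 0" using assms p0 order_root by blast
  moreover have "\<not> 2 \<le> Polynomial.order r p" using sqf[of r] order_divides[of r 2 p] p0 by blast
  ultimately show ?thesis by linarith
qed

text \<open>The norm of \<open>a + b y\<close> is nonzero because the order of \<open>a\<^sup>2\<close> at a zero of \<open>p\<close> is even and that of \<open>b\<^sup>2 p\<close> is odd.\<close>

lemma norm_nonzero:
  assumes "a \<noteq> 0 \<or> b \<noteq> 0" shows "a\<^sup>2 - b\<^sup>2 * p \<noteq> 0"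
proof
  assume eq: "a\<^sup>2 - b\<^sup>2 * p = 0"
  hence eq': "a\<^sup>2 = b\<^sup>2 * p" by simp
  have b: "b \<noteq> 0" using assms eq by auto
  hence a: "a \<noteq> 0" using eq' p0 by auto
  obtain r where r: "poly p r = 0" using root_p by blast
  have "Polynomial.order r (a\<^sup>2) = Polynomial.order r (b\<^sup>2 * p)" using eq' by simp
  hence "2 * Polynomial.order r a = 2 * Polynomial.order r b + 1"
    using a b p0 by (simp add: power2_eq_square order_mult order_p[OF r])
  thus False by presburger
qed

lemma okp_uminus: "okp d a b \<Longrightarrow> okp d a (- b)"
  by (auto simp: okp_def)

lemma el_norm:
  assumes "okp d a b" "P \<in> pts Cv"
  shows "val (el d a b) P * val (el d a (- b)) P = hf (2 * d) (a\<^sup>2 - b\<^sup>2 * p) (xc P) (zc P)"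
    and "Polynomial.degree (a\<^sup>2 - b\<^sup>2 * p) \<le> 2 * d"
proof -
  have e: "a * a + b * - b * p = a\<^sup>2 - b\<^sup>2 * p" "a * - b + a * b = 0" by (simp_all add: power2_eq_square)
  show "val (el d a b) P * val (el d a (- b)) P = hf (2 * d) (a\<^sup>2 - b\<^sup>2 * p) (xc P) (zc P)"
    using el_mult(1)[OF assms(1) okp_uminus[OF assms(1)] assms(2)] unfolding e by (simp add: val_el mult_2)
  show "Polynomial.degree (a\<^sup>2 - b\<^sup>2 * p) \<le> 2 * d"
    using el_mult(2)[OF assms(1) okp_uminus[OF assms(1)] assms(2)] unfolding e by (simp add: okp_def mult_2)
qed

lemma el_zeros_finite:
  assumes "okp d a b" "a \<noteq> 0 \<or> b \<noteq> 0" shows "finite {P \<in> pts Cv. val (el d a b) P = 0}"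
proof -
  obtain P where P: "P \<in> pts Cv" using ae_ex[of "\<lambda>_. True"] ae_all by blast
  have "{P \<in> pts Cv. val (el d a b) P = 0} \<subseteq> {P \<in> pts Cv. hf (2 * d) (a\<^sup>2 - b\<^sup>2 * p) (xc P) (zc P) = 0}"
    using el_norm(1)[OF assms(1)] by fastforce
  thus ?thesis using hf_zeros_finite[OF norm_nonzero[OF assms(2)] el_norm(2)[OF assms(1) P]] finite_subset by blast
qed

lemma hom_zeros:
  assumes "hom d H" "P \<in> pts Cv" "val H P \<noteq> 0" shows "ae (\<lambda>Q. val H Q \<noteq> 0)"
proof -
  obtain a b where ab: "okp d a b" "\<And>P. P \<in> pts Cv \<Longrightarrow> val H P = val (el d a b) P" by (rule hom_el_ex[OF assms(1)]) (rule that)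
  have "a \<noteq> 0 \<or> b \<noteq> 0" using assms(2,3) ab(2) by (auto simp: val_el)
  from el_zeros_finite[OF ab(1) this]
  show ?thesis unfolding ae_def by (rule finite_subset[rotated]) (use ab(2) in auto)
qed

lemma hom_ae_zero:
  assumes "hom d H" "ae (\<lambda>Q. val H Q = 0)" "P \<in> pts Cv" shows "val H P = 0"
proof (rule ccontr)
  assume "val H P \<noteq> 0"
  from ae_ex[OF ae_conj[OF hom_zeros[OF assms(1,3) this] assms(2)]] show False by auto
qed

lemma el_ae_zero:
  assumes "okp d a b" "ae (\<lambda>Q. val (el d a b) Q = 0)" shows "a = 0 \<and> b = 0"
proof (rule ccontr)
  assume "\<not> (a = 0 \<and> b = 0)"
  hence "ae (\<lambda>Q. val (el d a b) Q \<noteq> 0)" using el_zeros_finite[OF assms(1)] by (auto simp: ae_def)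
  from ae_ex[OF ae_conj[OF this assms(2)]] show False by auto
qed

lemma hform_nz: "q \<noteq> 0 \<Longrightarrow> Polynomial.degree q \<le> d \<Longrightarrow> ae (\<lambda>Q. hf d q (xc Q) (zc Q) \<noteq> 0)"
  using hf_zeros_finite by (simp add: ae_def)

lemma vanishes_Cv: "P \<in> pts Cv \<Longrightarrow> hom d H \<Longrightarrow> vanishes H P \<longleftrightarrow> val H P = 0"
  using vanishes_val[of P "[1,1,w]"] by (simp add: pts_Cv)

text \<open>The complement lies in the zero set of a form \<open>A + B y\<close>, hence in that of its norm, a nonzero binary form.\<close>

lemma zopen_ae: assumes "zopen Cv U" "U \<noteq> {}" shows "ae (\<lambda>P. P \<in> U)"
proof -
  obtain E where E: "\<And>H. H \<in> E \<Longrightarrow> \<exists>d. hom d H" "pts Cv - U = {P \<in> pts Cv. \<forall>H\<in>E. vanishes H P}" and U: "U \<subseteq> pts Cv"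
    using assms(1) unfolding zopen_def zclosed_def by auto
  obtain P where P: "P \<in> U" using assms(2) by blast
  then obtain H where H: "H \<in> E" "\<not> vanishes H P" using E(2) U by blast
  then obtain d where d: "hom d H" using E(1) by blast
  have "ae (\<lambda>Q. val H Q \<noteq> 0)" using hom_zeros[OF d] vanishes_Cv[OF _ d] P U H by blast
  thus ?thesis
  proof (rule ae_mono)
    fix Q assume "Q \<in> pts Cv" "val H Q \<noteq> 0"
    thus "Q \<in> U" using E(2) H vanishes_Cv[OF _ d] by blast
  qed
qed

lemma zopen_nonvan: assumes "hom d H" shows "zopen Cv {P \<in> pts Cv. val H P \<noteq> 0}"
proof -
  have "zclosed Cv (pts Cv - {P \<in> pts Cv. val H P \<noteq> 0})" unfolding zclosed_def
    using assms vanishes_Cv[OF _ assms] by (intro exI[of _ "{H}"]) auto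
  thus ?thesis unfolding zopen_def by auto
qed

lemma geneq_ae: "geneq Cv h k \<longleftrightarrow> ae (\<lambda>P. h P = k P)"
proof
  assume "geneq Cv h k"
  then obtain U where U: "zopen Cv U" "U \<noteq> {}" "\<forall>P\<in>U. h P = k P" unfolding geneq_def by blast
  show "ae (\<lambda>P. h P = k P)" by (rule ae_mono[OF zopen_ae[OF U(1,2)]]) (use U(3) in blast)
next
  assume ae: "ae (\<lambda>P. h P = k P)"
  define T where "T = bs ` {P \<in> pts Cv. h P \<noteq> k P}"
  define H where "H = (\<Prod>s\<in>T. hform 1 (lp s))"
  have fin: "finite T" using ae unfolding T_def ae_def by simp
  have hom: "hom (\<Sum>s\<in>T. 1) H" unfolding H_def by (rule homogeneous_prod) simp
  have Hv: "val H P = 0 \<longleftrightarrow> bs P \<in> T" if "P \<in> pts Cv" for P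
    using fin lp_zero[OF that] by (auto simp: H_def)
  have "infinite (range (Some :: 'a \<Rightarrow> _))" using infinite_alg_closed finite_imageD[of Some UNIV] by auto
  then obtain s where "s \<notin> T" using fin by (meson finite_subset subsetI)
  then obtain P where P: "P \<in> pts Cv" "val H P \<noteq> 0" using fibre_nonempty[of s] Hv by blast
  show "geneq Cv h k" unfolding geneq_def
  proof (intro exI conjI)
    show "zopen Cv {P \<in> pts Cv. val H P \<noteq> 0}" by (rule zopen_nonvan[OF hom])
    show "{P \<in> pts Cv. val H P \<noteq> 0} \<noteq> {}" using P by blast
    show "\<forall>P\<in>{P \<in> pts Cv. val H P \<noteq> 0}. h P = k P" using Hv by (auto simp: T_def)
  qed
qed

text \<open>\<open>vl P h c\<close>: the rational function \<open>h\<close> is regular at \<open>P\<close> with value \<open>c\<close>.\<close>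

definition vl :: "'a point \<Rightarrow> ('a point \<Rightarrow> 'a) \<Rightarrow> 'a \<Rightarrow> bool" where
  "vl P h c \<longleftrightarrow> P \<in> pts Cv \<and> (\<exists>d H G. hom d H \<and> hom d G \<and> val G P \<noteq> 0 \<and> val H P = c * val G P \<and>
     ae (\<lambda>Q. h Q = val H Q / val G Q))"

lemma vlI:
  assumes "P \<in> pts Cv" "hom d H" "hom d G" "val G P \<noteq> 0" "ae (\<lambda>Q. h Q = val H Q / val G Q)"
  shows "vl P h (val H P / val G P)"
  unfolding vl_def using assms by (intro conjI exI[of _ d] exI[of _ H] exI[of _ G]) auto

lemma regular_frac:
  assumes "hom d H" "hom d G" shows "regular_on Cv {P \<in> pts Cv. val G P \<noteq> 0} (ratio H G)"
  unfolding regular_on_def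
proof
  fix P assume "P \<in> {P \<in> pts Cv. val G P \<noteq> 0}"
  thus "\<exists>V F G' d. zopen Cv V \<and> P \<in> V \<and> V \<subseteq> {P \<in> pts Cv. val G P \<noteq> 0} \<and> homogeneous (fst Cv) d F \<and> homogeneous (fst Cv) d G' \<and>
      (\<forall>Q\<in>V. \<not> vanishes G' Q \<and> ratio H G Q = ratio F G' Q)"
    using assms zopen_nonvan[OF assms(2)] vanishes_Cv[OF _ assms(2)]
    by (intro exI[of _ "{P \<in> pts Cv. val G P \<noteq> 0}"] exI[of _ H] exI[of _ G] exI[of _ d]) auto
qed

lemma regular_at:
  assumes "P \<in> U" "regular_on Cv U k" "geneq Cv h k"
  shows "vl P h (k P)"
proof -
  obtain V H G d where V: "zopen Cv V" "P \<in> V" "V \<subseteq> U" "hom d H" "hom d G"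
     "\<forall>Q\<in>V. \<not> vanishes G Q \<and> k Q = ratio H G Q"
    using assms(1,2) unfolding regular_on_def by auto
  have P: "P \<in> pts Cv" using V zopen_pts by blast
  have "ae (\<lambda>Q. Q \<in> V)" using zopen_ae V by blast
  from ae_mono2[OF this assms(3)[unfolded geneq_ae]]
  have "ae (\<lambda>Q. h Q = val H Q / val G Q)" using V(6) by (simp add: ratio_val)
  moreover have "val G P \<noteq> 0" "k P = val H P / val G P" using V vanishes_Cv[OF P V(5)] by (auto simp: ratio_val)
  ultimately show ?thesis using vlI[OF P V(4,5)] by simp
qed

lemma vl_regular:
  assumes "vl P h c"
  obtains U k where "zopen Cv U" "P \<in> U" "regular_on Cv U k" "geneq Cv h k" "k P = c"
proof -
  obtain d H G where *: "P \<in> pts Cv" "hom d H" "hom d G" "val G P \<noteq> 0" "val H P = c * val G P"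
     "ae (\<lambda>Q. h Q = val H Q / val G Q)" using assms unfolding vl_def by blast
  show ?thesis
    using * zopen_nonvan[OF *(3)] regular_frac[OF *(2,3)]
    by (intro that[of "{P \<in> pts Cv. val G P \<noteq> 0}" "ratio H G"]) (auto simp: geneq_ae ratio_val)
qed

lemma local_ring_vl: "P \<in> pts Cv \<Longrightarrow> h \<in> local_ring Cv P \<longleftrightarrow> (\<exists>c. vl P h c)"
proof
  assume "h \<in> local_ring Cv P"
  then obtain U k where "zopen Cv U" "P \<in> U" "regular_on Cv U k" "geneq Cv h k" unfolding local_ring_def by blast
  thus "\<exists>c. vl P h c" using regular_at by blast
next
  assume "\<exists>c. vl P h c"
  then obtain c where "vl P h c" by blast
  then obtain U k where "zopen Cv U" "P \<in> U" "regular_on Cv U k" "geneq Cv h k" using vl_regular by metis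
  thus "h \<in> local_ring Cv P" unfolding local_ring_def by blast
qed

lemma local_max_ideal_vl: "P \<in> pts Cv \<Longrightarrow> h \<in> local_max_ideal Cv P \<longleftrightarrow> vl P h 0"
proof
  assume "h \<in> local_max_ideal Cv P"
  then obtain U k where "zopen Cv U" "P \<in> U" "regular_on Cv U k" "geneq Cv h k" "k P = 0" unfolding local_max_ideal_def by blast
  thus "vl P h 0" using regular_at[of P U k h] by simp
next
  assume "vl P h 0"
  then obtain U k where "zopen Cv U" "P \<in> U" "regular_on Cv U k" "geneq Cv h k" "k P = 0" using vl_regular by metis
  thus "h \<in> local_max_ideal Cv P" unfolding local_max_ideal_def by blast
qed

lemma rational_frac:
  "rational Cv h \<longleftrightarrow> (\<exists>d H G. hom d H \<and> hom d G \<and> ae (\<lambda>Q. val G Q \<noteq> 0 \<and> h Q = val H Q / val G Q))"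
proof
  assume "rational Cv h"
  then obtain U P where "zopen Cv U" "P \<in> U" "regular_on Cv U h" unfolding rational_def by blast
  hence "vl P h (h P)" using regular_at[of P U h h] by (simp add: geneq_ae ae_all)
  then obtain d H G where *: "P \<in> pts Cv" "hom d H" "hom d G" "val G P \<noteq> 0" 
     "ae (\<lambda>Q. h Q = val H Q / val G Q)" unfolding vl_def by blast
  thus "\<exists>d H G. hom d H \<and> hom d G \<and> ae (\<lambda>Q. val G Q \<noteq> 0 \<and> h Q = val H Q / val G Q)"
    using ae_conj[OF hom_zeros[OF *(3,1,4)] *(5)] by blast
next
  assume "\<exists>d H G. hom d H \<and> hom d G \<and> ae (\<lambda>Q. val G Q \<noteq> 0 \<and> h Q = val H Q / val G Q)"
  then obtain d H G where *: "hom d H" "hom d G" "ae (\<lambda>Q. val G Q \<noteq> 0 \<and> h Q = val H Q / val G Q)" by blast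
  define T where "T = bs ` {P \<in> pts Cv. \<not> (val G P \<noteq> 0 \<and> h P = val H P / val G P)}"
  define L where "L = (\<Prod>s\<in>T. hform 1 (lp s))"
  have fin: "finite T" using *(3) unfolding T_def ae_def by simp
  have hom: "hom (\<Sum>s\<in>T. 1) L" unfolding L_def by (rule homogeneous_prod) simp
  have Lv: "val L P = 0 \<longleftrightarrow> bs P \<in> T" if "P \<in> pts Cv" for P
    using fin lp_zero[OF that] by (auto simp: L_def)
  let ?U = "{P \<in> pts Cv. val L P \<noteq> 0}"
  have U: "val G Q \<noteq> 0 \<and> h Q = val H Q / val G Q" if "Q \<in> ?U" for Q using that Lv by (auto simp: T_def)
  have "infinite (range (Some :: 'a \<Rightarrow> _))" using infinite_alg_closed finite_imageD[of Some UNIV] by auto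
  then obtain s where "s \<notin> T" using fin by (meson finite_subset subsetI)
  then obtain P where P: "P \<in> ?U" using fibre_nonempty[of s] Lv by blast
  have "regular_on Cv ?U h" unfolding regular_on_def
  proof
    fix P assume "P \<in> ?U"
    thus "\<exists>V F G d. zopen Cv V \<and> P \<in> V \<and> V \<subseteq> ?U \<and> homogeneous (fst Cv) d F \<and> homogeneous (fst Cv) d G \<and>
      (\<forall>Q\<in>V. \<not> vanishes G Q \<and> h Q = ratio F G Q)"
      using *(1,2) zopen_nonvan[OF hom] U vanishes_Cv[OF _ *(2)]
      by (intro exI[of _ ?U] exI[of _ H] exI[of _ G] exI[of _ d]) (auto simp: ratio_val)
  qed
  thus "rational Cv h" unfolding rational_def using zopen_nonvan[OF hom] P by blast
qed

lemma vl_pts: "vl P h c \<Longrightarrow> P \<in> pts Cv"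
  by (simp add: vl_def)

lemma vl_cong: "vl P h c \<Longrightarrow> ae (\<lambda>Q. k Q = h Q) \<Longrightarrow> vl P k c"
  unfolding vl_def using ae_mono2[of "\<lambda>Q. k Q = h Q"] by (smt (verit, best))

lemma vl_const: "P \<in> pts Cv \<Longrightarrow> vl P (\<lambda>_. c) c"
  unfolding vl_def by (intro conjI exI[of _ 0] exI[of _ "mp_const c"] exI[of _ 1]) (auto intro: ae_all)

lemma vl_nz:
  assumes "vl P h c"
  obtains d H G where "hom d H" "hom d G" "val G P \<noteq> 0" "val H P = c * val G P"
     "ae (\<lambda>Q. val G Q \<noteq> 0 \<and> h Q = val H Q / val G Q)"
proof -
  obtain d H G where *: "P \<in> pts Cv" "hom d H" "hom d G" "val G P \<noteq> 0" "val H P = c * val G P"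
     "ae (\<lambda>Q. h Q = val H Q / val G Q)" using assms unfolding vl_def by blast
  thus ?thesis using that[of d H G] ae_conj[OF hom_zeros[OF *(3,1,4)] *(6)] by blast
qed

lemma vl_add: assumes "vl P h c" "vl P k e" shows "vl P (\<lambda>Q. h Q + k Q) (c + e)"
proof -
  obtain d H G where 1: "hom d H" "hom d G" "val G P \<noteq> 0" "val H P = c * val G P"
     "ae (\<lambda>Q. val G Q \<noteq> 0 \<and> h Q = val H Q / val G Q)" using vl_nz[OF assms(1)] .
  obtain d' H' G' where 2: "hom d' H'" "hom d' G'" "val G' P \<noteq> 0" "val H' P = e * val G' P"
     "ae (\<lambda>Q. val G' Q \<noteq> 0 \<and> k Q = val H' Q / val G' Q)" using vl_nz[OF assms(2)] .
  have "hom (d + d') (H * G' + G * H')" by (intro homogeneous_add homogeneous_mult 1 2)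
  moreover have "hom (d + d') (G * G')" by (intro homogeneous_mult 1 2)
  moreover have "ae (\<lambda>Q. h Q + k Q = val (H * G' + G * H') Q / val (G * G') Q)"
    by (rule ae_mono2[OF 1(5) 2(5)]) (simp add: field_simps)
  ultimately show ?thesis unfolding vl_def using 1(3,4) 2(3,4) vl_pts[OF assms(1)]
    by (intro conjI exI[of _ "d + d'"] exI[of _ "H * G' + G * H'"] exI[of _ "G * G'"]) (auto simp: algebra_simps)
qed

lemma vl_mult: assumes "vl P h c" "vl P k e" shows "vl P (\<lambda>Q. h Q * k Q) (c * e)"
proof -
  obtain d H G where 1: "hom d H" "hom d G" "val G P \<noteq> 0" "val H P = c * val G P"
     "ae (\<lambda>Q. val G Q \<noteq> 0 \<and> h Q = val H Q / val G Q)" using vl_nz[OF assms(1)] .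
  obtain d' H' G' where 2: "hom d' H'" "hom d' G'" "val G' P \<noteq> 0" "val H' P = e * val G' P"
     "ae (\<lambda>Q. val G' Q \<noteq> 0 \<and> k Q = val H' Q / val G' Q)" using vl_nz[OF assms(2)] .
  have "hom (d + d') (H * H')" by (intro homogeneous_mult 1 2)
  moreover have "hom (d + d') (G * G')" by (intro homogeneous_mult 1 2)
  moreover have "ae (\<lambda>Q. h Q * k Q = val (H * H') Q / val (G * G') Q)"
    by (rule ae_mono2[OF 1(5) 2(5)]) simp
  ultimately show ?thesis unfolding vl_def using 1(3,4) 2(3,4) vl_pts[OF assms(1)]
    by (intro conjI exI[of _ "d + d'"] exI[of _ "H * H'"] exI[of _ "G * G'"]) auto
qed

lemma vl_inverse: assumes "vl P h c" "c \<noteq> 0"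
  shows "vl P (\<lambda>Q. inverse (h Q)) (inverse c)" and "ae (\<lambda>Q. h Q \<noteq> 0)"
proof -
  obtain d H G where 1: "hom d H" "hom d G" "val G P \<noteq> 0" "val H P = c * val G P"
     "ae (\<lambda>Q. val G Q \<noteq> 0 \<and> h Q = val H Q / val G Q)" using vl_nz[OF assms(1)] .
  have nz: "val H P \<noteq> 0" using 1 assms(2) by simp
  have "ae (\<lambda>Q. inverse (h Q) = val G Q / val H Q)" by (rule ae_mono[OF 1(5)]) (simp add: field_simps)
  thus "vl P (\<lambda>Q. inverse (h Q)) (inverse c)" unfolding vl_def using 1(1-4) nz vl_pts[OF assms(1)] assms(2)
    by (intro conjI exI[of _ d] exI[of _ G] exI[of _ H]) (auto simp: field_simps)
  show "ae (\<lambda>Q. h Q \<noteq> 0)"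
    by (rule ae_mono2[OF 1(5) hom_zeros[OF 1(1) vl_pts[OF assms(1)] nz]]) simp
qed

lemma vl_unique: assumes "vl P h c" "vl P h e" shows "c = e"
proof -
  obtain d H G where 1: "hom d H" "hom d G" "val G P \<noteq> 0" "val H P = c * val G P"
     "ae (\<lambda>Q. val G Q \<noteq> 0 \<and> h Q = val H Q / val G Q)" using vl_nz[OF assms(1)] .
  obtain d' H' G' where 2: "hom d' H'" "hom d' G'" "val G' P \<noteq> 0" "val H' P = e * val G' P"
     "ae (\<lambda>Q. val G' Q \<noteq> 0 \<and> h Q = val H' Q / val G' Q)" using vl_nz[OF assms(2)] .
  have "hom (d + d') (H * G' - G * H')" by (intro homogeneous_diff homogeneous_mult 1 2)
  moreover have "ae (\<lambda>Q. val (H * G' - G * H') Q = 0)"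
    by (rule ae_mono2[OF 1(5) 2(5)]) (auto simp: field_simps)
  ultimately have "val (H * G' - G * H') P = 0" using hom_ae_zero vl_pts[OF assms(1)] by blast
  thus ?thesis using 1(3,4) 2(3,4) by simp
qed

lemma vl_power: "vl P h c \<Longrightarrow> vl P (\<lambda>Q. h Q ^ n) (c ^ n)"
  by (induction n) (auto intro: vl_const vl_mult vl_pts)

lemma vl_powi: assumes "vl P h c" "c \<noteq> 0" shows "vl P (\<lambda>Q. h Q powi k) (c powi k)"
proof (cases "k \<ge> 0")
  case True thus ?thesis using vl_power[OF assms(1), of "nat k"] by (simp add: power_int_def)
next
  case False thus ?thesis using vl_power[OF vl_inverse(1)[OF assms], of "nat (- k)"] by (simp add: power_int_def)
qed

lemma vl_frac:
  assumes "P \<in> pts Cv" "hom d H" "hom d G" "val G P \<noteq> 0"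
  shows "vl P (\<lambda>Q. val H Q / val G Q) (val H P / val G P)"
  by (rule vlI[OF assms]) (auto intro: ae_all)

end

section \<open>Uniformizers\<close>

lemma more_unknowns_than_equations:
  fixes M :: "nat \<Rightarrow> nat \<Rightarrow> 'a::field"
  assumes "finite A" "l < card A"
  shows "\<exists>c. (\<exists>j\<in>A. c j \<noteq> 0) \<and> (\<forall>i<l. (\<Sum>j\<in>A. c j * M j i) = 0)"
  using assms
proof (induction l arbitrary: A M)
  case 0
  hence "A \<noteq> {}" by auto
  thus ?case by (intro exI[of _ "\<lambda>_. 1"]) auto
next
  case (Suc l)
  show ?case
  proof (cases "\<forall>j\<in>A. M j l = 0")
    case True
    obtain c where "\<exists>j\<in>A. c j \<noteq> 0" "\<forall>i<l. (\<Sum>j\<in>A. c j * M j i) = 0" using Suc.IH[of A M] Suc.prems by auto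
    thus ?thesis using True by (intro exI[of _ c]) (auto simp: less_Suc_eq)
  next
    case False
    then obtain j0 where j0: "j0 \<in> A" "M j0 l \<noteq> 0" by blast
    define A' where "A' = A - {j0}"
    have A': "finite A'" "l < card A'" "A = insert j0 A'" "j0 \<notin> A'" using Suc.prems j0 by (auto simp: A'_def)
    obtain c where c: "\<exists>j\<in>A'. c j \<noteq> 0" "\<forall>i<l. (\<Sum>j\<in>A'. c j * (M j i - M j l / M j0 l * M j0 i)) = 0"
      using Suc.IH[of A' "\<lambda>j i. M j i - M j l / M j0 l * M j0 i"] A' by auto
    define k where "k = - (\<Sum>j\<in>A'. c j * M j l) / M j0 l"
    have s: "(\<Sum>j\<in>A. (c(j0 := k)) j * M j i) = k * M j0 i + (\<Sum>j\<in>A'. c j * M j i)" for i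
      unfolding A'(3) using A' by (simp, intro sum.cong) auto
    have "(\<Sum>j\<in>A. (c(j0 := k)) j * M j i) = 0" if "i < Suc l" for i
    proof (cases "i = l")
      case True thus ?thesis unfolding s using j0 by (simp add: k_def)
    next
      case False
      have "(\<Sum>j\<in>A'. c j * (M j i - M j l / M j0 l * M j0 i)) = (\<Sum>j\<in>A'. c j * M j i) + k * M j0 i"
        by (simp add: k_def right_diff_distrib sum_subtractf sum_distrib_right sum_divide_distrib mult.assoc)
      moreover have "i < l" using False that by simp
      hence "(\<Sum>j\<in>A'. c j * (M j i - M j l / M j0 l * M j0 i)) = 0" using c(2) by blast
      ultimately show ?thesis unfolding s by (metis add.commute)
    qed
    moreover have "\<exists>j\<in>A. (c(j0 := k)) j \<noteq> 0" using c(1) A' by auto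
    ultimately show ?thesis by blast
  qed
qed

context hyp_curve
begin

lemma hf_root:
  assumes "Polynomial.degree q \<le> e" "hf e q (nx s) (nz s) = 0"
  obtains q' where "q = lp s * q'" "Polynomial.degree q' \<le> e - 1" "q \<noteq> 0 \<Longrightarrow> e \<ge> 1"
proof (cases "q = 0")
  case True thus ?thesis using that[of 0] by simp
next
  case q: False
  show ?thesis
  proof (cases s)
    case None
    hence "Polynomial.coeff q e = 0" using assms(2) by (simp add: nx_def nz_def hf_z0)
    hence "Polynomial.degree q \<noteq> e" using q leading_coeff_0_iff by metis
    thus ?thesis using that[of q] assms(1) None by (simp add: lp_def)
  next
    case (Some r)
    hence "poly q r = 0" using assms by (simp add: nx_def nz_def hf_1)
    then obtain q' where q': "q = [:- r, 1:] * q'" using poly_eq_0_iff_dvd by (metis dvdE)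
    have "q' \<noteq> 0" using q q' by auto
    hence "Polynomial.degree q = 1 + Polynomial.degree q'" unfolding q' by (subst degree_mult_eq) auto
    thus ?thesis using that[of q'] assms(1) Some q' by (simp add: lp_def)
  qed
qed

lemma hf_coords:
  assumes "P \<in> pts Cv" "bs P = s" shows "hf e q (xc P) (zc P) = 0 \<longleftrightarrow> hf e q (nx s) (nz s) = 0"
proof -
  obtain c where "c \<noteq> 0" "xc P = c * nx s" "zc P = c * nz s" using coords_n[OF assms] .
  thus ?thesis by (simp add: hf_scale)
qed

lemma hf_lp_mult:
  assumes "Polynomial.degree q' \<le> e - 1" "e \<ge> 1"
  shows "hf e (lp s * q') x z = hf 1 (lp s) x z * hf (e - 1) q' x z"
  using hf_mult[OF deg_lp assms(1), of s x z] assms(2) by simp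

lemma branch_factor:
  assumes "P \<in> pts Cv" "yc P = 0"
  obtains p1 where "p = lp (bs P) * p1" "Polynomial.degree p1 \<le> 2 * w - 1" "hf (2 * w - 1) p1 (xc P) (zc P) \<noteq> 0"
proof -
  let ?s = "bs P"
  have "hf (2 * w) p (nx ?s) (nz ?s) = 0" using yc_sq[OF assms(1)] assms hf_coords[OF assms(1) refl] by auto
  then obtain p1 where p1: "p = lp ?s * p1" "Polynomial.degree p1 \<le> 2 * w - 1" by (rule hf_root[OF deg_le])
  have "hf (2 * w - 1) p1 (nx ?s) (nz ?s) \<noteq> 0"
  proof
    assume "hf (2 * w - 1) p1 (nx ?s) (nz ?s) = 0"
    then obtain p2 where p2: "p1 = lp ?s * p2" "Polynomial.degree p2 \<le> 2 * w - 1 - 1" by (rule hf_root[OF p1(2)])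
    show False
    proof (cases ?s)
      case None
      hence "Polynomial.degree p \<le> 2 * w - 2" using p1 p2 by (simp add: lp_def)
      thus False using deg_ge w by linarith
    next
      case (Some r)
      hence l: "lp ?s = [:- r, 1:]" by (simp add: lp_def)
      have "p = lp ?s * (lp ?s * p2)" using p1(1) p2(1) by simp
      hence "p = [:- r, 1:] ^ 2 * p2" by (simp only: l power2_eq_square mult.assoc)
      thus False using sqf[of r] by (metis dvdI)
    qed
  qed
  thus ?thesis using that p1 hf_coords[OF assms(1) refl] by blast
qed

abbreviation lf :: "'a option \<Rightarrow> 'a point \<Rightarrow> 'a" where "lf s Q \<equiv> hf 1 (lp s) (xc Q) (zc Q)"
abbreviation lg :: "'a option \<Rightarrow> 'a point \<Rightarrow> 'a" where "lg s Q \<equiv> hf 1 (lo s) (xc Q) (zc Q)"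

text \<open>A form \<open>A + B y\<close> such that \<open>A\<close> and \<open>B\<close> vanish at \<open>s\<close> is divisible by the linear form of \<open>s\<close>.\<close>

lemma el_divide:
  assumes ok: "okp d a b" and d1: "d \<ge> 1" and a0: "hf d a (nx s) (nz s) = 0" and b0: "hf (d - w) b (nx s) (nz s) = 0"
  obtains a' b' where "okp (d - 1) a' b'" "\<And>Q. val (el d a b) Q = lf s Q * val (el (d - 1) a' b') Q"
proof -
  have ok': "Polynomial.degree a \<le> d" "Polynomial.degree b \<le> d - w" using ok by (auto simp: okp_def)
  obtain a' where a': "a = lp s * a'" "Polynomial.degree a' \<le> d - 1" by (rule hf_root[OF ok'(1) a0])
  obtain b' where b': "b = lp s * b'" "Polynomial.degree b' \<le> d - w - 1" "b \<noteq> 0 \<Longrightarrow> d - w \<ge> 1"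
    using hf_root[OF ok'(2) b0] by metis
  have okn: "okp (d - 1) a' b'"
  proof (cases "b = 0")
    case True hence "b' = 0" using b'(1) by simp
    thus ?thesis using a' by (simp add: okp_def)
  next
    case False thus ?thesis using a'(2) b'(2) b'(3) by (auto simp: okp_def)
  qed
  have "val (el d a b) Q = lf s Q * val (el (d - 1) a' b') Q" for Q
  proof -
    have "hf d a (xc Q) (zc Q) = lf s Q * hf (d - 1) a' (xc Q) (zc Q)" unfolding a'(1) by (rule hf_lp_mult[OF a'(2) d1])
    moreover have "hf (d - w) b (xc Q) (zc Q) = lf s Q * hf (d - 1 - w) b' (xc Q) (zc Q)"
    proof (cases "b = 0")
      case False
      have "d - w - 1 = d - 1 - w" by simp
      thus ?thesis using hf_lp_mult[OF b'(2) b'(3)[OF False], of s] b'(1) by simp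
    next
      case True thus ?thesis using b'(1) by simp
    qed
    ultimately show ?thesis by (simp add: val_el algebra_simps)
  qed
  thus ?thesis using that okn by blast
qed

text \<open>The local parameter \<open>tN P\<close> of the projective line below \<open>P\<close>, the uniformizer \<open>t0 P\<close> at \<open>P\<close> and the ramification index.
  At branch points, where \<open>y = 0\<close>, the uniformizer is \<open>y\<close> up to normalization.\<close>

definition tN :: "'a point \<Rightarrow> 'a point \<Rightarrow> 'a" where "tN P Q = lf (bs P) Q / lg (bs P) Q"

definition t0 :: "'a point \<Rightarrow> 'a point \<Rightarrow> 'a" where
  "t0 P Q = (if yc P = 0 then yc Q / lg (bs P) Q ^ w else tN P Q)"

definition ram :: "'a point \<Rightarrow> nat" where "ram P = (if yc P = 0 then 2 else 1)"

lemma lf_ae: "ae (\<lambda>Q. lf s Q \<noteq> 0)" and lg_ae: "ae (\<lambda>Q. lg s Q \<noteq> 0)"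
  by (rule hform_nz; simp)+

lemma yc_ae: "ae (\<lambda>Q. yc Q \<noteq> 0)"
proof (rule ae_mono[OF hform_nz[OF p0 deg_le]])
  fix P assume "P \<in> pts Cv" "hf (2 * w) p (xc P) (zc P) \<noteq> 0"
  thus "yc P \<noteq> 0" using yc_sq[of P] by auto
qed

lemma t0_ae: "ae (\<lambda>Q. t0 P Q \<noteq> 0)"
  by (rule ae_mono3[OF yc_ae lf_ae[of "bs P"] lg_ae[of "bs P"]]) (auto simp: t0_def tN_def)

lemma hom_lg_power: "hom n (hform 1 (lo s) ^ n)"
  by (rule homogeneous_power[where d=1]) auto

lemma tN_vl: "P \<in> pts Cv \<Longrightarrow> vl P (tN P) 0"
  using vl_frac[of P 1 "hform 1 (lp (bs P))" "hform 1 (lo (bs P))"] lo_nonzero[of P] lp_zero[of P "bs P"]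
  by (simp add: tN_def[abs_def])

lemma t0_vl: "P \<in> pts Cv \<Longrightarrow> vl P (t0 P) 0"
proof (cases "yc P = 0")
  case True
  assume "P \<in> pts Cv"
  thus ?thesis using vl_frac[OF _ hom_var(3) hom_lg_power[of w "bs P"], of P] lo_nonzero[of P] True
    by (simp add: t0_def[abs_def])
next
  case False
  assume "P \<in> pts Cv"
  thus ?thesis using tN_vl False by (simp add: t0_def[abs_def])
qed

text \<open>At a branch point \<open>y\<^sup>2 = l p\<^sub>1\<close> with the linear form \<open>l\<close> and a form \<open>p\<^sub>1\<close> that does not vanish there.\<close>

lemma tN_t0:
  assumes P: "P \<in> pts Cv"
  obtains u c where "vl P u c" "c \<noteq> 0" "ae (\<lambda>Q. tN P Q = t0 P Q ^ ram P * u Q)"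
proof (cases "yc P = 0")
  case False
  thus ?thesis using that[OF vl_const[OF P, of 1]] by (simp add: t0_def ram_def ae_all)
next
  case True
  let ?s = "bs P"
  obtain p1 where p1: "p = lp ?s * p1" "Polynomial.degree p1 \<le> 2 * w - 1" "hf (2 * w - 1) p1 (xc P) (zc P) \<noteq> 0"
    by (rule branch_factor[OF P True])
  have v: "vl P (\<lambda>Q. lg ?s Q ^ (2 * w - 1) / hf (2 * w - 1) p1 (xc Q) (zc Q))
     (lg ?s P ^ (2 * w - 1) / hf (2 * w - 1) p1 (xc P) (zc P))"
    using vl_frac[OF P hom_lg_power[of "2 * w - 1" ?s], of "hform (2 * w - 1) p1"] p1(3) by simp
  have nz: "lg ?s P ^ (2 * w - 1) / hf (2 * w - 1) p1 (xc P) (zc P) \<noteq> 0" using p1(3) lo_nonzero[OF P] by simp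
  have p10: "p1 \<noteq> 0" using p1 p0 by auto
  show ?thesis
  proof (rule that[OF v nz], rule ae_mono2[OF lg_ae[of ?s] hform_nz[OF p10 p1(2)]])
    fix Q assume Q: "Q \<in> pts Cv" "lg ?s Q \<noteq> 0" "hf (2 * w - 1) p1 (xc Q) (zc Q) \<noteq> 0"
    have y2: "(yc Q)\<^sup>2 = lf ?s Q * hf (2 * w - 1) p1 (xc Q) (zc Q)"
      using yc_sq[OF Q(1)] hf_lp_mult[OF p1(2), of ?s] w unfolding p1(1)[symmetric] by simp
    have e: "lg ?s Q ^ w * lg ?s Q ^ w = lg ?s Q ^ (2 * w - 1) * lg ?s Q"
      using w by (simp add: power_add[symmetric] power_Suc2[symmetric] del: power_Suc power_Suc2) (simp add: mult_2)
    show "tN P Q = t0 P Q ^ ram P * (lg ?s Q ^ (2 * w - 1) / hf (2 * w - 1) p1 (xc Q) (zc Q))"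
      using Q(2,3) True by (simp add: tN_def t0_def ram_def power_divide y2 power2_eq_square[of "lg ?s Q ^ w"] e)
  qed
qed

text \<open>A function that vanishes at \<open>P\<close> has a numerator \<open>A + B y\<close> that vanishes at \<open>P\<close>. At a branch point \<open>A\<close> is divisible by
  the linear form \<open>l\<close> and \<open>y\<close> can be split off by \<open>y\<^sup>2 = l p\<^sub>1\<close>. At another point, either \<open>A - B y\<close> does not vanish and \<open>l\<close>
  divides the norm \<open>A\<^sup>2 - B\<^sup>2 p\<close>, or \<open>l\<close> divides \<open>A\<close> and \<open>B\<close>.\<close>

lemma t0_divides:
  assumes P: "P \<in> pts Cv" and h: "vl P h 0"
  obtains k c where "vl P k c" "ae (\<lambda>Q. h Q = k Q * t0 P Q)"
proof -
  let ?s = "bs P"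
  obtain d H G where H: "hom d H" and G: "hom d G" "val G P \<noteq> 0" and "val H P = 0 * val G P"
     and hHG: "ae (\<lambda>Q. val G Q \<noteq> 0 \<and> h Q = val H Q / val G Q)" by (rule vl_nz[OF h]) (rule that)
  hence HP: "val H P = 0" by simp
  obtain a b where ok: "okp d a b" and Hab: "\<And>P. P \<in> pts Cv \<Longrightarrow> val H P = val (el d a b) P"
    by (rule hom_el_ex[OF H]) (rule that)
  show ?thesis
  proof (cases "a = 0 \<and> b = 0")
    case True
    have "ae (\<lambda>Q. h Q = 0 * t0 P Q)" by (rule ae_mono[OF hHG]) (simp add: Hab True val_el)
    thus ?thesis using that[OF vl_const[OF P, of 0]] by blast
  next
    case ab: False
    have d1: "d \<ge> 1"
    proof (rule ccontr)
      assume "\<not> d \<ge> 1"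
      hence "d = 0" by simp
      hence "b = 0" "Polynomial.degree a = 0" using ok w by (auto simp: okp_def)
      hence "a \<noteq> 0" "val (el d a b) P = Polynomial.coeff a 0" using ab \<open>d = 0\<close> by (auto simp: val_el hf_def)
      thus False using HP Hab[OF P] \<open>Polynomial.degree a = 0\<close> leading_coeff_0_iff[of a] by simp
    qed
    have ok': "Polynomial.degree a \<le> d" "Polynomial.degree b \<le> d - w" "b \<noteq> 0 \<Longrightarrow> d \<ge> w" using ok by (auto simp: okp_def)
    show ?thesis
    proof (cases "yc P = 0")
      case br: True
      obtain p1 where p1: "p = lp ?s * p1" "Polynomial.degree p1 \<le> 2 * w - 1" "hf (2 * w - 1) p1 (xc P) (zc P) \<noteq> 0"
        by (rule branch_factor[OF P br])
      have p10: "p1 \<noteq> 0" using p1 p0 by auto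
      have "hf d a (xc P) (zc P) = 0" using HP Hab[OF P] br by (simp add: val_el)
      hence "hf d a (nx ?s) (nz ?s) = 0" using hf_coords[OF P refl] by blast
      then obtain a' where a': "a = lp ?s * a'" "Polynomial.degree a' \<le> d - 1" by (rule hf_root[OF ok'(1)])
      let ?K = "y_var * hform (d - 1) a' + hform (2 * w - 1) p1 * hform (d - w) b"
      let ?G = "hform (2 * w - 1) p1 * G"
      have "hom (w + (d - 1)) ?K"
      proof (rule homogeneous_add)
        show "hom (w + (d - 1)) (y_var * hform (d - 1) a')" by (intro homogeneous_mult hom_var hom_hform)
        show "hom (w + (d - 1)) (hform (2 * w - 1) p1 * hform (d - w) b)"
        proof (cases "b = 0")
          case False
          hence "w + (d - 1) = (2 * w - 1) + (d - w)" using ok'(3)[OF False] w d1 by linarith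
          thus ?thesis by (simp only:) (intro homogeneous_mult hom_hform)
        qed simp
      qed
      hence "hom (w + (d - 1) + w) (?K * hform 1 (lo ?s) ^ w)" by (intro homogeneous_mult hom_lg_power)
      moreover have "w + (d - 1) + w = 2 * w - 1 + d" using w d1 by linarith
      ultimately have K: "hom (2 * w - 1 + d) (?K * hform 1 (lo ?s) ^ w)" by simp
      have G': "hom (2 * w - 1 + d) ?G" by (intro homogeneous_mult hom_hform G(1))
      have "vl P (\<lambda>Q. val (?K * hform 1 (lo ?s) ^ w) Q / val ?G Q) (val (?K * hform 1 (lo ?s) ^ w) P / val ?G P)"
        by (rule vl_frac[OF P K G']) (use p1(3) G(2) in simp)
      moreover have "ae (\<lambda>Q. h Q = val (?K * hform 1 (lo ?s) ^ w) Q / val ?G Q * t0 P Q)"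
      proof (rule ae_mono3[OF hHG lg_ae[of ?s] hform_nz[OF p10 p1(2)]])
        fix Q assume Q: "Q \<in> pts Cv" "val G Q \<noteq> 0 \<and> h Q = val H Q / val G Q" "lg ?s Q \<noteq> 0" "hf (2 * w - 1) p1 (xc Q) (zc Q) \<noteq> 0"
        have y2: "yc Q * yc Q = lf ?s Q * hf (2 * w - 1) p1 (xc Q) (zc Q)"
          using yc_sq[OF Q(1)] hf_lp_mult[OF p1(2), of ?s] w unfolding p1(1)[symmetric] by (simp add: power2_eq_square)
        have "hf d a (xc Q) (zc Q) = lf ?s Q * hf (d - 1) a' (xc Q) (zc Q)"
          unfolding a'(1) by (rule hf_lp_mult[OF a'(2) d1])
        hence "hf (2 * w - 1) p1 (xc Q) (zc Q) * val H Q = yc Q * yc Q * hf (d - 1) a' (xc Q) (zc Q)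
           + hf (2 * w - 1) p1 (xc Q) (zc Q) * yc Q * hf (d - w) b (xc Q) (zc Q)"
          unfolding Hab[OF Q(1)] val_el y2 by (simp add: algebra_simps)
        hence "hf (2 * w - 1) p1 (xc Q) (zc Q) * val H Q = yc Q * val ?K Q" by (simp add: algebra_simps)
        hence "val H Q = yc Q * val ?K Q / hf (2 * w - 1) p1 (xc Q) (zc Q)" using Q(4) by (simp add: field_simps)
        thus "h Q = val (?K * hform 1 (lo ?s) ^ w) Q / val ?G Q * t0 P Q"
          using Q(2-4) br by (simp add: t0_def)
      qed
      ultimately show ?thesis by (rule that)
    next
      case nb: False
      have t: "t0 P = tN P" using nb by (auto simp: t0_def)
      have okm: "okp d a (- b)" using okp_uminus[OF ok] .
      show ?thesis
      proof (cases "val (el d a (- b)) P = 0")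
        case False
        define N where "N = a\<^sup>2 - b\<^sup>2 * p"
        have dN: "Polynomial.degree N \<le> 2 * d" using el_norm(2)[OF ok P] by (simp add: N_def)
        have nm: "val H Q * val (el d a (- b)) Q = hf (2 * d) N (xc Q) (zc Q)" if "Q \<in> pts Cv" for Q
          using el_norm(1)[OF ok that] Hab[OF that] by (simp add: N_def)
        have "hf (2 * d) N (nx ?s) (nz ?s) = 0" using nm[OF P] HP hf_coords[OF P refl] by auto
        then obtain N' where N': "N = lp ?s * N'" "Polynomial.degree N' \<le> 2 * d - 1" by (rule hf_root[OF dN])
        let ?K = "hform (2 * d - 1) N' * hform 1 (lo ?s)" and ?G = "el d a (- b) * G"
        have "hom (2 * d - 1 + 1) ?K" by (intro homogeneous_mult hom_hform)
        hence K: "hom (d + d) ?K" using d1 by (simp add: mult_2)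
        have G': "hom (d + d) ?G" by (intro homogeneous_mult hom_el[OF okm] G(1))
        have "vl P (\<lambda>Q. val ?K Q / val ?G Q) (val ?K P / val ?G P)"
          by (rule vl_frac[OF P K G']) (use False G(2) in simp)
        moreover have "ae (\<lambda>Q. h Q = val ?K Q / val ?G Q * t0 P Q)"
        proof (rule ae_mono3[OF hHG lg_ae[of ?s] hom_zeros[OF hom_el[OF okm] P False]])
          fix Q assume Q: "Q \<in> pts Cv" "val G Q \<noteq> 0 \<and> h Q = val H Q / val G Q" "lg ?s Q \<noteq> 0" "val (el d a (- b)) Q \<noteq> 0"
          have "val H Q * val (el d a (- b)) Q = lf ?s Q * hf (2 * d - 1) N' (xc Q) (zc Q)"
            unfolding nm[OF Q(1)] N'(1) by (rule hf_lp_mult[OF N'(2)]) (use d1 in linarith)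
          hence "val H Q = lf ?s Q * hf (2 * d - 1) N' (xc Q) (zc Q) / val (el d a (- b)) Q" using Q(4) by (simp add: field_simps)
          thus "h Q = val ?K Q / val ?G Q * t0 P Q" using Q(2-4) by (simp add: t tN_def)
        qed
        ultimately show ?thesis by (rule that)
      next
        case True
        have "2 * hf d a (xc P) (zc P) = val H P + val (el d a (- b)) P"
          unfolding Hab[OF P] by (simp add: val_el hf_uminus)
        hence a0: "hf d a (xc P) (zc P) = 0" using True HP two by simp
        hence b0: "hf (d - w) b (xc P) (zc P) = 0" using HP nb unfolding Hab[OF P] by (simp add: val_el)
        obtain a' b' where okn: "okp (d - 1) a' b'" and Hq': "\<And>Q. val (el d a b) Q = lf ?s Q * val (el (d - 1) a' b') Q"
          using el_divide[OF ok d1] a0 b0 hf_coords[OF P refl] by metis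
        have Hq: "val H Q = lf ?s Q * val (el (d - 1) a' b') Q" if "Q \<in> pts Cv" for Q unfolding Hab[OF that] by (rule Hq')
        let ?K = "el (d - 1) a' b' * hform 1 (lo ?s)"
        have "hom (d - 1 + 1) ?K" by (intro homogeneous_mult hom_hform hom_el[OF okn])
        hence K: "hom d ?K" using d1 by simp
        have "vl P (\<lambda>Q. val ?K Q / val G Q) (val ?K P / val G P)" by (rule vl_frac[OF P K G])
        moreover have "ae (\<lambda>Q. h Q = val ?K Q / val G Q * t0 P Q)"
          by (rule ae_mono2[OF hHG lg_ae[of ?s]]) (simp add: Hq t tN_def)
        ultimately show ?thesis by (rule that)
      qed
    qed
  qed
qed

lemma t0_uniformizer: assumes P: "P \<in> pts Cv" shows "uniformizer Cv P (t0 P)"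
  unfolding uniformizer_def
proof (intro conjI ballI)
  show "t0 P \<in> local_max_ideal Cv P" using t0_vl[OF P] local_max_ideal_vl[OF P] by blast
  show "\<not> geneq Cv (t0 P) (\<lambda>_. 0)" unfolding geneq_ae using ae_ex[OF ae_conj[OF t0_ae[of P]]] by blast
  fix h assume "h \<in> local_max_ideal Cv P"
  hence "vl P h 0" using local_max_ideal_vl[OF P] by blast
  then obtain k c where k: "vl P k c" "ae (\<lambda>Q. h Q = k Q * t0 P Q)" by (rule t0_divides[OF P]) (rule that)
  show "\<exists>k\<in>local_ring Cv P. geneq Cv h (\<lambda>Q. k Q * t0 P Q)"
    by (rule bexI[of _ k]) (use k local_ring_vl[OF P] in \<open>auto simp: geneq_ae\<close>)
qed

text \<open>Any two uniformizers differ by a unit, so that Riemann-Roch spaces can be tested with \<open>t0\<close>.\<close>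

lemma uniformizer_unit:
  assumes P: "P \<in> pts Cv" and t: "uniformizer Cv P t"
  obtains u c where "vl P u c" "c \<noteq> 0" "ae (\<lambda>Q. t Q = u Q * t0 P Q)"
proof -
  have "vl P t 0" using t local_max_ideal_vl[OF P] by (simp add: uniformizer_def)
  then obtain k c where k: "vl P k c" "ae (\<lambda>Q. t Q = k Q * t0 P Q)" by (rule t0_divides[OF P]) (rule that)
  have "t0 P \<in> local_max_ideal Cv P" using t0_vl[OF P] local_max_ideal_vl[OF P] by blast
  then obtain k' where k': "k' \<in> local_ring Cv P" "geneq Cv (t0 P) (\<lambda>Q. k' Q * t Q)" using t unfolding uniformizer_def by blast
  obtain c' where c': "vl P k' c'" using k'(1) local_ring_vl[OF P] by blast
  have "ae (\<lambda>Q. 1 = k' Q * k Q)"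
  proof (rule ae_mono3[OF k(2) k'(2)[unfolded geneq_ae] t0_ae[of P]])
    fix Q assume Q: "t Q = k Q * t0 P Q" "t0 P Q = k' Q * t Q" "t0 P Q \<noteq> 0"
    have "k' Q * k Q * t0 P Q = t0 P Q" unfolding mult.assoc Q(1)[symmetric] using Q(2) by simp
    thus "1 = k' Q * k Q" using Q(3) by simp
  qed
  from vl_cong[OF vl_mult[OF c' k(1)] this] have "c' * c = 1" using vl_unique vl_const[OF P] by blast
  hence "c \<noteq> 0" by auto
  from that[OF k(1) this k(2)] show ?thesis .
qed

section \<open>Riemann-Roch spaces and the genus of a hyperelliptic model\<close>

definition rr :: "('a point \<Rightarrow> int) \<Rightarrow> ('a point \<Rightarrow> 'a) \<Rightarrow> bool" where
  "rr D h \<longleftrightarrow> rational Cv h \<and> (\<forall>P\<in>pts Cv. \<exists>c. vl P (\<lambda>Q. t0 P Q powi D P * h Q) c)"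

lemma riemann_roch_space_rr: "h \<in> riemann_roch_space Cv D \<longleftrightarrow> rr D h"
proof -
  have "(\<forall>t. uniformizer Cv P t \<longrightarrow> (\<lambda>Q. t Q powi D P * h Q) \<in> local_ring Cv P) \<longleftrightarrow>
      (\<exists>c. vl P (\<lambda>Q. t0 P Q powi D P * h Q) c)" if P: "P \<in> pts Cv" for P
  proof
    assume "\<forall>t. uniformizer Cv P t \<longrightarrow> (\<lambda>Q. t Q powi D P * h Q) \<in> local_ring Cv P"
    thus "\<exists>c. vl P (\<lambda>Q. t0 P Q powi D P * h Q) c" using t0_uniformizer[OF P] local_ring_vl[OF P] by blast
  next
    assume "\<exists>c. vl P (\<lambda>Q. t0 P Q powi D P * h Q) c"
    then obtain c where c: "vl P (\<lambda>Q. t0 P Q powi D P * h Q) c" by blast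
    show "\<forall>t. uniformizer Cv P t \<longrightarrow> (\<lambda>Q. t Q powi D P * h Q) \<in> local_ring Cv P"
    proof (intro allI impI)
      fix t assume "uniformizer Cv P t"
      then obtain u e where u: "vl P u e" "e \<noteq> 0" "ae (\<lambda>Q. t Q = u Q * t0 P Q)" by (rule uniformizer_unit[OF P]) (rule that)
      have "ae (\<lambda>Q. t Q powi D P * h Q = u Q powi D P * (t0 P Q powi D P * h Q))"
        by (rule ae_mono[OF u(3)]) (simp add: power_int_mult_distrib)
      from vl_cong[OF vl_mult[OF vl_powi[OF u(1,2)] c] this]
      show "(\<lambda>Q. t Q powi D P * h Q) \<in> local_ring Cv P" using local_ring_vl[OF P] by blast
    qed
  qed
  thus ?thesis unfolding riemann_roch_space_def rr_def by blast
qed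

lemma rational_lin:
  assumes "rational Cv h" "rational Cv k" shows "rational Cv (\<lambda>Q. h Q + c * k Q)"
proof -
  obtain d H G where 1: "hom d H" "hom d G" "ae (\<lambda>Q. val G Q \<noteq> 0 \<and> h Q = val H Q / val G Q)"
    using assms(1) unfolding rational_frac by blast
  obtain d' H' G' where 2: "hom d' H'" "hom d' G'" "ae (\<lambda>Q. val G' Q \<noteq> 0 \<and> k Q = val H' Q / val G' Q)"
    using assms(2) unfolding rational_frac by blast
  let ?H = "H * G' + mp_const c * (G * H')" and ?G = "G * G'"
  have "hom (d + d') ?H"
  proof (rule homogeneous_add)
    show "hom (d + d') (H * G')" by (intro homogeneous_mult 1 2)
    show "hom (d + d') (mp_const c * (G * H'))"
      using homogeneous_mult[OF homogeneous_const homogeneous_mult[OF 1(2) 2(1)], of c] by simp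
  qed
  moreover have "hom (d + d') ?G" by (intro homogeneous_mult 1 2)
  moreover have "ae (\<lambda>Q. val ?G Q \<noteq> 0 \<and> h Q + c * k Q = val ?H Q / val ?G Q)"
    by (rule ae_mono2[OF 1(3) 2(3)]) (simp add: field_simps)
  ultimately show ?thesis unfolding rational_frac by blast
qed

lemma rr_lin: assumes "rr D h" "rr D k" shows "rr D (\<lambda>Q. h Q + c * k Q)"
  unfolding rr_def
proof (intro conjI ballI)
  show "rational Cv (\<lambda>Q. h Q + c * k Q)" using assms rational_lin unfolding rr_def by blast
  fix P assume P: "P \<in> pts Cv"
  obtain a where a: "vl P (\<lambda>Q. t0 P Q powi D P * h Q) a" using assms(1) P unfolding rr_def by blast
  obtain b where b: "vl P (\<lambda>Q. t0 P Q powi D P * k Q) b" using assms(2) P unfolding rr_def by blast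
  have "(\<lambda>Q. t0 P Q powi D P * (h Q + c * k Q)) = (\<lambda>Q. t0 P Q powi D P * h Q + c * (t0 P Q powi D P * k Q))"
    by (simp add: algebra_simps)
  thus "\<exists>e. vl P (\<lambda>Q. t0 P Q powi D P * (h Q + c * k Q)) e"
    using vl_add[OF a vl_mult[OF vl_const[OF P, of c] b]] by auto
qed

lemma rr_mono:
  assumes "rr D h" "\<And>P. P \<in> pts Cv \<Longrightarrow> D P \<le> D' P" shows "rr D' h"
  unfolding rr_def
proof (intro conjI ballI)
  show "rational Cv h" using assms unfolding rr_def by blast
  fix P assume P: "P \<in> pts Cv"
  obtain a where a: "vl P (\<lambda>Q. t0 P Q powi D P * h Q) a" using assms(1) P unfolding rr_def by blast
  define n where "n = nat (D' P - D P)"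
  have n: "D' P = int n + D P" using assms(2)[OF P] by (simp add: n_def)
  have "ae (\<lambda>Q. t0 P Q powi D' P * h Q = t0 P Q ^ n * (t0 P Q powi D P * h Q))"
    by (rule ae_mono[OF t0_ae[of P]]) (simp add: n power_int_add)
  from vl_cong[OF vl_mult[OF vl_power[OF t0_vl[OF P]] a] this]
  show "\<exists>c. vl P (\<lambda>Q. t0 P Q powi D' P * h Q) c" by blast
qed

text \<open>An upper bound for \<open>l(D)\<close>, stated as linear dependence: it makes sense without a basis of the Riemann-Roch
  space.\<close>

definition dim_le :: "('a point \<Rightarrow> int) \<Rightarrow> nat \<Rightarrow> bool" where
  "dim_le D l \<longleftrightarrow> (\<forall>(A::nat set) b. finite A \<and> card A = Suc l \<and> (\<forall>j\<in>A. rr D (b j)) \<longrightarrow>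
     (\<exists>c. (\<exists>j\<in>A. c j \<noteq> 0) \<and> ae (\<lambda>Q. (\<Sum>j\<in>A. c j * b j Q) = 0)))"

lemma ae_finite: "finite A \<Longrightarrow> (\<And>j. j \<in> A \<Longrightarrow> ae (R j)) \<Longrightarrow> ae (\<lambda>Q. \<forall>j\<in>A. R j Q)"
  by (induction A rule: finite_induct) (auto intro: ae_conj ae_all)

lemma riemann_roch_dim_le:
  assumes "riemann_roch_dim Cv D l" shows "dim_le D l"
  unfolding dim_le_def
proof (intro allI impI)
  fix A :: "nat set" and b assume A: "finite A \<and> card A = Suc l \<and> (\<forall>j\<in>A. rr D (b j))"
  obtain e where e: "\<forall>h\<in>riemann_roch_space Cv D. \<exists>c. geneq Cv h (\<lambda>Q. \<Sum>i<l. c i * e i Q)"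
    using assms unfolding riemann_roch_dim_def by (elim exE conjE) (rule that)
  have "\<exists>m. ae (\<lambda>Q. b j Q = (\<Sum>i<l. m i * e i Q))" if "j \<in> A" for j
    using bspec[OF e, of "b j"] A that unfolding geneq_ae riemann_roch_space_rr by simp
  hence "\<exists>M. \<forall>j\<in>A. ae (\<lambda>Q. b j Q = (\<Sum>i<l. M j i * e i Q))" by (intro bchoice) simp
  then obtain M where M: "\<forall>j\<in>A. ae (\<lambda>Q. b j Q = (\<Sum>i<l. M j i * e i Q))" ..
  have "\<exists>c. (\<exists>j\<in>A. c j \<noteq> 0) \<and> (\<forall>i<l. (\<Sum>j\<in>A. c j * M j i) = 0)"
    using A by (intro more_unknowns_than_equations) auto
  then obtain c where c: "\<exists>j\<in>A. c j \<noteq> 0" "\<forall>i<l. (\<Sum>j\<in>A. c j * M j i) = 0" by (elim exE conjE) (rule that)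
  have "ae (\<lambda>Q. \<forall>j\<in>A. b j Q = (\<Sum>i<l. M j i * e i Q))" by (rule ae_finite) (use A M in auto)
  hence "ae (\<lambda>Q. (\<Sum>j\<in>A. c j * b j Q) = 0)"
  proof (rule ae_mono)
    fix Q assume "\<forall>j\<in>A. b j Q = (\<Sum>i<l. M j i * e i Q)"
    hence "(\<Sum>j\<in>A. c j * b j Q) = (\<Sum>j\<in>A. \<Sum>i<l. c j * M j i * e i Q)"
      by (simp add: sum_distrib_left mult.assoc)
    also have "\<dots> = (\<Sum>i<l. (\<Sum>j\<in>A. c j * M j i) * e i Q)" by (subst sum.swap) (simp add: sum_distrib_right)
    finally show "(\<Sum>j\<in>A. c j * b j Q) = 0" using c(2) by simp
  qed
  thus "\<exists>c. (\<exists>j\<in>A. c j \<noteq> 0) \<and> ae (\<lambda>Q. (\<Sum>j\<in>A. c j * b j Q) = 0)" using c(1) by blast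
qed

lemma dim_le_bound:
  assumes "riemann_roch_dim Cv D l'" "dim_le D l" shows "l' \<le> l"
proof (rule ccontr)
  assume l: "\<not> l' \<le> l"
  obtain e where e: "\<forall>j<l'. e j \<in> riemann_roch_space Cv D"
    "\<forall>c. geneq Cv (\<lambda>Q. \<Sum>j<l'. c j * e j Q) (\<lambda>_. 0) \<longrightarrow> (\<forall>j<l'. c j = 0)"
    using assms(1) unfolding riemann_roch_dim_def by (elim exE conjE) (rule that)
  have "finite {..l} \<and> card {..l} = Suc l \<and> (\<forall>j\<in>{..l}. rr D (e j))"
    using e(1) l by (auto simp: riemann_roch_space_rr)
  then obtain c where c: "\<exists>j\<in>{..l}. c j \<noteq> 0" "ae (\<lambda>Q. (\<Sum>j\<in>{..l}. c j * e j Q) = 0)"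
    using assms(2) unfolding dim_le_def by blast
  define c' where "c' j = (if j \<le> l then c j else 0)" for j
  have "(\<Sum>j<l'. c' j * e j Q) = (\<Sum>j\<in>{..l}. c j * e j Q)" for Q
    using l by (intro sum.mono_neutral_cong_right) (auto simp: c'_def)
  hence "geneq Cv (\<lambda>Q. \<Sum>j<l'. c' j * e j Q) (\<lambda>_. 0)" using c(2) by (simp add: geneq_ae)
  hence "\<forall>j<l'. c' j = 0" using e(2) by blast
  moreover obtain j where "j \<le> l" "c j \<noteq> 0" using c(1) by auto
  ultimately show False using l by (auto simp: c'_def dest: spec[of _ j])
qed

text \<open>The elements of the Riemann-Roch space of \<open>D + P\<close> for which the linear functional ``value of \<open>t\<^bsup>D(P) + 1\<^esup> h\<close> at \<open>P\<close>''
  vanishes belong to that of \<open>D\<close>.\<close>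

lemma dim_le_point:
  assumes P: "P \<in> pts Cv" and D: "dim_le D l" shows "dim_le (D(P := D P + 1)) (Suc l)"
  unfolding dim_le_def
proof (intro allI impI)
  let ?D = "D(P := D P + 1)"
  fix A :: "nat set" and b assume A: "finite A \<and> card A = Suc (Suc l) \<and> (\<forall>j\<in>A. rr ?D (b j))"
  hence "\<forall>j\<in>A. \<exists>c. vl P (\<lambda>Q. t0 P Q powi ?D P * b j Q) c" using P unfolding rr_def by blast
  then obtain \<kappa> where \<kappa>: "\<And>j. j \<in> A \<Longrightarrow> vl P (\<lambda>Q. t0 P Q powi (D P + 1) * b j Q) (\<kappa> j)"
    unfolding fun_upd_same by metis
  have down: "rr D h" if h: "rr ?D h" "vl P (\<lambda>Q. t0 P Q powi (D P + 1) * h Q) 0" for h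
    unfolding rr_def
  proof (intro conjI ballI)
    show "rational Cv h" using h unfolding rr_def by blast
    fix R assume R: "R \<in> pts Cv"
    show "\<exists>c. vl R (\<lambda>Q. t0 R Q powi D R * h Q) c"
    proof (cases "R = P")
      case False
      hence "?D R = D R" by simp
      moreover have "\<exists>c. vl R (\<lambda>Q. t0 R Q powi ?D R * h Q) c" using h(1) R unfolding rr_def by blast
      ultimately show ?thesis by (simp only:)
    next
      case True
      obtain k c where k: "vl P k c" "ae (\<lambda>Q. t0 P Q powi (D P + 1) * h Q = k Q * t0 P Q)"
        by (rule t0_divides[OF P h(2)]) (rule that)
      have "ae (\<lambda>Q. t0 P Q powi D P * h Q = k Q)"
        by (rule ae_mono2[OF k(2) t0_ae[of P]]) (simp add: power_int_add)
      from vl_cong[OF k(1) this] show ?thesis unfolding True by (rule exI)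
    qed
  qed
  show "\<exists>c. (\<exists>j\<in>A. c j \<noteq> 0) \<and> ae (\<lambda>Q. (\<Sum>j\<in>A. c j * b j Q) = 0)"
  proof (cases "\<forall>j\<in>A. \<kappa> j = 0")
    case True
    have rD: "rr D (b j)" if "j \<in> A" for j using down[of "b j"] A \<kappa>[OF that] True that by simp
    obtain j0 where j0: "j0 \<in> A" using A by fastforce
    have "finite (A - {j0}) \<and> card (A - {j0}) = Suc l \<and> (\<forall>j\<in>A - {j0}. rr D (b j))" using A j0 rD by auto
    then obtain c where c: "\<exists>j\<in>A - {j0}. c j \<noteq> 0" "ae (\<lambda>Q. (\<Sum>j\<in>A - {j0}. c j * b j Q) = 0)"
      using D unfolding dim_le_def by blast
    have "(\<Sum>j\<in>A. (c(j0 := 0)) j * b j Q) = (\<Sum>j\<in>A - {j0}. c j * b j Q)" for Q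
      using A by (intro sum.mono_neutral_cong_right) auto
    thus ?thesis using c by (intro exI[of _ "c(j0 := 0)"]) auto
  next
    case False
    then obtain j0 where j0: "j0 \<in> A" "\<kappa> j0 \<noteq> 0" by blast
    define m where "m j = - (\<kappa> j / \<kappa> j0)" for j
    have rD: "rr D (\<lambda>Q. b j Q + m j * b j0 Q)" if j: "j \<in> A" for j
    proof (rule down)
      show "rr ?D (\<lambda>Q. b j Q + m j * b j0 Q)" using rr_lin A j j0 by blast
      have "vl P (\<lambda>Q. t0 P Q powi (D P + 1) * b j Q + m j * (t0 P Q powi (D P + 1) * b j0 Q)) (\<kappa> j + m j * \<kappa> j0)"
        by (intro vl_add vl_mult vl_const P \<kappa> j j0)
      moreover have "\<kappa> j + m j * \<kappa> j0 = 0" using j0 by (simp add: m_def)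
      ultimately show "vl P (\<lambda>Q. t0 P Q powi (D P + 1) * (b j Q + m j * b j0 Q)) 0"
        by (simp add: algebra_simps)
    qed
    have "finite (A - {j0}) \<and> card (A - {j0}) = Suc l \<and> (\<forall>j\<in>A - {j0}. rr D ((\<lambda>j Q. b j Q + m j * b j0 Q) j))" using A j0 rD by auto
    then obtain c where c: "\<exists>j\<in>A - {j0}. c j \<noteq> 0" "ae (\<lambda>Q. (\<Sum>j\<in>A - {j0}. c j * (b j Q + m j * b j0 Q)) = 0)"
      using D[unfolded dim_le_def, rule_format, of "A - {j0}" "\<lambda>j Q. b j Q + m j * b j0 Q"] by blast
    define k where "k = (\<Sum>j\<in>A - {j0}. c j * m j)"
    have "(\<Sum>j\<in>A. (c(j0 := k)) j * b j Q) = (\<Sum>j\<in>A - {j0}. c j * (b j Q + m j * b j0 Q))" for Q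
    proof -
      have "(\<Sum>j\<in>A. (c(j0 := k)) j * b j Q) = k * b j0 Q + (\<Sum>j\<in>A - {j0}. (c(j0 := k)) j * b j Q)"
        using A j0 by (subst sum.remove[of A j0]) auto
      also have "(\<Sum>j\<in>A - {j0}. (c(j0 := k)) j * b j Q) = (\<Sum>j\<in>A - {j0}. c j * b j Q)" by (rule sum.cong) auto
      finally show ?thesis by (simp add: k_def sum_distrib_right distrib_left sum.distrib mult.assoc add.commute)
    qed
    thus ?thesis using c by (intro exI[of _ "c(j0 := k)"]) auto
  qed
qed

lemma dim_le_cong: "(\<And>P. P \<in> pts Cv \<Longrightarrow> D P = D' P) \<Longrightarrow> dim_le D l = dim_le D' l"
proof -
  assume "\<And>P. P \<in> pts Cv \<Longrightarrow> D P = D' P"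
  hence "rr D = rr D'" by (auto simp: rr_def fun_eq_iff)
  thus ?thesis by (simp add: dim_le_def)
qed

lemma dim_le_point_n:
  assumes P: "P \<in> pts Cv" and D: "dim_le D l" shows "dim_le (D(P := D P + int n)) (l + n)"
proof (induction n)
  case (Suc n)
  have eq: "(D(P := D P + int n))(P := (D(P := D P + int n)) P + 1) = D(P := D P + int (Suc n))"
    by (simp add: fun_eq_iff)
  show ?case using dim_le_point[OF P Suc] unfolding eq by (simp only: add_Suc_right)
qed (use D in simp)

lemma dim_le_finite:
  assumes "finite T" "T \<subseteq> pts Cv" "\<And>P. P \<in> T \<Longrightarrow> D P \<le> D' P" "dim_le D l"
  shows "dim_le (\<lambda>P. if P \<in> T then D' P else D P) (l + nat (\<Sum>P\<in>T. D' P - D P))"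
  using assms(1-3)
proof (induction T rule: finite_induct)
  case (insert P T)
  let ?D = "\<lambda>P. if P \<in> T then D' P else D P"
  have IH: "dim_le ?D (l + nat (\<Sum>P\<in>T. D' P - D P))" using insert by auto
  from dim_le_point_n[OF _ this, of P "nat (D' P - D P)"] insert
  have "dim_le (?D(P := ?D P + int (nat (D' P - D P)))) (l + nat (\<Sum>P\<in>T. D' P - D P) + nat (D' P - D P))" by auto
  moreover have "?D(P := ?D P + int (nat (D' P - D P))) = (\<lambda>R. if R \<in> insert P T then D' R else D R)"
    using insert by (auto simp: fun_eq_iff)
  moreover have "l + nat (\<Sum>P\<in>T. D' P - D P) + nat (D' P - D P) = l + nat (\<Sum>P\<in>insert P T. D' P - D P)"
    using insert by (simp add: nat_add_distrib sum_nonneg)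
  ultimately show ?case by simp
qed (use assms(4) in simp)

end

context hyp_curve
begin

text \<open>The divisor of zeros of the product of the linear forms with zeros in the list \<open>ss\<close>.\<close>

definition fdiv :: "'a option list \<Rightarrow> 'a point \<Rightarrow> int" where
  "fdiv ss P = int (ram P * count_list ss (bs P))"

definition cp :: "'a option list \<Rightarrow> 'a poly" where "cp ss = prod_list (map lp ss)"

lemma cp_nz [simp]: "cp ss \<noteq> 0"
  by (induction ss) (auto simp: cp_def)

lemma deg_cp: "Polynomial.degree (cp ss) \<le> length ss"
proof (induction ss)
  case (Cons s ss)
  have "Polynomial.degree (cp (s # ss)) \<le> Polynomial.degree (lp s) + Polynomial.degree (cp ss)"
    by (simp add: cp_def degree_mult_le)
  also have "\<dots> \<le> 1 + length ss" by (rule add_mono[OF deg_lp Cons])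
  finally show ?case by simp
qed (simp add: cp_def)

lemma hf_cp_Cons: "hf (length (s # ss)) (cp (s # ss)) x z = hf 1 (lp s) x z * hf (length ss) (cp ss) x z"
  using hf_mult[OF deg_lp[of s] deg_cp[of ss], of x z] by (simp add: cp_def plus_1_eq_Suc)

lemma hf_cp_zero: "Q \<in> pts Cv \<Longrightarrow> hf (length ss) (cp ss) (xc Q) (zc Q) = 0 \<longleftrightarrow> bs Q \<in> set ss"
proof (induction ss)
  case Nil thus ?case by (simp add: cp_def hf_one)
next
  case (Cons s ss) thus ?case unfolding hf_cp_Cons using lp_zero[of Q s] by auto
qed

definition rest :: "'a option \<Rightarrow> 'a option list \<Rightarrow> 'a option list" where "rest s ss = filter (\<lambda>t. t \<noteq> s) ss"

lemma hf_cp_split: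
  "hf (length ss) (cp ss) x z = hf 1 (lp s) x z ^ count_list ss s * hf (length (rest s ss)) (cp (rest s ss)) x z"
proof (induction ss)
  case Nil thus ?case by (simp add: rest_def cp_def)
next
  case (Cons t ss)
  show ?case
  proof (cases "t = s")
    case True
    hence "rest s (t # ss) = rest s ss" by (simp add: rest_def)
    thus ?thesis unfolding hf_cp_Cons Cons using True by (simp add: power_add mult_ac)
  next
    case False
    hence "rest s (t # ss) = t # rest s ss" by (simp add: rest_def)
    thus ?thesis unfolding hf_cp_Cons Cons using False by (simp add: hf_cp_Cons[simplified] mult_ac)
  qed
qed

lemma length_rest: "count_list ss s + length (rest s ss) = length ss"
  by (induction ss) (auto simp: rest_def)

lemma cp_ae: "ae (\<lambda>Q. hf (length ss) (cp ss) (xc Q) (zc Q) \<noteq> 0)"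
  by (rule hform_nz) (auto simp: deg_cp)

text \<open>Multiplying by the power of a uniformizer that the divisor prescribes clears the factor of the
  denominator that vanishes at the point.\<close>

lemma clear_denominator:
  assumes P: "P \<in> pts Cv" and H: "hom (length ss + e) H" and M: "M \<noteq> 0" "Polynomial.degree M \<le> e"
    and h: "ae (\<lambda>Q. h Q = val H Q / (hf (length ss) (cp ss) (xc Q) (zc Q) * hf e M (xc Q) (zc Q)))"
  obtains u c where "vl P u c" "c \<noteq> 0"
    "ae (\<lambda>Q. u Q * (t0 P Q powi fdiv ss P * h Q) = val H Q / (lg (bs P) Q ^ length ss * hf e M (xc Q) (zc Q)))"
proof -
  let ?s = "bs P"
  define k where "k = count_list ss ?s"
  define r where "r = rest ?s ss"
  have kr: "k + length r = length ss" unfolding k_def r_def by (rule length_rest)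
  obtain v c where v: "vl P v c" "c \<noteq> 0" "ae (\<lambda>Q. tN P Q = t0 P Q ^ ram P * v Q)" by (rule tN_t0[OF P]) (rule that)
  define u where "u Q = v Q ^ k * (hf (length r) (cp r) (xc Q) (zc Q) / lg ?s Q ^ length r)" for Q
  have lg0: "lg ?s P \<noteq> 0" using lo_nonzero[OF P] by simp
  have "vl P (\<lambda>Q. hf (length r) (cp r) (xc Q) (zc Q) / lg ?s Q ^ length r) (hf (length r) (cp r) (xc P) (zc P) / lg ?s P ^ length r)"
    using vl_frac[OF P hom_hform hom_lg_power[of "length r" ?s], of "cp r"] lg0 by simp
  hence u: "vl P u (c ^ k * (hf (length r) (cp r) (xc P) (zc P) / lg ?s P ^ length r))"
    unfolding u_def[abs_def] by (intro vl_mult vl_power v)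
  have u0: "c ^ k * (hf (length r) (cp r) (xc P) (zc P) / lg ?s P ^ length r) \<noteq> 0"
    using v(2) hf_cp_zero[OF P, of r] lg0 by (auto simp: r_def rest_def)
  have "ae (\<lambda>Q. h Q = val H Q / (hf (length ss) (cp ss) (xc Q) (zc Q) * hf e M (xc Q) (zc Q)) \<and> tN P Q = t0 P Q ^ ram P * v Q)"
    by (rule ae_conj[OF h v(3)])
  moreover have "ae (\<lambda>Q. lf ?s Q \<noteq> 0 \<and> lg ?s Q \<noteq> 0)" by (rule ae_conj[OF lf_ae lg_ae])
  ultimately have "ae (\<lambda>Q. u Q * (t0 P Q powi fdiv ss P * h Q) = val H Q / (lg ?s Q ^ length ss * hf e M (xc Q) (zc Q)))"
  proof (rule ae_mono3[OF _ _ cp_ae[of r]])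
    fix Q assume Q: "h Q = val H Q / (hf (length ss) (cp ss) (xc Q) (zc Q) * hf e M (xc Q) (zc Q)) \<and> tN P Q = t0 P Q ^ ram P * v Q"
      "lf ?s Q \<noteq> 0 \<and> lg ?s Q \<noteq> 0" "hf (length r) (cp r) (xc Q) (zc Q) \<noteq> 0"
    have pw: "t0 P Q powi fdiv ss P = (t0 P Q ^ ram P) ^ k"
      unfolding fdiv_def k_def power_mult[symmetric] by (rule power_int_of_nat)
    have "v Q ^ k * (t0 P Q ^ ram P) ^ k = tN P Q ^ k" using Q(1) by (simp add: power_mult_distrib mult.commute)
    also have "\<dots> = lf ?s Q ^ k / lg ?s Q ^ k" by (simp add: tN_def power_divide)
    finally have tk: "v Q ^ k * (t0 P Q ^ ram P) ^ k = lf ?s Q ^ k / lg ?s Q ^ k" .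
    have c: "hf (length ss) (cp ss) (xc Q) (zc Q) = lf ?s Q ^ k * hf (length r) (cp r) (xc Q) (zc Q)"
      unfolding k_def r_def by (rule hf_cp_split)
    have l: "lg ?s Q ^ length ss = lg ?s Q ^ k * lg ?s Q ^ length r" unfolding kr[symmetric] by (rule power_add)
    have "u Q * (t0 P Q powi fdiv ss P * h Q) =
       (v Q ^ k * (t0 P Q ^ ram P) ^ k) * (hf (length r) (cp r) (xc Q) (zc Q) / lg ?s Q ^ length r) * h Q"
      by (simp add: u_def pw mult_ac)
    also have "\<dots> = val H Q / (lg ?s Q ^ length ss * hf e M (xc Q) (zc Q))"
      unfolding tk l using Q c by simp
    finally show "u Q * (t0 P Q powi fdiv ss P * h Q) = val H Q / (lg ?s Q ^ length ss * hf e M (xc Q) (zc Q))" .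
  qed
  thus ?thesis using that[OF u u0] by blast
qed

lemma rr_fdiv_lower:
  assumes H: "hom (length ss) H" and h: "ae (\<lambda>Q. h Q = val H Q / hf (length ss) (cp ss) (xc Q) (zc Q))"
  shows "rr (fdiv ss) h"
  unfolding rr_def
proof (intro conjI ballI)
  show "rational Cv h" unfolding rational_frac
    using H hom_hform[of "length ss" "cp ss"] ae_conj[OF cp_ae h] by (intro exI[of _ "length ss"] exI[of _ H] exI[of _ "hform (length ss) (cp ss)"]) simp
  fix P assume P: "P \<in> pts Cv"
  have H': "hom (length ss + 0) H" using H by simp
  have h': "ae (\<lambda>Q. h Q = val H Q / (hf (length ss) (cp ss) (xc Q) (zc Q) * hf 0 1 (xc Q) (zc Q)))" using h by (simp add: hf_one)
  obtain u c where u: "vl P u c" "c \<noteq> 0"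
    and eq: "ae (\<lambda>Q. u Q * (t0 P Q powi fdiv ss P * h Q) = val H Q / (lg (bs P) Q ^ length ss * hf 0 1 (xc Q) (zc Q)))"
    by (rule clear_denominator[OF P H' _ _ h']) (auto intro: that)
  have "vl P (\<lambda>Q. val H Q / val (hform 1 (lo (bs P)) ^ length ss) Q) (val H P / val (hform 1 (lo (bs P)) ^ length ss) P)"
    using lo_nonzero[OF P] by (intro vl_frac[OF P H hom_lg_power]) simp
  from vl_mult[OF vl_inverse(1)[OF u] this]
  obtain c' where c': "vl P (\<lambda>Q. inverse (u Q) * (val H Q / val (hform 1 (lo (bs P)) ^ length ss) Q)) c'" by blast
  have "ae (\<lambda>Q. t0 P Q powi fdiv ss P * h Q = inverse (u Q) * (val H Q / val (hform 1 (lo (bs P)) ^ length ss) Q))"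
  proof (rule ae_mono2[OF eq vl_inverse(2)[OF u]])
    fix Q assume Q: "u Q * (t0 P Q powi fdiv ss P * h Q) = val H Q / (lg (bs P) Q ^ length ss * hf 0 1 (xc Q) (zc Q))" "u Q \<noteq> 0"
    have "t0 P Q powi fdiv ss P * h Q = inverse (u Q) * (u Q * (t0 P Q powi fdiv ss P * h Q))" using Q(2) by simp
    thus "t0 P Q powi fdiv ss P * h Q = inverse (u Q) * (val H Q / val (hform 1 (lo (bs P)) ^ length ss) Q)"
      unfolding Q(1) by (simp add: hf_one)
  qed
  from vl_cong[OF c' this] show "\<exists>c. vl P (\<lambda>Q. t0 P Q powi fdiv ss P * h Q) c" by (rule exI)
qed

text \<open>The denominator is made a binary form by multiplying with its conjugate.\<close>

lemma rational_normal:
  assumes "rational Cv h"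
  obtains e a b M where "okp e a b" "M \<noteq> 0" "Polynomial.degree M \<le> e" "ae (\<lambda>Q. h Q = val (el e a b) Q / hf e M (xc Q) (zc Q))"
proof -
  obtain d H G where 1: "hom d H" "hom d G" "ae (\<lambda>Q. val G Q \<noteq> 0 \<and> h Q = val H Q / val G Q)"
    using assms unfolding rational_frac by blast
  obtain a b where ab: "okp d a b" "\<And>P. P \<in> pts Cv \<Longrightarrow> val H P = val (el d a b) P"
    by (rule hom_el_ex[OF 1(1)]) (rule that)
  obtain a' b' where ab': "okp d a' b'" "\<And>P. P \<in> pts Cv \<Longrightarrow> val G P = val (el d a' b') P"
    by (rule hom_el_ex[OF 1(2)]) (rule that)
  obtain P where P: "P \<in> pts Cv" "val G P \<noteq> 0" using ae_ex[OF 1(3)] by blast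
  have ne: "a' \<noteq> 0 \<or> b' \<noteq> 0" using P ab'(2) by (auto simp: val_el)
  define M where "M = a'\<^sup>2 - b'\<^sup>2 * p"
  have M: "M \<noteq> 0" "Polynomial.degree M \<le> 2 * d" using norm_nonzero[OF ne] el_norm(2)[OF ab'(1) P(1)] by (auto simp: M_def)
  note okm = okp_uminus[OF ab'(1)]
  define A B where "A = a * a' + b * (- b') * p" and "B = a * (- b') + a' * b"
  have okAB: "okp (2 * d) A B" using el_mult(2)[OF ab(1) okm P(1)] by (simp add: A_def B_def mult_2)
  have "ae (\<lambda>Q. h Q = val (el (2 * d) A B) Q / hf (2 * d) M (xc Q) (zc Q))"
  proof (rule ae_mono2[OF 1(3) hform_nz[OF M]])
    fix Q assume Q: "Q \<in> pts Cv" "val G Q \<noteq> 0 \<and> h Q = val H Q / val G Q" "hf (2 * d) M (xc Q) (zc Q) \<noteq> 0"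
    have 2: "val G Q * val (el d a' (- b')) Q = hf (2 * d) M (xc Q) (zc Q)"
      using el_norm(1)[OF ab'(1) Q(1)] ab'(2)[OF Q(1)] by (simp add: M_def)
    have 3: "val H Q * val (el d a' (- b')) Q = val (el (2 * d) A B) Q"
      using el_mult(1)[OF ab(1) okm Q(1)] ab(2)[OF Q(1)] by (simp add: A_def B_def mult_2)
    have "val (el d a' (- b')) Q \<noteq> 0" using 2 Q(3) by auto
    thus "h Q = val (el (2 * d) A B) Q / hf (2 * d) M (xc Q) (zc Q)"
      unfolding 2[symmetric] 3[symmetric] using Q(2) by simp
  qed
  thus ?thesis using that[OF okAB M] by blast
qed

lemma val_el_pt:
  assumes ok: "okp d a b" and y: "y\<^sup>2 = hf (2 * w) p (nx s) (nz s)"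
  shows "val (el d a b) (pt (nx s) (nz s) y) = 0 \<longleftrightarrow> hf d a (nx s) (nz s) + y * hf (d - w) b (nx s) (nz s) = 0"
proof -
  obtain c where c: "c \<noteq> 0" "xc (pt (nx s) (nz s) y) = c * nx s" "zc (pt (nx s) (nz s) y) = c * nz s" "yc (pt (nx s) (nz s) y) = c ^ w * y"
    by (rule pt_coords[OF n_nz y]) (rule that)
  have "val (el d a b) (pt (nx s) (nz s) y) = c ^ d * (hf d a (nx s) (nz s) + y * hf (d - w) b (nx s) (nz s))"
  proof (cases "b = 0")
    case True thus ?thesis by (simp add: val_el c hf_scale)
  next
    case False
    hence "c ^ d = c ^ w * c ^ (d - w)" using ok by (simp add: okp_def power_add[symmetric])
    thus ?thesis by (simp add: val_el c hf_scale algebra_simps)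
  qed
  thus ?thesis using c(1) by simp
qed

text \<open>Regularity at all points above \<open>s\<close> makes \<open>A + B y\<close> divisible by the linear form of \<open>s\<close>. If two points lie above \<open>s\<close>, then
  \<open>A + B y\<close> and \<open>A - B y\<close> both vanish at one of them, so \<open>A\<close> and \<open>B\<close> do. If there is only one, \<open>y\<close> vanishes to the first order
  and the linear form to the second.\<close>

lemma divide_linear_form:
  assumes ok: "okp d a b" and d: "d \<ge> 1"
    and reg: "\<And>P. P \<in> pts Cv \<Longrightarrow> bs P = s \<Longrightarrow> \<exists>c. vl P (\<lambda>Q. val (el d a b) Q / (lf s Q * lg s Q ^ (d - 1))) c"
  obtains a' b' where "okp (d - 1) a' b'" "\<And>Q. Q \<in> pts Cv \<Longrightarrow> val (el d a b) Q = lf s Q * val (el (d - 1) a' b') Q"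
proof -
  have ok': "Polynomial.degree a \<le> d" "Polynomial.degree b \<le> d - w" "b \<noteq> 0 \<Longrightarrow> d \<ge> w" using ok by (auto simp: okp_def)
  have zero: "val (el d a b) P = 0" if P: "P \<in> pts Cv" "bs P = s" for P
  proof -
    obtain c where c: "vl P (\<lambda>Q. val (el d a b) Q / (lf s Q * lg s Q ^ (d - 1))) c" using reg[OF P] by blast
    have lg0: "lg s P \<noteq> 0" using lo_nonzero[OF P] .
    have dd: "lg s Q ^ d = lg s Q * lg s Q ^ (d - 1)" for Q using d by (simp add: power_Suc[symmetric] del: power_Suc)
    have "ae (\<lambda>Q. val (el d a b) Q / lg s Q ^ d = tN P Q * (val (el d a b) Q / (lf s Q * lg s Q ^ (d - 1))))"
      by (rule ae_mono2[OF lf_ae[of s] lg_ae[of s]]) (simp add: tN_def P(2) dd)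
    from vl_cong[OF vl_mult[OF tN_vl[OF P(1)] c] this]
    have "vl P (\<lambda>Q. val (el d a b) Q / lg s Q ^ d) 0" by simp
    moreover have "vl P (\<lambda>Q. val (el d a b) Q / lg s Q ^ d) (val (el d a b) P / lg s P ^ d)"
      using vl_frac[OF P(1) hom_el[OF ok] hom_lg_power[of d s]] lg0 by simp
    ultimately have "val (el d a b) P / lg s P ^ d = 0" using vl_unique by blast
    thus ?thesis using lg0 by simp
  qed
  obtain y where y: "y\<^sup>2 = hf (2 * w) p (nx s) (nz s)" using sqrt_exists by blast
  define P where "P = pt (nx s) (nz s) y"
  have P: "P \<in> pts Cv" "bs P = s" unfolding P_def by (rule pt_in[OF n_nz y], rule bs_pt[OF y])
  have z1: "hf d a (nx s) (nz s) + y * hf (d - w) b (nx s) (nz s) = 0"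
    using zero[OF P] val_el_pt[OF ok y] by (simp add: P_def)
  have my: "(- y)\<^sup>2 = hf (2 * w) p (nx s) (nz s)" using y by simp
  have z2: "hf d a (nx s) (nz s) - y * hf (d - w) b (nx s) (nz s) = 0"
    using zero[OF pt_in[OF n_nz my] bs_pt[OF my]] val_el_pt[OF ok my] by simp
  have "2 * hf d a (nx s) (nz s) = (hf d a (nx s) (nz s) + y * hf (d - w) b (nx s) (nz s)) + (hf d a (nx s) (nz s) - y * hf (d - w) b (nx s) (nz s))"
    by simp
  hence a0: "hf d a (nx s) (nz s) = 0" unfolding z1 z2 using two by simp
  obtain a' where a': "a = lp s * a'" "Polynomial.degree a' \<le> d - 1" by (rule hf_root[OF ok'(1) a0])
  have b0: "hf (d - w) b (nx s) (nz s) = 0"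
  proof (cases "y = 0")
    case False thus ?thesis using z1 a0 by simp
  next
    case True
    show ?thesis
    proof (rule ccontr)
      \<comment> \<open>At a branch point only one point lies above \<open>s\<close>. There \<open>k = B y / l\<close> would be regular, but \<open>k\<^sup>2 l = B\<^sup>2 p\<^sub>1\<close>
        does not vanish.\<close>
      assume bn: "hf (d - w) b (nx s) (nz s) \<noteq> 0"
      hence b: "b \<noteq> 0" by auto
      have dw: "d \<ge> w" using ok'(3)[OF b] .
      obtain c0 where "yc P = c0 ^ w * y" unfolding P_def by (rule pt_coords[OF n_nz y]) blast
      hence yP: "yc P = 0" using True by simp
      obtain p1 where p1: "p = lp s * p1" "Polynomial.degree p1 \<le> 2 * w - 1" "hf (2 * w - 1) p1 (xc P) (zc P) \<noteq> 0"
        using branch_factor[OF P(1) yP] P(2) by blast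
      have lg0: "lg s P \<noteq> 0" using lo_nonzero[OF P] .
      obtain c where c: "vl P (\<lambda>Q. val (el d a b) Q / (lf s Q * lg s Q ^ (d - 1))) c" using reg[OF P] by blast
      have va: "vl P (\<lambda>Q. hf (d - 1) a' (xc Q) (zc Q) / lg s Q ^ (d - 1)) (hf (d - 1) a' (xc P) (zc P) / lg s P ^ (d - 1))" (is "vl P ?va ?ca")
        using vl_frac[OF P(1) hom_hform hom_lg_power[of "d - 1" s], of a'] lg0 by simp
      define k where "k Q = val (el d a b) Q / (lf s Q * lg s Q ^ (d - 1)) + (- 1) * ?va Q" for Q
      have vk: "vl P k (c + (- 1) * ?ca)" unfolding k_def[abs_def] by (intro vl_add vl_mult vl_const P c va)
      let ?K = "hform (2 * w - 1) p1 * hform (d - w) b ^ 2"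
      have hk: "hom (2 * d - 1) ?K"
        by (rule homogeneous_mult'[OF hom_hform homogeneous_power[OF hom_hform]]) (use dw w in auto)
      have v1: "vl P (\<lambda>Q. val ?K Q / val (hform 1 (lo s) ^ (2 * d - 1)) Q) (val ?K P / val (hform 1 (lo s) ^ (2 * d - 1)) P)"
        by (rule vl_frac[OF P(1) hk hom_lg_power]) (use lg0 in simp)
      have "ae (\<lambda>Q. val ?K Q / val (hform 1 (lo s) ^ (2 * d - 1)) Q = k Q ^ 2 * tN P Q)"
      proof (rule ae_mono2[OF lf_ae[of s] lg_ae[of s]])
        fix Q assume Q: "Q \<in> pts Cv" "lf s Q \<noteq> 0" "lg s Q \<noteq> 0"
        have y2: "(yc Q)\<^sup>2 = lf s Q * hf (2 * w - 1) p1 (xc Q) (zc Q)"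
          using yc_sq[OF Q(1)] hf_lp_mult[OF p1(2), of s] w unfolding p1(1)[symmetric] by simp
        have "hf d a (xc Q) (zc Q) = lf s Q * hf (d - 1) a' (xc Q) (zc Q)"
          unfolding a'(1) by (rule hf_lp_mult[OF a'(2) d])
        hence kq: "k Q = yc Q * hf (d - w) b (xc Q) (zc Q) / (lf s Q * lg s Q ^ (d - 1))"
          using Q(2,3) by (simp add: k_def val_el add_divide_distrib)
        have e: "(2 * d - 1) = 1 + (d - 1) * 2" using d by simp
        have "lg s Q ^ (2 * d - 1) = lg s Q * (lg s Q ^ (d - 1))\<^sup>2" unfolding e power_add power_mult by simp
        thus "val ?K Q / val (hform 1 (lo s) ^ (2 * d - 1)) Q = k Q ^ 2 * tN P Q"
          using Q(2,3) unfolding kq power_divide power_mult_distrib y2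
          by (simp add: tN_def P(2) power2_eq_square)
      qed
      from vl_cong[OF vl_mult[OF vl_power[OF vk] tN_vl[OF P(1)]] this]
      have "vl P (\<lambda>Q. val ?K Q / val (hform 1 (lo s) ^ (2 * d - 1)) Q) 0" by simp
      hence "val ?K P / val (hform 1 (lo s) ^ (2 * d - 1)) P = 0" using vl_unique v1 by blast
      thus False using p1(3) lg0 bn hf_coords[OF P] by simp
    qed
  qed
  show ?thesis by (rule el_divide[OF ok d a0 b0]) (rule that)
qed

lemma poly_form_root:
  assumes "Polynomial.degree M \<le> e" "e \<ge> 1" obtains s where "hf e M (nx s) (nz s) = 0"
proof (cases "Polynomial.coeff M e = 0")
  case True thus ?thesis using that[of None] by (simp add: nx_def nz_def hf_z0)
next
  case False
  hence "Polynomial.degree M = e" using assms(1) le_degree[of M e] by simp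
  then obtain r where "poly M r = 0" using alg_closed_imp_poly_has_root[of M] assms(2) by auto
  thus ?thesis using that[of "Some r"] assms(1) by (simp add: nx_def nz_def hf_1)
qed

text \<open>An element of the Riemann-Roch space is written with an additional factor \<open>M\<close> in the denominator, and the linear
  factors of \<open>M\<close> are cancelled one at a time: the function is regular up to the pole that the divisor allows.\<close>

lemma rr_fdiv_upper:
  assumes h: "rr (fdiv ss) h"
  obtains a b where "okp (length ss) a b" "ae (\<lambda>Q. h Q = val (el (length ss) a b) Q / hf (length ss) (cp ss) (xc Q) (zc Q))"
proof -
  let ?N = "length ss"
  have main: "\<exists>a b. okp ?N a b \<and> ae (\<lambda>Q. h Q = val (el ?N a b) Q / hf ?N (cp ss) (xc Q) (zc Q))"
    if "okp (?N + e) a b" "M \<noteq> 0" "Polynomial.degree M \<le> e"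
      "ae (\<lambda>Q. h Q = val (el (?N + e) a b) Q / (hf ?N (cp ss) (xc Q) (zc Q) * hf e M (xc Q) (zc Q)))" for e a b M
    using that
  proof (induction e arbitrary: a b M)
    case 0
    define c where "c = Polynomial.coeff M 0"
    have c: "hf 0 M x z = c" "c \<noteq> 0" for x z
      using 0 leading_coeff_0_iff[of M] by (auto simp: hf_def c_def)
    have "okp ?N (Polynomial.smult (inverse c) a) (Polynomial.smult (inverse c) b)" using 0(1) c by (auto simp: okp_def)
    moreover have "ae (\<lambda>Q. h Q = val (el ?N (Polynomial.smult (inverse c) a) (Polynomial.smult (inverse c) b)) Q / hf ?N (cp ss) (xc Q) (zc Q))"
      by (rule ae_mono[OF 0(4)]) (simp add: val_el hf_smult c field_simps)
    ultimately show ?case by blast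
  next
    case (Suc e)
    obtain s where s: "hf (Suc e) M (nx s) (nz s) = 0" by (rule poly_form_root[OF Suc(4)]) (simp, rule that)
    obtain M' where M': "M = lp s * M'" "Polynomial.degree M' \<le> e" using hf_root[OF Suc(4) s] by auto
    have M'0: "M' \<noteq> 0" using Suc(3) M' by auto
    have hM: "hf (Suc e) M x z = hf 1 (lp s) x z * hf e M' x z" for x z
      using hf_lp_mult[of M' "Suc e" s x z] M' by simp
    let ?d = "?N + Suc e"
    have reg: "\<exists>c. vl P (\<lambda>Q. val (el ?d a b) Q / (lf s Q * lg s Q ^ (?d - 1))) c" if P: "P \<in> pts Cv" "bs P = s" for P
    proof -
      obtain u c where u: "vl P u c" "c \<noteq> 0" and
        eq: "ae (\<lambda>Q. u Q * (t0 P Q powi fdiv ss P * h Q) = val (el ?d a b) Q / (lg (bs P) Q ^ ?N * hf (Suc e) M (xc Q) (zc Q)))"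
        by (rule clear_denominator[OF P(1) hom_el[OF Suc(2)] Suc(3,4,5)]) (rule that)
      obtain c1 where c1: "vl P (\<lambda>Q. t0 P Q powi fdiv ss P * h Q) c1" using h P(1) unfolding rr_def by blast
      have lg0: "lg s P \<noteq> 0" using lo_nonzero[OF P] .
      have v: "vl P (\<lambda>Q. hf e M' (xc Q) (zc Q) / lg s Q ^ e) (hf e M' (xc P) (zc P) / lg s P ^ e)"
        using vl_frac[OF P(1) hom_hform hom_lg_power[of e s], of M'] lg0 by simp
      have "ae (\<lambda>Q. val (el ?d a b) Q / (lf s Q * lg s Q ^ (?d - 1)) =
          u Q * (t0 P Q powi fdiv ss P * h Q) * (hf e M' (xc Q) (zc Q) / lg s Q ^ e))"
      proof (rule ae_mono3[OF eq lf_ae[of s] ae_conj[OF lg_ae[of s] hform_nz[OF M'0 M'(2)]]])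
        fix Q assume Q: "Q \<in> pts Cv" and 1: "u Q * (t0 P Q powi fdiv ss P * h Q) = val (el ?d a b) Q / (lg (bs P) Q ^ ?N * hf (Suc e) M (xc Q) (zc Q))"
          and 2: "lf s Q \<noteq> 0" "lg s Q \<noteq> 0 \<and> hf e M' (xc Q) (zc Q) \<noteq> 0"
        have e: "lg s Q ^ (?d - 1) = lg s Q ^ ?N * lg s Q ^ e" by (simp add: power_add)
        show "val (el ?d a b) Q / (lf s Q * lg s Q ^ (?d - 1)) = u Q * (t0 P Q powi fdiv ss P * h Q) * (hf e M' (xc Q) (zc Q) / lg s Q ^ e)"
          unfolding 1 P(2) hM e using 2 by simp
      qed
      from vl_cong[OF vl_mult[OF vl_mult[OF u(1) c1] v] this] show ?thesis by (rule exI)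
    qed
    obtain a' b' where ab: "okp (?d - 1) a' b'" "\<And>Q. Q \<in> pts Cv \<Longrightarrow> val (el ?d a b) Q = lf s Q * val (el (?d - 1) a' b') Q"
      by (rule divide_linear_form[OF Suc(2) _ reg]) (auto intro: that)
    have "ae (\<lambda>Q. h Q = val (el (?N + e) a' b') Q / (hf ?N (cp ss) (xc Q) (zc Q) * hf e M' (xc Q) (zc Q)))"
    proof (rule ae_mono2[OF Suc(5) lf_ae[of s]])
      fix Q assume Q: "Q \<in> pts Cv" "h Q = val (el ?d a b) Q / (hf ?N (cp ss) (xc Q) (zc Q) * hf (Suc e) M (xc Q) (zc Q))" "lf s Q \<noteq> 0"
      have e: "?d - 1 = ?N + e" by simp
      show "h Q = val (el (?N + e) a' b') Q / (hf ?N (cp ss) (xc Q) (zc Q) * hf e M' (xc Q) (zc Q))"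
        unfolding Q(2) ab(2)[OF Q(1)] hM e using Q(3) by simp
    qed
    moreover have "okp (?N + e) a' b'" using ab(1) by simp
    ultimately show ?case using Suc(1)[OF _ M'0 M'(2)] by blast
  qed
  have "rational Cv h" using h unfolding rr_def by blast
  then obtain e a b M where ok: "okp e a b" and M: "M \<noteq> 0" "Polynomial.degree M \<le> e"
    and eq: "ae (\<lambda>Q. h Q = val (el e a b) Q / hf e M (xc Q) (zc Q))" by (rule rational_normal) (rule that)
  obtain P where P: "P \<in> pts Cv" using fibre_nonempty by blast
  have okc: "okp ?N (cp ss) 0" using deg_cp by (simp add: okp_def)
  have ok2: "okp (?N + e) (cp ss * a) (cp ss * b)" using el_mult(2)[OF okc ok P] by simp
  have "ae (\<lambda>Q. h Q = val (el (?N + e) (cp ss * a) (cp ss * b)) Q / (hf ?N (cp ss) (xc Q) (zc Q) * hf e M (xc Q) (zc Q)))"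
  proof (rule ae_mono2[OF eq cp_ae[of ss]])
    fix Q assume Q: "Q \<in> pts Cv" "h Q = val (el e a b) Q / hf e M (xc Q) (zc Q)" "hf ?N (cp ss) (xc Q) (zc Q) \<noteq> 0"
    have "hf ?N (cp ss) (xc Q) (zc Q) * val (el e a b) Q = val (el (?N + e) (cp ss * a) (cp ss * b)) Q"
      using el_mult(1)[OF okc ok Q(1)] by (simp add: val_el[of ?N "cp ss" 0])
    thus "h Q = val (el (?N + e) (cp ss * a) (cp ss * b)) Q / (hf ?N (cp ss) (xc Q) (zc Q) * hf e M (xc Q) (zc Q))"
      using Q(2,3) by (simp flip: \<open>_ = val (el (?N + e) (cp ss * a) (cp ss * b)) Q\<close>)
  qed
  from main[OF ok2 M this] show ?thesis using that by blast
qed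

end

context hyp_curve
begin

lemma pt_inj: "pt (nx s) (nz s) y = pt (nx s) (nz s) y' \<Longrightarrow> y = y'"
proof -
  assume eq: "pt (nx s) (nz s) y = pt (nx s) (nz s) y'"
  have "vec3 (1 * nx s) (1 * nz s) (1 ^ w * y) \<in> pt (nx s) (nz s) y" unfolding pt_alt by (intro CollectI exI[of _ 1]) simp
  hence "vec3 (nx s) (nz s) y \<in> pt (nx s) (nz s) y'" using eq by simp
  then obtain c where c: "vec3 (nx s) (nz s) y = vec3 (c * nx s) (c * nz s) (c ^ w * y')" unfolding pt_alt by blast
  have "nx s = c * nx s" "nz s = c * nz s" "y = c ^ w * y'"
    using fun_cong[OF c, of 0] fun_cong[OF c, of 1] fun_cong[OF c, of 2] by (auto simp: vec3_def)
  moreover have "c = 1" using calculation n_nz[of s] by auto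
  ultimately show "y = y'" by simp
qed

lemma ram_pt:
  assumes "y\<^sup>2 = hf (2 * w) p (nx s) (nz s)"
  shows "ram (pt (nx s) (nz s) y) = (if y = 0 then 2 else 1)"
proof -
  obtain c where "c \<noteq> 0" "yc (pt (nx s) (nz s) y) = c ^ w * y" by (rule pt_coords[OF n_nz assms]) (rule that)
  thus ?thesis by (simp add: ram_def)
qed

text \<open>A fibre consists of two points or of one ramified point.\<close>

lemma fibre_degree: "(\<Sum>P\<in>{P \<in> pts Cv. bs P = s}. ram P) = 2"
proof -
  obtain y where y: "y\<^sup>2 = hf (2 * w) p (nx s) (nz s)" using sqrt_exists by blast
  have S: "{z. z\<^sup>2 = hf (2 * w) p (nx s) (nz s)} = {y, - y}"
    unfolding y[symmetric] by (auto simp: power2_eq_iff)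
  have "(\<Sum>P\<in>{P \<in> pts Cv. bs P = s}. ram P) = (\<Sum>z\<in>{y, - y}. ram (pt (nx s) (nz s) z))"
    unfolding fibre S by (subst sum.reindex) (auto intro: inj_onI pt_inj)
  also have "\<dots> = (\<Sum>z\<in>{y, - y}. if z = 0 then 2 else 1)"
  proof (rule sum.cong)
    fix z assume "z \<in> {y, - y}"
    hence "z\<^sup>2 = hf (2 * w) p (nx s) (nz s)" using S by blast
    thus "ram (pt (nx s) (nz s) z) = (if z = 0 then 2 else 1)" by (rule ram_pt)
  qed simp
  also have "\<dots> = 2"
  proof (cases "y = 0")
    case False
    hence "y \<noteq> - y" using two by (metis add_eq_0_iff mult_2 mult_eq_0_iff)
    thus ?thesis using False by simp
  qed simp
  finally show ?thesis .
qed

lemma fdiv_zero: "P \<in> pts Cv \<Longrightarrow> fdiv ss P \<noteq> 0 \<longleftrightarrow> bs P \<in> set ss"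
  by (auto simp: fdiv_def ram_def count_list_0_iff)

lemma fdiv_divisor: "is_divisor Cv (fdiv ss)"
  unfolding is_divisor_def using finite_over[of "set ss"] by (rule finite_subset[rotated]) (auto simp: fdiv_zero)

lemma sum_fdiv:
  assumes "finite T" "T \<subseteq> pts Cv" "{P \<in> pts Cv. bs P \<in> set ss} \<subseteq> T"
  shows "(\<Sum>P\<in>T. fdiv ss P) = 2 * int (length ss)"
proof -
  have "(\<Sum>P\<in>T. fdiv ss P) = (\<Sum>P\<in>{P \<in> pts Cv. bs P \<in> set ss}. fdiv ss P)"
    using assms fdiv_zero[of _ ss] by (intro sum.mono_neutral_right) auto
  also have "{P \<in> pts Cv. bs P \<in> set ss} = (\<Union>s\<in>set ss. {P \<in> pts Cv. bs P = s})" by auto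
  also have "(\<Sum>P\<in>(\<Union>s\<in>set ss. {P \<in> pts Cv. bs P = s}). fdiv ss P) = (\<Sum>s\<in>set ss. \<Sum>P\<in>{P \<in> pts Cv. bs P = s}. fdiv ss P)"
    by (rule sum.UNION_disjoint) (auto simp: finite_fibre)
  also have "\<dots> = (\<Sum>s\<in>set ss. int (count_list ss s * (\<Sum>P\<in>{P \<in> pts Cv. bs P = s}. ram P)))"
    by (intro sum.cong refl) (simp add: fdiv_def sum_distrib_left mult.commute)
  also have "\<dots> = int (2 * (\<Sum>s\<in>set ss. count_list ss s))" by (simp add: fibre_degree sum_distrib_left mult.commute)
  also have "\<dots> = 2 * int (length ss)" by (simp add: sum_count_set)
  finally show ?thesis .
qed

lemma fdiv_degree: "divisor_degree Cv (fdiv ss) = 2 * int (length ss)"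
  unfolding divisor_degree_def
  using fdiv_divisor[of ss] fdiv_zero by (intro sum_fdiv) (auto simp: is_divisor_def)

lemma effective_le_fdiv:
  assumes "finite T" "T \<subseteq> pts Cv"
  obtains ss where "length ss = (\<Sum>P\<in>T. m P)" "\<And>P. P \<in> T \<Longrightarrow> int (m P) \<le> fdiv ss P"
proof -
  have "\<exists>ss. length ss = (\<Sum>P\<in>T. m P) \<and> (\<forall>P\<in>T. m P \<le> count_list ss (bs P))"
    using assms
  proof (induction T rule: finite_induct)
    case (insert P T)
    then obtain ss where ss: "length ss = (\<Sum>P\<in>T. m P)" "\<forall>P\<in>T. m P \<le> count_list ss (bs P)" by auto
    have c: "count_list (replicate n s) t = (if s = t then n else 0)" for n t and s :: "'a option" by (induction n) auto
    show ?case using insert ss by (intro exI[of _ "replicate (m P) (bs P) @ ss"]) (auto simp: c)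
  qed simp
  then obtain ss where ss: "length ss = (\<Sum>P\<in>T. m P)" "\<forall>P\<in>T. m P \<le> count_list ss (bs P)" by blast
  have "int (m P) \<le> fdiv ss P" if "P \<in> T" for P
  proof -
    have "m P \<le> ram P * count_list ss (bs P)" using ss(2) that by (auto simp: ram_def)
    thus ?thesis unfolding fdiv_def by (simp only: of_nat_le_iff)
  qed
  thus ?thesis using that ss(1) by blast
qed

lemma sum_lessThan_split: "(\<Sum>j<m + n. g j) = (\<Sum>j<m. g j) + (\<Sum>i<n. g (m + i))" for g :: "nat \<Rightarrow> 'b::comm_monoid_add"
  by (induction n) (auto simp: ac_simps)

lemma coeff_sum_monom: "Polynomial.coeff (\<Sum>j<n. Polynomial.monom (c j) j) i = (if i < n then c i else 0)"
  by (simp add: coeff_sum sum.delta)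

text \<open>A basis is given by \<open>x\<^sup>j z\<^bsup>N - j\<^esup>\<close> and \<open>y x\<^sup>i z\<^bsup>N - w - i\<^esup>\<close>, divided by the product of the linear forms.\<close>

lemma riemann_roch_dim_fdiv:
  assumes N: "length ss = N" "w \<le> N + 1"
  shows "riemann_roch_dim Cv (fdiv ss) ((N + 1) + (N + 1 - w))"
proof -
  define B where "B j = (if j < N + 1 then el N (Polynomial.monom 1 j) 0 else el N 0 (Polynomial.monom 1 (j - (N + 1))))" for j
  define b where "b j Q = val (B j) Q / hf N (cp ss) (xc Q) (zc Q)" for j Q
  define l where "l = (N + 1) + (N + 1 - w)"
  have okB: "hom N (B j)" if "j < l" for j
  proof (cases "j < N + 1")
    case True
    thus ?thesis unfolding B_def by (simp, intro hom_el) (auto simp: okp_def degree_monom_eq)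
  next
    case False
    hence "j - (N + 1) + w \<le> N" using that N(2) unfolding l_def by linarith
    thus ?thesis unfolding B_def using False by (simp, intro hom_el) (auto simp: okp_def degree_monom_eq)
  qed
  have valB: "val (B j) Q = xc Q ^ j * zc Q ^ (N - j)" if "j < N + 1" for j Q
    using that by (simp add: B_def val_el hf_monom)
  have valB': "val (B (N + 1 + i)) Q = yc Q * (xc Q ^ i * zc Q ^ (N - w - i))" if "i < N + 1 - w" for i Q
    using that by (simp add: B_def val_el hf_monom)
  have expand: "val (el N a b') Q = (\<Sum>j<l. (if j < N + 1 then Polynomial.coeff a j else Polynomial.coeff b' (j - (N + 1))) * val (B j) Q)"
    if "okp N a b'" for a b' Q
  proof -
    have "(\<Sum>j<l. (if j < N + 1 then Polynomial.coeff a j else Polynomial.coeff b' (j - (N + 1))) * val (B j) Q)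
      = (\<Sum>j<N + 1. Polynomial.coeff a j * (xc Q ^ j * zc Q ^ (N - j))) + (\<Sum>i<N + 1 - w. Polynomial.coeff b' i * (yc Q * (xc Q ^ i * zc Q ^ (N - w - i))))"
      unfolding l_def sum_lessThan_split
      by (intro arg_cong2[where f="(+)"] sum.cong) (auto simp: valB valB'[simplified])
    also have "(\<Sum>j<N + 1. Polynomial.coeff a j * (xc Q ^ j * zc Q ^ (N - j))) = hf N a (xc Q) (zc Q)"
    proof -
      have "{..<N + 1} = {..N}" by auto
      thus ?thesis by (simp add: hf_def mult.assoc)
    qed
    also have "(\<Sum>i<N + 1 - w. Polynomial.coeff b' i * (yc Q * (xc Q ^ i * zc Q ^ (N - w - i)))) = yc Q * hf (N - w) b' (xc Q) (zc Q)"
    proof (cases "b' = 0")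
      case False
      hence "N + 1 - w = Suc (N - w)" using that by (auto simp: okp_def)
      thus ?thesis by (simp add: hf_def lessThan_Suc_atMost sum_distrib_left mult_ac)
    qed simp
    finally show ?thesis by (simp add: val_el)
  qed
  show ?thesis unfolding riemann_roch_dim_def l_def[symmetric]
  proof (intro exI[of _ b] conjI allI impI ballI)
    fix j assume "j < l"
    thus "b j \<in> riemann_roch_space Cv (fdiv ss)" unfolding riemann_roch_space_rr
      using rr_fdiv_lower[of ss "B j" "b j"] okB N(1) by (auto simp: b_def intro: ae_all)
  next
    fix h assume "h \<in> riemann_roch_space Cv (fdiv ss)"
    hence "rr (fdiv ss) h" by (simp add: riemann_roch_space_rr)
    then obtain a b' where ab: "okp N a b'" "ae (\<lambda>Q. h Q = val (el N a b') Q / hf N (cp ss) (xc Q) (zc Q))"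
      using rr_fdiv_upper[of ss h] N(1) by metis
    show "\<exists>c. geneq Cv h (\<lambda>Q. \<Sum>j<l. c j * b j Q)"
    proof (rule exI)
      show "geneq Cv h (\<lambda>Q. \<Sum>j<l. (if j < N + 1 then Polynomial.coeff a j else Polynomial.coeff b' (j - (N + 1))) * b j Q)"
        unfolding geneq_ae
      proof (rule ae_mono[OF ab(2)])
        fix Q assume Q: "h Q = val (el N a b') Q / hf N (cp ss) (xc Q) (zc Q)"
        show "h Q = (\<Sum>j<l. (if j < N + 1 then Polynomial.coeff a j else Polynomial.coeff b' (j - (N + 1))) * b j Q)"
          unfolding Q expand[OF ab(1)] b_def sum_divide_distrib by (rule sum.cong) (simp_all only: times_divide_eq_right)
      qed
    qed
  next
    fix c j assume "geneq Cv (\<lambda>Q. \<Sum>j<l. c j * b j Q) (\<lambda>_. 0)" "j < l"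
    hence ae0: "ae (\<lambda>Q. (\<Sum>j<l. c j * b j Q) = 0)" by (simp add: geneq_ae)
    define a where "a = (\<Sum>j<N + 1. Polynomial.monom (c j) j)"
    define b' where "b' = (\<Sum>i<N + 1 - w. Polynomial.monom (c (N + 1 + i)) i)"
    have ca: "Polynomial.coeff a i = (if i < N + 1 then c i else 0)"
      and cb: "Polynomial.coeff b' i = (if i < N + 1 - w then c (N + 1 + i) else 0)" for i
      unfolding a_def b'_def by (rule coeff_sum_monom)+
    have "Polynomial.degree a \<le> N" by (rule degree_le) (simp add: ca)
    moreover have "b' = 0 \<or> Polynomial.degree b' + w \<le> N"
    proof (cases "N + 1 - w = 0")
      case True thus ?thesis by (simp add: b'_def)
    next
      case False
      have "Polynomial.degree b' \<le> N - w" by (rule degree_le) (use False in \<open>auto simp: cb\<close>)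
      thus ?thesis using False by auto
    qed
    ultimately have ok: "okp N a b'" by (simp add: okp_def)
    have "ae (\<lambda>Q. val (el N a b') Q = 0)"
    proof (rule ae_mono2[OF ae0 cp_ae[of ss]])
      fix Q assume Q: "(\<Sum>j<l. c j * b j Q) = 0" "hf (length ss) (cp ss) (xc Q) (zc Q) \<noteq> 0"
      have "val (el N a b') Q = (\<Sum>j<l. c j * val (B j) Q)"
        unfolding expand[OF ok] by (intro sum.cong refl) (auto simp: ca cb l_def)
      also have "\<dots> = (\<Sum>j<l. c j * b j Q) * hf N (cp ss) (xc Q) (zc Q)"
        unfolding sum_distrib_right by (intro sum.cong refl) (use Q(2) N(1) in \<open>simp add: b_def\<close>)
      finally show "val (el N a b') Q = 0" using Q(1) by simp
    qed
    hence z: "a = 0" "b' = 0" using el_ae_zero[OF ok] by auto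
    show "c j = 0"
    proof (cases "j < N + 1")
      case True thus ?thesis using ca[of j] z(1) by simp
    next
      case False
      hence "j - (N + 1) < N + 1 - w" "N + 1 + (j - (N + 1)) = j" using \<open>j < l\<close> by (auto simp: l_def)
      thus ?thesis using cb[of "j - (N + 1)"] z(2) by simp
    qed
  qed
qed

text \<open>The genus is \<open>w - 1\<close>: the divisors of zeros of binary forms of large degree have
  \<open>deg D + 1 - l(D) = w - 1\<close>, every divisor is below such a divisor, and \<open>deg D - l(D)\<close> is monotone.\<close>

theorem genus: assumes "has_genus Cv g" shows "g + 1 = w"
proof -
  have le: "int w - 1 \<le> int g"
  proof -
    let ?ss = "replicate w (None :: 'a option)"
    have "\<forall>D l. is_divisor Cv D \<and> riemann_roch_dim Cv D l \<longrightarrow> divisor_degree Cv D + 1 - int l \<le> int g"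
      using assms unfolding has_genus_def by blast
    moreover have "riemann_roch_dim Cv (fdiv ?ss) ((w + 1) + (w + 1 - w))" by (rule riemann_roch_dim_fdiv) simp_all
    ultimately have "divisor_degree Cv (fdiv ?ss) + 1 - int ((w + 1) + (w + 1 - w)) \<le> int g"
      using fdiv_divisor[of ?ss] by blast
    thus ?thesis by (simp add: fdiv_degree)
  qed
  obtain D l where D: "is_divisor Cv D" "riemann_roch_dim Cv D l" "divisor_degree Cv D + 1 - int l = int g"
    using assms unfolding has_genus_def by blast
  define T0 where "T0 = {P \<in> pts Cv. D P \<noteq> 0}"
  have T0: "finite T0" "T0 \<subseteq> pts Cv" using D(1) by (auto simp: T0_def is_divisor_def)
  obtain ss0 where ss0: "\<And>P. P \<in> T0 \<Longrightarrow> int (nat (D P)) \<le> fdiv ss0 P"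
    by (rule effective_le_fdiv[OF T0, of "\<lambda>P. nat (D P)"]) (rule that)
  define ss where "ss = ss0 @ replicate w None"
  have dd: "fdiv ss P = fdiv ss0 P + fdiv (replicate w None) P" for P by (simp add: fdiv_def ss_def algebra_simps)
  have nn: "fdiv r P \<ge> 0" for r P by (simp add: fdiv_def)
  have Dle: "D P \<le> fdiv ss P" if "P \<in> pts Cv" for P
  proof (cases "P \<in> T0")
    case True
    hence "D P \<le> fdiv ss0 P" using ss0[OF True] by linarith
    thus ?thesis using nn[of "replicate w None" P] dd by simp
  next
    case False hence "D P = 0" using that by (simp add: T0_def)
    thus ?thesis using nn by simp
  qed
  define T where "T = T0 \<union> {P \<in> pts Cv. bs P \<in> set ss}"
  have T: "finite T" "T \<subseteq> pts Cv" using T0 finite_over[of "set ss"] by (auto simp: T_def)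
  have "dim_le (\<lambda>P. if P \<in> T then fdiv ss P else D P) (l + nat (\<Sum>P\<in>T. fdiv ss P - D P))"
    by (rule dim_le_finite[OF T _ riemann_roch_dim_le[OF D(2)]]) (use Dle T in auto)
  hence "dim_le (fdiv ss) (l + nat (\<Sum>P\<in>T. fdiv ss P - D P))"
    by (rule iffD1[OF dim_le_cong, rotated]) (use fdiv_zero in \<open>auto simp: T_def T0_def\<close>)
  moreover have N: "w \<le> length ss + 1" by (simp add: ss_def)
  ultimately have "(length ss + 1) + (length ss + 1 - w) \<le> l + nat (\<Sum>P\<in>T. fdiv ss P - D P)"
    using dim_le_bound[OF riemann_roch_dim_fdiv[OF refl N]] by blast
  moreover have "(\<Sum>P\<in>T. fdiv ss P - D P) = 2 * int (length ss) - divisor_degree Cv D"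
  proof -
    have "(\<Sum>P\<in>T. D P) = divisor_degree Cv D" unfolding divisor_degree_def
      using T by (intro sum.mono_neutral_right) (auto simp: T_def T0_def)
    moreover have "(\<Sum>P\<in>T. fdiv ss P) = 2 * int (length ss)" by (rule sum_fdiv[OF T]) (auto simp: T_def)
    ultimately show ?thesis by (simp add: sum_subtractf)
  qed
  moreover have "(\<Sum>P\<in>T. fdiv ss P - D P) \<ge> 0" using Dle T by (intro sum_nonneg) auto
  ultimately have "2 * int (length ss) + 2 - int w \<le> int l + 2 * int (length ss) - divisor_degree Cv D"
    using N by (simp add: of_nat_diff)
  thus ?thesis using D(3) le by linarith
qed

text \<open>The denominator of \<open>h\<close> vanishes at \<open>P\<close> to the order \<open>fdiv ss P\<close>, which exceeds the order \<open>D P\<close> of a pole of \<open>h\<close>, so the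
  numerator has to vanish as well.\<close>

lemma numerator_vanishes:
  assumes P: "P \<in> pts Cv" and H: "hom (length ss) H"
    and h: "ae (\<lambda>Q. h Q = val H Q / hf (length ss) (cp ss) (xc Q) (zc Q))"
    and D: "rr D h" "D P < fdiv ss P"
  shows "val H P = 0"
proof -
  have H': "hom (length ss + 0) H" using H by simp
  have h': "ae (\<lambda>Q. h Q = val H Q / (hf (length ss) (cp ss) (xc Q) (zc Q) * hf 0 1 (xc Q) (zc Q)))" using h by (simp add: hf_one)
  obtain u c where u: "vl P u c" "c \<noteq> 0"
    and eq: "ae (\<lambda>Q. u Q * (t0 P Q powi fdiv ss P * h Q) = val H Q / (lg (bs P) Q ^ length ss * hf 0 1 (xc Q) (zc Q)))"
    by (rule clear_denominator[OF P H' _ _ h']) (auto intro: that)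
  obtain e where e: "vl P (\<lambda>Q. t0 P Q powi D P * h Q) e" using D(1) P unfolding rr_def by blast
  define n where "n = nat (fdiv ss P - D P - 1)"
  have n: "fdiv ss P = int (Suc n) + D P" using D(2) by (simp add: n_def)
  have "ae (\<lambda>Q. val H Q / val (hform 1 (lo (bs P)) ^ length ss) Q = u Q * (t0 P Q ^ Suc n * (t0 P Q powi D P * h Q)))"
  proof (rule ae_mono2[OF eq t0_ae[of P]])
    fix Q assume Q: "u Q * (t0 P Q powi fdiv ss P * h Q) = val H Q / (lg (bs P) Q ^ length ss * hf 0 1 (xc Q) (zc Q))" "t0 P Q \<noteq> 0"
    have pw: "t0 P Q powi fdiv ss P = t0 P Q ^ Suc n * t0 P Q powi D P"
      unfolding n using Q(2) by (subst power_int_add) (simp_all only: power_int_of_nat simp_thms not_False_eq_True)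
    show "val H Q / val (hform 1 (lo (bs P)) ^ length ss) Q = u Q * (t0 P Q ^ Suc n * (t0 P Q powi D P * h Q))"
      using Q(1) unfolding pw by (simp add: hf_one mult.assoc)
  qed
  from vl_cong[OF vl_mult[OF u(1) vl_mult[OF vl_power[OF t0_vl[OF P]] e]] this]
  have "vl P (\<lambda>Q. val H Q / val (hform 1 (lo (bs P)) ^ length ss) Q) 0" by simp
  moreover have "vl P (\<lambda>Q. val H Q / val (hform 1 (lo (bs P)) ^ length ss) Q) (val H P / val (hform 1 (lo (bs P)) ^ length ss) P)"
    using lo_nonzero[OF P] by (intro vl_frac[OF P H hom_lg_power]) simp
  ultimately have "val H P / val (hform 1 (lo (bs P)) ^ length ss) P = 0" using vl_unique by blast
  thus ?thesis using lo_nonzero[OF P] by simp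
qed

text \<open>The divisor \<open>D\<close> is below the sum of two fibres, so \<open>h = A / (l l')\<close> with linear forms \<open>l\<close>, \<open>l'\<close> in \<open>x\<close>, \<open>z\<close> and a form \<open>A\<close> of
  degree \<open>2\<close>, in which no \<open>y\<close> occurs since \<open>2 < w\<close>. The sum of the two fibres has degree \<open>4\<close>, hence differs from \<open>D\<close> at some
  point. There \<open>A\<close> vanishes, and it cancels against \<open>l\<close> or \<open>l'\<close>.\<close>

lemma degree_two_function:
  assumes w3: "w \<ge> 3" and h: "rr D h" and D: "is_divisor Cv D" "divisor_degree Cv D = 2" "\<And>P. P \<in> pts Cv \<Longrightarrow> D P \<ge> 0"
  obtains s a where "Polynomial.degree a \<le> 1" "ae (\<lambda>Q. h Q = hf 1 a (xc Q) (zc Q) / lf s Q)"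
proof -
  define T where "T = {P \<in> pts Cv. D P \<noteq> 0}"
  have T: "finite T" "T \<subseteq> pts Cv" using D(1) by (auto simp: T_def is_divisor_def)
  obtain ss where ss: "length ss = (\<Sum>P\<in>T. nat (D P))" "\<And>P. P \<in> T \<Longrightarrow> int (nat (D P)) \<le> fdiv ss P"
    by (rule effective_le_fdiv[OF T, of "\<lambda>P. nat (D P)"]) (rule that)
  have "int (length ss) = (\<Sum>P\<in>T. D P)" unfolding ss(1) using D(3) T by (simp, intro sum.cong) auto
  also have "\<dots> = 2" using D(2) by (simp add: divisor_degree_def T_def)
  finally have len: "length ss = 2" by simp
  have Dle: "D P \<le> fdiv ss P" if "P \<in> pts Cv" for P
  proof (cases "P \<in> T")
    case True thus ?thesis using ss(2)[OF True] by linarith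
  next
    case False thus ?thesis using that by (simp add: T_def fdiv_def)
  qed
  obtain a b where ok: "okp (length ss) a b" and eq: "ae (\<lambda>Q. h Q = val (el (length ss) a b) Q / hf (length ss) (cp ss) (xc Q) (zc Q))"
    by (rule rr_fdiv_upper[OF rr_mono[OF h Dle]]) (auto intro: that)
  have b: "b = 0" "Polynomial.degree a \<le> 2" using ok len w3 by (auto simp: okp_def)
  obtain R where R: "R \<in> pts Cv" "D R \<noteq> fdiv ss R"
  proof (rule ccontr)
    assume "\<not> thesis"
    hence eqD: "D R = fdiv ss R" if "R \<in> pts Cv" for R using that \<open>\<And>R. R \<in> pts Cv \<Longrightarrow> D R \<noteq> fdiv ss R \<Longrightarrow> thesis\<close> by blast
    have "divisor_degree Cv D = divisor_degree Cv (fdiv ss)"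
      unfolding divisor_degree_def by (rule sum.cong) (auto simp: eqD)
    thus False using D(2) fdiv_degree[of ss] len by simp
  qed
  hence lt: "D R < fdiv ss R" using Dle by fastforce
  hence "fdiv ss R \<noteq> 0" using D(3)[OF R(1)] by linarith
  hence Rs: "bs R \<in> set ss" using fdiv_zero[OF R(1)] by blast
  define s where "s = bs R"
  have "val (el (length ss) a b) R = 0" by (rule numerator_vanishes[OF R(1) hom_el[OF ok] eq h lt])
  hence "hf 2 a (xc R) (zc R) = 0" by (simp add: val_el b len)
  hence "hf 2 a (nx s) (nz s) = 0" using hf_coords[OF R(1)] by (simp add: s_def)
  then obtain a' where a': "a = lp s * a'" "Polynomial.degree a' \<le> 2 - 1" by (rule hf_root[OF b(2)])
  define ss' where "ss' = rest s ss @ replicate (count_list ss s - 1) s"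
  have c1: "count_list ss s \<ge> 1" using Rs count_list_0_iff[of ss s] by (auto simp: s_def Suc_le_eq)
  have "hf (length ss) (cp ss) x z = hf 1 (lp s) x z * (hf 1 (lp s) x z ^ (count_list ss s - 1) * hf (length (rest s ss)) (cp (rest s ss)) x z)" for x z
    unfolding hf_cp_split[of ss x z s] using c1 by (simp add: power_eq_if)
  moreover have "\<exists>t. \<forall>x z. hf 1 (lp s) x z ^ (count_list ss s - 1) * hf (length (rest s ss)) (cp (rest s ss)) x z = hf 1 (lp t) x z"
  proof (cases "count_list ss s = 1")
    case True
    hence "length (rest s ss) = 1" using length_rest[of ss s] len by simp
    then obtain t where "rest s ss = [t]" by (auto simp: length_Suc_conv One_nat_def)
    thus ?thesis using True by (intro exI[of _ t]) (simp add: cp_def One_nat_def)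
  next
    case False
    have "count_list ss s \<ge> 2" using False c1 by arith
    hence c2: "count_list ss s = 2" "length (rest s ss) = 0" using length_rest[of ss s] len by linarith+
    thus ?thesis by (intro exI[of _ s]) (simp add: cp_def hf_one)
  qed
  ultimately obtain t where t: "\<And>x z. hf (length ss) (cp ss) x z = hf 1 (lp s) x z * hf 1 (lp t) x z" by metis
  have "ae (\<lambda>Q. h Q = hf 1 a' (xc Q) (zc Q) / lf t Q)"
  proof (rule ae_mono2[OF eq lf_ae[of s]])
    fix Q assume Q: "h Q = val (el (length ss) a b) Q / hf (length ss) (cp ss) (xc Q) (zc Q)" "lf s Q \<noteq> 0"
    have "hf 2 a (xc Q) (zc Q) = lf s Q * hf 1 a' (xc Q) (zc Q)"
      using hf_lp_mult[OF a'(2), of s "xc Q" "zc Q"] unfolding a'(1) by (simp add: One_nat_def)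
    hence "val (el (length ss) a b) Q = lf s Q * hf 1 a' (xc Q) (zc Q)" by (simp add: val_el b len)
    thus "h Q = hf 1 a' (xc Q) (zc Q) / lf t Q" unfolding Q(1) t using Q(2) by simp
  qed
  thus ?thesis using that[of a' t] a'(2) by simp
qed

end

section \<open>Isomorphic hyperelliptic models have equivalent binary forms\<close>

lemma dvd_of_order_le:
  fixes p q :: "'a::alg_closed_field poly"
  assumes "p \<noteq> 0" "q \<noteq> 0" "\<And>r. Polynomial.order r p \<le> Polynomial.order r q"
  shows "p dvd q"
  using assms
proof (induction "Polynomial.degree p" arbitrary: p q)
  case 0
  then obtain c where "p = [:c:]" by (metis degree_0_id)
  thus ?case using 0 by (auto simp: const_poly_dvd_iff dvd_field_iff)
next
  case (Suc n)
  obtain r where r: "poly p r = 0" using alg_closed_imp_poly_has_root[of p] Suc(2) by auto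
  then obtain p' where p': "p = [:- r, 1:] * p'" using poly_eq_0_iff_dvd by (metis dvdE)
  have "Polynomial.order r p \<noteq> 0" using r Suc(3) order_root by blast
  hence "Polynomial.order r q \<noteq> 0" using Suc(5)[of r] by linarith
  hence "poly q r = 0" using order_root by blast
  then obtain q' where q': "q = [:- r, 1:] * q'" using poly_eq_0_iff_dvd by (metis dvdE)
  have nz: "p' \<noteq> 0" "q' \<noteq> 0" using Suc(3,4) p' q' by auto
  have "Polynomial.degree p = 1 + Polynomial.degree p'" unfolding p' using nz by (subst degree_mult_eq) auto
  moreover have "Polynomial.order t p' \<le> Polynomial.order t q'" for t
    using Suc(5)[of t] Suc(3,4) unfolding p' q' by (simp add: order_mult del: mult_pCons_left)
  ultimately have "p' dvd q'" using Suc(1)[of p' q'] Suc(2) nz by simp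
  thus ?case unfolding p' q' by (rule mult_dvd_mono[OF dvd_refl])
qed

lemma proportional_of_order_eq:
  fixes p q :: "'a::alg_closed_field poly"
  assumes "p \<noteq> 0" "q \<noteq> 0" "\<And>r. Polynomial.order r p = Polynomial.order r q"
  obtains c where "c \<noteq> 0" "q = Polynomial.smult c p"
proof -
  have "p dvd q" "q dvd p" using dvd_of_order_le assms by (metis order_refl)+
  then obtain k where k: "q = p * k" by (auto elim: dvdE)
  have "Polynomial.degree p = Polynomial.degree q"
    using \<open>p dvd q\<close> \<open>q dvd p\<close> assms(1,2) by (intro antisym) (auto intro: dvd_imp_degree_le)
  moreover have "k \<noteq> 0" using k assms by auto
  ultimately have "Polynomial.degree k = 0" unfolding k using assms(1) by (simp add: degree_mult_eq)
  then obtain c where "k = [:c:]" by (metis degree_0_id)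
  thus ?thesis using that[of c] k \<open>k \<noteq> 0\<close> by auto
qed

lemma hf_power: "Polynomial.degree p \<le> d \<Longrightarrow> hf (d * n) (p ^ n) x z = hf d p x z ^ n"
proof (induction n)
  case (Suc n)
  have "Polynomial.degree (p ^ n) \<le> d * n"
    using degree_power_le[of p n] mult_le_mono1[OF Suc(2), of n] by linarith
  from hf_mult[OF Suc(2) this] Suc show ?case by simp
qed (simp add: hf_one)

lemma hf_deg1: "hf 1 a x z = Polynomial.coeff a 1 * x + Polynomial.coeff a 0 * z"
  by (simp add: hf_def One_nat_def)

lemma clear_squares:
  fixes x m h L :: "'a::field"
  assumes "m \<noteq> 0" "L \<noteq> 0" "(x / m)\<^sup>2 = h / L\<^sup>2" shows "(x * L)\<^sup>2 = m\<^sup>2 * h"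
  using assms by (simp add: power_divide power_mult_distrib frac_eq_eq mult.commute)

lemma hyp_curveI:
  fixes p :: "'a::alg_closed_field poly"
  assumes "no_repeated_linear_factors (hform (2 * w) p)" "Polynomial.degree p \<le> 2 * w" "w \<ge> 1" "(2::'a) \<noteq> 0"
  shows "hyp_curve w p"
  using no_repeated_hform[OF assms(1,2)] assms(2-4) by unfold_locales

text \<open>The pullback of \<open>x\<close> is a fractional linear function of \<open>x\<close> with denominator \<open>l\<close>. After this substitution, which
  turns \<open>p\<^sub>2\<close> into \<open>q\<close>, the pullback of \<open>y\<close> is a square root of \<open>q / l\<^bsup>2w\<^esup>\<close>. Writing it as \<open>(U + V y) / (M l\<^sup>w)\<close> gives \<open>U V = 0\<close>,
  and since \<open>q\<close> is not a square, \<open>V\<^sup>2 p\<^sub>1 = M\<^sup>2 q\<close>. As \<open>p\<^sub>1\<close> and \<open>q\<close> are squarefree, they are proportional.\<close>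

lemma isomorphic_models_imp_form_equiv:
  fixes p1 p2 :: "'a::alg_closed_field poly"
  assumes nr1: "no_repeated_linear_factors (hform (2 * w) p1)" and d1: "Polynomial.degree p1 \<le> 2 * w"
    and nr2: "no_repeated_linear_factors (hform (2 * w) p2)" and d2: "Polynomial.degree p2 \<le> 2 * w"
    and two: "(2::'a) \<noteq> 0" and w: "w \<ge> 3"
    and iso: "isomorphic (hyp_model w (hform (2 * w) p1)) (hyp_model w (hform (2 * w) p2))"
  shows "form_equiv (hform (2 * w) p1) (hform (2 * w) p2)"
proof -
  have w1: "w \<ge> 1" using w by simp
  interpret A: hyp_curve w p1 by (rule hyp_curveI[OF nr1 d1 w1 two])
  interpret B: hyp_curve w p2 by (rule hyp_curveI[OF nr2 d2 w1 two])
  have "\<exists>\<phi> \<psi>. iso_pair A.Cv B.Cv \<phi> \<psi>" using iso unfolding A.Cv_def B.Cv_def isomorphic_pair .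
  then obtain \<phi> \<psi> where "iso_pair A.Cv B.Cv \<phi> \<psi>" by (elim exE) (rule that)
  then interpret I: iso_pair A.Cv B.Cv \<phi> \<psi> .
  have fin: "finite {P \<in> pts A.Cv. R (\<phi> P)}" if "finite {Q \<in> pts B.Cv. R Q}" for R
  proof -
    have "{P \<in> pts A.Cv. R (\<phi> P)} \<subseteq> \<psi> ` {Q \<in> pts B.Cv. R Q}"
    proof
      fix P assume "P \<in> {P \<in> pts A.Cv. R (\<phi> P)}"
      thus "P \<in> \<psi> ` {Q \<in> pts B.Cv. R Q}" using I.inv(1)[of P] I.in_pts(1)[of P] by (intro image_eqI[of _ _ "\<phi> P"]) auto
    qed
    thus ?thesis using that finite_subset by blast
  qed
  have ae_pull: "A.ae (\<lambda>P. R (\<phi> P))" if "B.ae R" for R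
    using fin[of "\<lambda>Q. \<not> R Q"] that unfolding A.ae_def B.ae_def by simp
  \<comment> \<open>The coordinate function of the projective line has a divisor of poles of degree 2.\<close>
  define E where "E = B.fdiv [None]"
  have lz: "hf (length [None]) (B.cp [None]) x z = z" for x z :: 'a by (simp add: B.cp_def B.lp_def hf_one)
  have "B.rr E (\<lambda>Q. B.xc Q / B.zc Q)" unfolding E_def
    by (rule B.rr_fdiv_lower[of "[None]" x_var]) (use lz B.hom_var in \<open>simp_all add: B.ae_all One_nat_def\<close>)
  hence "(\<lambda>P. B.xc (\<phi> P) / B.zc (\<phi> P)) \<in> riemann_roch_space A.Cv (\<lambda>P. E (\<phi> P))"
    using I.riemann_roch_space_pull B.riemann_roch_space_rr by blast
  hence rr: "A.rr (\<lambda>P. E (\<phi> P)) (\<lambda>P. B.xc (\<phi> P) / B.zc (\<phi> P))" by (simp add: A.riemann_roch_space_rr)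
  have div: "is_divisor A.Cv (\<lambda>P. E (\<phi> P))" "divisor_degree A.Cv (\<lambda>P. E (\<phi> P)) = 2"
    using I.is_divisor_pull[OF B.fdiv_divisor] I.divisor_degree_pull[of E] B.fdiv_degree[of "[None]"] by (simp_all add: E_def)
  obtain s a where a: "Polynomial.degree a \<le> 1" and u: "A.ae (\<lambda>P. B.xc (\<phi> P) / B.zc (\<phi> P) = hf 1 a (A.xc P) (A.zc P) / A.lf s P)"
    by (rule A.degree_two_function[OF w rr div]) (auto simp: E_def B.fdiv_def intro: that)
  define \<alpha> \<beta> \<gamma> \<delta> where "\<alpha> = Polynomial.coeff a 1" and "\<beta> = Polynomial.coeff a 0"
    and "\<gamma> = Polynomial.coeff (A.lp s) 1" and "\<delta> = Polynomial.coeff (A.lp s) 0"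
  have ha: "hf 1 a x z = \<alpha> * x + \<beta> * z" and hl: "hf 1 (A.lp s) x z = \<gamma> * x + \<delta> * z" for x z
    by (simp_all add: hf_deg1 \<alpha>_def \<beta>_def \<gamma>_def \<delta>_def)
  have zc: "A.ae (\<lambda>P. B.zc (\<phi> P) \<noteq> 0)" using ae_pull[OF B.lf_ae[of None]] by (simp add: B.lp_def hf_one)
  have D: "\<alpha> * \<delta> - \<beta> * \<gamma> \<noteq> 0"
  proof
    assume D0: "\<alpha> * \<delta> - \<beta> * \<gamma> = 0"
    have "\<gamma> \<noteq> 0 \<or> \<delta> \<noteq> 0" unfolding \<gamma>_def \<delta>_def by (cases s) (auto simp: A.lp_def One_nat_def)
    hence "\<exists>c. \<alpha> = c * \<gamma> \<and> \<beta> = c * \<delta>"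
    proof
      assume "\<gamma> \<noteq> 0" thus ?thesis using D0 by (intro exI[of _ "\<alpha> / \<gamma>"]) (simp add: field_simps)
    next
      assume "\<delta> \<noteq> 0" thus ?thesis using D0 by (intro exI[of _ "\<beta> / \<delta>"]) (simp add: field_simps)
    qed
    then obtain c where c: "\<alpha> = c * \<gamma>" "\<beta> = c * \<delta>" by blast
    have "A.ae (\<lambda>P. B.bs (\<phi> P) = Some c)"
    proof (rule A.ae_mono3[OF u zc A.lf_ae[of s]])
      fix P assume P: "B.xc (\<phi> P) / B.zc (\<phi> P) = hf 1 a (A.xc P) (A.zc P) / A.lf s P" "B.zc (\<phi> P) \<noteq> 0" "A.lf s P \<noteq> 0"
      have "hf 1 a (A.xc P) (A.zc P) = c * A.lf s P" unfolding ha hl c by (simp add: algebra_simps)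
      thus "B.bs (\<phi> P) = Some c" using P by (simp add: B.bs_def)
    qed
    moreover have "finite {P \<in> pts A.Cv. B.bs (\<phi> P) = Some c}" by (rule fin) (rule B.finite_fibre)
    ultimately have "finite ({P \<in> pts A.Cv. B.bs (\<phi> P) = Some c} \<union> {P \<in> pts A.Cv. \<not> B.bs (\<phi> P) = Some c})" by (simp add: A.ae_def)
    moreover have "{P \<in> pts A.Cv. B.bs (\<phi> P) = Some c} \<union> {P \<in> pts A.Cv. \<not> B.bs (\<phi> P) = Some c} = pts A.Cv" by auto
    ultimately show False using A.infinite_pts by simp
  qed
  have "binary_form (2 * w) (subst2 \<alpha> \<beta> \<gamma> \<delta> (hform (2 * w) p2))" by (rule binary_form_subst2) simp
  then obtain q where dq: "Polynomial.degree q \<le> 2 * w" and q: "subst2 \<alpha> \<beta> \<gamma> \<delta> (hform (2 * w) p2) = hform (2 * w) q"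
    by (rule binary_form_imp_hform) (rule that)
  have hq: "hf (2 * w) q x z = hf (2 * w) p2 (\<alpha> * x + \<beta> * z) (\<gamma> * x + \<delta> * z)" for x z
    using fe_subst2[of \<alpha> \<beta> \<gamma> \<delta> "hform (2 * w) p2" x z] unfolding q by simp
  interpret Q: hyp_curve w q
    by (rule hyp_curveI[OF _ dq w1 two]) (use no_repeated_subst2[OF nr2 D] q in simp)
  \<comment> \<open>The pullback of \<open>y\<close> is a quotient of some \<open>A' + B' y\<close> by a binary form \<open>M\<close>.\<close>
  have "rational B.Cv (\<lambda>Q. B.yc Q / B.zc Q ^ w)" unfolding B.rational_frac
    by (rule exI[of _ w], rule exI[of _ y_var], rule exI[of _ "z_var ^ w"])
       (use B.hom_var B.lf_ae[of None] in \<open>auto simp: B.lp_def hf_one intro: homogeneous_power[where d=1] elim: B.ae_mono\<close>)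
  from I.rational_pull[OF this]
  have "rational A.Cv (\<lambda>P. B.yc (\<phi> P) / B.zc (\<phi> P) ^ w)" .
  then obtain e A' B' M where ok: "A.okp e A' B'" and M: "M \<noteq> 0" "Polynomial.degree M \<le> e"
    and v: "A.ae (\<lambda>P. B.yc (\<phi> P) / B.zc (\<phi> P) ^ w = val (A.el e A' B') P / hf e M (A.xc P) (A.zc P))"
    by (rule A.rational_normal) (rule that)
  define l where "l = A.lp s ^ w"
  have l: "Polynomial.degree l \<le> w" "l \<noteq> 0" "hf w l x z = hf 1 (A.lp s) x z ^ w" for x z
  proof -
    show "Polynomial.degree l \<le> w" unfolding l_def
      by (rule order.trans[OF degree_power_le]) (use mult_le_mono1[OF A.deg_lp[of s], of w] in \<open>simp only: mult_1\<close>)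
    show "l \<noteq> 0" by (simp add: l_def)
    show "hf w l x z = hf 1 (A.lp s) x z ^ w" unfolding l_def using hf_power[OF A.deg_lp[of s], of w x z] by simp
  qed
  have okl: "A.okp w l 0" using l(1) by (simp add: A.okp_def)
  obtain P0 where P0: "P0 \<in> pts A.Cv" using A.fibre_nonempty by blast
  have okL: "A.okp (e + w) (A' * l) (B' * l)" using A.el_mult(2)[OF ok okl P0] by (simp add: mult.commute)
  have vL: "val (A.el e A' B') P * A.lf s P ^ w = val (A.el (e + w) (A' * l) (B' * l)) P" if "P \<in> pts A.Cv" for P
    using A.el_mult(1)[OF ok okl that] by (simp add: A.val_el[of w] l(3) mult.commute)
  define U V where "U = A' * l" and "V = B' * l"
  have okUV: "A.okp (e + w) U V" using okL by (simp add: U_def V_def)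
  have okS: "A.okp (2 * (e + w)) (U * U + V * V * p1) (U * V + U * V)"
    using A.el_mult(2)[OF okUV okUV P0] by (simp only: mult_2)
  have dM: "Polynomial.degree (M * M * q) \<le> 2 * (e + w)"
  proof -
    have "Polynomial.degree (M * M) \<le> e + e" by (rule order.trans[OF degree_mult_le add_mono[OF M(2) M(2)]])
    hence "Polynomial.degree (M * M) + Polynomial.degree q \<le> (e + e) + 2 * w" using dq by (rule add_mono)
    moreover have "(e + e) + 2 * w = 2 * (e + w)" by (simp only: mult_2 add.assoc add.left_commute)
    ultimately show ?thesis using degree_mult_le[of "M * M" q] by linarith
  qed
  have hM: "hf (2 * (e + w)) (M * M * q) x z = hf e M x z ^ 2 * hf (2 * w) q x z" for x z
  proof -
    have e: "2 * (e + w) = (e + e) + 2 * w" by simp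
    have "Polynomial.degree (M * M) \<le> e + e" by (rule order.trans[OF degree_mult_le add_mono[OF M(2) M(2)]])
    from hf_mult[OF this dq, of x z] hf_mult[OF M(2) M(2), of x z] show ?thesis
      unfolding e by (simp only: power2_eq_square)
  qed
  have okD: "A.okp (2 * (e + w)) (U * U + V * V * p1 - M * M * q) (U * V + U * V)"
    using okS dM by (auto simp: A.okp_def intro: degree_diff_le)
  have "A.ae (\<lambda>P. (B.yc (\<phi> P) / B.zc (\<phi> P) ^ w = val (A.el e A' B') P / hf e M (A.xc P) (A.zc P)) \<and> hf e M (A.xc P) (A.zc P) \<noteq> 0)"
    by (rule A.ae_conj[OF v A.hform_nz[OF M]])
  hence "A.ae (\<lambda>P. val (A.el (2 * (e + w)) (U * U + V * V * p1 - M * M * q) (U * V + U * V)) P = 0)"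
  proof (rule A.ae_mono3[OF _ A.ae_conj[OF u zc] A.lf_ae[of s]])
    fix P assume P: "P \<in> pts A.Cv" and
      v: "B.yc (\<phi> P) / B.zc (\<phi> P) ^ w = val (A.el e A' B') P / hf e M (A.xc P) (A.zc P) \<and> hf e M (A.xc P) (A.zc P) \<noteq> 0"
      and u: "B.xc (\<phi> P) / B.zc (\<phi> P) = hf 1 a (A.xc P) (A.zc P) / A.lf s P \<and> B.zc (\<phi> P) \<noteq> 0" and lf: "A.lf s P \<noteq> 0"
    let ?X = "B.xc (\<phi> P)" and ?Z = "B.zc (\<phi> P)" and ?Y = "B.yc (\<phi> P)"
    let ?a = "hf 1 a (A.xc P) (A.zc P)" and ?l = "A.lf s P" and ?m = "hf e M (A.xc P) (A.zc P)"
    have "?Y\<^sup>2 = hf (2 * w) p2 ?X ?Z" by (rule B.yc_sq[OF I.in_pts(1)[OF P]])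
    also have "\<dots> = hf (2 * w) p2 (?Z * (?X / ?Z)) (?Z * 1)" using conjunct2[OF u] by simp
    also have "\<dots> = ?Z ^ (2 * w) * hf (2 * w) p2 (?X / ?Z) 1" by (rule hf_scale)
    also have "?X / ?Z = ?a / ?l" using u by simp
    also have "hf (2 * w) p2 (?a / ?l) 1 = hf (2 * w) p2 ?a ?l / ?l ^ (2 * w)"
      using hf_scale[of "2 * w" p2 ?l "?a / ?l" 1] lf by simp
    also have "hf (2 * w) p2 ?a ?l = hf (2 * w) q (A.xc P) (A.zc P)" unfolding hq ha hl ..
    finally have "?Y\<^sup>2 / ?Z ^ (2 * w) = hf (2 * w) q (A.xc P) (A.zc P) / ?l ^ (2 * w)" using u by simp
    moreover have "?Y\<^sup>2 / ?Z ^ (2 * w) = (?Y / ?Z ^ w)\<^sup>2" by (simp add: power_divide power_mult[symmetric] mult.commute)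
    ultimately have "(val (A.el e A' B') P / ?m)\<^sup>2 = hf (2 * w) q (A.xc P) (A.zc P) / (?l ^ w)\<^sup>2"
      using v by (simp add: power_mult[symmetric] mult.commute)
    hence "(val (A.el e A' B') P * ?l ^ w)\<^sup>2 = ?m\<^sup>2 * hf (2 * w) q (A.xc P) (A.zc P)"
      by (rule clear_squares[rotated 2]) (use v lf in auto)
    hence "val (A.el (2 * (e + w)) (U * U + V * V * p1) (U * V + U * V)) P = hf (2 * (e + w)) (M * M * q) (A.xc P) (A.zc P)"
      unfolding vL[OF P] U_def[symmetric] V_def[symmetric] hM
      using A.el_mult(1)[OF okUV okUV P] by (simp only: mult_2 power2_eq_square)
    moreover have "val (A.el d (x - y) z) P = val (A.el d x z) P - hf d y (A.xc P) (A.zc P)" for d x y z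
      by (simp add: A.val_el hf_diff)
    ultimately show "val (A.el (2 * (e + w)) (U * U + V * V * p1 - M * M * q) (U * V + U * V)) P = 0" by simp
  qed
  note z0 = A.el_ae_zero[OF okD this]
  have z: "U * U + V * V * p1 = M * M * q" "2 * (U * V) = 0"
    using z0[THEN conjunct1] z0[THEN conjunct2] by (simp_all only: right_minus_eq mult_2)
  have "(2 :: 'a poly) \<noteq> 0" using two by (simp add: numeral_poly)
  hence UV: "U = 0 \<or> V = 0" using z(2) by simp
  have "V \<noteq> 0"
  proof
    assume "V = 0"
    hence "U\<^sup>2 - M\<^sup>2 * q = 0" using z(1) by (simp add: power2_eq_square)
    thus False using Q.norm_nonzero[of U M] M(1) by blast
  qed
  \<comment> \<open>Both orders at \<open>r\<close> are at most \<open>1\<close> and have the same parity.\<close>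
  hence eq: "V * V * p1 = M * M * q" and V: "V \<noteq> 0" using z UV by auto
  have "Polynomial.order r p1 = Polynomial.order r q" for r
  proof -
    have "Polynomial.order r (V * V * p1) = Polynomial.order r (M * M * q)" using eq by simp
    hence "2 * Polynomial.order r V + Polynomial.order r p1 = 2 * Polynomial.order r M + Polynomial.order r q"
      using V M(1) A.p0 Q.p0 by (simp add: order_mult)
    moreover have "Polynomial.order r p1 \<le> 1" using A.order_p[of r] A.p0 order_root[of p1 r] by (cases "poly p1 r = 0") auto
    moreover have "Polynomial.order r q \<le> 1" using Q.order_p[of r] Q.p0 order_root[of q r] by (cases "poly q r = 0") auto
    ultimately show ?thesis by presburger
  qed
  then obtain c where c: "c \<noteq> 0" "q = Polynomial.smult c p1" by (rule proportional_of_order_eq[OF A.p0 Q.p0]) (rule that)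
  have "fe (hform (2 * w) p1) x z = inverse c * fe (hform (2 * w) p2) (\<alpha> * x + \<beta> * z) (\<gamma> * x + \<delta> * z)" for x z
    using hq[of x z] c by (simp add: hf_smult field_simps)
  thus ?thesis unfolding form_equiv_def using D c(1)
    by (intro exI[of _ \<alpha>] exI[of _ \<beta>] exI[of _ \<gamma>] exI[of _ \<delta>] exI[of _ "inverse c"]) simp
qed

theorem isomorphic_imp_form_equiv:
  fixes F G :: "'a::alg_closed_field mpoly"
  assumes "binary_form (2 * w) F" "binary_form (2 * w) G" "no_repeated_linear_factors F" "no_repeated_linear_factors G"
    and "(2::'a) \<noteq> 0" "w \<ge> 3" "isomorphic (hyp_model w F) (hyp_model w G)"
  shows "form_equiv F G"
proof -
  obtain p1 where "Polynomial.degree p1 \<le> 2 * w" "F = hform (2 * w) p1" by (rule binary_form_imp_hform[OF assms(1)])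
  moreover obtain p2 where "Polynomial.degree p2 \<le> 2 * w" "G = hform (2 * w) p2" by (rule binary_form_imp_hform[OF assms(2)])
  ultimately show ?thesis using isomorphic_models_imp_form_equiv assms(3-) by blast
qed

theorem genus_hyp_model:
  fixes F :: "'a::alg_closed_field mpoly"
  assumes "binary_form (2 * w) F" "no_repeated_linear_factors F" "(2::'a) \<noteq> 0" "w \<ge> 1"
    and "has_genus (hyp_model w F) g"
  shows "g + 1 = w"
proof -
  obtain p where p: "Polynomial.degree p \<le> 2 * w" "F = hform (2 * w) p" by (rule binary_form_imp_hform[OF assms(1)])
  interpret hyp_curve w p by (rule hyp_curveI) (use p assms in auto)
  show ?thesis using genus assms(5) by (simp add: Cv_def p)
qed

section \<open>Forms of a given type\<close>

text \<open>The factor \<open>e\<close> in the definition of the types, and the remaining sum as a form in \<open>x\<^sup>n\<close> and \<open>z\<^sup>n\<close>.\<close>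

definition outer_factor :: "nat \<Rightarrow> 'a::field \<Rightarrow> 'a \<Rightarrow> 'a" where
  "outer_factor i x z = (if i = 0 then 1 else if i = 1 then z else x * z)"

definition gsum :: "nat \<Rightarrow> (nat \<Rightarrow> 'a::field) \<Rightarrow> 'a \<Rightarrow> 'a \<Rightarrow> 'a" where
  "gsum m a t u = (\<Sum>j\<le>m. a j * t ^ j * u ^ (m - j))"

lemma fe_diag: "fe (diag_form i n m a) x z = outer_factor i x z * gsum m a (x ^ n) (z ^ n)"
proof -
  have "fe (\<Sum>j\<le>m. mp_const (a j) * x_var ^ (j * n) * z_var ^ ((m - j) * n)) x z = gsum m a (x ^ n) (z ^ n)"
    unfolding gsum_def by (simp add: power_mult mult.commute[of _ n])
  thus ?thesis by (auto simp: diag_form_def outer_factor_def)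
qed

lemma gsum_scale: "gsum m (\<lambda>j. c * s ^ j * a j) t u = c * gsum m a (s * t) u"
  by (simp add: gsum_def sum_distrib_left power_mult_distrib mult_ac)

lemma gsum_homog: "gsum m a (c * t) (c * u) = c ^ m * gsum m a t u"
proof -
  have "(c * t) ^ j * (c * u) ^ (m - j) = c ^ m * (t ^ j * u ^ (m - j))" if "j \<le> m" for j
  proof -
    have "c ^ j * c ^ (m - j) = c ^ m" using that by (simp only: power_add[symmetric] le_add_diff_inverse)
    thus ?thesis by (simp add: power_mult_distrib mult_ac)
  qed
  thus ?thesis unfolding gsum_def sum_distrib_left by (intro sum.cong refl) (simp add: mult_ac)
qed

lemma gsum_rev: "gsum m (\<lambda>j. a (m - j)) t u = gsum m a u t"
  unfolding gsum_def
  by (rule sum.reindex_bij_witness[of _ "\<lambda>j. m - j" "\<lambda>j. m - j"]) (auto simp: mult_ac)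

lemma gsum_cong: "(\<And>j. j \<le> m \<Longrightarrow> a j = b j) \<Longrightarrow> gsum m a t u = gsum m b t u"
  unfolding gsum_def by (intro sum.cong) auto

lemma gsum_eqI:
  fixes a b :: "nat \<Rightarrow> 'a::alg_closed_field"
  assumes "\<And>t. t \<noteq> 0 \<Longrightarrow> gsum m a t 1 = gsum m b t 1" "j \<le> m" shows "a j = b j"
proof -
  have p: "poly (\<Sum>j\<le>m. Polynomial.monom (c j) j) t = gsum m c t 1" for c :: "nat \<Rightarrow> 'a" and t
    by (simp add: gsum_def poly_sum poly_monom)
  have "{t. gsum m a t 1 \<noteq> gsum m b t 1} \<subseteq> {0}" using assms(1) by auto
  hence "(\<Sum>j\<le>m. Polynomial.monom (a j) j) = (\<Sum>j\<le>m. Polynomial.monom (b j) j)"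
    by (intro poly_eqI_cofinite) (simp add: p finite_subset)
  hence "Polynomial.coeff (\<Sum>j\<le>m. Polynomial.monom (a j) j) j = Polynomial.coeff (\<Sum>j\<le>m. Polynomial.monom (b j) j) j" by simp
  thus ?thesis using assms(2) by (simp add: coeff_sum sum.delta')
qed

lemma diag_form_eqI:
  fixes a b :: "nat \<Rightarrow> 'a::alg_closed_field"
  assumes "n > 0" "\<And>x z. fe (diag_form i n m a) x z = fe (diag_form i n m b) x z" "j \<le> m"
  shows "a j = b j"
proof (rule gsum_eqI[OF _ assms(3)])
  fix t :: 'a assume t: "t \<noteq> 0"
  obtain x where x: "x ^ n = t" using nth_root_exists[OF assms(1), of t] by auto
  hence "x \<noteq> 0" using t assms(1) by auto
  thus "gsum m a t 1 = gsum m b t 1" using assms(2)[of x 1] by (simp add: fe_diag outer_factor_def x split: if_splits)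
qed

lemma binary_form_diag:
  assumes "i \<le> 2" shows "binary_form (n * m + i) (diag_form i n m (a :: nat \<Rightarrow> 'a::field))"
proof -
  have x: "homogeneous [1,1] e (x_var ^ e :: 'a mpoly)" and z: "homogeneous [1,1] e (z_var ^ e :: 'a mpoly)" for e
    by (rule homogeneous_power[where d=1]; auto intro: homogeneous_var)+
  have s: "homogeneous [1,1] (n * m) (\<Sum>j\<le>m. mp_const (a j) * x_var ^ (j * n) * z_var ^ ((m - j) * n))"
  proof (rule homogeneous_sum)
    fix j assume "j \<in> {..m}"
    hence "(j + (m - j)) * n = m * n" by simp
    hence e: "n * m = 0 + j * n + (m - j) * n" by (simp only: add_mult_distrib mult.commute[of n m] add_0)
    show "homogeneous [1,1] (n * m) (mp_const (a j) * x_var ^ (j * n) * z_var ^ ((m - j) * n))"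
      unfolding e by (intro homogeneous_mult homogeneous_const x z)
  qed
  have "i = 0 \<or> i = 1 \<or> i = 2" using assms by auto
  thus ?thesis
  proof (elim disjE)
    assume "i = 0" thus ?thesis using s by (simp add: binary_form_def diag_form_def)
  next
    assume "i = 1"
    thus ?thesis using homogeneous_mult[OF z[of 1] s] by (simp add: binary_form_def diag_form_def add.commute)
  next
    assume "i = 2"
    thus ?thesis using homogeneous_mult[OF homogeneous_mult[OF x[of 1] z[of 1]] s]
      by (simp add: binary_form_def diag_form_def add.commute)
  qed
qed

text \<open>Automorphisms of a form up to scalars, as substitutions.\<close>

definition autf :: "'a::field mpoly \<Rightarrow> 'a \<Rightarrow> 'a \<Rightarrow> 'a \<Rightarrow> 'a \<Rightarrow> bool" where
  "autf F p q r s \<longleftrightarrow> p * s - q * r \<noteq> 0 \<and> (\<exists>c. c \<noteq> 0 \<and> (\<forall>x z. fe F (p * x + q * z) (r * x + s * z) = c * fe F x z))"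

text \<open>A form of type \<open>(i, n, m)\<close>, described by its coefficients and with matrices instead of classes in \<open>PGL\<^sub>2\<close>:
  automorphisms are diagonal and of order dividing \<open>n\<close>, and there are no repeated factors.\<close>

definition typed :: "nat \<Rightarrow> nat \<Rightarrow> nat \<Rightarrow> (nat \<Rightarrow> 'a::field) \<Rightarrow> bool" where
  "typed i n m a \<longleftrightarrow> i \<le> 2 \<and> n > 1 \<and> m > 0 \<and> (\<exists>\<zeta>::'a. \<zeta> ^ n = 1 \<and> \<zeta> \<noteq> 1) \<and>
     no_repeated_linear_factors (diag_form i n m a) \<and>
     (\<forall>p q r s. autf (diag_form i n m a) p q r s \<longrightarrow> q = 0 \<and> r = 0 \<and> p ^ n = s ^ n)"

lemma typedD:
  assumes "typed i n m a"
  shows "i \<le> 2" "n > 1" "m > 0" "no_repeated_linear_factors (diag_form i n m a)"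
    and "autf (diag_form i n m a) p q r s \<Longrightarrow> q = 0 \<and> r = 0 \<and> p ^ n = s ^ n"
  using assms unfolding typed_def by blast+

text \<open>Otherwise \<open>x\<^sup>2\<close> or \<open>z\<^sup>2\<close> would divide the form, as \<open>n > 1\<close>.\<close>

lemma typed_ends:
  assumes "typed i n m a" shows "a 0 \<noteq> 0" "a m \<noteq> 0"
proof -
  note n = typedD(2)[OF assms] and nr = typedD(4)[OF assms]
  let ?t = "\<lambda>j. mp_const (a j) * x_var ^ (j * n) * z_var ^ ((m - j) * n)"
  have c0: "mp_const (0::'a) = 0" "mp_const (1::'a) = 1" by (simp_all add: mp_const_def)
  show "a 0 \<noteq> 0"
  proof
    assume a0: "a 0 = 0"
    have "x_var ^ 2 dvd (\<Sum>j\<le>m. ?t j)"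
    proof (rule dvd_sum)
      fix j assume "j \<in> {..m}"
      show "x_var ^ 2 dvd ?t j"
      proof (cases "j = 0")
        case False
        hence "2 \<le> j * n" using n by (metis One_nat_def Suc_leI mult_le_mono mult_1 neq0_conv numeral_2_eq_2)
        thus ?thesis by (intro dvd_mult2 dvd_mult le_imp_power_dvd)
      qed (simp add: a0 c0)
    qed
    hence "(mp_const 1 * x_var + mp_const 0 * z_var) ^ 2 dvd diag_form i n m a"
      unfolding diag_form_def c0 by (simp add: dvd_mult)
    thus False using nr unfolding no_repeated_linear_factors_def by (metis prod.inject zero_neq_one)
  qed
  show "a m \<noteq> 0"
  proof
    assume a0: "a m = 0"
    have "z_var ^ 2 dvd (\<Sum>j\<le>m. ?t j)"
    proof (rule dvd_sum)
      fix j assume j: "j \<in> {..m}"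
      show "z_var ^ 2 dvd ?t j"
      proof (cases "j = m")
        case False
        hence "1 \<le> m - j" using j by auto
        hence "2 \<le> (m - j) * n" using n by (metis One_nat_def Suc_leI mult_le_mono mult_1 numeral_2_eq_2)
        thus ?thesis by (intro dvd_mult le_imp_power_dvd)
      qed (simp add: a0 c0)
    qed
    hence "(mp_const 0 * x_var + mp_const 1 * z_var) ^ 2 dvd diag_form i n m a"
      unfolding diag_form_def c0 by (simp add: dvd_mult)
    thus False using nr unfolding no_repeated_linear_factors_def by (metis prod.inject zero_neq_one)
  qed
qed

lemma outer_factor_scale: "outer_factor i (p * x) (s * z) = outer_factor i p s * outer_factor i x z"
  by (simp add: outer_factor_def mult_ac)

lemma outer_factor_nz: "p \<noteq> 0 \<Longrightarrow> s \<noteq> 0 \<Longrightarrow> outer_factor i p s \<noteq> 0"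
  by (simp add: outer_factor_def)

lemma outer_factor_swap: "i \<noteq> 1 \<Longrightarrow> outer_factor i z x = outer_factor i x z"
  by (simp add: outer_factor_def mult.commute)

text \<open>The exponents \<open>j\<close> with \<open>a j \<noteq> 0\<close> generate \<open>\<int>\<close>, multiplicatively expressed: otherwise the form
  would have a diagonal automorphism outside of \<open>C\<^sub>n\<close>.\<close>

lemma typed_exponents:
  fixes a :: "nat \<Rightarrow> 'a::alg_closed_field" and q :: 'a
  assumes t: "typed i n m a" and q: "\<And>j. j \<le> m \<Longrightarrow> a j \<noteq> 0 \<Longrightarrow> q ^ j = 1"
  shows "q = 1"
proof -
  note n = typedD(2)[OF t]
  obtain \<eta> where \<eta>: "\<eta> ^ n = q" using nth_root_exists[of n q] n by auto
  have "q ^ m = 1" using q typed_ends(2)[OF t] by simp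
  hence "q \<noteq> 0" using typedD(3)[OF t] by (auto simp: power_0_left)
  hence \<eta>0: "\<eta> \<noteq> 0" using \<eta> n by auto
  have g: "gsum m a (q * u) v = gsum m a u v" for u v
  proof -
    have "gsum m a (q * u) v = gsum m (\<lambda>j. 1 * q ^ j * a j) u v" unfolding gsum_scale by simp
    also have "\<dots> = gsum m a u v" using q by (intro gsum_cong) auto
    finally show ?thesis .
  qed
  have "fe (diag_form i n m a) (\<eta> * x + 0 * z) (0 * x + 1 * z) = outer_factor i \<eta> 1 * fe (diag_form i n m a) x z" for x z
    using outer_factor_scale[of i \<eta> x 1 z] by (simp add: fe_diag power_mult_distrib \<eta> g)
  hence "autf (diag_form i n m a) \<eta> 0 0 1" unfolding autf_def using \<eta>0 outer_factor_nz[of \<eta> 1 i]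
    by (intro conjI exI[of _ "outer_factor i \<eta> 1"]) auto
  from typedD(5)[OF t this] show "q = 1" using \<eta> by simp
qed

text \<open>The effect of diagonal and antidiagonal substitutions, combined with scalars, on the coefficients \<open>a\<^sub>j\<close> of a form of
  a given type; \<open>t\<close> is the \<open>n\<close>-th power of the ratio of the two entries of the matrix.\<close>

definition diag_equiv :: "nat \<Rightarrow> (nat \<Rightarrow> 'a::field) \<Rightarrow> (nat \<Rightarrow> 'a) \<Rightarrow> bool" where
  "diag_equiv m a b \<longleftrightarrow> (\<exists>c t. c \<noteq> 0 \<and> t \<noteq> 0 \<and> (\<forall>j\<le>m. b j = c * t ^ j * a j))"

definition antidiag_equiv :: "nat \<Rightarrow> (nat \<Rightarrow> 'a::field) \<Rightarrow> (nat \<Rightarrow> 'a) \<Rightarrow> bool" where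
  "antidiag_equiv m a b \<longleftrightarrow> (\<exists>c t. c \<noteq> 0 \<and> t \<noteq> 0 \<and> (\<forall>j\<le>m. b j = c * t ^ j * a (m - j)))"

lemma diag_form_of_diag_equiv:
  fixes a :: "nat \<Rightarrow> 'a::field"
  assumes "\<And>j. j \<le> m \<Longrightarrow> b j = c * (p ^ n) ^ j * a j" "p \<noteq> 0"
  shows "fe (diag_form i n m b) x z = c / outer_factor i p 1 * fe (diag_form i n m a) (p * x) z"
proof -
  have "gsum m b u v = c * gsum m a (p ^ n * u) v" for u v
    unfolding gsum_scale[symmetric] using assms by (intro gsum_cong) auto
  thus ?thesis using outer_factor_scale[of i p x 1 z] outer_factor_nz[OF assms(2), of 1 i]
    by (simp add: fe_diag power_mult_distrib)
qed

lemma diag_form_of_antidiag_equiv: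
  fixes a :: "nat \<Rightarrow> 'a::field"
  assumes "\<And>j. j \<le> m \<Longrightarrow> b j = c * (p ^ n) ^ j * a (m - j)" "p \<noteq> 0" "i \<noteq> 1"
  shows "fe (diag_form i n m b) x z = c / outer_factor i p 1 * fe (diag_form i n m a) z (p * x)"
proof -
  have "gsum m b u v = c * gsum m a v (p ^ n * u)" for u v
    unfolding gsum_rev[of m a "p ^ n * u", symmetric] gsum_scale[symmetric] using assms by (intro gsum_cong) auto
  thus ?thesis using outer_factor_scale[of i p x 1 z] outer_factor_nz[OF assms(2), of 1 i] outer_factor_swap[OF assms(3), of z "p * x"]
    by (simp add: fe_diag power_mult_distrib)
qed

lemma diag_equiv_form_equiv:
  fixes a b :: "nat \<Rightarrow> 'a::alg_closed_field"
  assumes "diag_equiv m a b" "n > 0" shows "form_equiv (diag_form i n m b) (diag_form i n m a)"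
proof -
  obtain c t where ct: "c \<noteq> 0" "t \<noteq> 0" "\<forall>j\<le>m. b j = c * t ^ j * a j" using assms(1) unfolding diag_equiv_def by blast
  obtain p where p: "p ^ n = t" using nth_root_exists[OF assms(2), of t] by auto
  hence p0: "p \<noteq> 0" using ct assms(2) by auto
  have "fe (diag_form i n m b) x z = c / outer_factor i p 1 * fe (diag_form i n m a) (p * x + 0 * z) (0 * x + 1 * z)" for x z
    using diag_form_of_diag_equiv[of m b c p n a i x z] ct p p0 by simp
  thus ?thesis unfolding form_equiv_def using p0 ct(1) outer_factor_nz[OF p0, of 1 i]
    by (intro exI[of _ p] exI[of _ 0] exI[of _ 0] exI[of _ 1] exI[of _ "c / outer_factor i p 1"]) auto
qed

text \<open>The conjugate of \<open>diag(\<zeta>, 1)\<close> by a linear equivalence of two forms of the same type is again diagonal, so the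
  equivalence permutes the two fixed points \<open>0\<close> and \<open>\<infinity>\<close> of \<open>C\<^sub>n\<close>.\<close>

lemma typed_equiv_cases:
  fixes a b :: "nat \<Rightarrow> 'a::alg_closed_field"
  assumes a: "typed i n m a" and b: "typed i n m b" and eq: "form_equiv (diag_form i n m b) (diag_form i n m a)"
  shows "diag_equiv m a b \<or> (i \<noteq> 1 \<and> antidiag_equiv m a b)"
proof -
  let ?A = "diag_form i n m a" and ?B = "diag_form i n m b"
  obtain p q r s c where D: "p * s - q * r \<noteq> 0" and c: "c \<noteq> 0"
    and e: "\<And>x z. fe ?B x z = c * fe ?A (p * x + q * z) (r * x + s * z)" using eq unfolding form_equiv_def by blast
  obtain \<zeta> :: 'a where \<zeta>: "\<zeta> ^ n = 1" "\<zeta> \<noteq> 1" using a unfolding typed_def by blast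
  have \<zeta>0: "\<zeta> \<noteq> 0" using \<zeta>(1) typedD(2)[OF a] by (auto simp: power_0_left)
  have Az: "fe ?A (\<zeta> * x) z = outer_factor i \<zeta> 1 * fe ?A x z" for x z
    using outer_factor_scale[of i \<zeta> x 1 z] by (simp add: fe_diag power_mult_distrib \<zeta>)
  obtain p' q' r' s' where D': "p' * s' - q' * r' \<noteq> 0"
    and cmp: "\<And>x z. p * (p' * x + q' * z) + q * (r' * x + s' * z) = x" "\<And>x z. r * (p' * x + q' * z) + s * (r' * x + s' * z) = z"
      "\<And>x z. p' * (p * x + q * z) + q' * (r * x + s * z) = x" "\<And>x z. r' * (p * x + q * z) + s' * (r * x + s * z) = z"
    by (rule inverse_substitution[OF D]) (rule that)
  define P Q R S where "P = p' * \<zeta> * p + q' * r" and "Q = p' * \<zeta> * q + q' * s" and "R = r' * \<zeta> * p + s' * r" and "S = r' * \<zeta> * q + s' * s"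
  have PQ: "P * x + Q * z = p' * (\<zeta> * (p * x + q * z)) + q' * (r * x + s * z)"
    "R * x + S * z = r' * (\<zeta> * (p * x + q * z)) + s' * (r * x + s * z)" for x z
    by (simp_all add: P_def Q_def R_def S_def algebra_simps)
  have "fe ?B (P * x + Q * z) (R * x + S * z) = outer_factor i \<zeta> 1 * fe ?B x z" for x z
    unfolding e PQ cmp(1,2) Az by simp
  moreover have "P * S - Q * R = \<zeta> * ((p' * s' - q' * r') * (p * s - q * r))"
    by (simp add: P_def Q_def R_def S_def algebra_simps)
  ultimately have "autf ?B P Q R S" unfolding autf_def using D D' \<zeta>0 outer_factor_nz[OF \<zeta>0, of 1 i]
    by (intro conjI exI[of _ "outer_factor i \<zeta> 1"]) auto
  from typedD(5)[OF b this] have QR: "Q = 0" "R = 0" by auto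
  have "p * Q + q * S = \<zeta> * q" "r * P + s * R = r" "r * Q + s * S = s" "p * P + q * R = \<zeta> * p"
    using cmp(1,2)[of "\<zeta> * q" s] cmp(1,2)[of "\<zeta> * p" r] by (simp_all add: P_def Q_def R_def S_def algebra_simps)
  hence l: "q * S = \<zeta> * q" "r * P = r" "s * S = s" "p * P = \<zeta> * p" using QR by simp_all
  show ?thesis
  proof (cases "q = 0")
    case True
    hence ps: "p \<noteq> 0" "s \<noteq> 0" using D by auto
    hence r: "r = 0" using l(2,4) \<zeta>(2) by auto
    have "fe ?B x z = fe (diag_form i n m (\<lambda>j. c * outer_factor i p s * s ^ (n * m) * ((p / s) ^ n) ^ j * a j)) x z" for x z
    proof -
      have "gsum m a ((p * x) ^ n) ((s * z) ^ n) = s ^ (n * m) * gsum m a ((p / s) ^ n * x ^ n) (z ^ n)"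
        using gsum_homog[of m a "s ^ n" "(p / s) ^ n * x ^ n" "z ^ n"] ps by (simp add: power_mult_distrib power_divide power_mult)
      thus ?thesis unfolding e unfolding True r fe_diag gsum_scale by (simp add: outer_factor_scale mult_ac)
    qed
    from diag_form_eqI[OF _ this] typedD(2)[OF a]
    have "\<forall>j\<le>m. b j = c * outer_factor i p s * s ^ (n * m) * ((p / s) ^ n) ^ j * a j" by simp
    moreover have "c * outer_factor i p s * s ^ (n * m) \<noteq> 0" "(p / s) ^ n \<noteq> 0" using c ps outer_factor_nz[OF ps, of i] by auto
    ultimately show ?thesis unfolding diag_equiv_def by blast
  next
    case False
    hence "S = \<zeta>" using l(1) by simp
    hence s: "s = 0" using l(3) \<zeta>(2) by auto
    hence r0: "r \<noteq> 0" using D by auto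
    hence "P = 1" using l(2) by simp
    hence p: "p = 0" using l(4) \<zeta>(2) by auto
    have i: "i \<noteq> 1"
    proof
      assume i: "i = 1"
      have "0 = c * fe ?A 0 r" using e[of 1 0] i by (simp add: p s fe_diag outer_factor_def)
      moreover have "gsum m a (0 ^ n) (r ^ n) = a 0 * (r ^ n) ^ m"
      proof -
        have "gsum m a (0 ^ n) (r ^ n) = (\<Sum>j\<in>{0}. a j * (0 ^ n) ^ j * (r ^ n) ^ (m - j))"
          unfolding gsum_def using typedD(2)[OF a] by (intro sum.mono_neutral_right) (auto simp: power_0_left)
        thus ?thesis by simp
      qed
      ultimately show False using c r0 i typed_ends(1)[OF a] by (simp add: fe_diag outer_factor_def)
    qed
    have "fe ?B x z = fe (diag_form i n m (\<lambda>j. c * outer_factor i q r * q ^ (n * m) * ((r / q) ^ n) ^ j * a (m - j))) x z" for x z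
    proof -
      have "gsum m a ((q * z) ^ n) ((r * x) ^ n) = q ^ (n * m) * gsum m a (z ^ n) ((r / q) ^ n * x ^ n)"
        using gsum_homog[of m a "q ^ n" "z ^ n" "(r / q) ^ n * x ^ n"] False by (simp add: power_mult_distrib power_divide power_mult)
      thus ?thesis unfolding e unfolding p s fe_diag gsum_scale[of m _ _ "\<lambda>j. a (m - j)"] gsum_rev
        using outer_factor_swap[OF i, of z x] by (simp add: outer_factor_scale mult_ac)
    qed
    from diag_form_eqI[OF _ this] typedD(2)[OF a]
    have "\<forall>j\<le>m. b j = c * outer_factor i q r * q ^ (n * m) * ((r / q) ^ n) ^ j * a (m - j)" by simp
    moreover have "c * outer_factor i q r * q ^ (n * m) \<noteq> 0" "(r / q) ^ n \<noteq> 0" using c False r0 outer_factor_nz[OF False r0, of i] by auto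
    ultimately show ?thesis using i unfolding antidiag_equiv_def by blast
  qed
qed

lemma autf_diag_conj:
  assumes "\<And>x z. fe G x z = c * fe F (p * x) z" "p \<noteq> 0" "c \<noteq> 0" "autf G P Q R S"
  shows "autf F P (p * Q) (R / p) S"
proof -
  obtain d where d: "P * S - Q * R \<noteq> 0" "d \<noteq> 0" "\<And>x z. fe G (P * x + Q * z) (R * x + S * z) = d * fe G x z"
    using assms(4) unfolding autf_def by blast
  have "fe F (P * x + p * Q * z) (R / p * x + S * z) = d * fe F x z" for x z
    using d(3)[of "x / p" z] assms(2,3) unfolding assms(1) by (simp add: algebra_simps)
  thus ?thesis unfolding autf_def using d assms(2) by (intro conjI exI[of _ d]) auto
qed

lemma form_equiv_no_repeated:
  fixes F G :: "'a::alg_closed_field mpoly"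
  assumes "form_equiv F G" "binary_form d F" "binary_form d G" "no_repeated_linear_factors G"
  shows "no_repeated_linear_factors F"
proof -
  obtain p q r s c where D: "p * s - q * r \<noteq> 0" and c: "c \<noteq> 0"
    and e: "\<And>x z. fe F x z = c * fe G (p * x + q * z) (r * x + s * z)" using assms(1) unfolding form_equiv_def by blast
  have "F = mp_const c * subst2 p q r s G"
    by (rule binary_form_eqI[OF assms(2) binary_form_const_mult[OF binary_form_subst2[OF assms(3)]]]) (simp add: e fe_subst2)
  thus ?thesis using no_repeated_const_mult[OF no_repeated_subst2[OF assms(4) D] c] by simp
qed

lemma typed_diag_equiv:
  fixes a b :: "nat \<Rightarrow> 'a::alg_closed_field"
  assumes a: "typed i n m a" and ab: "diag_equiv m a b" shows "typed i n m b"
proof -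
  note t = typedD(1-3)[OF a]
  obtain c t where ct: "c \<noteq> 0" "t \<noteq> 0" "\<forall>j\<le>m. b j = c * t ^ j * a j" using ab unfolding diag_equiv_def by blast
  obtain p where p: "p ^ n = t" using nth_root_exists[of n t] t by auto
  hence p0: "p \<noteq> 0" using ct t by auto
  have e: "fe (diag_form i n m b) x z = c / outer_factor i p 1 * fe (diag_form i n m a) (p * x) z" for x z
    using diag_form_of_diag_equiv[of m b c p n a i x z] ct p p0 by simp
  have c0: "c / outer_factor i p 1 \<noteq> 0" using ct(1) outer_factor_nz[OF p0, of 1 i] by simp
  have "no_repeated_linear_factors (diag_form i n m b)"
    by (rule form_equiv_no_repeated[OF diag_equiv_form_equiv[OF ab] binary_form_diag[OF t(1)] binary_form_diag[OF t(1)] typedD(4)[OF a]])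
       (use t in simp)
  moreover have "Q = 0 \<and> R = 0 \<and> P ^ n = S ^ n" if "autf (diag_form i n m b) P Q R S" for P Q R S
    using typedD(5)[OF a autf_diag_conj[OF e p0 c0 that]] p0 by auto
  ultimately show ?thesis using a unfolding typed_def by blast
qed

section \<open>Matrices\<close>

lemma fe_gl_act: "fe (gl_act A F) x z =
    fe F (matrix_inv A $ 1 $ 1 * x + matrix_inv A $ 1 $ 2 * z) (matrix_inv A $ 2 $ 1 * x + matrix_inv A $ 2 $ 2 * z)"
  by (simp add: gl_act_subst2 Let_def fe_subst2)

lemma binary_form_gl_act: "binary_form d F \<Longrightarrow> binary_form d (gl_act A F)"
  by (simp add: gl_act_subst2 Let_def binary_form_subst2)

lemma form_sim_iff:
  fixes F G :: "'a::alg_closed_field mpoly"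
  assumes "binary_form d F" "binary_form d G"
  shows "form_sim F G \<longleftrightarrow> (\<exists>c. c \<noteq> 0 \<and> (\<forall>x z. fe F x z = c * fe G x z))"
proof
  assume "\<exists>c. c \<noteq> 0 \<and> (\<forall>x z. fe F x z = c * fe G x z)"
  then obtain c where c: "c \<noteq> 0" "\<And>x z. fe F x z = c * fe G x z" by blast
  have "F = mp_const c * G" by (rule binary_form_eqI[OF assms(1) binary_form_const_mult[OF assms(2)]]) (simp add: c)
  thus "form_sim F G" using c(1) unfolding form_sim_def by blast
qed (auto simp: form_sim_def)

lemma matrix_with_inverse:
  fixes p q r s :: "'a::field"
  assumes D: "p * s - q * r \<noteq> 0"
  obtains A :: "'a ^ 2 ^ 2" where "invertible A" "matrix_inv A $ 1 $ 1 = p" "matrix_inv A $ 1 $ 2 = q"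
    "matrix_inv A $ 2 $ 1 = r" "matrix_inv A $ 2 $ 2 = s"
proof -
  define E where "E = p * s - q * r"
  have E: "E \<noteq> 0" using D by (simp add: E_def)
  define A :: "'a ^ 2 ^ 2" where "A = vector [vector [s / E, - q / E], vector [- r / E, p / E]]"
  have "A $ 1 $ 1 * A $ 2 $ 2 - A $ 1 $ 2 * A $ 2 $ 1 = (p * s - q * r) / (E * E)"
    by (simp add: A_def vector_2 diff_divide_distrib mult.commute)
  also have "\<dots> = 1 / E" using E by (simp add: E_def[symmetric])
  finally have d: "A $ 1 $ 1 * A $ 2 $ 2 - A $ 1 $ 2 * A $ 2 $ 1 = 1 / E" .
  have E1: "1 / E \<noteq> 0" using E by simp
  show ?thesis using that[of A] matrix_inv_2[OF d E1] E by (simp add: A_def vector_2)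
qed

lemma matrix_inv_det:
  fixes A :: "'a::field ^ 2 ^ 2"
  assumes "invertible A"
  shows "matrix_inv A $ 1 $ 1 * matrix_inv A $ 2 $ 2 - matrix_inv A $ 1 $ 2 * matrix_inv A $ 2 $ 1 \<noteq> 0"
proof -
  define E where "E = A $ 1 $ 1 * A $ 2 $ 2 - A $ 1 $ 2 * A $ 2 $ 1"
  have E: "E \<noteq> 0" using assms unfolding invertible_2 E_def .
  have "matrix_inv A $ 1 $ 1 * matrix_inv A $ 2 $ 2 - matrix_inv A $ 1 $ 2 * matrix_inv A $ 2 $ 1 = E / (E * E)"
    unfolding matrix_inv_2(1)[OF E_def[symmetric] E] by (simp add: vector_2 E_def diff_divide_distrib mult.commute)
  thus ?thesis using E by simp
qed

lemma form_sim_gl_act_equiv: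
  fixes F G :: "'a::alg_closed_field mpoly"
  assumes "invertible A" "binary_form d F" "binary_form d G" "form_sim F (gl_act A G)"
  shows "form_equiv F G"
  using assms(4) matrix_inv_det[OF assms(1)] unfolding form_sim_iff[OF assms(2) binary_form_gl_act[OF assms(3)]] fe_gl_act form_equiv_def
  by blast

lemma form_sim_aut:
  fixes F :: "'a::alg_closed_field mpoly"
  assumes "invertible A" "binary_form d F"
  shows "form_sim (gl_act A F) F \<longleftrightarrow>
    autf F (matrix_inv A $ 1 $ 1) (matrix_inv A $ 1 $ 2) (matrix_inv A $ 2 $ 1) (matrix_inv A $ 2 $ 2)"
  unfolding form_sim_iff[OF binary_form_gl_act[OF assms(2)] assms(2)] fe_gl_act autf_def using matrix_inv_det[OF assms(1)] by simp

lemma mat_mult_2: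
  fixes A :: "'a::field ^ 2 ^ 2"
  shows "(mat c ** A) $ i $ j = c * A $ i $ j"
proof -
  have "\<forall>i j. (mat c ** A) $ i $ j = c * A $ i $ j"
    unfolding forall_2 by (simp add: matrix_matrix_mult_def mat_def sum_2)
  thus ?thesis by blast
qed

text \<open>The classes in \<open>PGL\<^sub>2\<close> are those of \<open>diag(\<zeta>\<^sup>j, 1)\<close>, whose \<open>n\<close>-th powers are trivial.\<close>

lemma form_of_type_typed:
  fixes a :: "nat \<Rightarrow> 'a::alg_closed_field"
  assumes f: "form_of_type i n m (diag_form i n m a)" and n: "n > 1" shows "typed i n m a"
proof -
  let ?F = "diag_form i n m a"
  have i: "i \<le> 2" "m > 0" and nr: "no_repeated_linear_factors ?F" using f by (auto simp: form_of_type_def)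
  obtain \<zeta> :: 'a where \<zeta>: "primitive_root_of_unity n \<zeta>" and aut: "Aut_form ?F = {pgl_class (diag2 (\<zeta> ^ j) 1) | j. True}"
    using f unfolding form_of_type_def by blast
  have z1: "\<zeta> ^ n = 1" "\<zeta> \<noteq> 1" using \<zeta> n unfolding primitive_root_of_unity_def by (blast, metis power_one_right zero_less_one)
  have "q = 0 \<and> r = 0 \<and> p ^ n = s ^ n" if au: "autf ?F p q r s" for p q r s
  proof -
    have D: "p * s - q * r \<noteq> 0" using au unfolding autf_def by blast
    obtain A :: "'a ^ 2 ^ 2" where A: "invertible A" "matrix_inv A $ 1 $ 1 = p" "matrix_inv A $ 1 $ 2 = q"
      "matrix_inv A $ 2 $ 1 = r" "matrix_inv A $ 2 $ 2 = s" by (rule matrix_with_inverse[OF D]) (rule that)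
    have "form_sim (gl_act A ?F) ?F" using form_sim_aut[OF A(1) binary_form_diag[OF i(1)]] au A(2-5) by simp
    hence "pgl_class A \<in> Aut_form ?F" using A(1) unfolding Aut_form_def by blast
    then obtain j where j: "pgl_class A = pgl_class (diag2 (\<zeta> ^ j) 1)" unfolding aut by blast
    have "A = mat 1 ** A" by (simp add: vec_eq_iff mat_mult_2)
    hence "A \<in> pgl_class A" unfolding pgl_class_def using one_neq_zero by blast
    then obtain c where c: "c \<noteq> 0" "A = mat c ** diag2 (\<zeta> ^ j) 1" unfolding j unfolding pgl_class_def by blast
    have ent: "A $ 1 $ 1 = c * \<zeta> ^ j" "A $ 1 $ 2 = 0" "A $ 2 $ 1 = 0" "A $ 2 $ 2 = c"
      unfolding c(2) mat_mult_2 by (simp_all add: diag2_def vector_2)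
    define E where "E = c * \<zeta> ^ j * c"
    have dE: "A $ 1 $ 1 * A $ 2 $ 2 - A $ 1 $ 2 * A $ 2 $ 1 = E" by (simp add: ent E_def)
    have E: "E \<noteq> 0" using A(1) unfolding invertible_2 dE .
    have "p = c / E" "q = 0" "r = 0" "s = c * \<zeta> ^ j / E"
      using A(2-5) unfolding matrix_inv_2(1)[OF dE E] by (simp_all add: vector_2 ent)
    moreover have "(\<zeta> ^ j) ^ n = 1" using z1(1) by (simp add: power_mult[symmetric] mult.commute[of j]) (simp add: power_mult)
    ultimately show ?thesis by (simp add: power_divide power_mult_distrib)
  qed
  thus ?thesis unfolding typed_def using i n z1 nr by blast
qed

lemma form_of_type_diag_equiv:
  fixes a b :: "nat \<Rightarrow> 'a::alg_closed_field"
  assumes f: "form_of_type i n m (diag_form i n m a)" and n: "n > 1" and ab: "diag_equiv m a b"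
  shows "form_of_type i n m (diag_form i n m b)"
proof -
  let ?A = "diag_form i n m a" and ?B = "diag_form i n m b"
  have ta: "typed i n m a" by (rule form_of_type_typed[OF f n])
  have tb: "typed i n m b" by (rule typed_diag_equiv[OF ta ab])
  note t = typedD(1-3)[OF ta]
  obtain c t where ct: "c \<noteq> 0" "t \<noteq> 0" "\<forall>j\<le>m. b j = c * t ^ j * a j" using ab unfolding diag_equiv_def by blast
  obtain p where p: "p ^ n = t" using nth_root_exists[of n t] t by auto
  hence p0: "p \<noteq> 0" using ct t by auto
  have e: "fe ?B x z = c / outer_factor i p 1 * fe ?A (p * x) z" for x z
    using diag_form_of_diag_equiv[of m b c p n a i x z] ct p p0 by simp
  have c0: "c / outer_factor i p 1 \<noteq> 0" using ct(1) outer_factor_nz[OF p0, of 1 i] by simp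
  have e': "fe ?A x z = 1 / (c / outer_factor i p 1) * fe ?B (1 / p * x) z" for x z using c0 p0 by (simp add: e)
  have "autf ?B P Q R S \<longleftrightarrow> autf ?A P Q R S" for P Q R S
  proof
    assume B: "autf ?B P Q R S"
    hence "Q = 0" "R = 0" using typedD(5)[OF tb] by auto
    thus "autf ?A P Q R S" using autf_diag_conj[OF e p0 c0 B] by simp
  next
    assume A: "autf ?A P Q R S"
    hence "Q = 0" "R = 0" using typedD(5)[OF ta] by auto
    thus "autf ?B P Q R S" using autf_diag_conj[OF e' _ _ A] p0 c0 by simp
  qed
  hence "form_sim (gl_act A ?B) ?B \<longleftrightarrow> form_sim (gl_act A ?A) ?A" if "invertible A" for A
    using form_sim_aut[OF that binary_form_diag[OF t(1)]] by blast
  hence "Aut_form ?B = Aut_form ?A" unfolding Aut_form_def by blast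
  thus ?thesis using f typedD(4)[OF tb] unfolding form_of_type_def by auto
qed

section \<open>Field automorphisms and fixed fields\<close>

lemma field_auto_simps:
  assumes "field_auto \<sigma>"
  shows "\<sigma> 0 = 0" "\<sigma> 1 = 1" "\<sigma> (x + y) = \<sigma> x + \<sigma> y" "\<sigma> (x * y) = \<sigma> x * \<sigma> y" "\<sigma> (- x) = - \<sigma> x"
    "\<sigma> (x - y) = \<sigma> x - \<sigma> y" "\<sigma> (x ^ n) = \<sigma> x ^ n" "\<sigma> x = 0 \<longleftrightarrow> x = 0" "\<sigma> (inverse x) = inverse (\<sigma> x)"
    "\<sigma> (x / y) = \<sigma> x / \<sigma> y" "\<sigma> (x powi k) = \<sigma> x powi k" "\<sigma> x = \<sigma> y \<longleftrightarrow> x = y" "\<sigma> 2 = 2"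
proof -
  have h: "rhom \<sigma>" using assms by (simp add: field_auto_def)
  note r = rhomD[OF h]
  show z: "\<sigma> x = 0 \<longleftrightarrow> x = 0" for x using assms r(1) inv_auto(2) by metis
  show i: "\<sigma> (inverse x) = inverse (\<sigma> x)" for x
  proof (cases "x = 0")
    case False
    hence "\<sigma> (inverse x) * \<sigma> x = 1" by (simp add: r(4)[symmetric] r(2))
    thus ?thesis by (metis inverse_unique mult.commute)
  qed (simp add: r)
  show "\<sigma> 0 = 0" "\<sigma> 1 = 1" "\<sigma> (x + y) = \<sigma> x + \<sigma> y" "\<sigma> (x * y) = \<sigma> x * \<sigma> y" by (fact r)+
  show "\<sigma> (- x) = - \<sigma> x" "\<sigma> (x - y) = \<sigma> x - \<sigma> y" by (fact rhom_uminus[OF h], fact rhom_diff[OF h])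
  show pw: "\<sigma> (x ^ n) = \<sigma> x ^ n" for x n by (fact rhom_power[OF h])
  show "\<sigma> (x / y) = \<sigma> x / \<sigma> y" by (simp add: divide_inverse r(4) i)
  show "\<sigma> (x powi k) = \<sigma> x powi k" by (simp add: power_int_def pw i)
  show "\<sigma> x = \<sigma> y \<longleftrightarrow> x = y" using assms inv_auto(2) by metis
  have "\<sigma> (1 + 1) = 1 + 1" unfolding r(3) r(2) ..
  thus "\<sigma> 2 = 2" by simp
qed

lemma field_auto_sum: "field_auto \<sigma> \<Longrightarrow> \<sigma> (sum g A) = (\<Sum>x\<in>A. \<sigma> (g x))"
  and field_auto_prod: "field_auto \<sigma> \<Longrightarrow> \<sigma> (prod g A) = (\<Prod>x\<in>A. \<sigma> (g x))"
  by (auto simp: field_auto_def rhom_sum rhom_prod)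

lemma field_auto_comp: "field_auto \<sigma> \<Longrightarrow> field_auto \<tau> \<Longrightarrow> field_auto (\<lambda>x. \<sigma> (\<tau> x))"
  using bij_comp[of \<tau> \<sigma>] by (auto simp: field_auto_def rhom_comp o_def)

lemma field_auto_id: "field_auto (\<lambda>x. x)"
  using bij_id by (auto simp: field_auto_def rhom_def id_def)

text \<open>The definition of \<open>Gal\<close> asks for bijections that preserve sums and products; these fix \<open>0\<close> and \<open>1\<close>.\<close>

lemma Gal_UNIV: "\<sigma> \<in> Gal UNIV k \<longleftrightarrow> field_auto \<sigma> \<and> (\<forall>x\<in>k. \<sigma> x = x)"
proof
  assume s: "\<sigma> \<in> Gal UNIV k"
  hence b: "bij \<sigma>" and add: "\<And>x y. \<sigma> (x + y) = \<sigma> x + \<sigma> y" and mult: "\<And>x y. \<sigma> (x * y) = \<sigma> x * \<sigma> y"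
    and k: "\<forall>x\<in>k. \<sigma> x = x" by (auto simp: Gal_def)
  have "\<sigma> 0 = \<sigma> 0 + \<sigma> 0" using add[of 0 0] by (simp only: add_0_left)
  hence 0: "\<sigma> 0 = 0" by (simp only: add_cancel_right_left)
  have "\<sigma> 1 \<noteq> 0" using 0 b bij_is_inj[OF b] by (metis injD zero_neq_one)
  hence "\<sigma> 1 = 1" using mult[of 1 1] by simp
  thus "field_auto \<sigma> \<and> (\<forall>x\<in>k. \<sigma> x = x)" using 0 b add mult k by (auto simp: field_auto_def rhom_def)
qed (auto simp: Gal_def field_auto_def rhom_def)

lemma rhom_map_poly: "rhom (h :: 'a::comm_ring_1 \<Rightarrow> 'b::comm_ring_1) \<Longrightarrow> rhom (map_poly h)"
proof -
  assume h: "rhom h"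
  note r = rhomD[OF h]
  have c: "Polynomial.coeff (map_poly h p) n = h (Polynomial.coeff p n)" for p n by (simp add: coeff_map_poly r(1))
  show ?thesis unfolding rhom_def
    by (auto simp: poly_eq_iff c r coeff_mult rhom_sum[OF h] coeff_1)
qed

lemma map_poly_linear_factor:
  "rhom (h :: 'a::comm_ring_1 \<Rightarrow> 'b::comm_ring_1) \<Longrightarrow> map_poly h [:- u, 1:] = [:- h u, 1:]"
  by (simp add: map_poly_pCons rhomD rhom_uminus)

lemma poly_map_poly_hom:
  "rhom (h :: 'a::comm_ring_1 \<Rightarrow> 'b::comm_ring_1) \<Longrightarrow> poly (map_poly h p) (h x) = h (poly p x)"
  by (induction p) (simp_all add: map_poly_pCons rhomD)

text \<open>A finite-level form of Artin's theorem. A tuple is encoded as the coefficients of a polynomial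
  \<open>e\<close>. The polynomial with roots the \<open>H\<close>-conjugates of \<open>e\<close> has coefficients fixed by \<open>H\<close>, so an automorphism
  that fixes the fixed field of \<open>H\<close> permutes these conjugates.\<close>

lemma artin:
  fixes e :: "'k::field alg_closure poly"
  assumes H: "\<And>h. h \<in> H \<Longrightarrow> field_auto h" "\<And>h x. h \<in> H \<Longrightarrow> x \<in> ground_field \<Longrightarrow> h x = x"
    and comp: "\<And>g h. g \<in> H \<Longrightarrow> h \<in> H \<Longrightarrow> (\<lambda>x. g (h x)) \<in> H" and id: "(\<lambda>x. x) \<in> H"
    and \<sigma>: "field_auto \<sigma>" "\<And>x. x \<in> fixed_field H \<Longrightarrow> \<sigma> x = x"
  obtains h where "h \<in> H" "\<And>j. \<sigma> (Polynomial.coeff e j) = h (Polynomial.coeff e j)"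
proof -
  have rh: "rhom h" if "field_auto h" for h :: "'k alg_closure \<Rightarrow> _" using that by (simp add: field_auto_def)
  define E where "E = (\<lambda>h. map_poly h e) ` H"
  have c: "Polynomial.coeff (map_poly h p) n = h (Polynomial.coeff p n)" if "field_auto h" for h n and p :: "'k alg_closure poly"
    by (simp add: coeff_map_poly field_auto_simps[OF that])
  have conj_fin: "finite {h x | h. h \<in> H}" for x
  proof -
    obtain p :: "'k poly" where p: "p \<noteq> 0" "poly (map_poly to_ac p) x = 0" by (rule alg_closure_algebraic)
    define q where "q = map_poly to_ac p"
    have q0: "q \<noteq> 0" using p(1) by (simp add: q_def map_poly_eq_0_iff)
    have "poly q (h x) = 0" if "h \<in> H" for h
    proof -
      have "map_poly h q = q"
        by (simp add: poly_eq_iff c[OF H(1)[OF that]]) (simp add: q_def coeff_map_poly H(2)[OF that] ground_field_def)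
      thus ?thesis using poly_map_poly_hom[OF rh[OF H(1)[OF that]], of q x] p(2) field_auto_simps(1)[OF H(1)[OF that]]
        by (simp add: q_def)
    qed
    hence "{h x | h. h \<in> H} \<subseteq> {y. poly q y = 0}" by blast
    thus ?thesis using poly_roots_finite[OF q0] finite_subset by blast
  qed
  have finE: "finite E"
  proof -
    define R where "R = (\<Union>j\<le>Polynomial.degree e. {h (Polynomial.coeff e j) | h. h \<in> H})"
    have R: "finite R" unfolding R_def using conj_fin by blast
    have "E \<subseteq> Poly ` {xs. set xs \<subseteq> R \<and> length xs \<le> Suc (Polynomial.degree e)}"
    proof
      fix u assume "u \<in> E"
      then obtain h where h: "h \<in> H" "u = map_poly h e" by (auto simp: E_def)
      have "u = Poly (map h (coeffs e))" unfolding h(2) map_poly_def ..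
      moreover have "set (map h (coeffs e)) \<subseteq> R"
      proof
        fix y assume "y \<in> set (map h (coeffs e))"
        then obtain c where c': "c \<in> set (coeffs e)" "y = h c" by auto
        then obtain j where j: "j < length (coeffs e)" "c = coeffs e ! j" by (metis in_set_conv_nth)
        have "j \<le> Polynomial.degree e" using j(1) by (auto simp: coeffs_def split: if_splits)
        moreover have "y = h (Polynomial.coeff e j)" using j c'(2) by (simp add: coeffs_nth length_coeffs_degree split: if_splits) (metis coeffs_nth length_coeffs_degree coeffs_eq_Nil less_Suc_eq_le list.size(3) not_less_zero)
        ultimately show "y \<in> R" unfolding R_def using h(1) by blast
      qed
      moreover have "length (map h (coeffs e)) \<le> Suc (Polynomial.degree e)" by (simp add: coeffs_def)
      ultimately show "u \<in> Poly ` {xs. set xs \<subseteq> R \<and> length xs \<le> Suc (Polynomial.degree e)}" by blast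
    qed
    thus ?thesis using finite_lists_length_le[OF R] finite_subset by blast
  qed
  define P where "P = (\<Prod>u\<in>E. [:- u, 1:])"
  have mP: "map_poly (map_poly h) P = (\<Prod>u\<in>E. [:- map_poly h u, 1:])" if "field_auto h" for h
    unfolding P_def rhom_prod[OF rhom_map_poly[OF rhom_map_poly[OF rh[OF that]]]]
    by (simp add: map_poly_linear_factor[OF rhom_map_poly[OF rh[OF that]]])
  have fixP: "map_poly (map_poly h) P = P" if h: "h \<in> H" for h
  proof -
    have inj: "inj (map_poly h)"
    proof (rule injI)
      fix u v assume "map_poly h u = map_poly h v"
      hence "h (Polynomial.coeff u n) = h (Polynomial.coeff v n)" for n by (metis c[OF H(1)[OF h]])
      thus "u = v" by (simp add: poly_eq_iff field_auto_simps(12)[OF H(1)[OF h]])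
    qed
    have "map_poly h ` E \<subseteq> E"
    proof
      fix v assume "v \<in> map_poly h ` E"
      then obtain g where g: "g \<in> H" "v = map_poly h (map_poly g e)" by (auto simp: E_def)
      have "v = map_poly (\<lambda>x. h (g x)) e"
        by (simp add: g(2) poly_eq_iff c[OF H(1)[OF h]] c[OF H(1)[OF g(1)]] c[OF H(1)[OF comp[OF h g(1)]]])
      thus "v \<in> E" unfolding E_def using comp[OF h g(1)] by blast
    qed
    hence "bij_betw (map_poly h) E E"
      using endo_inj_surj[OF finE] inj_on_subset[OF inj subset_UNIV] unfolding bij_betw_def by blast
    from prod.reindex_bij_betw[OF this, of "\<lambda>u. [:- u, 1:]"] show ?thesis
      unfolding mP[OF H(1)[OF h]] by (simp add: P_def)
  qed
  have "Polynomial.coeff (Polynomial.coeff P i) j \<in> fixed_field H" for i j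
    unfolding fixed_field_def
  proof (intro CollectI ballI)
    fix h assume h: "h \<in> H"
    have "map_poly h (Polynomial.coeff P i) = Polynomial.coeff (map_poly (map_poly h) P) i" by (simp add: coeff_map_poly)
    hence "Polynomial.coeff (map_poly h (Polynomial.coeff P i)) j = Polynomial.coeff (Polynomial.coeff P i) j"
      unfolding fixP[OF h] by simp
    thus "h (Polynomial.coeff (Polynomial.coeff P i) j) = Polynomial.coeff (Polynomial.coeff P i) j" using c[OF H(1)[OF h]] by simp
  qed
  hence sP: "map_poly (map_poly \<sigma>) P = P"
    using \<sigma>(2) by (simp add: poly_eq_iff coeff_map_poly c[OF \<sigma>(1)])
  have "e \<in> E" unfolding E_def using id by (force intro: image_eqI[of _ _ "\<lambda>x. x"] simp: map_poly_id')
  hence "poly P e = 0" unfolding P_def poly_prod using finE by (intro prod_zero) auto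
  hence "poly P (map_poly \<sigma> e) = 0"
    using poly_map_poly_hom[OF rhom_map_poly[OF rh[OF \<sigma>(1)]], of P e] unfolding sP by simp
  then obtain u where u: "u \<in> E" "poly [:- u, 1:] (map_poly \<sigma> e) = 0"
    unfolding P_def poly_prod using finE by (auto simp: prod_zero_iff)
  then obtain h where h: "h \<in> H" "map_poly \<sigma> e = map_poly h e" by (auto simp: E_def)
  show ?thesis by (rule that[OF h(1)]) (metis h(2) c[OF \<sigma>(1)] c[OF H(1)[OF h(1)]])
qed

lemma artin_tuple:
  fixes a :: "nat \<Rightarrow> 'k::field alg_closure"
  assumes H: "\<And>h. h \<in> H \<Longrightarrow> field_auto h" "\<And>h x. h \<in> H \<Longrightarrow> x \<in> ground_field \<Longrightarrow> h x = x"
    and comp: "\<And>g h. g \<in> H \<Longrightarrow> h \<in> H \<Longrightarrow> (\<lambda>x. g (h x)) \<in> H" and id: "(\<lambda>x. x) \<in> H"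
    and \<sigma>: "field_auto \<sigma>" "\<And>x. x \<in> fixed_field H \<Longrightarrow> \<sigma> x = x"
  obtains h where "h \<in> H" "\<And>j. j \<le> m \<Longrightarrow> \<sigma> (a j) = h (a j)"
proof -
  define e where "e = (\<Sum>j<Suc m. Polynomial.monom (a j) j)"
  have ce: "Polynomial.coeff e j = a j" if "j \<le> m" for j using that by (simp add: e_def coeff_sum sum.delta)
  have "\<exists>h\<in>H. \<forall>j. \<sigma> (Polynomial.coeff e j) = h (Polynomial.coeff e j)"
    by (rule artin[of H \<sigma> e]) (fact H comp id \<sigma> | blast)+
  then obtain h where h: "h \<in> H" "\<And>j. \<sigma> (Polynomial.coeff e j) = h (Polynomial.coeff e j)" by blast
  show ?thesis by (rule that[OF h(1)]) (use h(2) ce in metis)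
qed

section \<open>Homogeneous diagonal invariants\<close>

lemma subgroup_int_principal:
  fixes Z :: "int set"
  assumes "0 \<in> Z" "\<And>x y. x \<in> Z \<Longrightarrow> y \<in> Z \<Longrightarrow> x - y \<in> Z"
  obtains d where "d \<in> Z" "\<And>z. z \<in> Z \<Longrightarrow> d dvd z"
proof (cases "\<exists>z\<in>Z. z > 0")
  case False
  have "z = 0" if "z \<in> Z" for z
  proof -
    have "- z \<in> Z" using assms(2)[OF assms(1) that] by simp
    hence "\<not> z > 0" "\<not> - z > 0" using False that by blast+
    thus ?thesis by linarith
  qed
  thus ?thesis using that[of 0] assms(1) by auto
next
  case True
  then obtain n :: nat where "int n \<in> Z" "n > 0" by (metis zero_less_imp_eq_int)
  define d where "d = (LEAST n. int n \<in> Z \<and> n > 0)"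
  have d: "int d \<in> Z" "d > 0" using LeastI[of "\<lambda>n. int n \<in> Z \<and> n > 0" n] \<open>int n \<in> Z\<close> \<open>n > 0\<close> by (auto simp: d_def)
  have mult: "k * int d \<in> Z" for k
  proof -
    have neg: "- x \<in> Z" if "x \<in> Z" for x using assms(2)[OF assms(1) that] by simp
    have add: "x + y \<in> Z" if "x \<in> Z" "y \<in> Z" for x y using assms(2)[OF that(1) neg[OF that(2)]] by simp
    have "int k * int d \<in> Z" for k by (induction k) (auto simp: assms(1) distrib_right intro: add d)
    thus ?thesis using neg by (cases k rule: int_cases2) (metis mult_minus_left)+
  qed
  have "int d dvd z" if z: "z \<in> Z" for z
  proof -
    have "z - (z div int d) * int d \<in> Z" using assms(2) z mult by blast
    hence "z mod int d \<in> Z" by (simp add: minus_div_mult_eq_mod)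
    moreover have "0 \<le> z mod int d" "z mod int d < int d" using d(2) by auto
    ultimately have "z mod int d = 0" using not_less_Least[of "nat (z mod int d)" "\<lambda>n. int n \<in> Z \<and> n > 0"] d(2)
      unfolding d_def[symmetric] by (metis int_nat_eq nat_less_iff not_le of_nat_0_less_iff order_le_imp_less_or_eq)
    thus ?thesis by auto
  qed
  thus ?thesis using that d(1) by blast
qed

text \<open>The divisibility of \<open>K\<^sup>*\<close>, including the trivial exponent.\<close>

lemma powi_root:
  fixes x :: "'a::alg_closed_field"
  assumes "x \<noteq> 0" "d = 0 \<Longrightarrow> x = 1"
  obtains u where "u \<noteq> 0" "u powi d = x"
proof (cases "d = 0")
  case True thus ?thesis using that[of 1] assms(2) by simp
next
  case False
  hence n: "nat \<bar>d\<bar> > 0" by simp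
  obtain u where u: "u ^ nat \<bar>d\<bar> = x" using nth_root_exists[OF n, of x] by auto
  hence u0: "u \<noteq> 0" using assms(1) n by (auto simp: power_0_left)
  show ?thesis
  proof (cases "d > 0")
    case True thus ?thesis using that[OF u0] u by (simp add: power_int_def)
  next
    case False
    hence "inverse u powi d = x" using u \<open>d \<noteq> 0\<close> by (simp add: power_int_def)
    thus ?thesis using that[of "inverse u"] u0 by simp
  qed
qed

lemma power_int_sum: "x \<noteq> 0 \<Longrightarrow> x powi (sum g A) = (\<Prod>i\<in>A. x powi g i)" for x :: "'a::field"
  by (induction A rule: infinite_finite_induct) (auto simp: power_int_add)

lemma power_int_prod: "prod f A powi k = (\<Prod>i\<in>A. f i powi k)" for f :: "'b \<Rightarrow> 'a::field"
  by (induction A rule: infinite_finite_induct) (auto simp: power_int_mult_distrib)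

lemma same_weighted_point_map:
  "same_weighted_point (map g xs @ map g' ys) (map f xs @ map f' ys) (map h xs @ map h' ys) \<longleftrightarrow>
   (\<exists>c. c \<noteq> 0 \<and> (\<forall>x\<in>set xs. h x = c ^ g x * f x) \<and> (\<forall>y\<in>set ys. h' y = c ^ g' y * f' y))"
proof -
  have split: "(\<forall>l<m + n. R l) \<longleftrightarrow> (\<forall>l<m. R l) \<and> (\<forall>l<n. R (m + l))" for m n :: nat and R
    by (auto simp: all_conj_distrib) (metis add_diff_inverse_nat nat_add_left_cancel_less)
  show ?thesis unfolding same_weighted_point_def length_append split
    by (simp add: nth_append all_set_conv_all_nth)
qed

text \<open>The \<open>\<rho>\<^sub>t\<close>, the ratios of two tuples with the same invariants, define a character of \<open>\<int>\<^sup>r\<close> that is trivial on the kernel of \<open>M\<^sub>S\<close>.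
  So it factors through the image of \<open>M\<^sub>S\<close>, a subgroup of \<open>\<int>\<close>, and it extends to \<open>\<int>\<close> because \<open>K\<^sup>*\<close> is divisible.\<close>

lemma invariants_determine_ratios:
  fixes \<rho> :: "nat \<Rightarrow> 'a::alg_closed_field"
  assumes nb: "nonneg_basis m S vs" and \<rho>: "\<And>t. t < length S \<Longrightarrow> \<rho> t \<noteq> 0"
    and one: "\<And>v. v \<in> set vs \<Longrightarrow> (\<Prod>t<length S. \<rho> t ^ v t) = 1"
  obtains u where "u \<noteq> 0" "\<And>t. t < length S \<Longrightarrow> \<rho> t = u powi (2 * int (S ! t) - int m)"
proof -
  define r where "r = length S"
  define M where "M v = (\<Sum>t<r. (2 * int (S ! t) - int m) * v t)" for v
  define ch where "ch v = (\<Prod>t<r. \<rho> t powi v t)" for v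
  have ch0: "ch v \<noteq> 0" for v using \<rho> by (auto simp: ch_def r_def)
  have ch_diff: "ch (\<lambda>t. v t - v' t) = ch v / ch v'" for v v'
    unfolding ch_def prod_dividef[symmetric] using \<rho> by (intro prod.cong) (auto simp: power_int_diff r_def)
  have ch_mult: "ch (\<lambda>t. k * v t) = ch v powi k" for k v
    unfolding ch_def power_int_prod by (intro prod.cong) (auto simp: power_int_mult mult.commute[of k])
  have ker: "ch v = 1" if v: "v \<in> kernel_lattice m S" for v
  proof -
    let ?bs = "map (\<lambda>v t. int (v t)) vs"
    obtain c where c: "v = (\<lambda>t. \<Sum>l<length ?bs. c l * (?bs ! l) t)"
      using nb v unfolding nonneg_basis_def is_Z_basis_def by blast
    have "ch v = (\<Prod>t<r. \<Prod>l<length ?bs. \<rho> t powi (c l * (?bs ! l) t))"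
      unfolding ch_def c using \<rho> by (intro prod.cong refl power_int_sum) (auto simp: r_def)
    also have "\<dots> = (\<Prod>l<length ?bs. ch (\<lambda>t. c l * (?bs ! l) t))" unfolding ch_def by (rule prod.swap)
    also have "\<dots> = (\<Prod>l<length ?bs. 1)"
    proof (rule prod.cong)
      fix l assume "l \<in> {..<length ?bs}"
      hence l: "l < length vs" by simp
      have "ch (?bs ! l) = (\<Prod>t<length S. \<rho> t ^ (vs ! l) t)" using l by (simp add: ch_def r_def)
      also have "\<dots> = 1" using one l by simp
      finally show "ch (\<lambda>t. c l * (?bs ! l) t) = 1" by (simp add: ch_mult)
    qed simp
    finally show ?thesis by simp
  qed
  have kerI: "v \<in> kernel_lattice m S" if "\<And>t. t \<ge> r \<Longrightarrow> v t = 0" "M v = 0" for v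
    using that by (simp add: kernel_lattice_def M_def r_def)
  define Z where "Z = M ` {v. \<forall>t\<ge>r. v t = 0}"
  obtain d where d: "d \<in> Z" "\<And>z. z \<in> Z \<Longrightarrow> d dvd z"
  proof (rule subgroup_int_principal[of Z])
    show "0 \<in> Z" unfolding Z_def by (rule image_eqI[of _ _ "\<lambda>_. 0"]) (auto simp: M_def)
    fix x y assume "x \<in> Z" "y \<in> Z"
    then obtain v v' where "x = M v" "y = M v'" "\<forall>t\<ge>r. v t = 0" "\<forall>t\<ge>r. v' t = 0" by (auto simp: Z_def)
    thus "x - y \<in> Z" unfolding Z_def
      by (intro image_eqI[of _ _ "\<lambda>t. v t - v' t"]) (auto simp: M_def right_diff_distrib sum_subtractf)
  qed (rule that)
  then obtain v0 where v0: "d = M v0" "\<forall>t\<ge>r. v0 t = 0" by (auto simp: Z_def)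
  have "ch v0 = 1" if "d = 0" using ker[OF kerI[of v0]] v0 that by simp
  then obtain u where u: "u \<noteq> 0" "u powi d = ch v0" using powi_root[OF ch0[of v0], of d] by metis
  have "\<rho> t = u powi (2 * int (S ! t) - int m)" if t: "t < length S" for t
  proof -
    define e where "e = (\<lambda>i. if i = t then 1 else 0 :: int)"
    have Me: "M e = 2 * int (S ! t) - int m" 
    proof -
      have "M e = (\<Sum>i<r. if i = t then 2 * int (S ! t) - int m else 0)" unfolding M_def by (intro sum.cong) (auto simp: e_def)
      thus ?thesis using t by (simp add: r_def)
    qed
    have che: "ch e = \<rho> t"
    proof -
      have "ch e = (\<Prod>i<r. if i = t then \<rho> t else 1)" unfolding ch_def by (intro prod.cong) (auto simp: e_def)
      thus ?thesis using t by (simp add: r_def)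
    qed
    have "M e \<in> Z" unfolding Z_def using t by (auto simp: e_def r_def)
    then obtain k where k: "M e = d * k" using d(2) by (auto elim: dvdE)
    have "(\<lambda>i. e i - k * v0 i) \<in> kernel_lattice m S"
    proof (rule kerI)
      show "e i - k * v0 i = 0" if "i \<ge> r" for i using that t v0(2) by (simp add: e_def r_def)
      have "M (\<lambda>i. e i - k * v0 i) = M e - k * M v0"
        by (simp add: M_def right_diff_distrib sum_subtractf sum_distrib_left mult_ac)
      thus "M (\<lambda>i. e i - k * v0 i) = 0" using k v0(1) by simp
    qed
    hence "ch e / ch (\<lambda>i. k * v0 i) = 1" using ker ch_diff by metis
    hence "ch e = ch v0 powi k" using ch0 by (simp add: ch_mult)
    thus ?thesis unfolding che u(2)[symmetric] Me[symmetric] k by (simp add: power_int_mult)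
  qed
  thus ?thesis using that u(1) by blast
qed

text \<open>A diagonal substitution multiplies an invariant monomial by a power of a constant that depends only on its
  degree. Conversely, proportional invariants determine the \<open>a\<^sub>s\<close> with \<open>s \<in> S\<close> up to a diagonal substitution, and the
  products \<open>a\<^sub>m\<^sub>-\<^sub>j a\<^sub>j\<close> then determine the remaining coefficients.\<close>

lemma same_invariants_iff_diag_equiv:
  fixes a :: "nat \<Rightarrow> 'a::alg_closed_field"
  assumes adm: "admissible m a S" and nb: "nonneg_basis m S vs" and \<sigma>: "field_auto \<sigma>"
  shows "same_weighted_point (J_weights m S vs) (map \<sigma> (J_values m S vs a)) (J_values m S vs a) \<longleftrightarrow> diag_equiv m a (\<lambda>j. \<sigma> (a j))"
proof -
  note fs = field_auto_simps[OF \<sigma>]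
  let ?J = "\<lambda>a v. \<Prod>t<length S. a (S ! t) ^ v t"
  have S: "S ! t \<le> m" "a (S ! t) \<noteq> 0" if "t < length S" for t
  proof -
    show "a (S ! t) \<noteq> 0" using adm nth_mem[OF that] unfolding admissible_def by blast
    have "S ! t \<in> {0..m}" using adm nth_mem[OF that] unfolding admissible_def by blast
    thus "S ! t \<le> m" by simp
  qed
  have "map \<sigma> (J_values m S vs a) = map (\<lambda>v. ?J (\<lambda>j. \<sigma> (a j)) v) vs @ map (\<lambda>j. \<sigma> (a (m - j)) * \<sigma> (a j)) (filter (\<lambda>j. 2 * j < m) [0..<m])"
    by (simp add: J_values_def fs field_auto_prod[OF \<sigma>])
  hence "same_weighted_point (J_weights m S vs) (map \<sigma> (J_values m S vs a)) (J_values m S vs a) \<longleftrightarrow>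
    (\<exists>c. c \<noteq> 0 \<and> (\<forall>v\<in>set vs. ?J a v = c ^ (\<Sum>t<length S. v t) * ?J (\<lambda>j. \<sigma> (a j)) v) \<and>
       (\<forall>j\<in>set (filter (\<lambda>j. 2 * j < m) [0..<m]). a (m - j) * a j = c ^ 2 * (\<sigma> (a (m - j)) * \<sigma> (a j))))"
    unfolding J_weights_def J_values_def by (simp only: same_weighted_point_map)
  also have "\<dots> \<longleftrightarrow> diag_equiv m a (\<lambda>j. \<sigma> (a j))"
  proof
    assume "diag_equiv m a (\<lambda>j. \<sigma> (a j))"
    then obtain C t where C: "C \<noteq> 0" "t \<noteq> 0" "\<And>j. j \<le> m \<Longrightarrow> \<sigma> (a j) = C * t ^ j * a j" unfolding diag_equiv_def by blast
    obtain \<theta> where \<theta>: "\<theta> ^ 2 = t" using nth_root_exists[of 2 t] by auto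
    hence \<theta>0: "\<theta> \<noteq> 0" using C(2) by auto
    define D where "D = C * \<theta> ^ m"
    have D0: "D \<noteq> 0" using C(1) \<theta>0 by (simp add: D_def)
    have 1: "?J (\<lambda>j. \<sigma> (a j)) v = D ^ (\<Sum>t<length S. v t) * ?J a v" if v: "v \<in> set vs" for v
    proof -
      have "(\<lambda>t. int (v t)) \<in> kernel_lattice m S" using nb v unfolding nonneg_basis_def is_Z_basis_def by auto
      hence "(\<Sum>t<length S. (2 * int (S ! t) - int m) * int (v t)) = 0" by (simp add: kernel_lattice_def)
      hence "int (\<Sum>t<length S. 2 * (S ! t) * v t) = int (\<Sum>t<length S. m * v t)"
        by (simp add: left_diff_distrib sum_subtractf)
      hence k: "(\<Sum>t<length S. 2 * (S ! t) * v t) = m * (\<Sum>t<length S. v t)" by (simp only: of_nat_eq_iff sum_distrib_left)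
      have "?J (\<lambda>j. \<sigma> (a j)) v = (\<Prod>i<length S. C ^ v i * \<theta> ^ (2 * (S ! i) * v i) * a (S ! i) ^ v i)"
        using C(3) S(1) by (intro prod.cong refl) (auto simp: power_mult_distrib power_mult \<theta>)
      also have "\<dots> = C ^ (\<Sum>t<length S. v t) * \<theta> ^ (\<Sum>t<length S. 2 * (S ! t) * v t) * ?J a v"
        by (simp add: prod.distrib power_sum)
      also have "\<dots> = D ^ (\<Sum>t<length S. v t) * ?J a v" unfolding k by (simp add: D_def power_mult_distrib power_mult)
      finally show ?thesis .
    qed
    have 2: "\<sigma> (a (m - j)) * \<sigma> (a j) = D ^ 2 * (a (m - j) * a j)" if "j \<le> m" for j
    proof -
      have "t ^ (m - j) * t ^ j = t ^ m" using that by (simp only: power_add[symmetric] le_add_diff_inverse2)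
      also have "\<dots> = (\<theta> ^ m) ^ 2" unfolding \<theta>[symmetric] power_mult[symmetric] by (simp only: mult.commute)
      finally have *: "t ^ (m - j) * t ^ j = (\<theta> ^ m) ^ 2" .
      have "\<sigma> (a (m - j)) * \<sigma> (a j) = (C * t ^ (m - j) * a (m - j)) * (C * t ^ j * a j)" using C(3)[of j] C(3)[of "m - j"] that by simp
      also have "\<dots> = C * C * (t ^ (m - j) * t ^ j) * (a (m - j) * a j)" by (simp only: mult_ac)
      finally have "\<sigma> (a (m - j)) * \<sigma> (a j) = C * C * (\<theta> ^ m) ^ 2 * (a (m - j) * a j)" unfolding * .
      thus ?thesis by (simp add: D_def power_mult_distrib power2_eq_square mult_ac)
    qed
    show "\<exists>c. c \<noteq> 0 \<and> (\<forall>v\<in>set vs. ?J a v = c ^ (\<Sum>t<length S. v t) * ?J (\<lambda>j. \<sigma> (a j)) v) \<and>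
       (\<forall>j\<in>set (filter (\<lambda>j. 2 * j < m) [0..<m]). a (m - j) * a j = c ^ 2 * (\<sigma> (a (m - j)) * \<sigma> (a j)))"
      by (rule exI[of _ "inverse D"]) (use D0 1 2 in \<open>auto simp: power_inverse mult.assoc[symmetric]\<close>)
  next
    assume "\<exists>c. c \<noteq> 0 \<and> (\<forall>v\<in>set vs. ?J a v = c ^ (\<Sum>t<length S. v t) * ?J (\<lambda>j. \<sigma> (a j)) v) \<and>
       (\<forall>j\<in>set (filter (\<lambda>j. 2 * j < m) [0..<m]). a (m - j) * a j = c ^ 2 * (\<sigma> (a (m - j)) * \<sigma> (a j)))"
    then obtain c where c: "c \<noteq> 0" "\<And>v. v \<in> set vs \<Longrightarrow> ?J a v = c ^ (\<Sum>t<length S. v t) * ?J (\<lambda>j. \<sigma> (a j)) v"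
       "\<And>j. 2 * j < m \<Longrightarrow> a (m - j) * a j = c ^ 2 * (\<sigma> (a (m - j)) * \<sigma> (a j))" by auto
    define b where "b j = c * \<sigma> (a j)" for j
    define \<rho> where "\<rho> t = b (S ! t) / a (S ! t)" for t
    have \<rho>0: "\<rho> t \<noteq> 0" if "t < length S" for t using S[OF that] c(1) by (simp add: \<rho>_def b_def fs)
    have \<rho>1: "(\<Prod>t<length S. \<rho> t ^ v t) = 1" if v: "v \<in> set vs" for v
    proof -
      have "?J b v = ?J a v" unfolding c(2)[OF v] by (simp add: b_def power_mult_distrib prod.distrib power_sum)
      moreover have "?J a v \<noteq> 0" using S(2) by auto
      ultimately show ?thesis by (simp add: \<rho>_def power_divide prod_dividef)
    qed
    have "\<exists>u. u \<noteq> 0 \<and> (\<forall>t<length S. \<rho> t = u powi (2 * int (S ! t) - int m))"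
      by (rule invariants_determine_ratios[of m S vs \<rho>]) (use nb \<rho>0 \<rho>1 in blast)+
    then obtain u where u: "u \<noteq> 0" "\<And>t. t < length S \<Longrightarrow> \<rho> t = u powi (2 * int (S ! t) - int m)" by blast
    have bS: "b s = u powi (2 * int s - int m) * a s" if s: "s \<in> set S" for s
    proof -
      obtain t where t: "t < length S" "S ! t = s" using s by (auto simp: in_set_conv_nth)
      thus ?thesis using u(2)[OF t(1)] S(2)[OF t(1)] by (simp add: \<rho>_def field_simps)
    qed
    have pair: "b (m - j) * b j = a (m - j) * a j" if "2 * j < m" for j
      using c(3)[OF that] by (simp add: b_def power2_eq_square mult_ac)
    have ball: "b j = u powi (2 * int j - int m) * a j" if j: "j \<le> m" for j
    proof (cases "a j = 0 \<and> a (m - j) = 0")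
      case True thus ?thesis by (simp add: b_def fs)
    next
      case False
      then obtain s where s: "s \<in> {j, m - j}" "s \<in> set S" using adm j unfolding admissible_def by blast
      show ?thesis
      proof (cases "s = j")
        case True thus ?thesis using bS s by simp
      next
        case ne: False
        hence sj: "s = m - j" "m - s = j" using s(1) j by auto
        have s0: "a s \<noteq> 0" using adm s(2) unfolding admissible_def by blast
        have "b s * b j = a s * a j"
        proof (cases "2 * j < m")
          case True thus ?thesis using pair[OF True] sj by simp
        next
          case False
          hence "2 * s < m" using ne sj j by linarith
          thus ?thesis using pair[of s] sj by (simp add: mult.commute)
        qed
        moreover have "2 * int s - int m = - (2 * int j - int m)" using sj j by simp
        ultimately have *: "inverse (u powi (2 * int j - int m)) * a s * b j = a s * a j"
          using bS[OF s(2)] by (simp only: power_int_minus)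
        define w where "w = u powi (2 * int j - int m)"
        have w0: "w \<noteq> 0" using u(1) by (simp add: w_def)
        have "a s * b j = w * (inverse w * a s * b j)" using w0 by simp
        also have "\<dots> = a s * (w * a j)" using * unfolding w_def[symmetric] by (simp only: mult_ac)
        finally show ?thesis using s0 by (simp add: w_def)
      qed
    qed
    have "\<sigma> (a j) = (inverse c * u powi (- int m)) * (u ^ 2) ^ j * a j" if j: "j \<le> m" for j
    proof -
      have "u powi (2 * int j - int m) = u powi (- int m) * (u ^ 2) ^ j"
      proof -
        have "u powi (2 * int j - int m) = u powi (- int m) * u powi (int (2 * j))"
          using u(1) by (simp add: power_int_add[symmetric])
        thus ?thesis by (simp only: power_int_of_nat power_mult)
      qed
      moreover have "\<sigma> (a j) = inverse c * b j" using c(1) by (simp add: b_def)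
      ultimately show ?thesis unfolding ball[OF j] by (simp add: mult_ac)
    qed
    moreover have "inverse c * u powi (- int m) \<noteq> 0" "u ^ 2 \<noteq> 0" using c(1) u(1) by auto
    ultimately show "diag_equiv m a (\<lambda>j. \<sigma> (a j))" unfolding diag_equiv_def by blast
  qed
  finally show ?thesis .
qed

text \<open>After division by \<open>a\<^sub>0\<close>, each \<open>h \<in> H\<close> multiplies \<open>a\<^sub>j\<close> by \<open>T(h)\<^sup>j\<close>. The exponents \<open>z\<close> for which some \<open>U\<close> is multiplied by
  \<open>T(h)\<^sup>z\<close> for all \<open>h\<close> form a subgroup of \<open>\<int>\<close>. It contains the \<open>j\<close> with \<open>a\<^sub>j \<noteq> 0\<close> and is generated by one \<open>d\<close>; if \<open>U\<close> belongs to \<open>d\<close>,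
  scaling by a \<open>d\<close>-th root of \<open>1 / U\<close> cancels all factors \<open>T(h)\<close>.\<close>

lemma rational_coefficients:
  fixes a :: "nat \<Rightarrow> 'a::alg_closed_field"
  assumes H: "\<And>h. h \<in> H \<Longrightarrow> field_auto h" "\<And>h. h \<in> H \<Longrightarrow> diag_equiv m a (\<lambda>j. h (a j))"
    and a: "a 0 \<noteq> 0" "a m \<noteq> 0" "m > 0"
  obtains b where "diag_equiv m a b" "b 0 = 1" "\<And>h j. h \<in> H \<Longrightarrow> j \<le> m \<Longrightarrow> h (b j) = b j"
proof -
  define a' where "a' j = a j / a 0" for j
  have "\<exists>t. t \<noteq> 0 \<and> (\<forall>j\<le>m. h (a' j) = t ^ j * a' j)" if h: "h \<in> H" for h
  proof -
    obtain C t where C: "C \<noteq> 0" "t \<noteq> 0" "\<And>j. j \<le> m \<Longrightarrow> h (a j) = C * t ^ j * a j" using H(2)[OF h] unfolding diag_equiv_def by blast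
    have "h (a' j) = t ^ j * a' j" if "j \<le> m" for j
      using C(3)[OF that] C(3)[of 0] C(1) a(1) by (simp add: a'_def field_auto_simps[OF H(1)[OF h]])
    thus ?thesis using C(2) by blast
  qed
  then obtain T where T: "\<And>h. h \<in> H \<Longrightarrow> T h \<noteq> 0" "\<And>h j. h \<in> H \<Longrightarrow> j \<le> m \<Longrightarrow> h (a' j) = T h ^ j * a' j" by metis
  define Z where "Z = {z::int. \<exists>U. U \<noteq> 0 \<and> (\<forall>h\<in>H. h U = U * T h powi z)}"
  obtain d where d: "d \<in> Z" "\<And>z. z \<in> Z \<Longrightarrow> d dvd z"
  proof (rule subgroup_int_principal[of Z])
    show "0 \<in> Z" unfolding Z_def by (auto simp: field_auto_simps(2)[OF H(1)] intro!: exI[of _ 1])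
    fix x y assume "x \<in> Z" "y \<in> Z"
    then obtain U V where "U \<noteq> 0" "\<forall>h\<in>H. h U = U * T h powi x" "V \<noteq> 0" "\<forall>h\<in>H. h V = V * T h powi y" by (auto simp: Z_def)
    thus "x - y \<in> Z" unfolding Z_def using T(1)
      by (intro CollectI exI[of _ "U / V"]) (auto simp: field_auto_simps(10)[OF H(1)] power_int_diff)
  qed (rule that)
  have supp: "int j \<in> Z" if "j \<le> m" "a j \<noteq> 0" for j
    unfolding Z_def using T(2)[OF _ that(1)] that(2) a(1) by (intro CollectI exI[of _ "a' j"]) (auto simp: a'_def mult.commute)
  obtain U where U: "U \<noteq> 0" "\<And>h. h \<in> H \<Longrightarrow> h U = U * T h powi d" using d(1) by (auto simp: Z_def)
  have d0: "d \<noteq> 0" using d(2)[OF supp[OF order_refl a(2)]] a(3) by auto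
  obtain y where y: "y \<noteq> 0" "y powi d = inverse U" by (rule powi_root[of "inverse U" d]) (use U(1) d0 in \<open>auto intro: that\<close>)
  define b where "b j = y ^ j * a' j" for j
  have "h (b j) = b j" if h: "h \<in> H" and j: "j \<le> m" for h j
  proof (cases "a j = 0")
    case True thus ?thesis by (simp add: b_def a'_def field_auto_simps[OF H(1)[OF h]])
  next
    case False
    obtain k where k: "int j = d * k" using d(2)[OF supp[OF j False]] by (auto elim: dvdE)
    have yj: "y ^ j = inverse U powi k"
    proof -
      have "y ^ j = y powi (d * k)" unfolding k[symmetric] by simp
      thus ?thesis by (simp add: power_int_mult y(2))
    qed
    have tj: "T h ^ j = (T h powi d) powi k"
    proof -
      have "T h ^ j = T h powi (d * k)" unfolding k[symmetric] by simp
      thus ?thesis by (simp add: power_int_mult)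
    qed
    have "h (y ^ j) * T h ^ j = (inverse (U * T h powi d) * T h powi d) powi k"
      unfolding yj tj power_int_mult_distrib by (simp add: field_auto_simps[OF H(1)[OF h]] U(2)[OF h])
    also have "inverse (U * T h powi d) * T h powi d = inverse U" using T(1)[OF h] U(1) by (simp add: field_simps)
    finally have "h (y ^ j) * T h ^ j = y ^ j" unfolding yj .
    thus ?thesis unfolding b_def field_auto_simps(4)[OF H(1)[OF h]] T(2)[OF h j] by (simp add: mult.assoc[symmetric])
  qed
  moreover have "diag_equiv m a b" unfolding diag_equiv_def
    by (rule exI[of _ "inverse (a 0)"], rule exI[of _ y]) (use a(1) y(1) in \<open>simp add: b_def a'_def divide_inverse\<close>)
  moreover have "b 0 = 1" using a(1) by (simp add: b_def a'_def)
  ultimately show ?thesis using that by blast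
qed

section \<open>Conjugation of forms\<close>

lemma fe_map:
  assumes "field_auto \<sigma>" shows "fe (Poly_Mapping.map \<sigma> F) (\<sigma> x) (\<sigma> z) = \<sigma> (fe F x z)"
proof -
  have h: "rhom \<sigma>" using assms by (simp add: field_auto_def)
  have "(\<lambda>i. if i = 0 then \<sigma> x else if i = 1 then \<sigma> z else 0) = (\<lambda>i. \<sigma> (if i = 0 then x else if i = 1 then z else 0))" for x z
    by (auto simp: field_auto_simps[OF assms])
  note * = this[of x z]
  show ?thesis unfolding fe_def * by (rule eval_map[OF h])
qed

lemma map_diag_form:
  assumes "field_auto \<sigma>"
  shows "Poly_Mapping.map \<sigma> (diag_form i n m a) = diag_form i n m (\<lambda>j. \<sigma> (a j))"
proof -
  have h: "rhom \<sigma>" using assms by (simp add: field_auto_def)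
  note m = rhom_map[OF h]
  have b: "Poly_Mapping.map \<sigma> (mp_const c) = mp_const (\<sigma> c)" "Poly_Mapping.map \<sigma> (mp_var l) = mp_var l" for c l
    using rhomD[OF h] by simp_all
  show ?thesis by (simp add: diag_form_def rhomD[OF m] rhom_sum[OF m] rhom_power[OF m] b)
qed

lemma no_repeated_map:
  assumes \<sigma>: "field_auto \<sigma>" and nr: "no_repeated_linear_factors F"
  shows "no_repeated_linear_factors (Poly_Mapping.map \<sigma> F)"
  unfolding no_repeated_linear_factors_def
proof (intro allI impI notI)
  fix \<alpha> \<beta> assume ne: "(\<alpha>, \<beta>) \<noteq> (0, 0)" and "(mp_const \<alpha> * x_var + mp_const \<beta> * z_var)\<^sup>2 dvd Poly_Mapping.map \<sigma> F"
  then obtain G where G: "Poly_Mapping.map \<sigma> F = (mp_const \<alpha> * x_var + mp_const \<beta> * z_var)\<^sup>2 * G" by (auto elim: dvdE)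
  let ?\<tau> = "finv \<sigma>"
  have \<tau>: "field_auto ?\<tau>" by (rule field_auto_inv[OF \<sigma>])
  hence h: "rhom ?\<tau>" by (simp add: field_auto_def)
  note m = rhom_map[OF h]
  have b: "Poly_Mapping.map ?\<tau> (mp_const c) = mp_const (?\<tau> c)" "Poly_Mapping.map ?\<tau> (mp_var l) = mp_var l" for c l
    using rhomD[OF h] by simp_all
  have "F = Poly_Mapping.map ?\<tau> (Poly_Mapping.map \<sigma> F)"
    using \<sigma> field_auto_simps(1)[OF \<sigma>] field_auto_simps(1)[OF \<tau>] by (simp add: map_map map_ident)
  also have "\<dots> = (mp_const (?\<tau> \<alpha>) * x_var + mp_const (?\<tau> \<beta>) * z_var)\<^sup>2 * Poly_Mapping.map ?\<tau> G"
    unfolding G by (simp add: rhomD[OF m] rhom_power[OF m] b)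
  finally have "(mp_const (?\<tau> \<alpha>) * x_var + mp_const (?\<tau> \<beta>) * z_var)\<^sup>2 dvd F" by (rule dvdI)
  moreover have "(?\<tau> \<alpha>, ?\<tau> \<beta>) \<noteq> (0, 0)" using ne field_auto_simps(8)[OF \<tau>] by auto
  ultimately show False using nr unfolding no_repeated_linear_factors_def by blast
qed

lemma typed_map:
  assumes \<sigma>: "field_auto \<sigma>" and a: "typed i n m a" shows "typed i n m (\<lambda>j. \<sigma> (a j))"
proof -
  let ?\<tau> = "finv \<sigma>"
  have \<tau>: "field_auto ?\<tau>" by (rule field_auto_inv[OF \<sigma>])
  note ts = field_auto_simps[OF \<tau>]
  have nr: "no_repeated_linear_factors (diag_form i n m (\<lambda>j. \<sigma> (a j)))"
    using no_repeated_map[OF \<sigma> typedD(4)[OF a]] unfolding map_diag_form[OF \<sigma>] .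
  have "q = 0 \<and> r = 0 \<and> p ^ n = s ^ n" if au: "autf (diag_form i n m (\<lambda>j. \<sigma> (a j))) p q r s" for p q r s
  proof -
    obtain c where c: "p * s - q * r \<noteq> 0" "c \<noteq> 0"
      "\<And>x z. fe (diag_form i n m (\<lambda>j. \<sigma> (a j))) (p * x + q * z) (r * x + s * z) = c * fe (diag_form i n m (\<lambda>j. \<sigma> (a j))) x z"
      using au unfolding autf_def by blast
    have bk: "fe (diag_form i n m a) (?\<tau> x) (?\<tau> z) = ?\<tau> (fe (diag_form i n m (\<lambda>j. \<sigma> (a j))) x z)" for x z
    proof -
      have "fe (diag_form i n m (\<lambda>j. \<sigma> (a j))) x z = \<sigma> (fe (diag_form i n m a) (?\<tau> x) (?\<tau> z))"
        using fe_map[OF \<sigma>, of "diag_form i n m a" "?\<tau> x" "?\<tau> z"] unfolding map_diag_form[OF \<sigma>] inv_auto(1)[OF \<sigma>] .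
      thus ?thesis by (simp only: inv_auto(2)[OF \<sigma>])
    qed
    have "fe (diag_form i n m a) (?\<tau> p * x + ?\<tau> q * z) (?\<tau> r * x + ?\<tau> s * z) = ?\<tau> c * fe (diag_form i n m a) x z" for x z
      using arg_cong[OF c(3)[of "\<sigma> x" "\<sigma> z"], of ?\<tau>] unfolding ts(4) bk[symmetric]
      by (simp only: ts(3,4) inv_auto(2)[OF \<sigma>])
    moreover have "?\<tau> p * ?\<tau> s - ?\<tau> q * ?\<tau> r \<noteq> 0" using c(1) ts(8)[of "p * s - q * r"] by (simp add: ts)
    moreover have "?\<tau> c \<noteq> 0" using c(2) ts(8) by blast
    ultimately have "autf (diag_form i n m a) (?\<tau> p) (?\<tau> q) (?\<tau> r) (?\<tau> s)" unfolding autf_def by blast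
    from typedD(5)[OF a this] have *: "?\<tau> q = 0 \<and> ?\<tau> r = 0 \<and> ?\<tau> (p ^ n) = ?\<tau> (s ^ n)" by (simp add: ts)
    show ?thesis using * by (simp only: ts(8) ts(12))
  qed
  thus ?thesis using a nr unfolding typed_def by blast
qed

lemma conj_hyp_model:
  assumes "field_auto \<sigma>"
  shows "conjugate \<sigma> (hyp_model w F) = hyp_model w (Poly_Mapping.map \<sigma> F)"
proof -
  have h: "rhom \<sigma>" using assms by (simp add: field_auto_def)
  note m = rhom_map[OF h]
  have b: "Poly_Mapping.map \<sigma> (mp_var l) = mp_var l" for l using rhomD[OF h] by simp
  show ?thesis by (simp add: conjugate_def hyp_model_def rhom_diff[OF m] rhom_power[OF m] b)
qed

section \<open>Diagonal and antidiagonal equivalence of coefficients\<close>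

lemma power_complement: "j \<le> m \<Longrightarrow> u ^ (m - j) * u ^ j = u ^ m" for u :: "'a::monoid_mult"
  by (simp only: power_add[symmetric] le_add_diff_inverse2)

lemma diag_equivI: "c \<noteq> 0 \<Longrightarrow> t \<noteq> 0 \<Longrightarrow> (\<And>j. j \<le> m \<Longrightarrow> b j = c * t ^ j * a j) \<Longrightarrow> diag_equiv m a b"
  unfolding diag_equiv_def by blast

lemma antidiag_equivI: "c \<noteq> 0 \<Longrightarrow> t \<noteq> 0 \<Longrightarrow> (\<And>j. j \<le> m \<Longrightarrow> b j = c * t ^ j * a (m - j)) \<Longrightarrow> antidiag_equiv m a b"
  unfolding antidiag_equiv_def by blast

lemma diag_equivE: assumes "diag_equiv m a b" obtains c t where "c \<noteq> 0" "t \<noteq> 0" "\<And>j. j \<le> m \<Longrightarrow> b j = c * t ^ j * a j"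
  using assms unfolding diag_equiv_def by (elim exE conjE) (rule that; blast)

lemma antidiag_equivE: assumes "antidiag_equiv m a b" obtains c t where "c \<noteq> 0" "t \<noteq> 0" "\<And>j. j \<le> m \<Longrightarrow> b j = c * t ^ j * a (m - j)"
  using assms unfolding antidiag_equiv_def by (elim exE conjE) (rule that; blast)

lemma diag_equiv_sym: assumes "diag_equiv m a b" shows "diag_equiv m b a"
proof -
  obtain c t where c: "c \<noteq> 0" "t \<noteq> 0" "\<And>j. j \<le> m \<Longrightarrow> b j = c * t ^ j * a j" using assms by (rule diag_equivE) (rule that)
  show ?thesis by (rule diag_equivI[of "1 / c" "1 / t"]) (use c in \<open>simp_all add: power_divide\<close>)
qed

lemma diag_equiv_trans: assumes "diag_equiv m a b" "diag_equiv m b d" shows "diag_equiv m a d"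
proof -
  obtain c t where c: "c \<noteq> 0" "t \<noteq> 0" "\<And>j. j \<le> m \<Longrightarrow> b j = c * t ^ j * a j" using assms(1) by (rule diag_equivE) (rule that)
  obtain e u where e: "e \<noteq> 0" "u \<noteq> 0" "\<And>j. j \<le> m \<Longrightarrow> d j = e * u ^ j * b j" using assms(2) by (rule diag_equivE) (rule that)
  show ?thesis by (rule diag_equivI[of "e * c" "u * t"]) (use c e in \<open>simp_all add: power_mult_distrib\<close>)
qed

lemma antidiag_diag_trans: assumes "antidiag_equiv m a b" "diag_equiv m b d" shows "antidiag_equiv m a d"
proof -
  obtain c t where c: "c \<noteq> 0" "t \<noteq> 0" "\<And>j. j \<le> m \<Longrightarrow> b j = c * t ^ j * a (m - j)" using assms(1) by (rule antidiag_equivE) (rule that)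
  obtain e u where e: "e \<noteq> 0" "u \<noteq> 0" "\<And>j. j \<le> m \<Longrightarrow> d j = e * u ^ j * b j" using assms(2) by (rule diag_equivE) (rule that)
  show ?thesis by (rule antidiag_equivI[of "e * c" "u * t"]) (use c e in \<open>simp_all add: power_mult_distrib\<close>)
qed

lemma power_ratio: "j \<le> m \<Longrightarrow> t \<noteq> 0 \<Longrightarrow> u ^ j * t ^ (m - j) = t ^ m * (u / t) ^ j" for t u :: "'a::field"
  by (simp add: power_complement[of j m t, symmetric] power_divide)

lemma diag_antidiag_trans: assumes "diag_equiv m a b" "antidiag_equiv m b d" shows "antidiag_equiv m a d"
proof -
  obtain c t where c: "c \<noteq> 0" "t \<noteq> 0" "\<And>j. j \<le> m \<Longrightarrow> b j = c * t ^ j * a j" using assms(1) by (rule diag_equivE) (rule that)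
  obtain e u where e: "e \<noteq> 0" "u \<noteq> 0" "\<And>j. j \<le> m \<Longrightarrow> d j = e * u ^ j * b (m - j)" using assms(2) by (rule antidiag_equivE) (rule that)
  show ?thesis
  proof (rule antidiag_equivI[of "e * c * t ^ m" "u / t"])
    fix j assume j: "j \<le> m"
    have "d j = e * c * (u ^ j * t ^ (m - j)) * a (m - j)" using e(3)[OF j] c(3)[of "m - j"] by simp
    thus "d j = e * c * t ^ m * (u / t) ^ j * a (m - j)" unfolding power_ratio[OF j c(2)] by (simp only: mult_ac)
  qed (use c e in simp_all)
qed

lemma antidiag_antidiag_trans: assumes "antidiag_equiv m a b" "antidiag_equiv m b d" shows "diag_equiv m a d"
proof -
  obtain c t where c: "c \<noteq> 0" "t \<noteq> 0" "\<And>j. j \<le> m \<Longrightarrow> b j = c * t ^ j * a (m - j)" using assms(1) by (rule antidiag_equivE) (rule that)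
  obtain e u where e: "e \<noteq> 0" "u \<noteq> 0" "\<And>j. j \<le> m \<Longrightarrow> d j = e * u ^ j * b (m - j)" using assms(2) by (rule antidiag_equivE) (rule that)
  show ?thesis
  proof (rule diag_equivI[of "e * c * t ^ m" "u / t"])
    fix j assume j: "j \<le> m"
    have "d j = e * c * (u ^ j * t ^ (m - j)) * a j" using e(3)[OF j] c(3)[of "m - j"] j by simp
    thus "d j = e * c * t ^ m * (u / t) ^ j * a j" unfolding power_ratio[OF j c(2)] by (simp only: mult_ac)
  qed (use c e in simp_all)
qed

lemma diag_equiv_map: assumes "field_auto g" "diag_equiv m a b" shows "diag_equiv m (\<lambda>j. g (a j)) (\<lambda>j. g (b j))"
proof -
  obtain c t where c: "c \<noteq> 0" "t \<noteq> 0" "\<And>j. j \<le> m \<Longrightarrow> b j = c * t ^ j * a j" using assms(2) by (rule diag_equivE) (rule that)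
  show ?thesis by (rule diag_equivI[of "g c" "g t"]) (use c in \<open>simp_all add: field_auto_simps[OF assms(1)]\<close>)
qed

lemma antidiag_equiv_map: assumes "field_auto g" "antidiag_equiv m a b" shows "antidiag_equiv m (\<lambda>j. g (a j)) (\<lambda>j. g (b j))"
proof -
  obtain c t where c: "c \<noteq> 0" "t \<noteq> 0" "\<And>j. j \<le> m \<Longrightarrow> b j = c * t ^ j * a (m - j)" using assms(2) by (rule antidiag_equivE) (rule that)
  show ?thesis by (rule antidiag_equivI[of "g c" "g t"]) (use c in \<open>simp_all add: field_auto_simps[OF assms(1)]\<close>)
qed

section \<open>Forms over fixed fields\<close>

lemma coeffs_in_fixed_field_iff:
  assumes "\<forall>g\<in>G. field_auto g"
  shows "coeffs_in (fixed_field G) F \<longleftrightarrow> (\<forall>g\<in>G. Poly_Mapping.map g F = F)"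
proof -
  have "Poly_Mapping.map g F = F \<longleftrightarrow> (\<forall>mon. g (Poly_Mapping.lookup F mon) = Poly_Mapping.lookup F mon)" if "g \<in> G" for g
    using lookup_map[of g F] field_auto_simps(1)[OF bspec[OF assms that]] by (auto simp: poly_mapping_eq_iff fun_eq_iff)
  thus ?thesis unfolding coeffs_in_def fixed_field_def by blast
qed

lemma coeffs_in_fixed_field_diag:
  assumes "\<forall>g\<in>G. field_auto g" "\<And>g j. g \<in> G \<Longrightarrow> j \<le> m \<Longrightarrow> g (b j) = b j"
  shows "coeffs_in (fixed_field G) (diag_form i n m b)"
  unfolding coeffs_in_fixed_field_iff[OF assms(1)]
proof
  fix g assume g: "g \<in> G"
  show "Poly_Mapping.map g (diag_form i n m b) = diag_form i n m b" unfolding map_diag_form[OF bspec[OF assms(1) g]]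
    unfolding diag_form_def by (intro arg_cong2[of _ _ _ _ "(*)"] sum.cong refl) (simp add: assms(2)[OF g])
qed

section \<open>Quadratic extensions given by automorphism groups\<close>

lemma line_extension_type:
  "ring.line_extension ring_of_type_algebra k v E = {c * v + e | c e. c \<in> k \<and> e \<in> (E :: 'a::field set)}"
  unfolding ring.line_extension_def[OF ring_from_type_algebra] r_coset_def set_add_def set_mult_def
  by (auto simp: ring_of_type_algebra_def)

lemma dimension_one:
  fixes k :: "'a::field set"
  assumes "0 \<in> k"
  shows "ring.dimension ring_of_type_algebra 1 k k"
proof -
  let ?R = "ring_of_type_algebra :: 'a ring"
  have "ring.dimension ?R 0 k {\<zero>\<^bsub>?R\<^esub>}" by (rule ring.zero_dim[OF ring_from_type_algebra])
  hence "ring.dimension ?R 0 k {0}" by (simp add: ring_of_type_algebra_def)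
  from ring.Suc_dim[OF ring_from_type_algebra _ _ this, of 1]
  have "ring.dimension ?R (Suc 0) k (ring.line_extension ?R k 1 {0})" by (simp add: ring_of_type_algebra_def)
  moreover have "ring.line_extension ?R k 1 {0} = k" unfolding line_extension_type by auto
  ultimately show ?thesis by (simp add: One_nat_def)
qed

text \<open>The extension \<open>L|k\<close> of fixed fields for a subgroup \<open>H\<close> of index \<open>2\<close> in a group \<open>\<Gamma>\<close> of field automorphisms.\<close>

locale quadratic_extension =
  fixes \<Gamma> H :: "('a::alg_closed_field \<Rightarrow> 'a) set" and s :: "'a \<Rightarrow> 'a" and k L :: "'a set"
  assumes auto: "g \<in> \<Gamma> \<Longrightarrow> field_auto g"
    and comp: "g \<in> \<Gamma> \<Longrightarrow> h \<in> \<Gamma> \<Longrightarrow> (\<lambda>x. g (h x)) \<in> \<Gamma>"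
    and inverse: "g \<in> \<Gamma> \<Longrightarrow> finv g \<in> \<Gamma>"
    and H_sub: "H \<subseteq> \<Gamma>" and s: "s \<in> \<Gamma>" "s \<notin> H"
    and index: "g \<in> \<Gamma> \<Longrightarrow> h \<in> \<Gamma> \<Longrightarrow> (\<lambda>x. g (h x)) \<in> H \<longleftrightarrow> (g \<in> H \<longleftrightarrow> h \<in> H)"
    and k: "k = fixed_field \<Gamma>" and L: "L = fixed_field H" and ne: "L \<noteq> k" and two: "(2::'a) \<noteq> 0"
begin

lemma s_auto: "field_auto s"
  by (rule auto[OF s(1)])

lemmas sD = field_auto_simps[OF s_auto]

lemma H_auto: "h \<in> H \<Longrightarrow> field_auto h"
  using auto H_sub by blast

lemma \<Gamma>_auto: "\<forall>g\<in>\<Gamma>. field_auto g" and H_autos: "\<forall>h\<in>H. field_auto h"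
  using auto H_auto by blast+

lemma L_fixed: "x \<in> L \<Longrightarrow> h \<in> H \<Longrightarrow> h x = x"
  by (simp add: L fixed_field_def)

lemma L_I: "(\<And>h. h \<in> H \<Longrightarrow> h x = x) \<Longrightarrow> x \<in> L"
  by (simp add: L fixed_field_def)

text \<open>The composition of \<open>g\<close> with the inverse of \<open>s\<close> lies in \<open>H\<close>.\<close>

lemma outside: assumes "g \<in> \<Gamma>" "g \<notin> H" "x \<in> L" shows "g x = s x"
proof -
  have ss: "(\<lambda>x. s (s x)) \<in> H" using index[OF s(1) s(1)] by blast
  have "finv s \<notin> H"
  proof
    assume "finv s \<in> H"
    moreover have "(\<lambda>x. s (s x)) \<in> \<Gamma>" using ss H_sub by blast
    ultimately have "(\<lambda>x. finv s (s (s x))) \<in> H" using index[OF inverse[OF s(1)], of "\<lambda>x. s (s x)"] ss by blast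
    thus False using s(2) by (simp add: s_auto)
  qed
  hence "(\<lambda>x. finv s (g x)) \<in> H" using index[OF inverse[OF s(1)] assms(1)] assms(2) by blast
  from L_fixed[OF assms(3) this] have "s (finv s (g x)) = s x" by simp
  thus ?thesis by (simp add: s_auto)
qed

lemma s_L: assumes "x \<in> L" shows "s x \<in> L"
proof (rule L_I)
  fix h assume h: "h \<in> H"
  hence "h \<in> \<Gamma>" using H_sub by blast
  hence "(\<lambda>x. h (s x)) \<in> \<Gamma>" "(\<lambda>x. h (s x)) \<notin> H" using comp[OF _ s(1)] index[OF _ s(1)] h s(2) by blast+
  from outside[OF this assms] show "h (s x) = s x" .
qed

lemma s_s: "x \<in> L \<Longrightarrow> s (s x) = x"
  using L_fixed[of x "\<lambda>x. s (s x)"] index[OF s(1) s(1)] by blast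

lemma k_iff: "x \<in> k \<longleftrightarrow> x \<in> L \<and> s x = x"
proof
  assume "x \<in> k" thus "x \<in> L \<and> s x = x" using H_sub s(1) by (auto simp: k L fixed_field_def)
next
  assume x: "x \<in> L \<and> s x = x"
  have "g x = x" if "g \<in> \<Gamma>" for g using outside[OF that] L_fixed x by metis
  thus "x \<in> k" by (simp add: k fixed_field_def)
qed

lemma L_closed:
  "0 \<in> L" "1 \<in> L" "2 \<in> L" "x \<in> L \<Longrightarrow> y \<in> L \<Longrightarrow> x + y \<in> L" "x \<in> L \<Longrightarrow> y \<in> L \<Longrightarrow> x - y \<in> L" "x \<in> L \<Longrightarrow> y \<in> L \<Longrightarrow> x * y \<in> L"
  "x \<in> L \<Longrightarrow> y \<in> L \<Longrightarrow> x / y \<in> L" "x \<in> L \<Longrightarrow> - x \<in> L" "x \<in> L \<Longrightarrow> x ^ j \<in> L"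
  by (rule L_I; simp add: L_fixed field_auto_simps[OF H_auto])+

lemma skew_element:
  obtains \<delta> where "\<delta> \<in> L" "s \<delta> = - \<delta>" "\<delta> \<noteq> 0"
proof -
  have "k \<subseteq> L" using k_iff by blast
  then obtain x where x: "x \<in> L" "s x \<noteq> x" using ne k_iff by blast
  show ?thesis
    by (rule that[of "x - s x"]) (use x s_L s_s L_closed in \<open>auto simp: sD\<close>)
qed

lemma decomposition:
  assumes \<delta>: "\<delta> \<in> L" "s \<delta> = - \<delta>" "\<delta> \<noteq> 0" and x: "x \<in> L"
  obtains c e where "c \<in> k" "e \<in> k" "x = c * \<delta> + e"
proof -
  define c where "c = (x - s x) / (2 * \<delta>)"
  define e where "e = (x + s x) / 2"
  have "c \<in> L" "e \<in> L" unfolding c_def e_def by (intro L_closed x \<delta>(1) s_L[OF x])+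
  moreover have "s c = (s x - x) / (- (2 * \<delta>))" "s e = e"
    unfolding c_def e_def by (simp_all add: sD s_s[OF x] \<delta>(2) add.commute)
  moreover have "(s x - x) / (- (2 * \<delta>)) = c" unfolding c_def using minus_divide_divide[of "x - s x" "2 * \<delta>"] by simp
  ultimately have "c \<in> k" "e \<in> k" using k_iff by auto
  moreover have "c * \<delta> = (x - s x) / 2" using \<delta>(3) by (simp add: c_def)
  hence "c * \<delta> + e = ((x - s x) + (x + s x)) / 2" by (simp only: e_def add_divide_distrib)
  moreover have "((x - s x) + (x + s x)) / 2 = (2 * x) / 2" by simp
  ultimately show ?thesis using that[of c e] two by simp
qed

lemma skew_ne: assumes "s \<delta> = - \<delta>" "\<delta> \<noteq> 0" shows "s \<delta> \<noteq> \<delta>"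
proof
  assume "s \<delta> = \<delta>"
  hence "\<delta> + \<delta> = 0" using assms(1) by (metis add.right_inverse)
  thus False using two assms(2) by (simp add: mult_2[symmetric])
qed

lemma dimension_two: "ring.dimension ring_of_type_algebra 2 k L"
proof -
  obtain \<delta> where \<delta>: "\<delta> \<in> L" "s \<delta> = - \<delta>" "\<delta> \<noteq> 0" by (rule skew_element)
  let ?R = "ring_of_type_algebra :: 'a ring"
  have dk: "\<delta> \<notin> k" using k_iff skew_ne[OF \<delta>(2,3)] by blast
  have k0: "0 \<in> k" using k_iff L_closed(1) sD(1) by blast
  have "ring.dimension ?R (Suc 1) k (ring.line_extension ?R k \<delta> k)"
    by (rule ring.Suc_dim[OF ring_from_type_algebra]) (use dk dimension_one[OF k0] in \<open>auto simp: ring_of_type_algebra_def\<close>)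
  moreover have "ring.line_extension ?R k \<delta> k = L"
  proof
    show "ring.line_extension ?R k \<delta> k \<subseteq> L" unfolding line_extension_type using L_closed \<delta>(1) k_iff by auto
    show "L \<subseteq> ring.line_extension ?R k \<delta> k" unfolding line_extension_type
    proof
      fix x assume "x \<in> L"
      then obtain c e where "c \<in> k" "e \<in> k" "x = c * \<delta> + e" by (rule decomposition[OF \<delta>])
      thus "x \<in> {c * \<delta> + e | c e. c \<in> k \<and> e \<in> k}" by blast
    qed
  qed
  moreover have "Suc 1 = 2" by simp
  ultimately show ?thesis by (simp only:)
qed

lemma Gal_id: "restrict (\<lambda>x. x) L \<in> Gal L k"
  using k_iff L_closed(4,6) by (auto simp: Gal_def bij_betw_def inj_on_def)

lemma Gal_s: "restrict s L \<in> Gal L k"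
proof -
  have "bij_betw s L L" by (rule bij_betwI[of s L L s]) (auto simp: s_L s_s)
  thus ?thesis using k_iff L_closed(4,6) by (auto simp: Gal_def sD)
qed

text \<open>An automorphism of \<open>L|k\<close> sends \<open>\<delta>\<close> to a square root of \<open>\<delta>\<^sup>2 \<in> k\<close>, and \<open>L = k + k \<delta>\<close>.\<close>

lemma Gal_cases:
  assumes \<sigma>: "\<sigma> \<in> Gal L k" shows "(\<forall>x\<in>L. \<sigma> x = x) \<or> (\<forall>x\<in>L. \<sigma> x = s x)"
proof -
  obtain \<delta> where \<delta>: "\<delta> \<in> L" "s \<delta> = - \<delta>" "\<delta> \<noteq> 0" by (rule skew_element)
  have add: "\<sigma> (x + y) = \<sigma> x + \<sigma> y" and mult: "\<sigma> (x * y) = \<sigma> x * \<sigma> y" if "x \<in> L" "y \<in> L" for x y using \<sigma> that by (auto simp: Gal_def)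
  have kf: "\<sigma> x = x" if "x \<in> k" for x using \<sigma> that by (auto simp: Gal_def)
  have kL: "x \<in> L" if "x \<in> k" for x using that k_iff by blast
  have ev: "\<sigma> (c * \<delta> + e) = c * \<sigma> \<delta> + e" if "c \<in> k" "e \<in> k" for c e
    using that add[of "c * \<delta>" e] mult[of c \<delta>] L_closed(6)[OF kL \<delta>(1)] kL kf \<delta>(1) by simp
  have "\<delta> * \<delta> \<in> k" using k_iff L_closed(6)[OF \<delta>(1) \<delta>(1)] \<delta>(2) by (simp add: sD)
  hence "\<sigma> \<delta> * \<sigma> \<delta> = \<delta> * \<delta>" using kf[of "\<delta> * \<delta>"] mult[OF \<delta>(1) \<delta>(1)] by simp
  hence "\<sigma> \<delta> = \<delta> \<or> \<sigma> \<delta> = - \<delta>" by (simp add: square_eq_iff)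
  thus ?thesis
  proof
    assume a: "\<sigma> \<delta> = \<delta>"
    have "\<sigma> x = x" if x: "x \<in> L" for x
    proof -
      obtain c e where ce: "c \<in> k" "e \<in> k" "x = c * \<delta> + e" by (rule decomposition[OF \<delta> x])
      show ?thesis unfolding ce(3) ev[OF ce(1,2)] a ..
    qed
    thus ?thesis by blast
  next
    assume a: "\<sigma> \<delta> = - \<delta>"
    have "\<sigma> x = s x" if x: "x \<in> L" for x
    proof -
      obtain c e where ce: "c \<in> k" "e \<in> k" "x = c * \<delta> + e" by (rule decomposition[OF \<delta> x])
      have "s c = c" "s e = e" using ce k_iff by auto
      thus ?thesis unfolding ce(3) ev[OF ce(1,2)] a by (simp add: sD \<delta>(2))
    qed
    thus ?thesis by blast
  qed
qed

lemma Gal_eq: "Gal L k = {restrict (\<lambda>x. x) L, restrict s L}"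
proof
  show "Gal L k \<subseteq> {restrict (\<lambda>x. x) L, restrict s L}"
  proof
    fix \<sigma> assume \<sigma>: "\<sigma> \<in> Gal L k"
    hence e: "\<sigma> \<in> extensional L" by (simp add: Gal_def)
    hence "\<sigma> = restrict \<sigma> L" by (simp add: extensional_restrict)
    moreover have "restrict \<sigma> L = restrict g L" if "\<forall>x\<in>L. \<sigma> x = g x" for g using that by (auto simp: restrict_def)
    ultimately show "\<sigma> \<in> {restrict (\<lambda>x. x) L, restrict s L}" using Gal_cases[OF \<sigma>] by (metis insertI1 insertI2)
  qed
qed (use Gal_id Gal_s in blast)

lemma generates_s: "generates_Gal L k (restrict s L)"
  unfolding generates_Gal_def
proof (intro conjI ballI)
  fix \<tau> assume "\<tau> \<in> Gal L k"
  from Gal_cases[OF this] show "\<exists>j. \<forall>x\<in>L. \<tau> x = (restrict s L ^^ j) x"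
  proof
    assume "\<forall>x\<in>L. \<tau> x = x" thus ?thesis by (intro exI[of _ 0]) simp
  next
    assume "\<forall>x\<in>L. \<tau> x = s x" thus ?thesis by (intro exI[of _ "Suc 0"]) simp
  qed
qed (rule Gal_s)

lemma generates_eq_s: assumes "generates_Gal L k \<sigma>" "x \<in> L" shows "\<sigma> x = s x"
proof -
  obtain \<delta> where \<delta>: "\<delta> \<in> L" "s \<delta> = - \<delta>" "\<delta> \<noteq> 0" by (rule skew_element)
  have \<sigma>: "\<sigma> \<in> Gal L k" using assms(1) by (simp add: generates_Gal_def)
  obtain j where j: "\<forall>x\<in>L. restrict s L x = (\<sigma> ^^ j) x" using assms(1) Gal_s unfolding generates_Gal_def by blast
  have "\<not> (\<forall>x\<in>L. \<sigma> x = x)"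
  proof
    assume a: "\<forall>x\<in>L. \<sigma> x = x"
    have "(\<sigma> ^^ j) \<delta> = \<delta>" by (induction j) (simp_all add: a \<delta>(1))
    hence "s \<delta> = \<delta>" using j \<delta>(1) by simp
    thus False using skew_ne[OF \<delta>(2,3)] by blast
  qed
  thus ?thesis using Gal_cases[OF \<sigma>] assms(2) by blast
qed

definition nm :: "'a \<Rightarrow> 'a" where "nm x = x * s x"

lemma norm_group_eq: "norm_group L k = nm ` (L - {0})"
proof -
  obtain \<delta> where \<delta>: "\<delta> \<in> L" "s \<delta> = - \<delta>" "\<delta> \<noteq> 0" by (rule skew_element)
  have "restrict (\<lambda>x. x) L \<noteq> restrict s L"
  proof
    assume "restrict (\<lambda>x. x) L = restrict s L"
    from fun_cong[OF this, of \<delta>] show False using skew_ne[OF \<delta>(2,3)] \<delta>(1) by simp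
  qed
  hence "(\<Prod>\<tau>\<in>Gal L k. \<tau> x) = nm x" if "x \<in> L" for x unfolding Gal_eq nm_def using that by simp
  thus ?thesis unfolding norm_group_def by (auto simp: image_iff) metis+
qed

lemma nm_hom: "nm 1 = 1" "nm (x * y) = nm x * nm y" "nm (x / y) = nm x / nm y" "nm (x ^ j) = nm x ^ j" "nm x = 0 \<longleftrightarrow> x = 0"
  by (simp_all add: nm_def sD power_mult_distrib)

lemma nm_k: "x \<in> k \<Longrightarrow> nm x = x ^ 2"
  by (simp add: nm_def k_iff power2_eq_square)

lemma coset_eq:
  assumes "t' = t * nm x" "x \<in> L" "x \<noteq> 0"
  shows "(\<lambda>c. t' * c) ` norm_group L k = (\<lambda>c. t * c) ` norm_group L k"
proof -
  have "(\<lambda>c. nm x * c) ` nm ` (L - {0}) = nm ` (L - {0})"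
  proof
    show "(\<lambda>c. nm x * c) ` nm ` (L - {0}) \<subseteq> nm ` (L - {0})"
    proof
      fix v assume "v \<in> (\<lambda>c. nm x * c) ` nm ` (L - {0})"
      then obtain y where "y \<in> L - {0}" "v = nm x * nm y" by blast
      hence "v = nm (x * y)" "x * y \<in> L - {0}" using assms(2,3) L_closed(6) by (auto simp: nm_hom)
      thus "v \<in> nm ` (L - {0})" by blast
    qed
    show "nm ` (L - {0}) \<subseteq> (\<lambda>c. nm x * c) ` nm ` (L - {0})"
    proof
      fix v assume "v \<in> nm ` (L - {0})"
      then obtain y where y: "y \<in> L - {0}" "v = nm y" by blast
      have "v = nm x * nm (y / x)" using assms(3) y by (simp add: nm_hom)
      moreover have "y / x \<in> L - {0}" using y assms(2,3) L_closed(7) by auto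
      ultimately show "v \<in> (\<lambda>c. nm x * c) ` nm ` (L - {0})" by blast
    qed
  qed
  moreover have "(\<lambda>c. t' * c) ` A = (\<lambda>c. t * c) ` (\<lambda>c. nm x * c) ` A" for A
    unfolding image_image assms(1) by (simp add: mult.assoc)
  ultimately show ?thesis unfolding norm_group_eq by simp
qed

lemma coset_trivial_iff: "(\<lambda>c. t * c) ` norm_group L k = norm_group L k \<longleftrightarrow> t \<in> nm ` (L - {0})"
proof
  assume a: "(\<lambda>c. t * c) ` norm_group L k = norm_group L k"
  have "1 \<in> norm_group L k" unfolding norm_group_eq by (rule image_eqI[of _ _ 1]) (auto simp: nm_hom L_closed)
  hence "t * 1 \<in> (\<lambda>c. t * c) ` norm_group L k" by blast
  thus "t \<in> nm ` (L - {0})" unfolding a by (simp only: norm_group_eq mult_1_right)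
next
  assume "t \<in> nm ` (L - {0})"
  then obtain x where "x \<in> L" "x \<noteq> 0" "t = 1 * nm x" by auto
  from coset_eq[OF this(3,1,2)] show "(\<lambda>c. t * c) ` norm_group L k = norm_group L k" by simp
qed

end

section \<open>Descent along a quadratic extension\<close>

text \<open>By \<open>typed_exponents\<close>, the scalar and the base of a system of factors \<open>A u\<^sup>j\<close> can be read off from the coefficients of
  a form of the given type.\<close>

lemma exponents_eq:
  fixes b :: "nat \<Rightarrow> 'a::alg_closed_field"
  assumes b: "typed i n m b" and nz: "A \<noteq> 0" "v \<noteq> 0" and eq: "\<And>j. j \<le> m \<Longrightarrow> A * u ^ j * b j = B * v ^ j * b j"
  shows "A = B" "u = v"
proof -
  show AB: "A = B" using eq[of 0] typed_ends(1)[OF b] by simp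
  have "(u / v) ^ j = 1" if "j \<le> m" "b j \<noteq> 0" for j
    using eq[OF that(1)] that(2) nz AB by (simp add: power_divide)
  from typed_exponents[OF b this] show "u = v" using nz(2) by simp
qed

lemma exponents_eq_rev:
  fixes b :: "nat \<Rightarrow> 'a::alg_closed_field"
  assumes b: "typed i n m b" and nz: "A \<noteq> 0" "v \<noteq> 0" and eq: "\<And>j. j \<le> m \<Longrightarrow> A * u ^ j * b (m - j) = B * v ^ j * b (m - j)"
  shows "A = B" "u = v"
proof -
  show AB: "A = B" using eq[of 0] typed_ends(2)[OF b] by simp
  have 1: "(u / v) ^ j = 1" if "j \<le> m" "b (m - j) \<noteq> 0" for j
    using eq[OF that(1)] that(2) nz AB by (simp add: power_divide)
  have "(u / v) ^ j = 1" if "j \<le> m" "b j \<noteq> 0" for j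
  proof -
    have "(u / v) ^ m = 1" using 1[of m] typed_ends(1)[OF b] by simp
    moreover have "(u / v) ^ (m - j) = 1" using 1[of "m - j"] that by simp
    moreover have "(u / v) ^ m = (u / v) ^ j * (u / v) ^ (m - j)" using that(1) by (simp only: power_add[symmetric] le_add_diff_inverse)
    ultimately show ?thesis by simp
  qed
  from typed_exponents[OF b this] show "u = v" using nz(2) by simp
qed

lemma fe_diag_rev: "i \<noteq> 1 \<Longrightarrow> fe (diag_form i n m (\<lambda>j. a (m - j))) x z = fe (diag_form i n m a) z x"
  by (simp add: fe_diag gsum_rev outer_factor_swap[of i x z])

lemma fe_diag_homog: "fe (diag_form i n m a) (c * x) (c * z) = outer_factor i c c * (c ^ n) ^ m * fe (diag_form i n m a) x z"
  by (simp add: fe_diag outer_factor_scale power_mult_distrib gsum_homog)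

lemma fe_diag_cong: "(\<And>j. j \<le> m \<Longrightarrow> a j = b j) \<Longrightarrow> fe (diag_form i n m a) x z = fe (diag_form i n m b) x z"
  using gsum_cong[of m a b] by (simp add: fe_diag)

text \<open>Two linear substitutions that have proportional effects on a form of the given type have proportional rows,
  since automorphisms are diagonal.\<close>

lemma rows_proportional:
  fixes b :: "nat \<Rightarrow> 'a::alg_closed_field"
  assumes b: "typed i n m b" and D: "p * v - q * r \<noteq> 0" "p' * v' - q' * r' \<noteq> 0" and \<kappa>: "\<kappa> \<noteq> 0"
    and eq: "\<And>x z. fe (diag_form i n m b) (p' * x + q' * z) (r' * x + v' * z) = \<kappa> * fe (diag_form i n m b) (p * x + q * z) (r * x + v * z)"
  shows "p' * q = q' * p" "r' * v = v' * r"
proof -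
  obtain p1 q1 r1 v1 where D1: "p1 * v1 - q1 * r1 \<noteq> 0"
    and 1: "\<And>x z. p * (p1 * x + q1 * z) + q * (r1 * x + v1 * z) = x" "\<And>x z. r * (p1 * x + q1 * z) + v * (r1 * x + v1 * z) = z"
    and 2: "\<And>x z. p1 * (p * x + q * z) + q1 * (r * x + v * z) = x" "\<And>x z. r1 * (p * x + q * z) + v1 * (r * x + v * z) = z"
    by (rule inverse_substitution[OF D(1)]) (rule that)
  define P where "P = p' * p1 + q' * r1"
  define Q where "Q = p' * q1 + q' * v1"
  define R where "R = r' * p1 + v' * r1"
  define S where "S = r' * q1 + v' * v1"
  have "P * S - Q * R = (p' * v' - q' * r') * (p1 * v1 - q1 * r1)" by (simp add: P_def Q_def R_def S_def algebra_simps)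
  hence dPS: "P * S - Q * R \<noteq> 0" using D(2) D1 by simp
  have PQ: "P * x + Q * z = p' * (p1 * x + q1 * z) + q' * (r1 * x + v1 * z)"
    and RS: "R * x + S * z = r' * (p1 * x + q1 * z) + v' * (r1 * x + v1 * z)" for x z
    by (simp_all add: P_def Q_def R_def S_def algebra_simps)
  have "fe (diag_form i n m b) (P * x + Q * z) (R * x + S * z) = \<kappa> * fe (diag_form i n m b) x z" for x z
    unfolding PQ RS eq 1 ..
  hence "autf (diag_form i n m b) P Q R S" unfolding autf_def using dPS \<kappa> by blast
  from typedD(5)[OF b this] have QR: "Q = 0" "R = 0" by auto
  have "P * (p * x + q * z) = p' * x + q' * z" for x z
    using PQ[of "p * x + q * z" "r * x + v * z"] unfolding 2 QR by simp
  from this[of 1 0] this[of 0 1] have "p' = P * p" "q' = P * q" by simp_all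
  thus "p' * q = q' * p" by (simp add: mult_ac)
  have "S * (r * x + v * z) = r' * x + v' * z" for x z
    using RS[of "p * x + q * z" "r * x + v * z"] unfolding 2 QR by simp
  from this[of 1 0] this[of 0 1] have "r' = S * r" "v' = S * v" by simp_all
  thus "r' * v = v' * r" by (simp add: mult_ac)
qed

text \<open>Coefficients \<open>b\<^sub>j \<in> L\<close> of a form of type \<open>(i, n, m)\<close> on which the nontrivial automorphism \<open>s\<close> of \<open>L|k\<close> acts through an
  antidiagonal substitution.\<close>

locale quadratic_form = quadratic_extension +
  fixes i n m :: nat and b :: "nat \<Rightarrow> 'a" and c t :: 'a
  assumes b: "typed i n m b" and i: "i \<noteq> 1" and b0: "b 0 = 1" and bL: "j \<le> m \<Longrightarrow> b j \<in> L"
    and nz: "c \<noteq> 0" "t \<noteq> 0" and sb: "j \<le> m \<Longrightarrow> s (b j) = c * t ^ j * b (m - j)"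
begin

lemma cL: "c \<in> L"
proof -
  have "c * b m = 1" using sb[of 0] b0 by (simp add: sD)
  hence "c = 1 / b m" using typed_ends(2)[OF b] by (simp add: field_simps)
  thus ?thesis using L_closed(2,7) bL[of m] by simp
qed

lemma tL: "t \<in> L"
proof (rule L_I)
  fix h assume h: "h \<in> H"
  note hD = field_auto_simps[OF H_auto[OF h]]
  have "c * (h t) ^ j * b (m - j) = c * t ^ j * b (m - j)" if j: "j \<le> m" for j
  proof -
    have "h (s (b j)) = s (b j)" by (rule L_fixed[OF s_L[OF bL[OF j]] h])
    moreover have "h (s (b j)) = c * (h t) ^ j * b (m - j)"
      unfolding sb[OF j] using L_fixed[OF cL h] L_fixed[OF bL[of "m - j"] h] by (simp add: hD)
    ultimately show ?thesis using sb[OF j] by metis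
  qed
  from exponents_eq_rev(2)[OF b nz this] show "h t = t" .
qed

text \<open>Applying \<open>s\<close> twice multiplies \<open>b\<^sub>j\<close> by \<open>c s(c) t\<^sup>m (s(t) / t)\<^sup>j\<close>, which must be \<open>1\<close> whenever \<open>b\<^sub>j \<noteq> 0\<close>.\<close>

lemma c_norm: "nm c * t ^ m = 1" and tk: "t \<in> k"
proof -
  have *: "(nm c * t ^ m) * (s t) ^ j * b j = 1 * t ^ j * b j" if j: "j \<le> m" for j
  proof -
    have "b j = s (c * t ^ j * b (m - j))" using s_s[OF bL[OF j]] sb[OF j] by simp
    also have "\<dots> = s c * s t ^ j * (c * t ^ (m - j) * b (m - (m - j)))" using sb[of "m - j"] by (simp add: sD)
    finally have "b j = nm c * s t ^ j * t ^ (m - j) * b j" using j by (simp add: nm_def mult_ac)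
    hence "t ^ j * b j = nm c * s t ^ j * (t ^ (m - j) * t ^ j) * b j" by (metis mult.assoc mult.commute)
    thus ?thesis unfolding power_complement[OF j] by (simp only: mult_ac mult_1_left)
  qed
  have "nm c * t ^ m \<noteq> 0" using nz by (simp add: nm_hom)
  from exponents_eq[OF b this nz(2) *] show "nm c * t ^ m = 1" "t \<in> k" using k_iff tL by auto
qed

text \<open>For \<open>m = 2l + 1\<close> the relation \<open>c s(c) t\<^sup>m = 1\<close> reads \<open>t = Nm(1 / (c t\<^sup>l))\<close>.\<close>

lemma norm_if_odd: assumes "odd m" shows "t \<in> nm ` (L - {0})"
proof -
  obtain l where l: "m = 2 * l + 1" using assms by (rule oddE)
  have "nm (1 / (c * t ^ l)) = 1 / (nm c * t ^ (2 * l))" by (simp add: nm_hom nm_k[OF tk] power_mult)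
  moreover have "nm c * t ^ (2 * l) * t = 1" using c_norm by (simp add: l power_add mult_ac)
  ultimately have "t = nm (1 / (c * t ^ l))" by (metis divide_inverse inverse_unique mult_1)
  moreover have "1 / (c * t ^ l) \<in> L - {0}" using L_closed cL tL nz by auto
  ultimately show ?thesis by blast
qed

text \<open>If \<open>t\<close> is a norm, then by Hilbert 90 one can rescale such that \<open>s\<close> reverses the coefficients; the
  substitution of \<open>x + \<delta> z\<close> and \<open>x - \<delta> z\<close> with \<open>s \<delta> = - \<delta>\<close> then gives a form over \<open>k\<close>.\<close>

lemma descent_if_norm:
  assumes "t \<in> nm ` (L - {0})"
  obtains \<beta> f0 where "diag_equiv m b \<beta>" "binary_form (n * m + i) f0" "coeffs_in k f0" "form_equiv f0 (diag_form i n m \<beta>)"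
proof -
  obtain y where y: "y \<in> L" "y \<noteq> 0" "t = y * s y" using assms by (auto simp: nm_def)
  obtain \<delta> where \<delta>: "\<delta> \<in> L" "s \<delta> = - \<delta>" "\<delta> \<noteq> 0" by (rule skew_element)
  have sy: "s y \<noteq> 0" using y(2) by (simp add: sD)
  define c' where "c' = c * y ^ m"
  have c'L: "c' \<in> L" unfolding c'_def by (intro L_closed cL y(1))
  have "nm c' = nm c * t ^ m" unfolding c'_def nm_hom y(3) nm_def[of y] ..
  hence c'n: "s c' * c' = 1" using c_norm by (simp add: nm_def mult.commute)
  \<comment> \<open>Hilbert 90 for \<open>c'\<close>, with \<open>1 + c'\<close> as resolvent and \<open>\<delta>\<close> in the exceptional case.\<close>
  obtain \<kappa> where \<kappa>: "\<kappa> \<in> L" "\<kappa> \<noteq> 0" "s \<kappa> * c' = \<kappa>"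
  proof (cases "1 + c' = 0")
    case True
    hence "c' = - 1" by (metis add.commute eq_neg_iff_add_eq_0)
    thus ?thesis using that[of \<delta>] \<delta> by simp
  next
    case False
    thus ?thesis using that[of "1 + c'"] c'L L_closed c'n by (simp add: sD distrib_right add.commute)
  qed
  define \<beta> where "\<beta> j = \<kappa> * (1 / y) ^ j * b j" for j
  have \<beta>L: "\<beta> j \<in> L" if "j \<le> m" for j unfolding \<beta>_def by (intro L_closed \<kappa>(1) y(1) bL[OF that])
  have s\<beta>: "s (\<beta> j) = \<beta> (m - j)" if j: "j \<le> m" for j
  proof -
    have 1: "s (1 / y) * t = y" unfolding y(3) using sy by (simp add: sD)
    have 2: "y ^ j = y ^ m * (1 / y) ^ (m - j)"
    proof -
      have "y ^ m * (1 / y) ^ (m - j) = y ^ j * (y ^ (m - j) * (1 / y) ^ (m - j))" using power_complement[OF j, of y] by (metis mult.assoc mult.commute)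
      also have "y ^ (m - j) * (1 / y) ^ (m - j) = 1" using y(2) by (simp add: power_mult_distrib[symmetric])
      finally show ?thesis by simp
    qed
    have "s (\<beta> j) = s \<kappa> * s (1 / y) ^ j * (c * t ^ j * b (m - j))" unfolding \<beta>_def sD(4) sD(7) sb[OF j] ..
    also have "\<dots> = s \<kappa> * c * (s (1 / y) * t) ^ j * b (m - j)" by (simp add: power_mult_distrib mult_ac)
    also have "\<dots> = (s \<kappa> * c') * (1 / y) ^ (m - j) * b (m - j)" unfolding 1 unfolding 2 c'_def by (simp only: mult_ac)
    finally show ?thesis unfolding \<kappa>(3) \<beta>_def .
  qed
  let ?F = "diag_form i n m \<beta>"
  define f0 where "f0 = subst2 1 \<delta> 1 (- \<delta>) ?F"
  have bF: "binary_form (n * m + i) ?F" by (rule binary_form_diag[OF typedD(1)[OF b]])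
  have bf: "binary_form (n * m + i) f0" unfolding f0_def by (rule binary_form_subst2[OF bF])
  have e: "fe f0 x z = fe ?F (x + \<delta> * z) (x - \<delta> * z)" for x z by (simp add: f0_def fe_subst2)
  have "coeffs_in k f0"
    unfolding k coeffs_in_fixed_field_iff[OF \<Gamma>_auto]
  proof
    fix g assume g: "g \<in> \<Gamma>"
    note ga = auto[OF g] and gD = field_auto_simps[OF auto[OF g]]
    have hom: "binary_form (n * m + i) (Poly_Mapping.map g f0)" using homogeneous_map[of _ _ f0 g] bf gD(1) unfolding binary_form_def by blast
    show "Poly_Mapping.map g f0 = f0"
    proof (rule binary_form_eqI[OF hom bf])
      fix U V :: 'a
      define x where "x = finv g U"
      define z where "z = finv g V"
      have xz: "U = g x" "V = g z" by (simp_all add: x_def z_def ga)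
      have "fe (Poly_Mapping.map g f0) U V = g (fe ?F (x + \<delta> * z) (x - \<delta> * z))" unfolding xz fe_map[OF ga] e ..
      also have "\<dots> = fe (diag_form i n m (\<lambda>j. g (\<beta> j))) (U + g \<delta> * V) (U - g \<delta> * V)"
        unfolding fe_map[OF ga, symmetric] map_diag_form[OF ga] by (simp only: gD xz)
      also have "\<dots> = fe ?F (U + \<delta> * V) (U - \<delta> * V)"
      proof (cases "g \<in> H")
        case True
        show ?thesis unfolding L_fixed[OF \<delta>(1) True] by (rule fe_diag_cong) (use L_fixed[OF \<beta>L True] in blast)
      next
        case False
        have "g (\<beta> j) = \<beta> (m - j)" if "j \<le> m" for j using outside[OF g False \<beta>L[OF that]] s\<beta>[OF that] by simp
        hence "fe (diag_form i n m (\<lambda>j. g (\<beta> j))) (U - \<delta> * V) (U + \<delta> * V) = fe (diag_form i n m (\<lambda>j. \<beta> (m - j))) (U - \<delta> * V) (U + \<delta> * V)"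
          by (rule fe_diag_cong)
        thus ?thesis unfolding fe_diag_rev[OF i] outside[OF g False \<delta>(1)] \<delta>(2) by simp
      qed
      finally show "fe (Poly_Mapping.map g f0) U V = fe f0 U V" unfolding e .
    qed
  qed
  moreover have "diag_equiv m b \<beta>" unfolding diag_equiv_def by (rule exI[of _ \<kappa>], rule exI[of _ "1 / y"]) (use \<kappa> y in \<open>simp add: \<beta>_def\<close>)
  moreover have "form_equiv f0 ?F" unfolding form_equiv_def
  proof (intro exI conjI allI)
    have "1 * - \<delta> - \<delta> * 1 = - (2 * \<delta>)" by simp
    thus "1 * - \<delta> - \<delta> * 1 \<noteq> 0" using two \<delta>(3) by (simp del: mult_1 mult_1_right)
    show "(1::'a) \<noteq> 0" by simp
    show "fe f0 x z = 1 * fe ?F (1 * x + \<delta> * z) (1 * x + - \<delta> * z)" for x z unfolding e by simp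
  qed
  ultimately show ?thesis using that bf by blast
qed

end

context quadratic_form
begin

text \<open>A form over \<open>k\<close> that is equivalent to the given one is a form of the given type in two linear forms. Up to scalars
  these are fixed by \<open>H\<close> and exchanged by \<open>s\<close>, so they can be normalized to \<open>x + \<epsilon> z\<close> and \<open>x + s(\<epsilon>) z\<close> with \<open>\<epsilon> \<in> L\<close>. Its
  coefficients \<open>\<beta>\<^sub>j = C \<omega>\<^sup>j b\<^sub>j\<close> with respect to them satisfy \<open>s(\<beta>\<^sub>j) = \<beta>\<^sub>m\<^sub>-\<^sub>j\<close>, which means \<open>t Nm(\<omega>) = 1\<close>.\<close>

lemma norm_if_descent:
  assumes bf: "binary_form (n * m + i) f0" and fk: "coeffs_in k f0" and eqv: "form_equiv f0 (diag_form i n m b)"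
  shows "t \<in> nm ` (L - {0})"
proof -
  let ?F = "diag_form i n m b"
  note n0 = typedD(2)[OF b]
  obtain p q r v e where D: "p * v - q * r \<noteq> 0" and e: "e \<noteq> 0"
    and f0: "\<And>x z. fe f0 x z = e * fe ?F (p * x + q * z) (r * x + v * z)" using eqv unfolding form_equiv_def by blast
  have f0g: "fe f0 (g x) (g z) = g (fe f0 x z)" if g: "g \<in> \<Gamma>" for g x z
  proof -
    have "Poly_Mapping.map g f0 = f0" using fk g unfolding k coeffs_in_fixed_field_iff[OF \<Gamma>_auto] by blast
    thus ?thesis using fe_map[OF auto[OF g], of f0 x z] by simp
  qed
  have rows_h: "h p * q = h q * p \<and> h r * v = h v * r" if h: "h \<in> H" for h
  proof -
    have hg: "h \<in> \<Gamma>" using h H_sub by blast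
    note ha = H_auto[OF h] and hD = field_auto_simps[OF H_auto[OF h]]
    have hF: "h (fe ?F x z) = fe ?F (h x) (h z)" for x z
    proof -
      have "h (fe ?F x z) = fe (diag_form i n m (\<lambda>j. h (b j))) (h x) (h z)" using fe_map[OF ha, of ?F x z] unfolding map_diag_form[OF ha] by simp
      also have "\<dots> = fe ?F (h x) (h z)" by (rule fe_diag_cong) (rule L_fixed[OF bL h])
      finally show ?thesis .
    qed
    have eq: "fe ?F (h p * x + h q * z) (h r * x + h v * z) = (e / h e) * fe ?F (p * x + q * z) (r * x + v * z)" for x z
    proof -
      define x' where "x' = finv h x"
      define z' where "z' = finv h z"
      have xz: "x = h x'" "z = h z'" by (simp_all add: x'_def z'_def ha)
      have "e * fe ?F (p * x + q * z) (r * x + v * z) = h (e * fe ?F (p * x' + q * z') (r * x' + v * z'))"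
        using f0g[OF hg, of x' z'] unfolding f0 xz .
      also have "\<dots> = h e * fe ?F (h p * x + h q * z) (h r * x + h v * z)" unfolding hD(4) hF by (simp only: hD xz)
      finally show ?thesis using e by (simp add: hD)
    qed
    have D': "h p * h v - h q * h r \<noteq> 0" using D hD(8)[of "p * v - q * r"] by (simp only: hD(4,6) simp_thms)
    have e': "e / h e \<noteq> 0" using e by (simp add: hD)
    from rows_proportional[OF b D D' e' eq] show ?thesis by blast
  qed
  obtain P where P: "P ^ n = t" using nth_root_exists[of n t] n0 by auto
  have P0: "P \<noteq> 0" using P nz(2) n0 by (auto simp: power_0_left)
  have rows_s: "s r * q = s v * p \<and> s p * v = s q * r"
  proof -
    have sF: "s (fe ?F x z) = (c / outer_factor i P 1) * fe ?F (s z) (P * s x)" for x z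
    proof -
      have "s (fe ?F x z) = fe (diag_form i n m (\<lambda>j. s (b j))) (s x) (s z)"
        using fe_map[OF s_auto, of ?F x z] unfolding map_diag_form[OF s_auto] by simp
      also have "\<dots> = (c / outer_factor i P 1) * fe ?F (s z) (P * s x)"
        by (rule diag_form_of_antidiag_equiv[OF _ P0 i]) (simp add: sb P)
      finally show ?thesis .
    qed
    have C0: "c / outer_factor i P 1 \<noteq> 0" using nz(1) outer_factor_nz[OF P0, of 1 i] by simp
    have eq: "fe ?F (s r * x + s v * z) ((P * s p) * x + (P * s q) * z) = (e / (s e * (c / outer_factor i P 1))) * fe ?F (p * x + q * z) (r * x + v * z)" for x z
    proof -
      define x' where "x' = finv s x"
      define z' where "z' = finv s z"
      have xz: "x = s x'" "z = s z'" by (simp_all add: x'_def z'_def s_auto)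
      have "e * fe ?F (p * x + q * z) (r * x + v * z) = s (e * fe ?F (p * x' + q * z') (r * x' + v * z'))"
        using f0g[OF s(1), of x' z'] unfolding f0 xz .
      also have "\<dots> = s e * ((c / outer_factor i P 1) * fe ?F (s (r * x' + v * z')) (P * s (p * x' + q * z')))" unfolding sD(4) sF ..
      also have "s (r * x' + v * z') = s r * x + s v * z" by (simp only: xz sD)
      also have "P * s (p * x' + q * z') = (P * s p) * x + (P * s q) * z" by (simp only: xz sD distrib_left mult.assoc)
      finally have *: "e * fe ?F (p * x + q * z) (r * x + v * z)
        = (s e * (c / outer_factor i P 1)) * fe ?F (s r * x + s v * z) ((P * s p) * x + (P * s q) * z)" by (simp only: mult.assoc)
      define w where "w = s e * (c / outer_factor i P 1)"
      have w0: "w \<noteq> 0" unfolding w_def using C0 e by (simp add: sD)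
      show ?thesis using * w0 unfolding w_def[symmetric] by (simp add: divide_simps mult.commute)
    qed
    have "s r * (P * s q) - s v * (P * s p) = - (P * s (p * v - q * r))" by (simp add: sD algebra_simps)
    hence D': "s r * (P * s q) - s v * (P * s p) \<noteq> 0" using D P0 sD(8)[of "p * v - q * r"] by simp
    have e': "e / (s e * (c / outer_factor i P 1)) \<noteq> 0" using e C0 by (simp add: sD)
    have "s r * q = s v * p" "(P * s p) * v = (P * s q) * r" using rows_proportional[OF b D D' e' eq] by blast+
    thus ?thesis using P0 by (simp add: mult.assoc)
  qed
  have p0: "p \<noteq> 0"
  proof
    assume "p = 0"
    hence "s r * q = 0" "q * r \<noteq> 0" using rows_s D by auto
    thus False by (simp add: sD)
  qed
  have r0: "r \<noteq> 0"
  proof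
    assume "r = 0"
    hence "s p * v = 0" "p * v \<noteq> 0" using rows_s D by auto
    thus False by (simp add: sD)
  qed
  define \<epsilon> where "\<epsilon> = q / p"
  have \<epsilon>L: "\<epsilon> \<in> L"
  proof (rule L_I)
    fix h assume h: "h \<in> H"
    note hD = field_auto_simps[OF H_auto[OF h]]
    have "h q / h p = q / p" using rows_h[OF h] p0 by (simp add: frac_eq_eq hD mult.commute)
    thus "h \<epsilon> = \<epsilon>" by (simp add: \<epsilon>_def hD)
  qed
  have s\<epsilon>: "s \<epsilon> = v / r" using rows_s p0 r0 by (simp add: \<epsilon>_def sD frac_eq_eq mult.commute)
  have \<epsilon>ne: "\<epsilon> \<noteq> s \<epsilon>" unfolding s\<epsilon> unfolding \<epsilon>_def using D p0 r0 by (simp add: frac_eq_eq mult.commute)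
  define \<omega> where "\<omega> = (p / r) ^ n"
  have \<omega>0: "\<omega> \<noteq> 0" using p0 r0 by (simp add: \<omega>_def)
  define E where "E = outer_factor i r r * (r ^ n) ^ m"
  have E0: "E \<noteq> 0" using r0 outer_factor_nz[OF r0 r0, of i] by (simp add: E_def)
  define C where "C = e * E * outer_factor i (p / r) 1"
  have pr0: "p / r \<noteq> 0" using p0 r0 by simp
  have C0: "C \<noteq> 0" using e E0 outer_factor_nz[OF pr0, of 1 i] by (simp add: C_def)
  define \<beta> where "\<beta> j = C * \<omega> ^ j * b j" for j
  let ?G = "\<lambda>g. diag_form i n m (\<lambda>j. g (\<beta> j))"
  have f0\<beta>: "fe f0 x z = fe (diag_form i n m \<beta>) (x + \<epsilon> * z) (x + s \<epsilon> * z)" for x z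
  proof -
    have 1: "p * x + q * z = r * ((p / r) * (x + \<epsilon> * z))" "r * x + v * z = r * (x + s \<epsilon> * z)"
      unfolding s\<epsilon> using p0 r0 by (simp_all add: \<epsilon>_def distrib_left)
    have "fe f0 x z = e * E * fe ?F ((p / r) * (x + \<epsilon> * z)) (x + s \<epsilon> * z)" unfolding f0 1 fe_diag_homog by (simp add: E_def)
    moreover have "fe (diag_form i n m \<beta>) (x + \<epsilon> * z) (x + s \<epsilon> * z) = C / outer_factor i (p / r) 1 * fe ?F ((p / r) * (x + \<epsilon> * z)) (x + s \<epsilon> * z)"
      by (rule diag_form_of_diag_equiv[OF _ pr0]) (simp add: \<beta>_def \<omega>_def)
    moreover have "C / outer_factor i (p / r) 1 = e * E" using outer_factor_nz[OF pr0, of 1 i] by (simp add: C_def)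
    ultimately show ?thesis by (simp only:)
  qed
  have conj: "fe (?G g) (x + g \<epsilon> * z) (x + g (s \<epsilon>) * z) = fe (diag_form i n m \<beta>) (x + \<epsilon> * z) (x + s \<epsilon> * z)" if g: "g \<in> \<Gamma>" for g x z
  proof -
    note ga = auto[OF g] and gD = field_auto_simps[OF auto[OF g]]
    define x' where "x' = finv g x"
    define z' where "z' = finv g z"
    have xz: "x = g x'" "z = g z'" by (simp_all add: x'_def z'_def ga)
    have "fe f0 x z = g (fe (diag_form i n m \<beta>) (x' + \<epsilon> * z') (x' + s \<epsilon> * z'))" 
      using f0g[OF g, of x' z'] unfolding xz[symmetric] f0\<beta>[of x' z'] .
    also have "\<dots> = fe (?G g) (x + g \<epsilon> * z) (x + g (s \<epsilon>) * z)"
      unfolding fe_map[OF ga, symmetric] map_diag_form[OF ga] by (simp only: gD xz)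
    finally show ?thesis unfolding f0\<beta> by simp
  qed
  have coords: "\<exists>x z. u = x + \<epsilon> * z \<and> w = x + s \<epsilon> * z" for u w
  proof (intro exI conjI)
    have d: "\<epsilon> - s \<epsilon> \<noteq> 0" using \<epsilon>ne by simp
    define z where "z = (u - w) / (\<epsilon> - s \<epsilon>)"
    have z: "\<epsilon> * z - s \<epsilon> * z = u - w" unfolding left_diff_distrib[symmetric] z_def using d by simp
    show "u = (u - \<epsilon> * z) + \<epsilon> * z" by simp
    have "w = u - (\<epsilon> * z - s \<epsilon> * z)" unfolding z by simp
    thus "w = (u - \<epsilon> * z) + s \<epsilon> * z" by simp
  qed
  have \<beta>L: "\<beta> j \<in> L" if j: "j \<le> m" for j
  proof (rule L_I)
    fix h assume h: "h \<in> H"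
    have hg: "h \<in> \<Gamma>" using h H_sub by blast
    have "fe (?G h) u w = fe (diag_form i n m \<beta>) u w" for u w
    proof -
      obtain x z where "u = x + \<epsilon> * z" "w = x + s \<epsilon> * z" using coords by blast
      thus ?thesis using conj[OF hg, of x z] unfolding L_fixed[OF \<epsilon>L h] L_fixed[OF s_L[OF \<epsilon>L] h] by simp
    qed
    from diag_form_eqI[OF _ this j] show "h (\<beta> j) = \<beta> j" using n0 by simp
  qed
  have s\<beta>: "s (\<beta> j) = \<beta> (m - j)" if j: "j \<le> m" for j
  proof -
    have "fe (?G s) u w = fe (diag_form i n m (\<lambda>j. \<beta> (m - j))) u w" for u w
    proof -
      obtain x z where "w = x + \<epsilon> * z" "u = x + s \<epsilon> * z" using coords by blast
      thus ?thesis using conj[OF s(1), of x z] unfolding fe_diag_rev[OF i] s_s[OF \<epsilon>L] by simp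
    qed
    from diag_form_eqI[OF _ this j] show ?thesis using n0 by simp
  qed
  have CL: "C \<in> L" using \<beta>L[of 0] b0 by (simp add: \<beta>_def)
  have \<omega>L: "\<omega> \<in> L"
  proof (rule L_I)
    fix h assume h: "h \<in> H"
    note hD = field_auto_simps[OF H_auto[OF h]]
    have "C * h \<omega> ^ j * b j = C * \<omega> ^ j * b j" if j: "j \<le> m" for j
    proof -
      have "h (\<beta> j) = C * h \<omega> ^ j * b j" unfolding \<beta>_def hD(4) hD(7) L_fixed[OF CL h] L_fixed[OF bL[OF j] h] ..
      thus ?thesis using L_fixed[OF \<beta>L[OF j] h] by (simp add: \<beta>_def)
    qed
    from exponents_eq(2)[OF b C0 \<omega>0 this] show "h \<omega> = \<omega>" .
  qed
  have "(s C * c) * (s \<omega> * t * \<omega>) ^ j * b (m - j) = (C * \<omega> ^ m) * 1 ^ j * b (m - j)" if j: "j \<le> m" for j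
  proof -
    have "s C * s \<omega> ^ j * (c * t ^ j * b (m - j)) = C * \<omega> ^ (m - j) * b (m - j)"
      using s\<beta>[OF j] unfolding \<beta>_def sD(4) sD(7) sb[OF j] .
    hence "\<omega> ^ j * (s C * s \<omega> ^ j * (c * t ^ j * b (m - j))) = C * (\<omega> ^ (m - j) * \<omega> ^ j) * b (m - j)" by (simp only: mult_ac)
    thus ?thesis unfolding power_complement[OF j] by (simp add: power_mult_distrib mult_ac)
  qed
  from exponents_eq_rev(2)[OF b _ _ this] have "s \<omega> * t * \<omega> = 1" using C0 nz(1) by (simp add: sD)
  hence "t * nm \<omega> = 1" by (simp add: nm_def mult_ac)
  hence "t = nm (1 / \<omega>)" using \<omega>0 by (simp add: nm_hom field_simps)
  moreover have "1 / \<omega> \<in> L - {0}" using L_closed \<omega>L \<omega>0 by auto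
  ultimately show ?thesis by blast
qed

text \<open>Another form of the given type over \<open>L\<close> with its own \<open>t'\<close> differs from the given one by a diagonal or an antidiagonal
  substitution; accordingly \<open>t' / t\<close> or \<open>t' t\<close> is a norm.\<close>

lemma change_of_model:
  assumes b': "diag_equiv m b b' \<or> antidiag_equiv m b b'" and b'L: "\<And>j. j \<le> m \<Longrightarrow> b' j \<in> L"
    and t': "c' \<noteq> 0" "t' \<noteq> 0" "\<And>j. j \<le> m \<Longrightarrow> s (b' j) = c' * t' ^ j * b' (m - j)"
  obtains x where "x \<in> L" "x \<noteq> 0" "t' = t * nm x"
  using b'
proof
  assume "diag_equiv m b b'"
  then obtain \<gamma> \<omega> where g: "\<gamma> \<noteq> 0" "\<omega> \<noteq> 0" "\<And>j. j \<le> m \<Longrightarrow> b' j = \<gamma> * \<omega> ^ j * b j" unfolding diag_equiv_def by blast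
  have gL: "\<gamma> \<in> L" using b'L[of 0] g(3)[of 0] b0 by simp
  have lL: "\<omega> \<in> L"
  proof (rule L_I)
    fix h assume h: "h \<in> H"
    note hD = field_auto_simps[OF H_auto[OF h]]
    have "\<gamma> * h \<omega> ^ j * b j = \<gamma> * \<omega> ^ j * b j" if j: "j \<le> m" for j
    proof -
      have "h (b' j) = \<gamma> * h \<omega> ^ j * b j" unfolding g(3)[OF j] hD(4) hD(7) L_fixed[OF gL h] L_fixed[OF bL[OF j] h] ..
      thus ?thesis using L_fixed[OF b'L[OF j] h] g(3)[OF j] by simp
    qed
    from exponents_eq(2)[OF b g(1,2) this] show "h \<omega> = \<omega>" .
  qed
  have "(s \<gamma> * c) * (s \<omega> * t * \<omega>) ^ j * b (m - j) = (c' * \<gamma> * \<omega> ^ m) * t' ^ j * b (m - j)" if j: "j \<le> m" for j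
  proof -
    have "s \<gamma> * s \<omega> ^ j * (c * t ^ j * b (m - j)) = c' * t' ^ j * (\<gamma> * \<omega> ^ (m - j) * b (m - j))"
      using t'(3)[OF j] g(3)[of "m - j"] unfolding g(3)[OF j] sD(4) sD(7) sb[OF j] by simp
    hence "\<omega> ^ j * (s \<gamma> * s \<omega> ^ j * (c * t ^ j * b (m - j))) = c' * t' ^ j * (\<gamma> * (\<omega> ^ (m - j) * \<omega> ^ j) * b (m - j))" by (simp only: mult_ac)
    thus ?thesis unfolding power_complement[OF j] by (simp add: power_mult_distrib mult_ac)
  qed
  from exponents_eq_rev(2)[OF b _ _ this] have "s \<omega> * t * \<omega> = t'" using g t' nz(1) by (simp add: sD)
  hence "t' = t * nm \<omega>" by (simp add: nm_def mult_ac)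
  thus ?thesis using that[OF lL g(2)] by blast
next
  assume "antidiag_equiv m b b'"
  then obtain \<gamma> \<omega> where g: "\<gamma> \<noteq> 0" "\<omega> \<noteq> 0" "\<And>j. j \<le> m \<Longrightarrow> b' j = \<gamma> * \<omega> ^ j * b (m - j)" unfolding antidiag_equiv_def by blast
  have gL: "\<gamma> \<in> L"
  proof -
    have "b' 0 / b m \<in> L" using b'L[of 0] bL[of m] L_closed(7) by simp
    thus ?thesis using g(3)[of 0] typed_ends(2)[OF b] by simp
  qed
  have lL: "\<omega> \<in> L"
  proof (rule L_I)
    fix h assume h: "h \<in> H"
    note hD = field_auto_simps[OF H_auto[OF h]]
    have "\<gamma> * h \<omega> ^ j * b (m - j) = \<gamma> * \<omega> ^ j * b (m - j)" if j: "j \<le> m" for j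
    proof -
      have "h (b' j) = \<gamma> * h \<omega> ^ j * b (m - j)" unfolding g(3)[OF j] hD(4) hD(7) L_fixed[OF gL h] using L_fixed[OF bL[of "m - j"] h] by simp
      thus ?thesis using L_fixed[OF b'L[OF j] h] g(3)[OF j] by simp
    qed
    from exponents_eq_rev(2)[OF b g(1,2) this] show "h \<omega> = \<omega>" .
  qed
  have "(s \<gamma> * c * t ^ m) * (s \<omega> * \<omega>) ^ j * b j = (c' * \<gamma> * \<omega> ^ m) * (t * t') ^ j * b j" if j: "j \<le> m" for j
  proof -
    have 1: "s (b' j) = s \<gamma> * s \<omega> ^ j * (c * t ^ (m - j) * b j)"
      unfolding g(3)[OF j] sD(4) sD(7) using sb[of "m - j"] j by simp
    have 2: "s (b' j) = c' * t' ^ j * (\<gamma> * \<omega> ^ (m - j) * b j)" using t'(3)[OF j] g(3)[of "m - j"] j by simp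
    have "\<omega> ^ j * t ^ j * (s \<gamma> * s \<omega> ^ j * (c * t ^ (m - j) * b j)) = \<omega> ^ j * t ^ j * (c' * t' ^ j * (\<gamma> * \<omega> ^ (m - j) * b j))" unfolding 1[symmetric] 2[symmetric] ..
    hence "s \<gamma> * s \<omega> ^ j * \<omega> ^ j * (c * (t ^ (m - j) * t ^ j) * b j) = c' * (t ^ j * t' ^ j) * (\<gamma> * (\<omega> ^ (m - j) * \<omega> ^ j) * b j)"
      by (simp only: mult_ac)
    thus ?thesis unfolding power_complement[OF j] by (simp add: power_mult_distrib mult_ac)
  qed
  from exponents_eq(2)[OF b _ _ this] have "s \<omega> * \<omega> = t * t'" using g t' nz by (simp add: sD)
  hence "nm \<omega> = t * t'" by (simp add: nm_def mult.commute)
  moreover have "nm (\<omega> / t) = nm \<omega> / (t * t)" by (simp add: nm_hom nm_k[OF tk] power2_eq_square)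
  ultimately have "t' = t * nm (\<omega> / t)" using nz(2) by simp
  thus ?thesis using that[of "\<omega> / t"] lL tL L_closed(7) g(2) nz(2) by simp
qed

text \<open>The action of a matrix substitutes its inverse, which sends \<open>(x, z)\<close> to \<open>(z / \<mu>, x / \<nu>)\<close>.\<close>

lemma fe_antidiagonal:
  assumes "\<nu> \<noteq> 0" "\<mu> \<noteq> 0"
  shows "fe (gl_act (diag2 \<nu> \<mu> ** swap2) F) x z = fe F (z / \<mu>) (x / \<nu>)"
proof -
  let ?A = "diag2 \<nu> \<mu> ** swap2"
  have A: "?A $ 1 $ 1 = 0" "?A $ 1 $ 2 = \<nu>" "?A $ 2 $ 1 = \<mu>" "?A $ 2 $ 2 = 0"
    by (simp_all add: diag2_def swap2_def matrix_matrix_mult_def sum_2 vector_2)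
  have D: "?A $ 1 $ 1 * ?A $ 2 $ 2 - ?A $ 1 $ 2 * ?A $ 2 $ 1 = - (\<nu> * \<mu>)" unfolding A by simp
  have "- (\<nu> * \<mu>) \<noteq> 0" using assms by simp
  from matrix_inv_2(1)[OF D this] show ?thesis
    unfolding fe_gl_act using assms by (simp add: vector_2 A)
qed

lemma map_generator:
  assumes "coeffs_in L F" "generates_Gal L k \<sigma>" shows "Poly_Mapping.map \<sigma> F = Poly_Mapping.map s F"
proof (rule poly_mapping_eqI)
  fix mon
  have "\<sigma> 0 = 0" using generates_eq_s[OF assms(2) L_closed(1)] sD(1) by simp
  thus "Poly_Mapping.lookup (Poly_Mapping.map \<sigma> F) mon = Poly_Mapping.lookup (Poly_Mapping.map s F) mon"
    using lookup_map[of \<sigma> F mon] lookup_map[of s F mon] sD(1) generates_eq_s[OF assms(2)] assms(1) by (simp add: coeffs_in_def)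
qed

text \<open>The class of \<open>t\<close> is the norm obstruction: the matrix in its definition has \<open>\<mu>\<^sup>n / \<nu>\<^sup>n\<close> in the role of \<open>t\<close> for
  another form over \<open>L\<close>.\<close>

lemma norm_obstruction_eq:
  assumes f: "form_of_type i n m (diag_form i n m a)" and ab: "diag_equiv m a b"
  shows "norm_obstruction k L i n m (diag_form i n m a) = (\<lambda>x. t * x) ` norm_group L k"
proof -
  let ?f = "diag_form i n m a"
  note n1 = typedD(2)[OF b]
  have i2: "i \<le> 2" by (rule typedD(1)[OF b])
  have ta: "typed i n m a" by (rule form_of_type_typed[OF f n1])
  have bd: "binary_form (n * m + i) (diag_form i n m \<beta>)" for \<beta> :: "nat \<Rightarrow> 'a" by (rule binary_form_diag[OF i2])
  show ?thesis unfolding norm_obstruction_def if_not_P[OF ne]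
  proof (rule the_equality, goal_cases)
    case 1
    let ?fL = "diag_form i n m b"
    have "form_equiv ?fL ?f" by (rule diag_equiv_form_equiv[OF ab]) (use n1 in simp)
    then obtain p q r v e where D: "p * v - q * r \<noteq> 0" "e \<noteq> 0"
      and eq: "\<And>x z. fe ?fL x z = e * fe ?f (p * x + q * z) (r * x + v * z)" unfolding form_equiv_def by blast
    obtain A :: "'a ^ 2 ^ 2" where A: "invertible A" "matrix_inv A $ 1 $ 1 = p" "matrix_inv A $ 1 $ 2 = q"
      "matrix_inv A $ 2 $ 1 = r" "matrix_inv A $ 2 $ 2 = v" by (rule matrix_with_inverse[OF D(1)])
    have simA: "form_sim ?fL (gl_act A ?f)" unfolding form_sim_iff[OF bd binary_form_gl_act[OF bd]] fe_gl_act A using D(2) eq by blast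
    obtain P where P: "P ^ n = t" using nth_root_exists[of n t] n1 by auto
    have P0: "P \<noteq> 0" using P nz(2) n1 by (auto simp: power_0_left)
    have cL': "coeffs_in L ?fL" unfolding L by (rule coeffs_in_fixed_field_diag[OF H_autos]) (rule L_fixed[OF bL])
    have mp: "Poly_Mapping.map (restrict s L) ?fL = diag_form i n m (\<lambda>j. s (b j))"
      unfolding map_generator[OF cL' generates_s] by (rule map_diag_form[OF s_auto])
    have "fe (diag_form i n m (\<lambda>j. s (b j))) x z = (c / outer_factor i P 1 * (outer_factor i P P * (P ^ n) ^ m)) * fe (gl_act (diag2 1 P ** swap2) ?fL) x z" for x z
    proof -
      have "fe (diag_form i n m (\<lambda>j. s (b j))) x z = c / outer_factor i P 1 * fe ?fL z (P * x)"
        by (rule diag_form_of_antidiag_equiv[OF _ P0 i]) (simp add: sb P)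
      also have "fe ?fL z (P * x) = fe ?fL (P * (z / P)) (P * x)" using P0 by simp
      also have "\<dots> = (outer_factor i P P * (P ^ n) ^ m) * fe ?fL (z / P) x" by (rule fe_diag_homog)
      finally show ?thesis unfolding fe_antidiagonal[OF one_neq_zero P0] by simp
    qed
    moreover have "c / outer_factor i P 1 * (outer_factor i P P * (P ^ n) ^ m) \<noteq> 0" using nz(1) P0 outer_factor_nz[OF P0 P0, of i] outer_factor_nz[OF P0 one_neq_zero, of i] by simp
    ultimately have simS: "form_sim (Poly_Mapping.map (restrict s L) ?fL) (gl_act (diag2 1 P ** swap2) ?fL)"
      unfolding mp form_sim_iff[OF bd binary_form_gl_act[OF bd]] by blast
    have tt: "(\<lambda>x. t * x) ` norm_group L k = (\<lambda>x. P ^ n / 1 ^ n * x) ` norm_group L k" by (simp add: P)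
    have ft: "form_of_type i n m ?fL" by (rule form_of_type_diag_equiv[OF f n1 ab])
    show ?case
      by (rule exI[of _ ?fL], rule exI[of _ A], rule exI[of _ "restrict s L"], rule exI[of _ 1], rule exI[of _ P])
        (intro conjI ft cL' A(1) simA generates_s one_neq_zero P0 simS tt)
  next
    case (2 N)
    then obtain fL A \<sigma> \<nu> \<mu> where fL: "form_of_type i n m fL" "coeffs_in L fL"
      and A: "invertible A" "form_sim fL (gl_act A ?f)" and \<sigma>: "generates_Gal L k \<sigma>" and nz': "\<nu> \<noteq> 0" "\<mu> \<noteq> 0"
      and sim: "form_sim (Poly_Mapping.map \<sigma> fL) (gl_act (diag2 \<nu> \<mu> ** swap2) fL)"
      and N: "N = (\<lambda>c. \<mu> ^ n / \<nu> ^ n * c) ` norm_group L k" by (elim exE conjE) (rule that)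
    obtain b' where b': "fL = diag_form i n m b'" using fL(1) unfolding form_of_type_def by blast
    have tb': "typed i n m b'" using form_of_type_typed fL(1) n1 unfolding b' by blast
    have "form_equiv (diag_form i n m b') ?f" using form_sim_gl_act_equiv[OF A(1) bd bd] A(2) unfolding b' by blast
    from typed_equiv_cases[OF ta tb' this] have "diag_equiv m b b' \<or> antidiag_equiv m b b'"
      using diag_equiv_trans[OF diag_equiv_sym[OF ab]] diag_antidiag_trans[OF diag_equiv_sym[OF ab]] by blast
    moreover have "b' j \<in> L" if j: "j \<le> m" for j
    proof (rule L_I)
      fix h assume h: "h \<in> H"
      have "diag_form i n m (\<lambda>j. h (b' j)) = diag_form i n m b'"
        using fL(2) h unfolding L coeffs_in_fixed_field_iff[OF H_autos] b' by (metis map_diag_form[OF H_auto[OF h]])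
      hence "\<And>x z. fe (diag_form i n m (\<lambda>j. h (b' j))) x z = fe (diag_form i n m b') x z" by simp
      from diag_form_eqI[OF _ this j] show "h (b' j) = b' j" using n1 by simp
    qed
    moreover define \<rho> where "\<rho> = \<mu> / \<nu>"
    have \<rho>0: "\<rho> \<noteq> 0" using nz' by (simp add: \<rho>_def)
    obtain e where e: "e \<noteq> 0" "\<And>x z. fe (diag_form i n m (\<lambda>j. s (b' j))) x z = e * fe (diag_form i n m b') (z / \<mu>) (x / \<nu>)"
    proof -
      have "form_sim (diag_form i n m (\<lambda>j. s (b' j))) (gl_act (diag2 \<nu> \<mu> ** swap2) (diag_form i n m b'))"
        using sim unfolding map_generator[OF fL(2) \<sigma>] unfolding b' map_diag_form[OF s_auto] .
      thus ?thesis unfolding form_sim_iff[OF bd binary_form_gl_act[OF bd]] fe_antidiagonal[OF nz'] using that by blast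
    qed
    define K where "K = outer_factor i \<mu> \<mu> * (\<mu> ^ n) ^ m"
    have K0: "K \<noteq> 0" using nz' outer_factor_nz[OF nz'(2) nz'(2), of i] by (simp add: K_def)
    define c' where "c' = e / K * outer_factor i \<rho> 1"
    have c'0: "c' \<noteq> 0" using e(1) K0 outer_factor_nz[OF \<rho>0 one_neq_zero, of i] by (simp add: c'_def)
    have "fe (diag_form i n m (\<lambda>j. s (b' j))) x z = fe (diag_form i n m (\<lambda>j. c' * (\<rho> ^ n) ^ j * b' (m - j))) x z" for x z
    proof -
      have "fe (diag_form i n m b') z (\<rho> * x) = K * fe (diag_form i n m b') (z / \<mu>) (x / \<nu>)"
        unfolding K_def fe_diag_homog[symmetric] using nz' by (simp add: \<rho>_def)
      moreover have "fe (diag_form i n m (\<lambda>j. c' * (\<rho> ^ n) ^ j * b' (m - j))) x z = c' / outer_factor i \<rho> 1 * fe (diag_form i n m b') z (\<rho> * x)"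
        by (rule diag_form_of_antidiag_equiv[OF refl \<rho>0 i])
      moreover have "c' / outer_factor i \<rho> 1 = e / K" using outer_factor_nz[OF \<rho>0 one_neq_zero, of i] by (simp add: c'_def)
      ultimately show ?thesis unfolding e(2) using K0 by simp
    qed
    from diag_form_eqI[OF _ this] have "s (b' j) = c' * (\<rho> ^ n) ^ j * b' (m - j)" if "j \<le> m" for j using n1 that by simp
    moreover have "\<rho> ^ n \<noteq> 0" using \<rho>0 by simp
    ultimately obtain x where x: "x \<in> L" "x \<noteq> 0" "\<rho> ^ n = t * nm x" using change_of_model[of b' c' "\<rho> ^ n"] c'0 by metis
    have "\<mu> ^ n / \<nu> ^ n = t * nm x" using x(3) by (simp add: \<rho>_def power_divide)
    from coset_eq[OF this x(1,2)] show ?case unfolding N .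
  qed
qed

end

section \<open>Curves with field of moduli equal to the ground field\<close>

lemma conjugate_comp:
  assumes "field_auto \<sigma>" "field_auto \<tau>"
  shows "conjugate \<sigma> (conjugate \<tau> C) = conjugate (\<lambda>x. \<sigma> (\<tau> x)) C"
  using field_auto_simps(1)[OF assms(1)] field_auto_simps(1)[OF assms(2)] by (simp add: conjugate_def image_image map_map)

lemma conjugate_id: "conjugate (\<lambda>x. x) C = C"
  by (simp add: conjugate_def map_ident)

text \<open>A hyperelliptic curve of type \<open>(i, n, m)\<close> with field of moduli \<open>k\<close>. The group \<open>H\<close> consists of the \<open>\<sigma> \<in> \<Gamma>\<close> for which the
  coefficients of \<open>f\<^sup>\<sigma>\<close> arise from those of \<open>f\<close> by a diagonal substitution.\<close>

locale typed_curve =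
  fixes C :: "'k::field alg_closure variety" and a :: "nat \<Rightarrow> 'k alg_closure" and g i n m :: nat
  assumes char: "CHAR('k) \<noteq> 2" and hyp: "hyperelliptic C" and genus: "has_genus C g" and n: "n > 1"
    and moduli: "field_of_moduli ground_field C = ground_field" and rep: "represents i n m (diag_form i n m a) C"
begin

abbreviation \<Gamma> :: "('k alg_closure \<Rightarrow> 'k alg_closure) set" where "\<Gamma> \<equiv> Gal UNIV ground_field"

definition H :: "('k alg_closure \<Rightarrow> 'k alg_closure) set" where "H = {\<sigma> \<in> \<Gamma>. diag_equiv m a (\<lambda>j. \<sigma> (a j))}"

lemma two: "(2::'k alg_closure) \<noteq> 0"
proof
  assume "(2::'k alg_closure) = 0"
  hence "of_nat 2 = (0::'k alg_closure)" by simp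
  hence "CHAR('k) dvd 2" unfolding of_nat_eq_0_iff_char_dvd by simp
  hence "CHAR('k) \<le> 2" "CHAR('k) \<noteq> 0" by (auto dest: dvd_imp_le intro!: gr0I)
  moreover have "CHAR('k) \<noteq> 1" using CHAR_not_1 by (simp add: One_nat_def)
  ultimately show False using char by linarith
qed

lemma f_type: "form_of_type i n m (diag_form i n m a)"
  using rep by (simp add: represents_def)

lemma ta: "typed i n m a"
  by (rule form_of_type_typed[OF f_type n])

lemma binary: "binary_form (n * m + i) (diag_form i n m b)" for b :: "nat \<Rightarrow> 'k alg_closure"
  by (rule binary_form_diag[OF typedD(1)[OF ta]])

lemma even_degree: "n * m + i = 2 * ((n * m + i) div 2)"
  using f_type by (simp add: form_of_type_def)

lemma genus_eq: assumes "has_genus C g'" shows "g' + 1 = (n * m + i) div 2"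
proof -
  have "isomorphic C (hyp_model ((n * m + i) div 2) (diag_form i n m a))" using rep by (simp add: represents_def)
  then obtain \<phi> \<psi> where "iso_pair C (hyp_model ((n * m + i) div 2) (diag_form i n m a)) \<phi> \<psi>" unfolding isomorphic_pair by blast
  from iso_pair.has_genus_push[OF this assms] have g: "has_genus (hyp_model ((n * m + i) div 2) (diag_form i n m a)) g'" .
  have "n * m \<ge> n * 1" using typedD(3)[OF ta] by (intro mult_le_mono) auto
  hence "(n * m + i) div 2 \<ge> 1" using n by linarith
  from genus_hyp_model[OF _ typedD(4)[OF ta] two this g] show ?thesis using binary even_degree by simp
qed

lemma half_degree: "(n * m + i) div 2 = g + 1"
  using genus_eq[OF genus] by simp

lemma degree_eq: "n * m + i = 2 * (g + 1)"
  using even_degree unfolding half_degree .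

lemma g2: "g + 1 \<ge> 3"
proof -
  obtain g' where "g' \<ge> 2" "has_genus C g'" using hyp unfolding hyperelliptic_def by blast
  thus ?thesis using genus_eq[of g'] half_degree by simp
qed

lemma binary': "binary_form (2 * (g + 1)) (diag_form i n m b)" for b :: "nat \<Rightarrow> 'k alg_closure"
  using binary unfolding degree_eq .

lemma represents_diag_equiv: assumes "diag_equiv m a b" shows "represents i n m (diag_form i n m b) C"
proof -
  have "isomorphic (hyp_model (g + 1) (diag_form i n m b)) (hyp_model (g + 1) (diag_form i n m a))"
    by (rule form_equiv_imp_isomorphic[OF binary' binary' diag_equiv_form_equiv[OF assms]]) (use n in simp)
  hence "isomorphic C (hyp_model (g + 1) (diag_form i n m b))"
    using rep unfolding represents_def half_degree by (blast intro: isomorphic_trans isomorphic_sym)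
  thus ?thesis unfolding represents_def half_degree using form_of_type_diag_equiv[OF f_type n assms] by blast
qed

lemma descentI:
  assumes "diag_equiv m a b" "binary_form (n * m + i) f0" "coeffs_in ground_field f0" "form_equiv f0 (diag_form i n m b)"
  shows "hyperelliptic_descent ground_field g C f0"
proof -
  have bf: "binary_form (2 * (g + 1)) f0" using assms(2) unfolding degree_eq .
  have "isomorphic (hyp_model (g + 1) f0) (hyp_model (g + 1) (diag_form i n m b))"
    by (rule form_equiv_imp_isomorphic[OF bf binary' assms(4)])
  hence "isomorphic C (hyp_model (g + 1) f0)"
    using represents_diag_equiv[OF assms(1)] unfolding represents_def half_degree by (blast intro: isomorphic_trans isomorphic_sym)
  moreover have "no_repeated_linear_factors f0"
    by (rule form_equiv_no_repeated[OF assms(4) bf binary' typedD(4)[OF typed_diag_equiv[OF ta assms(1)]]])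
  ultimately show ?thesis unfolding hyperelliptic_descent_def using bf assms(3) by simp
qed

lemma descentD:
  assumes "diag_equiv m a b" "hyperelliptic_descent ground_field g C f0"
  shows "binary_form (n * m + i) f0" "coeffs_in ground_field f0" "form_equiv f0 (diag_form i n m b)"
proof -
  have bf: "binary_form (2 * (g + 1)) f0" and nr: "no_repeated_linear_factors f0"
    and iso: "isomorphic C (hyp_model (g + 1) f0)" and c: "coeffs_in ground_field f0"
    using assms(2) unfolding hyperelliptic_descent_def by simp_all
  show "binary_form (n * m + i) f0" using bf unfolding degree_eq .
  show "coeffs_in ground_field f0" by (fact c)
  have "isomorphic (hyp_model (g + 1) f0) (hyp_model (g + 1) (diag_form i n m b))"
    using represents_diag_equiv[OF assms(1)] iso unfolding represents_def half_degree by (blast intro: isomorphic_trans isomorphic_sym)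
  from isomorphic_imp_form_equiv[OF bf binary' nr typedD(4)[OF typed_diag_equiv[OF ta assms(1)]] two g2 this]
  show "form_equiv f0 (diag_form i n m b)" .
qed

lemma \<Gamma>_auto: "\<sigma> \<in> \<Gamma> \<Longrightarrow> field_auto \<sigma>" and \<Gamma>_fixes: "\<sigma> \<in> \<Gamma> \<Longrightarrow> x \<in> ground_field \<Longrightarrow> \<sigma> x = x"
  by (simp_all add: Gal_UNIV)

lemma \<Gamma>_comp: "\<sigma> \<in> \<Gamma> \<Longrightarrow> \<tau> \<in> \<Gamma> \<Longrightarrow> (\<lambda>x. \<sigma> (\<tau> x)) \<in> \<Gamma>"
  using field_auto_comp[of \<sigma> \<tau>] by (simp add: Gal_UNIV)

lemma \<Gamma>_inverse: assumes "\<sigma> \<in> \<Gamma>" shows "finv \<sigma> \<in> \<Gamma>"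
proof -
  have "finv \<sigma> x = x" if "x \<in> ground_field" for x
    using inv_auto(2)[OF \<Gamma>_auto[OF assms], of x] \<Gamma>_fixes[OF assms that] by simp
  thus ?thesis using field_auto_inv[OF \<Gamma>_auto[OF assms]] by (simp add: Gal_UNIV)
qed

lemma \<Gamma>_id: "(\<lambda>x. x) \<in> \<Gamma>"
  using field_auto_id by (simp add: Gal_UNIV)

lemma fixed_field_\<Gamma>: "fixed_field \<Gamma> = ground_field"
proof
  show "fixed_field \<Gamma> \<subseteq> ground_field" using moduli unfolding field_of_moduli_def fixed_field_def by blast
  show "ground_field \<subseteq> fixed_field \<Gamma>" using \<Gamma>_fixes unfolding fixed_field_def by blast
qed

text \<open>The automorphisms \<open>\<sigma>\<close> with \<open>C\<^sup>\<sigma> \<cong> C\<close> act on the coefficients through diagonal and antidiagonal substitutions.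
  By hypothesis their fixed field is \<open>k\<close>, so \<open>artin_tuple\<close> applies to the finitely many coefficients.\<close>

lemma \<Gamma>_cases: assumes "\<sigma> \<in> \<Gamma>" shows "diag_equiv m a (\<lambda>j. \<sigma> (a j)) \<or> (i \<noteq> 1 \<and> antidiag_equiv m a (\<lambda>j. \<sigma> (a j)))"
proof -
  define M where "M = {\<sigma> \<in> \<Gamma>. isomorphic C (conjugate \<sigma> C)}"
  have MF: "fixed_field M = ground_field" using moduli unfolding field_of_moduli_def M_def .
  have M\<Gamma>: "h \<in> \<Gamma>" if "h \<in> M" for h using that by (simp add: M_def)
  have Mcomp: "(\<lambda>x. h (h' x)) \<in> M" if h: "h \<in> M" "h' \<in> M" for h h'
  proof -
    have "isomorphic (conjugate h C) (conjugate h (conjugate h' C))"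
      by (rule conj_isomorphic) (use h \<Gamma>_auto in \<open>auto simp: M_def\<close>)
    moreover have "isomorphic C (conjugate h C)" using h(1) by (simp add: M_def)
    ultimately have "isomorphic C (conjugate h (conjugate h' C))" by (blast intro: isomorphic_trans)
    thus ?thesis unfolding conjugate_comp[OF \<Gamma>_auto[OF M\<Gamma>[OF h(1)]] \<Gamma>_auto[OF M\<Gamma>[OF h(2)]]]
      using \<Gamma>_comp[OF M\<Gamma>[OF h(1)] M\<Gamma>[OF h(2)]] by (simp add: M_def)
  qed
  have isoC: "isomorphic C (hyp_model (g + 1) (diag_form i n m a))" using rep unfolding represents_def half_degree by blast
  have Mid: "(\<lambda>x. x) \<in> M"
    unfolding M_def using \<Gamma>_id isomorphic_trans[OF isoC isomorphic_sym[OF isoC]] by (simp add: conjugate_id)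
  have "\<exists>h\<in>M. \<forall>j\<le>m. \<sigma> (a j) = h (a j)"
    by (rule artin_tuple[of M \<sigma> m a]) (use \<Gamma>_auto M\<Gamma> \<Gamma>_fixes Mcomp Mid assms MF in \<open>blast | simp\<close>)+
  then obtain h where h: "h \<in> M" "\<And>j. j \<le> m \<Longrightarrow> \<sigma> (a j) = h (a j)" by blast
  have ha: "field_auto h" using \<Gamma>_auto M\<Gamma> h(1) by blast
  let ?fh = "diag_form i n m (\<lambda>j. h (a j))"
  have "isomorphic (conjugate h C) (hyp_model (g + 1) ?fh)"
    using conj_isomorphic[OF ha isoC] unfolding conj_hyp_model[OF ha] map_diag_form[OF ha] .
  moreover have "isomorphic C (conjugate h C)" using h(1) by (simp add: M_def)
  ultimately have "isomorphic (hyp_model (g + 1) ?fh) (hyp_model (g + 1) (diag_form i n m a))"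
    using isoC by (blast intro: isomorphic_trans isomorphic_sym)
  from isomorphic_imp_form_equiv[OF binary' binary' typedD(4)[OF typed_map[OF ha ta]] typedD(4)[OF ta] two g2 this]
  have "form_equiv ?fh (diag_form i n m a)" .
  from typed_equiv_cases[OF ta typed_map[OF ha ta] this]
  show ?thesis unfolding diag_equiv_def antidiag_equiv_def using h(2) by simp
qed

lemma H_inverse: assumes "\<sigma> \<in> H" shows "finv \<sigma> \<in> H"
proof -
  have s: "\<sigma> \<in> \<Gamma>" "diag_equiv m a (\<lambda>j. \<sigma> (a j))" using assms by (simp_all add: H_def)
  note sa = \<Gamma>_auto[OF s(1)]
  have "diag_equiv m (\<lambda>j. finv \<sigma> (a j)) a" using diag_equiv_map[OF field_auto_inv[OF sa] s(2)] by (simp add: sa)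
  thus ?thesis using diag_equiv_sym \<Gamma>_inverse[OF s(1)] by (simp add: H_def)
qed

lemma H_comp: assumes "\<sigma> \<in> H" "\<tau> \<in> H" shows "(\<lambda>x. \<sigma> (\<tau> x)) \<in> H"
proof -
  have "diag_equiv m (\<lambda>j. \<sigma> (a j)) (\<lambda>j. \<sigma> (\<tau> (a j)))" by (rule diag_equiv_map) (use assms \<Gamma>_auto in \<open>auto simp: H_def\<close>)
  moreover have "diag_equiv m a (\<lambda>j. \<sigma> (a j))" using assms(1) by (simp add: H_def)
  ultimately show ?thesis using diag_equiv_trans assms \<Gamma>_comp by (auto simp: H_def)
qed

text \<open>The composition of two antidiagonal substitutions is diagonal.\<close>

lemma H_index:
  assumes s: "\<sigma> \<in> \<Gamma>" and t: "\<tau> \<in> \<Gamma>" shows "(\<lambda>x. \<sigma> (\<tau> x)) \<in> H \<longleftrightarrow> (\<sigma> \<in> H \<longleftrightarrow> \<tau> \<in> H)"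
proof -
  note sa = \<Gamma>_auto[OF s] and ta = \<Gamma>_auto[OF t]
  have 1: "\<tau> \<in> H" if "(\<lambda>x. \<sigma> (\<tau> x)) \<in> H" "\<sigma> \<in> H"
    using H_comp[OF H_inverse[OF that(2)] that(1)] by (simp add: sa)
  have 2: "\<sigma> \<in> H" if "(\<lambda>x. \<sigma> (\<tau> x)) \<in> H" "\<tau> \<in> H"
    using H_comp[OF that(1) H_inverse[OF that(2)]] by (simp add: ta)
  have 3: "(\<lambda>x. \<sigma> (\<tau> x)) \<in> H" if "\<sigma> \<notin> H" "\<tau> \<notin> H"
  proof -
    have "antidiag_equiv m a (\<lambda>j. \<sigma> (a j))" "antidiag_equiv m a (\<lambda>j. \<tau> (a j))" using \<Gamma>_cases[OF s] \<Gamma>_cases[OF t] that s t by (auto simp: H_def)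
    from antidiag_antidiag_trans[OF this(1) antidiag_equiv_map[OF sa this(2)]] show ?thesis using \<Gamma>_comp[OF s t] by (simp add: H_def)
  qed
  show ?thesis using 1 2 3 H_comp by blast
qed

lemma H_sub: "H \<subseteq> \<Gamma>" by (auto simp: H_def)

lemma rational_model:
  obtains b where "diag_equiv m a b" "b 0 = 1" "\<And>h j. h \<in> H \<Longrightarrow> j \<le> m \<Longrightarrow> h (b j) = b j"
proof (rule rational_coefficients[of H m a])
  show "field_auto h" "diag_equiv m a (\<lambda>j. h (a j))" if "h \<in> H" for h using that \<Gamma>_auto by (auto simp: H_def)
qed (use typed_ends[OF ta] typedD(3)[OF ta] that in auto)

lemma descent_of_type:
  assumes "H = \<Gamma>"
  obtains f0 where "hyperelliptic_descent ground_field g C f0" "represents i n m f0 C"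
proof -
  obtain b where b: "diag_equiv m a b" "\<And>h j. h \<in> H \<Longrightarrow> j \<le> m \<Longrightarrow> h (b j) = b j" using rational_model by metis
  have "coeffs_in (fixed_field \<Gamma>) (diag_form i n m b)"
    by (rule coeffs_in_fixed_field_diag) (use b(2) assms \<Gamma>_auto in blast)+
  hence c: "coeffs_in ground_field (diag_form i n m b)" unfolding fixed_field_\<Gamma> .
  have "form_equiv (diag_form i n m b) (diag_form i n m b)" unfolding form_equiv_def
    by (intro exI[of _ 1] exI[of _ 0]) auto
  thus ?thesis using that descentI[OF b(1) binary c] represents_diag_equiv[OF b(1)] by blast
qed

lemma invariant_extension_eq:
  assumes "admissible m a S" "nonneg_basis m S vs"
  shows "invariant_extension ground_field m S vs a = fixed_field H"
proof -
  have "same_weighted_point (J_weights m S vs) (map \<sigma> (J_values m S vs a)) (J_values m S vs a) \<longleftrightarrow> diag_equiv m a (\<lambda>j. \<sigma> (a j))" if "\<sigma> \<in> \<Gamma>" for \<sigma>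
    by (rule same_invariants_iff_diag_equiv[OF assms \<Gamma>_auto[OF that]])
  hence "{\<sigma> \<in> \<Gamma>. same_weighted_point (J_weights m S vs) (map \<sigma> (J_values m S vs a)) (J_values m S vs a)} = H"
    unfolding H_def by blast
  thus ?thesis unfolding invariant_extension_def by simp
qed

text \<open>If the fixed field of \<open>H\<close> were \<open>k\<close>, then by \<open>artin_tuple\<close> every element of \<open>\<Gamma>\<close> would act diagonally.\<close>

lemma quadratic_case:
  assumes "H \<noteq> \<Gamma>"
  obtains s b c t where "quadratic_form \<Gamma> H s ground_field (fixed_field H) i n m b c t" "diag_equiv m a b"
proof -
  obtain s where s: "s \<in> \<Gamma>" "s \<notin> H" using assms H_sub by blast
  have i: "i \<noteq> 1" and sad: "antidiag_equiv m a (\<lambda>j. s (a j))" using \<Gamma>_cases[OF s(1)] s by (auto simp: H_def)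
  have ne: "fixed_field H \<noteq> ground_field"
  proof
    assume e: "fixed_field H = ground_field"
    have "\<exists>h\<in>H. \<forall>j\<le>m. s (a j) = h (a j)"
    proof (rule artin_tuple[of H s m a])
      show "(\<lambda>x. x) \<in> H" using \<Gamma>_id diag_equivI[of 1 1 m a a] by (simp add: H_def)
    qed (use \<Gamma>_auto H_sub \<Gamma>_fixes H_comp s(1) e in \<open>blast | simp\<close>)+
    then obtain h where h: "h \<in> H" "\<And>j. j \<le> m \<Longrightarrow> s (a j) = h (a j)" by blast
    hence "diag_equiv m a (\<lambda>j. s (a j))" unfolding H_def diag_equiv_def by simp
    thus False using s by (simp add: H_def)
  qed
  obtain b where b: "diag_equiv m a b" "b 0 = 1" "\<And>h j. h \<in> H \<Longrightarrow> j \<le> m \<Longrightarrow> h (b j) = b j" by (rule rational_model) (rule that)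
  have "antidiag_equiv m b (\<lambda>j. s (b j))"
    by (rule diag_antidiag_trans[OF diag_equiv_sym[OF b(1)] antidiag_diag_trans[OF sad diag_equiv_map[OF \<Gamma>_auto[OF s(1)] b(1)]]])
  then obtain c t where ct: "c \<noteq> 0" "t \<noteq> 0" "\<And>j. j \<le> m \<Longrightarrow> s (b j) = c * t ^ j * b (m - j)" by (rule antidiag_equivE) (rule that)
  have "quadratic_form \<Gamma> H s ground_field (fixed_field H) i n m b c t"
  proof
    show "b j \<in> fixed_field H" if "j \<le> m" for j using b(3) that by (simp add: fixed_field_def)
  qed (use \<Gamma>_auto \<Gamma>_comp \<Gamma>_inverse H_sub s H_index fixed_field_\<Gamma> ne two typed_diag_equiv[OF ta b(1)] i b(2) ct in \<open>auto simp only:\<close>)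
  thus ?thesis using that b(1) by blast
qed

end

theorem theorem3p14:
  fixes C :: "'k::field alg_closure variety"
    and f :: "'k alg_closure mpoly"
    and a :: "nat \<Rightarrow> 'k alg_closure"
    and L :: "'k alg_closure set"
    and g i n m :: nat
    and S :: "nat list"
    and vs :: "(nat \<Rightarrow> nat) list"
  assumes "perfect TYPE('k)" and "CHAR('k) \<noteq> 2"
    and "hyperelliptic C" and "has_genus C g"
    and "n > 1"
    and "field_of_moduli ground_field C = ground_field"
    and "represents i n m f C" and "f = diag_form i n m a"
    and "admissible m a S" and "nonneg_basis m S vs"
    and "L = invariant_extension ground_field m S vs a"
  shows
    "(i = 0 \<or> i = 2 \<longrightarrow>
        (odd m \<longrightarrow> descends_hyperelliptically ground_field g C) \<and>
        (even m \<longrightarrow> (descends_hyperelliptically ground_field g C \<longleftrightarrow>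
                      norm_obstruction_trivial ground_field L i n m f)) \<and>
        (\<exists>d\<in>{1, 2}. ring.dimension ring_of_type_algebra d ground_field L) \<and>
        (\<exists>fL. coeffs_in L fL \<and> represents i n m fL C)) \<and>
     (i = 1 \<longrightarrow>
        descends_hyperelliptically ground_field g C \<and>
        (\<exists>f0. hyperelliptic_descent ground_field g C f0 \<and> represents 1 n m f0 C))"
proof -
  interpret tc: typed_curve C a g i n m
    by unfold_locales (fact assms(2-6) assms(7)[unfolded assms(8)])+
  have L: "L = fixed_field tc.H" unfolding assms(11) by (rule tc.invariant_extension_eq[OF assms(9,10)])
  show ?thesis
  proof (cases "tc.H = tc.\<Gamma>")
    case True
    have Lk: "L = ground_field" unfolding L True by (rule tc.fixed_field_\<Gamma>)
    obtain f0 where f0: "hyperelliptic_descent ground_field g C f0" "represents i n m f0 C"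
      by (rule tc.descent_of_type[OF True]) (rule that)
    have "descends_hyperelliptically ground_field g C" unfolding descends_hyperelliptically_def using f0(1) by blast
    moreover have "norm_obstruction_trivial ground_field L i n m f"
      by (simp add: norm_obstruction_trivial_def norm_obstruction_def Lk)
    moreover have "coeffs_in L f0" using f0(1) by (simp add: hyperelliptic_descent_def Lk)
    moreover have "ring.dimension ring_of_type_algebra 1 ground_field L"
      unfolding Lk by (rule dimension_one) (auto simp: ground_field_def intro: image_eqI[of _ _ 0])
    ultimately show ?thesis using f0 by blast
  next
    case False
    then obtain s b c t where qf: "quadratic_form tc.\<Gamma> tc.H s ground_field (fixed_field tc.H) i n m b c t" and ab: "diag_equiv m a b"
      by (rule tc.quadratic_case) (rule that)
    interpret quadratic_form tc.\<Gamma> tc.H s ground_field L i n m b c t using qf unfolding L .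
    have "descends_hyperelliptically ground_field g C \<longleftrightarrow> t \<in> nm ` (L - {0})"
    proof
      assume "descends_hyperelliptically ground_field g C"
      then obtain f0 where "hyperelliptic_descent ground_field g C f0" unfolding descends_hyperelliptically_def by blast
      from tc.descentD[OF ab this] show "t \<in> nm ` (L - {0})" by (rule norm_if_descent)
    next
      assume "t \<in> nm ` (L - {0})"
      then obtain \<beta> f0 where "diag_equiv m b \<beta>" "binary_form (n * m + i) f0" "coeffs_in ground_field f0" "form_equiv f0 (diag_form i n m \<beta>)"
        by (rule descent_if_norm) (rule that)
      thus "descends_hyperelliptically ground_field g C"
        unfolding descends_hyperelliptically_def using tc.descentI diag_equiv_trans[OF ab] by blast
    qed
    moreover have "norm_obstruction_trivial ground_field L i n m f \<longleftrightarrow> t \<in> nm ` (L - {0})"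
      unfolding norm_obstruction_trivial_def assms(8) norm_obstruction_eq[OF tc.f_type ab] by (rule coset_trivial_iff)
    moreover have "coeffs_in L (diag_form i n m b)" unfolding L
      by (rule coeffs_in_fixed_field_diag[OF H_autos]) (rule L_fixed[OF bL, unfolded L])
    moreover have "represents i n m (diag_form i n m b) C" by (rule tc.represents_diag_equiv[OF ab])
    ultimately show ?thesis using norm_if_odd dimension_two i by blast
  qed
qed

end
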